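(* The intertwining gap $\gamma$ is a complete quasimetric on the set of affine isometric isomorphism classes of metric Bauer simplices. Moreover, in this setting $\gamma=\gamma_q$ is topologically equivalent to $\mathrm{dist}_{\mathrm q}$, that is, $\gamma$-convergence of a sequence $(X_n)$ of metric Bauer simplices to a metric Bauer simplex $X$ is the same as $\mathrm{dist}_{\mathrm q}$-convergence of $(\mathrm{Aff}(X_n))$ to $\mathrm{Aff}(X)$.
   Context: A **metric Bauer simplex** is a (metrisable) Bauer simplex $X$, i.e. a Choquet simplex with compact extreme boundary $\partial_eX$, whose metric is induced from a metric $\rho$ on $\partial_eX$ by identifying $X$ with the space $\mathcal{M}^1_+(\partial_eX)$ of Borel probability measures on $\partial_eX$ (via representing measures) equipped with the Wasserstein metric $W_\rho(\mu,\nu)=\sup\{|\int f\,d\mu-\int f\,d\nu|\mid f\colon\partial_eX\to\mathbb{R}\ 1\text{-Lipschitz}\}$. **Intertwining gap.** For compact convex metric spaces $X,Y$ and $\varepsilon>0$, $\mathrm{Isom}_\varepsilon(X,Y)$ is the set of continuous affine maps $f\colon X\to Y$ that are $\varepsilon$-isometric ($|d_Y(f(x_1),f(x_2))-d_X(x_1,x_2)|<\varepsilon$ for all $x_1,x_2\in X$) and $\varepsilon$-invertible (there is a continuous affine $g\colon Y\to X$ with $d_Y(f(g(y)),y)<\varepsilon$ for all $y\in Y$). $\gamma(X,Y)=\inf\{\varepsilon>0\mid\mathrm{Isom}_\varepsilon(X,Y)\times\mathrm{Isom}_\varepsilon(Y,X)\neq\emptyset\}$. The quantum intertwining gap of $\mathrm{Aff}(X)$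 and $\mathrm{Aff}(Y)$ (viewed as the quantum spaces with state spaces $X$ and $Y$) is $\gamma_q(\mathrm{Aff}(X),\mathrm{Aff}(Y))=\gamma(X,Y)$. **Quasimetric:** a symmetric function $d\ge0$ with $d(x,y)=0\iff x=y$, for which there is a constant $C$ such that $d(x,z)\le C(d(x,y)+d(y,z))$ for all $x,y,z$; complete means every Cauchy sequence converges. **Quantum Gromov--Hausdorff distance.** $\mathrm{Aff}(X)$ is the order unit space of continuous affine functions $X\to\mathbb{R}$ (order unit $1$, state space $X$), equipped with the Lip-norm $L_{d_X}(f)=\sup_{x\neq y\in X}|f(x)-f(y)|/d_X(x,y)$. A Lip-norm on an order unit space $(E,e)$ is a seminorm $L\colon E\to[0,\infty]$ with $\ker L=\mathbb{R}e$ such that $\rho_L(\sigma,\tau)=\sup\{|\sigma(x)-\tau(x)|\mid L(x)\le1\}$ is a metric inducing the $w^*$-topology on the state space $S(E)$. $\mathrm{dist}_{\mathrm q}((E_1,L_1),(E_2,L_2))$ is the infimum of the $\rho_L$-Hausdorff distances between $S(E_1)$ and $S(E_2)$ inside $S(E_1\oplus E_2)$ over all Lip-norms $L$ on $E_1\oplus E_2$ inducing $L_1,L_2$ as quotient seminorms. *)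

theory Defs
  imports "HOL-Probability.Probability" "HOL-Library.Function_Algebras"
    "HOL-Library.Product_Order"
begin

section \<open>Ordered and topological vector spaces\<close>

text \<open>Function spaces carry the pointwise vector space operations and order, products the
  componentwise ones.\<close>

instantiation "fun" :: (type, real_vector) real_vector
begin

definition scaleR_fun_def: "scaleR r f = (\<lambda>x. r *\<^sub>R f x)"

instance
  by standard (auto simp: scaleR_fun_def plus_fun_def fun_eq_iff algebra_simps)

end

instance "fun" :: (type, ordered_real_vector) ordered_real_vector
  by standard (auto simp: scaleR_fun_def le_fun_def zero_fun_def
      intro: scaleR_left_mono scaleR_right_mono)

instance prod :: (ordered_ab_semigroup_add, ordered_ab_semigroup_add) ordered_ab_semigroup_add
  by standard (auto simp: less_eq_prod_def intro: add_left_mono)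

instance prod :: (ordered_cancel_ab_semigroup_add, ordered_cancel_ab_semigroup_add)
  ordered_cancel_ab_semigroup_add ..

instance prod :: (ordered_ab_semigroup_add_imp_le, ordered_ab_semigroup_add_imp_le)
  ordered_ab_semigroup_add_imp_le
  by standard (auto simp: less_eq_prod_def)

instance prod :: (ordered_comm_monoid_add, ordered_comm_monoid_add) ordered_comm_monoid_add ..

instance prod :: (ordered_cancel_comm_monoid_add, ordered_cancel_comm_monoid_add)
  ordered_cancel_comm_monoid_add ..

instance prod :: (ordered_ab_semigroup_monoid_add_imp_le, ordered_ab_semigroup_monoid_add_imp_le)
  ordered_ab_semigroup_monoid_add_imp_le ..

instance prod :: (ordered_ab_group_add, ordered_ab_group_add) ordered_ab_group_add ..

instance prod :: (ordered_real_vector, ordered_real_vector) ordered_real_vector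
  by standard (auto simp: less_eq_prod_def intro: scaleR_left_mono scaleR_right_mono)

text \<open>Hausdorff locally convex spaces. The condition on \<open>V\<close> in the second assumption is
  \<open>convex V\<close> written out; the class command does not accept the constant itself.\<close>

class locally_convex_space = real_vector + topological_ab_group_add + t2_space +
  assumes tendsto_scaleR_Pair:
    "((\<lambda>p. fst p *\<^sub>R snd p) \<longlongrightarrow> r *\<^sub>R x) (nhds r \<times>\<^sub>F nhds x)"
  and locally_convex_expanded:
    "open U \<Longrightarrow> 0 \<in> U \<Longrightarrow> \<exists>V. open V \<and> 0 \<in> V \<and> V \<subseteq> U \<and>
      (\<forall>x\<in>V. \<forall>y\<in>V. \<forall>u\<ge>0. \<forall>v\<ge>0. u + v = 1 \<longrightarrow> u *\<^sub>R x + v *\<^sub>R y \<in> V)"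

lemma locally_convex:
  fixes U :: "'a::locally_convex_space set"
  assumes "open U" "0 \<in> U"
  shows "\<exists>V. open V \<and> 0 \<in> V \<and> V \<subseteq> U \<and> convex V"
  using locally_convex_expanded[OF assms] by (simp add: convex_def)

instance real_normed_vector \<subseteq> locally_convex_space
proof
  fix r :: real and x :: 'a
  show "((\<lambda>p. fst p *\<^sub>R snd p) \<longlongrightarrow> r *\<^sub>R x) (nhds r \<times>\<^sub>F nhds x)"
    by (intro tendsto_scaleR filterlim_fst filterlim_snd)
next
  fix U :: "'a set"
  assume "open U" "0 \<in> U"
  then obtain e where "e > 0" "ball 0 e \<subseteq> U"
    by (auto simp: open_contains_ball)
  then show "\<exists>V. open V \<and> 0 \<in> V \<and> V \<subseteq> U \<and>
      (\<forall>x\<in>V. \<forall>y\<in>V. \<forall>u\<ge>0. \<forall>v\<ge>0. u + v = 1 \<longrightarrow> u *\<^sub>R x + v *\<^sub>R y \<in> V)"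
    using convex_ball[of 0 e] unfolding convex_def by (intro exI[of _ "ball 0 e"]) simp
qed

text \<open>Function spaces with the product topology; in particular \<open>nat \<Rightarrow> real\<close>.\<close>

lemma tendsto_fun_componentwise:
  fixes f :: "'c \<Rightarrow> 'a \<Rightarrow> 'b::topological_space"
  shows "(f \<longlongrightarrow> l) F \<longleftrightarrow> (\<forall>i. ((\<lambda>x. f x i) \<longlongrightarrow> l i) F)"
  using limitin_componentwise[of "\<lambda>_. euclidean" UNIV f l F]
  by (simp add: euclidean_product_topology)

lemma open_fun_coordinate:
  fixes W :: "'b::topological_space set"
  shows "open W \<Longrightarrow> open {h::'a \<Rightarrow> 'b. h i \<in> W}"
  using product_topology_basis'[of "{i}" "\<lambda>_. W" id] by simp

instance "fun" :: (type, t0_space) t0_space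
proof
  fix f g :: "'a \<Rightarrow> 'b"
  assume "f \<noteq> g"
  then obtain i where "f i \<noteq> g i" by auto
  then obtain U where "open U" "\<not> (f i \<in> U \<longleftrightarrow> g i \<in> U)"
    using t0_space_class.t0_space by blast
  then show "\<exists>U. open U \<and> \<not> (f \<in> U \<longleftrightarrow> g \<in> U)"
    by (intro exI[of _ "{h. h i \<in> U}"]) (simp add: open_fun_coordinate)
qed

instance "fun" :: (type, t1_space) t1_space
proof
  fix f g :: "'a \<Rightarrow> 'b"
  assume "f \<noteq> g"
  then obtain i where "f i \<noteq> g i" by auto
  then obtain U where "open U" "f i \<in> U" "g i \<notin> U"
    by (meson t1_space_class.t1_space)
  then show "\<exists>U. open U \<and> f \<in> U \<and> g \<notin> U"
    by (intro exI[of _ "{h. h i \<in> U}"]) (simp add: open_fun_coordinate)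
qed

instance "fun" :: (type, t2_space) t2_space
proof
  fix f g :: "'a \<Rightarrow> 'b"
  assume "f \<noteq> g"
  then obtain i where "f i \<noteq> g i" by auto
  then obtain U V where "open U" "open V" "f i \<in> U" "g i \<in> V" "U \<inter> V = {}"
    by (meson hausdorff)
  then show "\<exists>U V. open U \<and> open V \<and> f \<in> U \<and> g \<in> V \<and> U \<inter> V = {}"
    by (intro exI[of _ "{h. h i \<in> U}"] exI[of _ "{h. h i \<in> V}"])
      (auto simp: open_fun_coordinate)
qed

instance "fun" :: (type, topological_monoid_add) topological_monoid_add
proof
  fix a b :: "'a \<Rightarrow> 'b"
  have "((\<lambda>x. x i) \<longlongrightarrow> c i) (nhds c)" for c :: "'a \<Rightarrow> 'b" and i
    using tendsto_fun_componentwise[of "\<lambda>x. x" c "nhds c"] by (simp add: filterlim_ident)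
  then show "((\<lambda>x. fst x + snd x) \<longlongrightarrow> a + b) (nhds a \<times>\<^sub>F nhds b)"
    unfolding tendsto_fun_componentwise plus_fun_def
    by (intro allI tendsto_add filterlim_compose[OF _ filterlim_fst]
        filterlim_compose[OF _ filterlim_snd])
qed

instance "fun" :: (type, topological_group_add) topological_group_add
proof
  fix a :: "'a \<Rightarrow> 'b"
  have "((\<lambda>x. x i) \<longlongrightarrow> a i) (nhds a)" for i
    using tendsto_fun_componentwise[of "\<lambda>x. x" a "nhds a"] by (simp add: filterlim_ident)
  then show "(uminus \<longlongrightarrow> - a) (nhds a)"
    by (auto simp: tendsto_fun_componentwise intro: tendsto_minus)
qed

instance "fun" :: (type, topological_ab_group_add) topological_ab_group_add ..

instance "fun" :: (type, locally_convex_space) locally_convex_space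
proof
  fix r :: real and a :: "'a \<Rightarrow> 'b"
  have "((\<lambda>x. x i) \<longlongrightarrow> a i) (nhds a)" for i
    using tendsto_fun_componentwise[of "\<lambda>x. x" a "nhds a"] by (simp add: filterlim_ident)
  then have "((\<lambda>p. (fst p, snd p i)) \<longlongrightarrow> (r, a i)) (nhds r \<times>\<^sub>F nhds a)" for i
    by (intro tendsto_Pair filterlim_fst filterlim_compose[OF _ filterlim_snd])
  then have "((\<lambda>p. fst p *\<^sub>R snd p i) \<longlongrightarrow> r *\<^sub>R a i) (nhds r \<times>\<^sub>F nhds a)" for i
    using filterlim_compose[OF tendsto_scaleR_Pair[of r "a i"], of "\<lambda>p. (fst p, snd p i)"]
    by (simp add: nhds_prod)
  then show "((\<lambda>p. fst p *\<^sub>R snd p) \<longlongrightarrow> r *\<^sub>R a) (nhds r \<times>\<^sub>F nhds a)"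
    by (simp add: tendsto_fun_componentwise scaleR_fun_def)
next
  fix U :: "('a \<Rightarrow> 'b) set"
  assume "open U" "0 \<in> U"
  then obtain X where X: "0 \<in> Pi\<^sub>E UNIV X" "\<And>i. open (X i)" "finite {i. X i \<noteq> UNIV}"
      "Pi\<^sub>E UNIV X \<subseteq> U"
    using product_topology_open_contains_basis[of "\<lambda>_. euclidean" UNIV U 0]
    by (auto simp: open_fun_def)
  have "\<exists>V. open V \<and> 0 \<in> V \<and> V \<subseteq> X i \<and> convex V \<and> (X i = UNIV \<longrightarrow> V = UNIV)" for i
  proof (cases "X i = UNIV")
    case False
    have "0 \<in> X i" using X(1) by (auto simp: PiE_iff)
    then show ?thesis using locally_convex[OF X(2)[of i]] False by auto
  qed auto
  then obtain V where V: "\<And>i. open (V i)" "\<And>i. 0 \<in> V i" "\<And>i. V i \<subseteq> X i" "\<And>i. convex (V i)"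
      "\<And>i. X i = UNIV \<Longrightarrow> V i = UNIV"
    by metis
  have "finite {i. V i \<noteq> UNIV}"
    by (rule finite_subset[OF _ X(3)]) (use V(5) in auto)
  then have "open (Pi\<^sub>E UNIV V)" using V(1) by (intro open_PiE)
  moreover have "0 \<in> Pi\<^sub>E UNIV V"
    using V(2) by (simp add: PiE_iff)
  moreover have "Pi\<^sub>E UNIV V \<subseteq> U"
    using PiE_mono[of UNIV V X] V(3) X(4) by (meson order_trans)
  moreover have "\<forall>x\<in>Pi\<^sub>E UNIV V. \<forall>y\<in>Pi\<^sub>E UNIV V. \<forall>u\<ge>0. \<forall>v\<ge>0. u + v = 1 \<longrightarrow>
      u *\<^sub>R x + v *\<^sub>R y \<in> Pi\<^sub>E UNIV V"
    using V(4) unfolding convex_def by (simp add: PiE_iff scaleR_fun_def)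
  ultimately show "\<exists>V. open V \<and> 0 \<in> V \<and> V \<subseteq> U \<and>
      (\<forall>x\<in>V. \<forall>y\<in>V. \<forall>u\<ge>0. \<forall>v\<ge>0. u + v = 1 \<longrightarrow> u *\<^sub>R x + v *\<^sub>R y \<in> V)"
    by (intro exI[of _ "Pi\<^sub>E UNIV V"] conjI)
qed


section \<open>Compact convex metric spaces and the intertwining gap\<close>

definition affine_on :: "'a::real_vector set \<Rightarrow> ('a \<Rightarrow> 'b::real_vector) \<Rightarrow> bool" where
  "affine_on C f \<longleftrightarrow>
    (\<forall>x\<in>C. \<forall>y\<in>C. \<forall>u\<ge>0. \<forall>v\<ge>0. u + v = 1 \<longrightarrow>
      f (u *\<^sub>R x + v *\<^sub>R y) = u *\<^sub>R f x + v *\<^sub>R f y)"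

text \<open>The metric induces the topology inherited from the ambient space.\<close>

definition compact_convex_metric_space :: "'a::locally_convex_space metric \<Rightarrow> bool" where
  "compact_convex_metric_space X \<longleftrightarrow>
    mspace X \<noteq> {} \<and> compact (mspace X) \<and> convex (mspace X) \<and>
    mtopology_of X = top_of_set (mspace X)"

definition affine_maps ::
  "'a::real_vector metric \<Rightarrow> 'b::real_vector metric \<Rightarrow> ('a \<Rightarrow> 'b) set" where
  "affine_maps X Y =
    {f. continuous_map (mtopology_of X) (mtopology_of Y) f \<and> affine_on (mspace X) f}"

definition isom_eps ::
  "real \<Rightarrow> 'a::real_vector metric \<Rightarrow> 'b::real_vector metric \<Rightarrow> ('a \<Rightarrow> 'b) set" where
  "isom_eps \<epsilon> X Y =
    {f \<in> affine_maps X Y.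
      (\<forall>x1\<in>mspace X. \<forall>x2\<in>mspace X. \<bar>mdist Y (f x1) (f x2) - mdist X x1 x2\<bar> < \<epsilon>) \<and>
      (\<exists>g\<in>affine_maps Y X. \<forall>y\<in>mspace Y. mdist Y (f (g y)) y < \<epsilon>)}"

text \<open>For nonempty compact \<open>X\<close> and \<open>Y\<close> the set below is nonempty: constant maps lie in
  \<open>isom_eps \<epsilon>\<close> as soon as \<open>\<epsilon>\<close> exceeds both diameters.\<close>

definition intertwining_gap :: "'a::real_vector metric \<Rightarrow> 'b::real_vector metric \<Rightarrow> real" where
  "intertwining_gap X Y = Inf {\<epsilon>. \<epsilon> > 0 \<and> isom_eps \<epsilon> X Y \<times> isom_eps \<epsilon> Y X \<noteq> {}}"

definition affinely_isometric :: "'a::real_vector metric \<Rightarrow> 'b::real_vector metric \<Rightarrow> bool" where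
  "affinely_isometric X Y \<longleftrightarrow>
    (\<exists>f. bij_betw f (mspace X) (mspace Y) \<and> affine_on (mspace X) f \<and>
      (\<forall>x1\<in>mspace X. \<forall>x2\<in>mspace X. mdist Y (f x1) (f x2) = mdist X x1 x2))"

section \<open>Metric Bauer simplices\<close>

text \<open>\<open>Aff(C)\<close>. A function on \<open>C\<close> is extended by \<open>0\<close>, so that equality of functions is equality
  on \<open>C\<close> and \<open>affine_functions C\<close> is a linear subspace of \<open>'a \<Rightarrow> real\<close>.\<close>

definition affine_functions :: "'a::locally_convex_space set \<Rightarrow> ('a \<Rightarrow> real) set" where
  "affine_functions C = {f. continuous_on C f \<and> affine_on C f \<and> (\<forall>x. x \<notin> C \<longrightarrow> f x = 0)}"

definition extreme_boundary :: "'a::real_vector set \<Rightarrow> 'a set" where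
  "extreme_boundary C = {x. x extreme_point_of C}"

text \<open>Borel probability measures on the extreme boundary, as Borel measures on the ambient space
  concentrated there.\<close>

definition boundary_measures :: "'a::locally_convex_space set \<Rightarrow> 'a measure set" where
  "boundary_measures C =
    {\<mu>. sets \<mu> = sets borel \<and> prob_space \<mu> \<and> emeasure \<mu> (extreme_boundary C) = 1}"

definition represents :: "'a::locally_convex_space set \<Rightarrow> 'a measure \<Rightarrow> 'a \<Rightarrow> bool" where
  "represents C \<mu> x \<longleftrightarrow> (\<forall>f\<in>affine_functions C. (LINT y|\<mu>. f y) = f x)"

text \<open>Choquet simplices among the metrisable compact convex sets, to which this is applied only:
  the boundary is then a Borel set, and the maximal representing measures of a point are those
  concentrated on it.\<close>

definition choquet_simplex :: "'a::locally_convex_space set \<Rightarrow> bool" where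
  "choquet_simplex C \<longleftrightarrow>
    C \<noteq> {} \<and> compact C \<and> convex C \<and>
    (\<forall>x\<in>C. \<exists>!\<mu>. \<mu> \<in> boundary_measures C \<and> represents C \<mu> x)"

definition bauer_simplex :: "'a::locally_convex_space set \<Rightarrow> bool" where
  "bauer_simplex C \<longleftrightarrow> choquet_simplex C \<and> compact (extreme_boundary C)"

definition wasserstein :: "'a::topological_space metric \<Rightarrow> 'a measure \<Rightarrow> 'a measure \<Rightarrow> real" where
  "wasserstein \<rho> \<mu> \<nu> =
    (SUP f\<in>{f :: 'a \<Rightarrow> real. \<forall>x\<in>mspace \<rho>. \<forall>y\<in>mspace \<rho>. \<bar>f x - f y\<bar> \<le> mdist \<rho> x y}.
      \<bar>(LINT x:mspace \<rho>|\<mu>. f x) - (LINT x:mspace \<rho>|\<nu>. f x)\<bar>)"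

definition metric_bauer_simplex :: "'a::locally_convex_space metric \<Rightarrow> bool" where
  "metric_bauer_simplex X \<longleftrightarrow>
    compact_convex_metric_space X \<and> bauer_simplex (mspace X) \<and>
    (\<exists>\<rho>. mspace \<rho> = extreme_boundary (mspace X) \<and>
      mtopology_of \<rho> = top_of_set (extreme_boundary (mspace X)) \<and>
      (\<forall>x\<in>mspace X. \<forall>y\<in>mspace X.
        \<forall>\<mu>\<in>boundary_measures (mspace X). \<forall>\<nu>\<in>boundary_measures (mspace X).
          represents (mspace X) \<mu> x \<longrightarrow> represents (mspace X) \<nu> y \<longrightarrow>
            mdist X x y = wasserstein \<rho> \<mu> \<nu>))"

section \<open>Isomorphism classes\<close>

text \<open>The classes are represented inside the space of real sequences with the product topology,
  where every metrisable compact convex set has an affinely homeomorphic copy. The class of a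
  simplex in any locally convex space is the set of its copies there.\<close>

definition iso_class :: "'a::locally_convex_space metric \<Rightarrow> (nat \<Rightarrow> real) metric set" where
  "iso_class X = {Z. metric_bauer_simplex Z \<and> affinely_isometric X Z}"

definition bauer_classes :: "(nat \<Rightarrow> real) metric set set" where
  "bauer_classes = iso_class ` {Z :: (nat \<Rightarrow> real) metric. metric_bauer_simplex Z}"

definition class_gap ::
  "(nat \<Rightarrow> real) metric set \<Rightarrow> (nat \<Rightarrow> real) metric set \<Rightarrow> real" where
  "class_gap A B = intertwining_gap (SOME X. X \<in> A) (SOME Y. Y \<in> B)"

definition quasimetric_on :: "'s set \<Rightarrow> ('s \<Rightarrow> 's \<Rightarrow> real) \<Rightarrow> bool" where
  "quasimetric_on S d \<longleftrightarrow>
    (\<forall>x\<in>S. \<forall>y\<in>S. 0 \<le> d x y \<and> d x y = d y x \<and> (d x y = 0 \<longleftrightarrow> x = y)) \<and>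
    (\<exists>C. \<forall>x\<in>S. \<forall>y\<in>S. \<forall>z\<in>S. d x z \<le> C * (d x y + d y z))"

definition complete_quasimetric_on :: "'s set \<Rightarrow> ('s \<Rightarrow> 's \<Rightarrow> real) \<Rightarrow> bool" where
  "complete_quasimetric_on S d \<longleftrightarrow>
    quasimetric_on S d \<and>
    (\<forall>s :: nat \<Rightarrow> 's. range s \<subseteq> S \<longrightarrow>
      (\<forall>e>0. \<exists>N. \<forall>m\<ge>N. \<forall>n\<ge>N. d (s m) (s n) < e) \<longrightarrow>
      (\<exists>x\<in>S. (\<lambda>n. d (s n) x) \<longlonglongrightarrow> 0))"

section \<open>Order unit spaces, Lip-norms and the quantum Gromov--Hausdorff distance\<close>

text \<open>An order unit space is a linear subspace of an ordered vector space type, with the inherited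
  order.\<close>

record 'v order_unit_space =
  elems :: "'v set"
  ounit :: "'v"

definition is_order_unit_space :: "'v::ordered_real_vector order_unit_space \<Rightarrow> bool" where
  "is_order_unit_space E \<longleftrightarrow>
    subspace (elems E) \<and> ounit E \<in> elems E \<and>
    (\<forall>x\<in>elems E. \<exists>r. x \<le> r *\<^sub>R ounit E) \<and>
    (\<forall>x\<in>elems E. (\<forall>r>0. x \<le> r *\<^sub>R ounit E) \<longrightarrow> x \<le> 0)"

text \<open>States are extended by \<open>0\<close>. The \<open>w\<^sup>*\<close>-topology is the topology inherited from the product
  topology on \<open>'v \<Rightarrow> real\<close>.\<close>

definition state_space :: "'v::ordered_real_vector order_unit_space \<Rightarrow> ('v \<Rightarrow> real) set" where
  "state_space E =
    {\<sigma>. (\<forall>x\<in>elems E. \<forall>y\<in>elems E. \<sigma> (x + y) = \<sigma> x + \<sigma> y) \<and>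
      (\<forall>c. \<forall>x\<in>elems E. \<sigma> (c *\<^sub>R x) = c * \<sigma> x) \<and>
      (\<forall>x\<in>elems E. 0 \<le> x \<longrightarrow> 0 \<le> \<sigma> x) \<and>
      \<sigma> (ounit E) = 1 \<and> (\<forall>x. x \<notin> elems E \<longrightarrow> \<sigma> x = 0)}"

definition lip_rho ::
  "'v order_unit_space \<Rightarrow> ('v \<Rightarrow> ennreal) \<Rightarrow> ('v \<Rightarrow> real) \<Rightarrow> ('v \<Rightarrow> real) \<Rightarrow> ennreal" where
  "lip_rho E L \<sigma> \<tau> = (SUP x\<in>{x \<in> elems E. L x \<le> 1}. ennreal \<bar>\<sigma> x - \<tau> x\<bar>)"

definition lip_norm ::
  "'v::ordered_real_vector order_unit_space \<Rightarrow> ('v \<Rightarrow> ennreal) \<Rightarrow> bool" where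
  "lip_norm E L \<longleftrightarrow>
    is_order_unit_space E \<and>
    (\<forall>x\<in>elems E. \<forall>y\<in>elems E. L (x + y) \<le> L x + L y) \<and>
    (\<forall>c. \<forall>x\<in>elems E. L (c *\<^sub>R x) = ennreal \<bar>c\<bar> * L x) \<and>
    {x \<in> elems E. L x = 0} = range (\<lambda>c. c *\<^sub>R ounit E) \<and>
    (\<forall>\<sigma>\<in>state_space E. \<forall>\<tau>\<in>state_space E. lip_rho E L \<sigma> \<tau> < \<infinity>) \<and>
    Metric_space (state_space E) (\<lambda>\<sigma> \<tau>. enn2real (lip_rho E L \<sigma> \<tau>)) \<and>
    Metric_space.mtopology (state_space E) (\<lambda>\<sigma> \<tau>. enn2real (lip_rho E L \<sigma> \<tau>)) =
      top_of_set (state_space E)"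

definition state_metric ::
  "'v::ordered_real_vector order_unit_space \<Rightarrow> ('v \<Rightarrow> ennreal) \<Rightarrow> ('v \<Rightarrow> real) metric" where
  "state_metric E L = metric (state_space E, \<lambda>\<sigma> \<tau>. enn2real (lip_rho E L \<sigma> \<tau>))"

definition quantum_gap ::
  "'v::ordered_real_vector order_unit_space \<Rightarrow> ('v \<Rightarrow> ennreal) \<Rightarrow>
   'w::ordered_real_vector order_unit_space \<Rightarrow> ('w \<Rightarrow> ennreal) \<Rightarrow> real" where
  "quantum_gap E1 L1 E2 L2 = intertwining_gap (state_metric E1 L1) (state_metric E2 L2)"

definition direct_sum ::
  "'v order_unit_space \<Rightarrow> 'w order_unit_space \<Rightarrow> ('v \<times> 'w) order_unit_space" where
  "direct_sum E1 E2 = \<lparr>elems = elems E1 \<times> elems E2, ounit = (ounit E1, ounit E2)\<rparr>"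

definition left_states ::
  "'v::ordered_real_vector order_unit_space \<Rightarrow> 'w order_unit_space \<Rightarrow> ('v \<times> 'w \<Rightarrow> real) set" where
  "left_states E1 E2 =
    (\<lambda>\<sigma> p. if p \<in> elems E1 \<times> elems E2 then \<sigma> (fst p) else 0) ` state_space E1"

definition right_states ::
  "'v order_unit_space \<Rightarrow> 'w::ordered_real_vector order_unit_space \<Rightarrow> ('v \<times> 'w \<Rightarrow> real) set" where
  "right_states E1 E2 =
    (\<lambda>\<sigma> p. if p \<in> elems E1 \<times> elems E2 then \<sigma> (snd p) else 0) ` state_space E2"

definition induces_quotients ::
  "'v order_unit_space \<Rightarrow> ('v \<Rightarrow> ennreal) \<Rightarrow> 'w order_unit_space \<Rightarrow> ('w \<Rightarrow> ennreal) \<Rightarrow>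
   ('v \<times> 'w \<Rightarrow> ennreal) \<Rightarrow> bool" where
  "induces_quotients E1 L1 E2 L2 L \<longleftrightarrow>
    (\<forall>x\<in>elems E1. L1 x = (INF y\<in>elems E2. L (x, y))) \<and>
    (\<forall>y\<in>elems E2. L2 y = (INF x\<in>elems E1. L (x, y)))"

definition hausdorff_dist :: "('s \<Rightarrow> 's \<Rightarrow> ennreal) \<Rightarrow> 's set \<Rightarrow> 's set \<Rightarrow> ennreal" where
  "hausdorff_dist d A B = max (SUP a\<in>A. INF b\<in>B. d a b) (SUP b\<in>B. INF a\<in>A. d a b)"

definition dist_q ::
  "'v::ordered_real_vector order_unit_space \<Rightarrow> ('v \<Rightarrow> ennreal) \<Rightarrow>
   'w::ordered_real_vector order_unit_space \<Rightarrow> ('w \<Rightarrow> ennreal) \<Rightarrow> ennreal" where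
  "dist_q E1 L1 E2 L2 =
    (INF L\<in>{L. lip_norm (direct_sum E1 E2) L \<and> induces_quotients E1 L1 E2 L2 L}.
      hausdorff_dist (lip_rho (direct_sum E1 E2) L) (left_states E1 E2) (right_states E1 E2))"

definition Aff :: "'a::locally_convex_space metric \<Rightarrow> ('a \<Rightarrow> real) order_unit_space" where
  "Aff X = \<lparr>elems = affine_functions (mspace X), ounit = indicator (mspace X)\<rparr>"

definition lip_const :: "'a metric \<Rightarrow> ('a \<Rightarrow> real) \<Rightarrow> ennreal" where
  "lip_const X f =
    (SUP (x, y)\<in>{(x, y). x \<in> mspace X \<and> y \<in> mspace X \<and> x \<noteq> y}.
      ennreal (\<bar>f x - f y\<bar> / mdist X x y))"

end

theory Submission
  imports Defs
begin

text \<open>A metric Bauer simplex \<open>X\<close> is governed by its extreme boundary \<open>K\<close>: affine functions on \<open>X\<close> that are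
  \<open>1\<close>-Lipschitz are exactly the extensions of \<open>1\<close>-Lipschitz functions on \<open>K\<close>, and they determine the
  metric. Hence the intertwining gap of \<open>X\<close> and \<open>Y\<close> is, up to constants, the least distortion of a
  correspondence between \<open>K\<close> and the boundary \<open>M\<close> of \<open>Y\<close>: a Lipschitz partition of unity on \<open>K\<close> turns
  a correspondence into an affine map \<open>X \<rightarrow> Y\<close>, and conversely an almost isometric, almost invertible
  affine map sends extreme points close to extreme points. The same comparison holds for \<open>dist_q\<close>: a
  Lip-norm on the direct sum yields a correspondence of extreme boundaries, and an intertwining map
  \<open>f\<close> yields the Lip-norm given by the two Lipschitz constants and the deviation of \<open>a\<close> from \<open>b \<circ> f\<close>.

  If the gap vanishes, a cluster point of the intertwining maps in the topology of pointwise convergence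
  is an affine isometry, which is surjective by compactness. For completeness, a fast Cauchy sequence is a chain of
  correspondences between boundaries of distortion \<open>2\<^sup>-\<^sup>n\<close>; threads through the chain carry a limit
  pseudometric. The corresponding simplex is realised among real sequences: a dense sequence of
  nonexpansive functions maps the boundary into \<open>nat \<Rightarrow> real\<close>, and \<open>X\<close> is the closed convex hull of
  the image with the supremum metric. Applied to a constant chain this also gives the copy of an
  arbitrary metric Bauer simplex among real sequences.\<close>

section \<open>Affine and Lipschitz functions\<close>

text \<open>The pivot is that the distance to a boundary point \<open>k\<close> is an affine
  function on \<open>X\<close>: the Wasserstein distance from a Dirac mass is linear in the other
  measure. Between two interior points the distance is merely convex, so estimates are tested on
  affine functions or at points of \<open>K\<close>, where inequalities between affine functions are
  decided. An affine function that is small somewhere is small at some point of \<open>K\<close>;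
  this is how almost inverse maps, or nearby states, produce partners in the other boundary.
  Measures are confined to the passage between \<open>metric_bauer_simplex\<close> and the locale
  \<open>bauer_model\<close>, which speaks of affine functions only. Since the extension property
  concerns Lipschitz functions, a Riesz representation is built for functionals on these. The
  triangle inequality holds up to the factor 2, because the error of an approximate inverse is
  distorted by the next map: errors \<open>a\<close> and \<open>b\<close> compose to
  \<open>a + 2 * b\<close>.\<close>

lemma affine_onD:
  assumes "affine_on C f" "x \<in> C" "y \<in> C" "0 \<le> u" "0 \<le> v" "u + v = 1"
  shows "f (u *\<^sub>R x + v *\<^sub>R y) = u *\<^sub>R f x + v *\<^sub>R f y"
  using assms by (simp add: affine_on_def)

lemma affine_on_const [simp]: "affine_on C (\<lambda>_. c)"
  by (auto simp: affine_on_def scaleR_left_distrib[symmetric])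

lemma affine_on_add: "affine_on C f \<Longrightarrow> affine_on C g \<Longrightarrow> affine_on C (\<lambda>x. f x + g x)"
  by (simp add: affine_on_def algebra_simps)

lemma affine_on_diff: "affine_on C f \<Longrightarrow> affine_on C g \<Longrightarrow> affine_on C (\<lambda>x. f x - g x)"
  by (simp add: affine_on_def algebra_simps)

lemma affine_on_minus: "affine_on C f \<Longrightarrow> affine_on C (\<lambda>x. - f x)"
  by (simp add: affine_on_def)

lemma affine_on_cmult:
  fixes f :: "'a::real_vector \<Rightarrow> real"
  shows "affine_on C f \<Longrightarrow> affine_on C (\<lambda>x. c * f x)"
  by (simp add: affine_on_def algebra_simps)

lemma affine_on_scaleR_right:
  fixes f :: "'a::real_vector \<Rightarrow> real"
  shows "affine_on C f \<Longrightarrow> affine_on C (\<lambda>x. f x *\<^sub>R p)"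
  by (simp add: affine_on_def algebra_simps)

lemma affine_on_sum:
  "(\<And>i. i \<in> I \<Longrightarrow> affine_on C (f i)) \<Longrightarrow> affine_on C (\<lambda>x. \<Sum>i\<in>I. f i x)"
  by (simp add: affine_on_def scaleR_sum_right sum.distrib)

lemma affine_on_compose:
  assumes "affine_on C f" "affine_on D g" "f ` C \<subseteq> D"
  shows "affine_on C (\<lambda>x. g (f x))"
  using assms by (simp add: affine_on_def image_subset_iff)

lemma affine_on_cong:
  assumes "convex C" "\<And>x. x \<in> C \<Longrightarrow> f x = g x"
  shows "affine_on C f \<longleftrightarrow> affine_on C g"
  using assms unfolding affine_on_def convex_def by metis

lemma affine_on_ident [simp]: "affine_on C (\<lambda>x. x)"
  by (simp add: affine_on_def)

text \<open>One point is split off and the remaining weights are renormalised by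
  \<open>1 - a i\<close>; if \<open>a i = 1\<close> this is impossible, but then all other weights
  vanish.\<close>

lemma affine_on_convex_sum:
  fixes f :: "'a::real_vector \<Rightarrow> real"
  assumes "affine_on C f" "convex C" "finite I" "\<And>i. i \<in> I \<Longrightarrow> p i \<in> C"
    "\<And>i. i \<in> I \<Longrightarrow> 0 \<le> a i" "sum a I = 1"
  shows "f (\<Sum>i\<in>I. a i *\<^sub>R p i) = (\<Sum>i\<in>I. a i * f (p i))"
  using assms(3-)
proof (induction I arbitrary: a rule: finite_induct)
  case (insert i I)
  show ?case
  proof (cases "a i = 1")
    case True
    then have "sum a I = 0" using insert by simp
    then have "\<forall>j\<in>I. a j = 0"
      using insert by (simp add: sum_nonneg_eq_0_iff)
    then show ?thesis using insert.hyps True by simp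
  next
    case False
    define b where "b = (\<lambda>j. a j / (1 - a i))"
    have s: "sum a I = 1 - a i" using insert by simp
    moreover have "sum a I \<ge> 0" using insert by (simp add: sum_nonneg)
    ultimately have lt: "a i < 1" using False by linarith
    have b: "\<And>j. j \<in> I \<Longrightarrow> 0 \<le> b j" "sum b I = 1"
      using insert lt s by (auto simp: b_def sum_divide_distrib[symmetric])
    have ab: "a j = (1 - a i) * b j" for j using lt by (simp add: b_def)
    have mem: "(\<Sum>j\<in>I. b j *\<^sub>R p j) \<in> C"
      using convex_sum[OF insert.hyps(1) assms(2) b(2)] b(1) insert.prems(1) by simp
    have "(\<Sum>j\<in>I. a j *\<^sub>R p j) = (1 - a i) *\<^sub>R (\<Sum>j\<in>I. b j *\<^sub>R p j)"
      unfolding scaleR_sum_right by (intro sum.cong refl) (simp add: ab[symmetric])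
    then have "f (\<Sum>j\<in>insert i I. a j *\<^sub>R p j) = f (a i *\<^sub>R p i + (1 - a i) *\<^sub>R (\<Sum>j\<in>I. b j *\<^sub>R p j))"
      using insert.hyps by simp
    also have "\<dots> = a i * f (p i) + (1 - a i) * f (\<Sum>j\<in>I. b j *\<^sub>R p j)"
      using affine_onD[OF assms(1) _ mem, of "p i" "a i" "1 - a i"] insert.prems lt by simp
    also have "f (\<Sum>j\<in>I. b j *\<^sub>R p j) = (\<Sum>j\<in>I. b j * f (p j))"
      using insert.IH[of b] b insert.prems by simp
    also have "a i * f (p i) + (1 - a i) * \<dots> = (\<Sum>j\<in>insert i I. a j * f (p j))"
      using insert.hyps by (simp add: sum_distrib_left mult.assoc[symmetric] ab[symmetric])
    finally show ?thesis .
  qed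
qed simp

section \<open>Lipschitz functions and the metric topology\<close>

lemma mdist_self [simp]: "x \<in> mspace X \<Longrightarrow> mdist X x x = 0"
  by simp

text \<open>The set \<open>S\<close> is separate from \<open>mspace X\<close> because the same
  metric serves for functions on the boundary and for their extensions.\<close>

definition lip_on :: "real \<Rightarrow> 'a metric \<Rightarrow> 'a set \<Rightarrow> ('a \<Rightarrow> real) \<Rightarrow> bool" where
  "lip_on C X S h \<longleftrightarrow> (\<forall>x\<in>S. \<forall>y\<in>S. \<bar>h x - h y\<bar> \<le> C * mdist X x y)"

lemma lip_onD: "lip_on C X S h \<Longrightarrow> x \<in> S \<Longrightarrow> y \<in> S \<Longrightarrow> \<bar>h x - h y\<bar> \<le> C * mdist X x y"
  by (simp add: lip_on_def)

lemma lip_onI: "(\<And>x y. x \<in> S \<Longrightarrow> y \<in> S \<Longrightarrow> h x - h y \<le> C * mdist X x y) \<Longrightarrow> lip_on C X S h"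
  unfolding lip_on_def by (metis abs_le_iff minus_diff_eq mdist_commute)

lemma lip_on_subset: "lip_on C X S h \<Longrightarrow> T \<subseteq> S \<Longrightarrow> lip_on C X T h"
  by (auto simp: lip_on_def)

lemma lip_on_mono: "lip_on C X S h \<Longrightarrow> C \<le> D \<Longrightarrow> lip_on D X S h"
  unfolding lip_on_def by (meson mdist_nonneg mult_right_mono order_trans)

lemma lip_on_cmult: "lip_on C X S h \<Longrightarrow> lip_on (\<bar>c\<bar> * C) X S (\<lambda>x. c * h x)"
  unfolding lip_on_def
  by (auto simp: right_diff_distrib[symmetric] abs_mult mult.assoc intro: mult_left_mono)

lemma lip_on_add: "lip_on C X S h \<Longrightarrow> lip_on D X S g \<Longrightarrow> lip_on (C + D) X S (\<lambda>x. h x + g x)"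
  unfolding lip_on_def distrib_right
  by (meson abs_diff_triangle_ineq add_mono order_trans)

lemma lip_on_diff: "lip_on C X S h \<Longrightarrow> lip_on D X S g \<Longrightarrow> lip_on (C + D) X S (\<lambda>x. h x - g x)"
  using lip_on_add[of C X S h D "\<lambda>x. - g x"] by (simp add: lip_on_def abs_minus_commute)

lemma lip_on_const [simp]: "C \<ge> 0 \<Longrightarrow> lip_on C X S (\<lambda>_. c)"
  by (simp add: lip_on_def)

lemma lip_on_mdist: "S \<subseteq> mspace X \<Longrightarrow> x \<in> mspace X \<Longrightarrow> lip_on 1 X S (mdist X x)"
  by (rule lip_onI) (smt (verit) mdist_triangle mdist_commute subsetD mult_1)

lemma continuous_map_real_iff:
  assumes "mtopology_of X = top_of_set (mspace X)"
  shows "continuous_map (mtopology_of X) euclidean f \<longleftrightarrow> continuous_on (mspace X) f"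
  using assms by (simp add: continuous_map_iff_continuous)

lemma continuous_on_mdist:
  assumes "mtopology_of X = top_of_set (mspace X)" "continuous_on S f" "continuous_on S g"
    "f ` S \<subseteq> mspace X" "g ` S \<subseteq> mspace X"
  shows "continuous_on S (\<lambda>x. mdist X (f x) (g x))"
proof -
  have "continuous_map (top_of_set S) (mtopology_of X) f" "continuous_map (top_of_set S) (mtopology_of X) g"
    using assms by (auto simp: continuous_map_in_subtopology)
  from continuous_map_mdist[OF this] show ?thesis by simp
qed

text \<open>The metric induces the ambient topology, so \<open>mdist X y x\<close> tends to 0 as
  \<open>y\<close> tends to \<open>x\<close> within \<open>S\<close>, and the Lipschitz bound
  squeezes the increments of \<open>h\<close>.\<close>

lemma lip_on_continuous:
  assumes "mtopology_of X = top_of_set (mspace X)" "lip_on C X S h" "S \<subseteq> mspace X"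
  shows "continuous_on S h"
proof (clarsimp simp: continuous_on_def)
  fix x assume x: "x \<in> S"
  have "continuous_on S (\<lambda>y. C * mdist X y x)"
    using x assms by (intro continuous_intros continuous_on_mdist[of X]) auto
  then have "((\<lambda>y. C * mdist X y x) \<longlongrightarrow> C * mdist X x x) (at x within S)"
    using x unfolding continuous_on_def by blast
  moreover have "mdist X x x = 0" using x assms(3) by (simp add: subset_iff)
  ultimately have "((\<lambda>y. C * mdist X y x) \<longlongrightarrow> 0) (at x within S)" by simp
  then have "((\<lambda>y. h y - h x) \<longlongrightarrow> 0) (at x within S)"
  proof (rule Lim_null_comparison[rotated])
    show "\<forall>\<^sub>F y in at x within S. norm (h y - h x) \<le> C * mdist X y x"
      using lip_onD[OF assms(2) _ x] by (auto simp: eventually_at_filter)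
  qed
  then show "(h \<longlongrightarrow> h x) (at x within S)" by (simp add: LIM_zero_iff)
qed

lemma compact_mdist_bounded:
  assumes "mtopology_of X = top_of_set (mspace X)" "compact (mspace X)"
  obtains B where "B > 0" "\<And>x y. x \<in> mspace X \<Longrightarrow> y \<in> mspace X \<Longrightarrow> mdist X x y \<le> B"
proof (cases "mspace X = {}")
  case False
  then obtain p where p: "p \<in> mspace X" by auto
  have "compact ((\<lambda>x. mdist X p x) ` mspace X)"
    by (rule compact_continuous_image[OF continuous_on_mdist[OF assms(1)] assms(2)]) (use p in auto)
  then obtain B where B: "\<And>x. x \<in> mspace X \<Longrightarrow> mdist X p x \<le> B"
    by (metis bounded_real abs_le_D1 compact_imp_bounded image_eqI)
  show ?thesis
  proof
    show "2 * \<bar>B\<bar> + 1 > 0" by simp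
    fix x y assume "x \<in> mspace X" "y \<in> mspace X"
    then show "mdist X x y \<le> 2 * \<bar>B\<bar> + 1"
      using mdist_triangle[of x X p y] p B[of x] B[of y] by (simp add: mdist_commute)
  qed
qed (auto intro: that[of 1])

lemma compact_finite_net:
  assumes top: "mtopology_of X = top_of_set (mspace X)" and "compact S" "S \<subseteq> mspace X" "\<delta> > 0"
  obtains F where "finite F" "F \<subseteq> S" "\<And>s. s \<in> S \<Longrightarrow> \<exists>i\<in>F. mdist X i s < \<delta>"
proof -
  have op: "openin (top_of_set (mspace X)) (mball_of X i \<delta>)" for i
    unfolding top[symmetric] mball_of_def mtopology_of_def
    by (rule Metric_space.openin_mball) simp
  have "\<forall>i. \<exists>U. open U \<and> mball_of X i \<delta> = mspace X \<inter> U"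
    using op unfolding openin_open by blast
  then obtain U where U: "\<And>i. open (U i)" "\<And>i. mball_of X i \<delta> = mspace X \<inter> U i"
    unfolding choice_iff by blast
  have "S \<subseteq> (\<Union>i\<in>S. U i)"
  proof
    fix s assume "s \<in> S"
    then have "s \<in> mspace X" "mdist X s s = 0" using assms(3) by (auto simp: subset_iff)
    then have "s \<in> mball_of X s \<delta>" using assms(4) by simp
    then show "s \<in> (\<Union>i\<in>S. U i)" using U(2) \<open>s \<in> S\<close> by blast
  qed
  then obtain F where F: "F \<subseteq> S" "finite F" "S \<subseteq> (\<Union>i\<in>F. U i)"
    using compactE_image[OF assms(2), of S U] U(1) by blast
  show ?thesis
  proof
    fix s assume "s \<in> S"
    then obtain i where i: "i \<in> F" "s \<in> mspace X \<inter> U i" using F assms(3) by blast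
    have "s \<in> mball_of X i \<delta>" using i U(2) by blast
    then show "\<exists>i\<in>F. mdist X i s < \<delta>" using i(1) by auto
  qed (use F in auto)
qed

text \<open>Tent functions of height \<delta> around the net points, divided by their sum
  \<open>W\<close>. The net has mesh \<delta> / 2, so \<open>W\<close> is at least \<delta> / 2 and
  the quotients stay Lipschitz. The function \<open>d\<close> is not tied to a metric type, so that
  pseudometrics on the natural numbers are covered.\<close>

lemma partition_of_unity:
  fixes d :: "'i \<Rightarrow> 'i \<Rightarrow> real"
  assumes "finite F" and "\<delta> > 0" and net: "\<And>s. s \<in> S \<Longrightarrow> \<exists>i\<in>F. d i s < \<delta> / 2"
    and lip: "\<And>i s t. i \<in> F \<Longrightarrow> s \<in> S \<Longrightarrow> t \<in> S \<Longrightarrow> \<bar>d i s - d i t\<bar> \<le> d s t"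
    and "\<And>s t. s \<in> S \<Longrightarrow> t \<in> S \<Longrightarrow> 0 \<le> d s t"
  shows "\<exists>\<phi> C. 0 < C \<and> (\<forall>i\<in>F. \<forall>s\<in>S. \<forall>t\<in>S. \<bar>\<phi> i s - \<phi> i t\<bar> \<le> C * d s t) \<and>
    (\<forall>i\<in>F. \<forall>s\<in>S. 0 \<le> \<phi> i s) \<and> (\<forall>s\<in>S. (\<Sum>i\<in>F. \<phi> i s) = 1) \<and>
    (\<forall>i\<in>F. \<forall>s\<in>S. \<delta> \<le> d i s \<longrightarrow> \<phi> i s = 0)"
proof -
  define w where "w = (\<lambda>i s. max 0 (\<delta> - d i s))"
  define W where "W = (\<lambda>s. \<Sum>i\<in>F. w i s)"
  define N where "N = real (card F)"
  have w0: "0 \<le> w i s" for i s by (simp add: w_def)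
  have wl: "\<bar>w i s - w i t\<bar> \<le> d s t" if "i \<in> F" "s \<in> S" "t \<in> S" for i s t
    using lip[OF that] by (auto simp: w_def)
  have W: "W s \<ge> \<delta> / 2" if s: "s \<in> S" for s
  proof -
    obtain i where i: "i \<in> F" "d i s < \<delta> / 2" using net[OF s] by auto
    have "w i s \<le> W s" unfolding W_def using assms(1) i w0 by (intro member_le_sum) auto
    then show ?thesis using i by (auto simp: w_def)
  qed
  have Wl: "\<bar>W s - W t\<bar> \<le> N * d s t" if "s \<in> S" "t \<in> S" for s t
  proof -
    have "\<bar>W s - W t\<bar> \<le> (\<Sum>i\<in>F. \<bar>w i s - w i t\<bar>)"
      unfolding W_def sum_subtractf[symmetric] by (rule sum_abs)
    also have "\<dots> \<le> (\<Sum>i\<in>F. d s t)" by (intro sum_mono wl that)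
    finally show ?thesis by (simp add: N_def)
  qed
  have quot: "w i s / W s \<le> 1" if "i \<in> F" "s \<in> S" for i s
  proof -
    have "w i s \<le> W s" unfolding W_def using assms(1) that w0 by (intro member_le_sum) auto
    then show ?thesis using W[OF that(2)] assms(2) by (simp add: divide_le_eq_1)
  qed
  show ?thesis
  proof (intro exI[of _ "\<lambda>i s. w i s / W s"] exI[of _ "2 * (N + 1) / \<delta>"] conjI ballI impI)
    show "2 * (N + 1) / \<delta> > 0" using assms(2) by (simp add: N_def add_nonneg_pos)
    fix i s assume i: "i \<in> F" and s: "s \<in> S"
    show "w i s / W s = 0" if "\<delta> \<le> d i s" using that by (simp add: w_def)
    have "W s \<ge> 0" using W[OF s] assms(2) by simp
    then show "0 \<le> w i s / W s" using w0 by simp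
  next
    fix i s assume i: "i \<in> F" and s: "s \<in> S"
    fix t assume t: "t \<in> S"
    have p: "W s > 0" "W t > 0" using W[OF s] W[OF t] assms(2) by linarith+
    \<comment> \<open>Arranged so that each summand contains a difference of Lipschitz functions;
      the remaining factor \<open>w i t / W t\<close> is at most 1.\<close>
    have "w i s / W s - w i t / W t = (w i s - w i t) / W s + (w i t / W t) * ((W t - W s) / W s)"
      using p by (simp add: field_simps)
    then have "\<bar>w i s / W s - w i t / W t\<bar> \<le> \<bar>w i s - w i t\<bar> / W s + (w i t / W t) * (\<bar>W t - W s\<bar> / W s)"
      using p w0[of i t]
        abs_triangle_ineq[of "(w i s - w i t) / W s" "(w i t / W t) * ((W t - W s) / W s)"]
      by (simp add: abs_mult abs_divide)
    also have "\<dots> \<le> \<bar>w i s - w i t\<bar> / W s + 1 * (\<bar>W t - W s\<bar> / W s)"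
      using quot[OF i t] p by (intro add_left_mono mult_right_mono) auto
    also have "\<dots> = (\<bar>w i s - w i t\<bar> + \<bar>W t - W s\<bar>) / W s" by (simp add: add_divide_distrib)
    also have "\<dots> \<le> (d s t + N * d s t) / W s"
      using wl[OF i s t] Wl[OF s t] p by (intro divide_right_mono) auto
    also have "\<dots> \<le> (d s t + N * d s t) / (\<delta> / 2)"
      using W[OF s] assms(2) assms(5)[OF s t] by (intro divide_left_mono) (auto simp: N_def)
    also have "\<dots> = 2 * (N + 1) / \<delta> * d s t" by (simp add: field_simps)
    finally show "\<bar>w i s / W s - w i t / W t\<bar> \<le> 2 * (N + 1) / \<delta> * d s t" .
  next
    fix s assume "s \<in> S"
    then show "(\<Sum>i\<in>F. w i s / W s) = 1"
      using W[of s] assms(2) unfolding sum_divide_distrib[symmetric] by (simp add: W_def)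
  qed
qed

section \<open>Compact convex metric spaces\<close>

lemma affine_mapsD:
  assumes "f \<in> affine_maps X Y"
  shows "continuous_map (mtopology_of X) (mtopology_of Y) f" "affine_on (mspace X) f"
    "x \<in> mspace X \<Longrightarrow> f x \<in> mspace Y"
  using assms by (auto simp: affine_maps_def continuous_map_def)

lemma affine_maps_compose:
  assumes "f \<in> affine_maps X Y" "g \<in> affine_maps Y Z"
  shows "(\<lambda>x. g (f x)) \<in> affine_maps X Z"
  using assms continuous_map_compose[of "mtopology_of X" "mtopology_of Y" f "mtopology_of Z" g]
  by (auto simp: affine_maps_def comp_def continuous_map_def intro!: affine_on_compose[of _ f _ g])

lemma affine_maps_id: "(\<lambda>x. x) \<in> affine_maps X X"
  by (simp add: affine_maps_def)

locale compact_convex_space =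
  fixes X :: "'a::locally_convex_space metric"
  assumes ccms: "compact_convex_metric_space X"
begin

lemma top: "mtopology_of X = top_of_set (mspace X)"
  and conv: "convex (mspace X)" and comp: "compact (mspace X)" and nonempty: "mspace X \<noteq> {}"
  using ccms by (auto simp: compact_convex_metric_space_def)

lemma convD: "x \<in> mspace X \<Longrightarrow> y \<in> mspace X \<Longrightarrow> 0 \<le> u \<Longrightarrow> 0 \<le> v \<Longrightarrow> u + v = 1 \<Longrightarrow>
    u *\<^sub>R x + v *\<^sub>R y \<in> mspace X"
  using conv by (simp add: convex_def)

lemma continuous_compose:
  assumes "f \<in> affine_maps W X" "continuous_on (mspace X) H"
  shows "continuous_map (mtopology_of W) euclideanreal (\<lambda>w. H (f w))"
proof -
  have "continuous_map (mtopology_of X) euclideanreal H"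
    using assms(2) by (simp add: continuous_map_real_iff[OF top])
  then show ?thesis
    using continuous_map_compose[of "mtopology_of W" "mtopology_of X" f euclideanreal H]
      affine_mapsD(1)[OF assms(1)] by (simp add: comp_def)
qed

end

text \<open>The form in which metric Bauer simplices are used: \<open>K\<close> turns out to be the extreme boundary of
  \<open>X\<close>, and the three conditions are equivalent to \<open>metric_bauer_simplex X\<close>.\<close>

locale bauer_model = compact_convex_space X
  for X :: "'a::locally_convex_space metric" +
  fixes K :: "'a set"
  assumes K: "K \<subseteq> mspace X" "compact K"
    and lip_extension: "lip_on 1 X K h \<Longrightarrow>
      \<exists>H. affine_on (mspace X) H \<and> lip_on 1 X (mspace X) H \<and> (\<forall>k\<in>K. H k = h k)"
    and nonneg_from_K: "continuous_on (mspace X) (H :: 'a \<Rightarrow> real) \<Longrightarrow> affine_on (mspace X) H \<Longrightarrow>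
      (\<And>k. k \<in> K \<Longrightarrow> 0 \<le> H k) \<Longrightarrow> x \<in> mspace X \<Longrightarrow> 0 \<le> H x"
    and dist_attained: "x \<in> mspace X \<Longrightarrow> y \<in> mspace X \<Longrightarrow> c < mdist X x y \<Longrightarrow>
      \<exists>H. affine_on (mspace X) H \<and> lip_on 1 X (mspace X) H \<and> c < H x - H y"
begin

lemma K_mspace: "k \<in> K \<Longrightarrow> k \<in> mspace X"
  using K(1) by blast

lemma lip_cont: "lip_on C X (mspace X) H \<Longrightarrow> continuous_on (mspace X) H"
  using lip_on_continuous[OF top] by blast

lemma le_from_K:
  fixes G H :: "'a \<Rightarrow> real"
  assumes "continuous_on (mspace X) G" "affine_on (mspace X) G"
    "continuous_on (mspace X) H" "affine_on (mspace X) H"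
    "\<And>k. k \<in> K \<Longrightarrow> G k \<le> H k" "x \<in> mspace X"
  shows "G x \<le> H x"
  using nonneg_from_K[of "\<lambda>x. H x - G x" x] assms
  by (simp add: affine_on_diff continuous_on_diff)

lemma bound_from_K:
  fixes G :: "'a \<Rightarrow> real"
  assumes "continuous_on (mspace X) G" "affine_on (mspace X) G"
    "\<And>k. k \<in> K \<Longrightarrow> G k \<le> c" "x \<in> mspace X"
  shows "G x \<le> c"
  using le_from_K[of G "\<lambda>_. c" x] assms by simp

lemma eq_from_K:
  fixes G H :: "'a \<Rightarrow> real"
  assumes "continuous_on (mspace X) G" "affine_on (mspace X) G"
    "continuous_on (mspace X) H" "affine_on (mspace X) H"
    "\<And>k. k \<in> K \<Longrightarrow> G k = H k" "x \<in> mspace X"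
  shows "G x = H x"
  using le_from_K[of G H x] le_from_K[of H G x] assms by (simp add: order_antisym)

lemma K_nonempty: "K \<noteq> {}"
proof
  assume "K = {}"
  then have "(0::real) \<le> -1" if "x \<in> mspace X" for x
    using nonneg_from_K[of "\<lambda>_. -1" x] that by simp
  then show False using nonempty by auto
qed

text \<open>A minimum principle. It turns closeness of arbitrary points of the simplex, measured by
  an affine function, into closeness of a boundary point.\<close>

lemma ex_K_less:
  fixes G :: "'a \<Rightarrow> real"
  assumes "continuous_on (mspace X) G" "affine_on (mspace X) G" "x \<in> mspace X" "G x < c"
  shows "\<exists>k\<in>K. G k < c"
proof (rule ccontr)
  assume "\<not> ?thesis"
  then have "c \<le> G x"
    using le_from_K[of "\<lambda>_. c" G x] assms by (simp add: not_less)
  then show False using assms by simp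
qed

text \<open>Rescaling to constant 1. For \<open>C = 0\<close> one cannot divide, but then
  \<open>h\<close> is constant on \<open>K\<close>.\<close>

lemma lip_extension_scaled:
  assumes "lip_on C X K h" "C \<ge> 0"
  shows "\<exists>H. affine_on (mspace X) H \<and> lip_on C X (mspace X) H \<and> (\<forall>k\<in>K. H k = h k)"
proof (cases "C = 0")
  case True
  obtain k0 where k0: "k0 \<in> K" using K_nonempty by auto
  have "\<forall>k\<in>K. h k0 = h k"
  proof
    fix k assume "k \<in> K"
    from lip_onD[OF assms(1) k0 this] show "h k0 = h k" using True by simp
  qed
  then show ?thesis using assms(2) by (intro exI[of _ "\<lambda>_. h k0"]) simp
next
  case False
  then have C: "C > 0" using assms(2) by simp
  have "lip_on 1 X K (\<lambda>x. inverse C * h x)" using lip_on_cmult[OF assms(1), of "inverse C"] C by simp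
  then obtain H where H: "affine_on (mspace X) H" "lip_on 1 X (mspace X) H" "\<forall>k\<in>K. H k = inverse C * h k"
    using lip_extension by blast
  then show ?thesis using C lip_on_cmult[OF H(2), of C]
    by (intro exI[of _ "\<lambda>x. C * H x"]) (auto intro: affine_on_cmult)
qed

text \<open>The affine extension \<open>H\<close> of the distance to \<open>k\<close> vanishes at
  \<open>k\<close> and is 1-Lipschitz, so it is below the distance. Conversely every 1-Lipschitz
  affine \<open>G\<close> satisfies \<open>G - G k \<le> H\<close> on \<open>K\<close>, hence on
  \<open>X\<close>, and such differences attain the distance by
  \<open>dist_attained\<close>.\<close>

lemma dist_from_K_affine:
  assumes k: "k \<in> K"
  shows "affine_on (mspace X) (mdist X k)"
proof -
  have kX: "k \<in> mspace X" using k K by auto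
  obtain H where H: "affine_on (mspace X) H" "lip_on 1 X (mspace X) H" "\<forall>x\<in>K. H x = mdist X k x"
    using lip_extension[OF lip_on_mdist[OF K(1) kX]] by auto
  have Hk: "H k = 0" using H k kX by simp
  have "H x = mdist X k x" if x: "x \<in> mspace X" for x
  proof (rule antisym)
    show "H x \<le> mdist X k x" using lip_onD[OF H(2) kX x] Hk by simp
    show "mdist X k x \<le> H x"
    proof (rule ccontr)
      assume "\<not> ?thesis"
      then have "H x < mdist X x k" by (simp add: mdist_commute)
      then obtain G where G: "affine_on (mspace X) G" "lip_on 1 X (mspace X) G" "H x < G x - G k"
        using dist_attained[OF x kX] by blast
      have "G x - G k \<le> H x"
      proof (rule le_from_K[OF _ _ _ H(1) _ x])
        fix j assume j: "j \<in> K"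
        then show "G j - G k \<le> H j"
          using lip_onD[OF G(2), of j k] K(1) kX H(3) by (auto simp: mdist_commute)
      next
        show "continuous_on (mspace X) (\<lambda>x. G x - G k)"
          by (intro continuous_on_diff continuous_on_const lip_cont[OF G(2)])
        show "affine_on (mspace X) (\<lambda>x. G x - G k)"
          by (intro affine_on_diff affine_on_const G(1))
        show "continuous_on (mspace X) H" by (rule lip_cont[OF H(2)])
      qed
      then show False using G(3) by simp
    qed
  qed
  then show ?thesis using affine_on_cong[OF conv, of H "mdist X k"] H(1) by blast
qed

lemma continuous_mdist: "x \<in> mspace X \<Longrightarrow> continuous_on (mspace X) (mdist X x)"
  by (rule continuous_on_mdist[OF top]) auto

lemma affine_maps_comp_mdist:
  assumes "f \<in> affine_maps W X" "k \<in> K"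
  shows "affine_on (mspace W) (\<lambda>w. mdist X k (f w))"
  by (rule affine_on_compose[OF affine_mapsD(2)[OF assms(1)] dist_from_K_affine[OF assms(2)]])
    (use affine_mapsD(3)[OF assms(1)] in blast)

text \<open>The McShane infimum \<open>h\<close> is \<open>C\<close>-Lipschitz on \<open>K\<close>
  and lies between \<phi> - \<eta> and \<phi> there. Its affine extension stays between these two
  affine functions on all of \<open>X\<close>, so only values on \<open>K\<close> have to be
  controlled.\<close>

lemma smooth_almost_lip:
  assumes cont: "continuous_on (mspace X) \<phi>" and aff: "affine_on (mspace X) \<phi>" and "0 \<le> C"
    and al: "\<And>k k'. k \<in> K \<Longrightarrow> k' \<in> K \<Longrightarrow> \<phi> k - \<phi> k' \<le> C * mdist X k k' + \<eta>"
  shows "\<exists>a. affine_on (mspace X) a \<and> lip_on C X (mspace X) a \<and> (\<forall>x\<in>mspace X. \<bar>a x - \<phi> x\<bar> \<le> \<eta>)"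
proof -
  define h where "h = (\<lambda>k. INF j\<in>K. \<phi> j + C * mdist X k j)"
  have "bounded (\<phi> ` K)"
    using K by (intro compact_imp_bounded compact_continuous_image continuous_on_subset[OF cont])
  then obtain B where B: "\<And>k. k \<in> K \<Longrightarrow> \<bar>\<phi> k\<bar> \<le> B" by (auto simp: bounded_iff)
  have bb: "bdd_below ((\<lambda>j. \<phi> j + C * mdist X k j) ` K)" for k
  proof (rule bdd_belowI2[of _ "- B"])
    fix j assume "j \<in> K"
    then show "- B \<le> \<phi> j + C * mdist X k j"
      using B[of j] mult_nonneg_nonneg[OF assms(3), of "mdist X k j"] by auto
  qed
  have le: "h k \<le> \<phi> j + C * mdist X k j" if "j \<in> K" for k j
    unfolding h_def by (rule cINF_lower[OF bb that])
  have ge: "c \<le> h k" if "\<And>j. j \<in> K \<Longrightarrow> c \<le> \<phi> j + C * mdist X k j" for c k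
    unfolding h_def by (rule cINF_greatest[OF K_nonempty that])
  have "lip_on C X K h"
  proof (rule lip_onI)
    fix x y assume xy: "x \<in> K" "y \<in> K"
    have "h x - C * mdist X x y \<le> h y"
    proof (rule ge)
      fix j assume j: "j \<in> K"
      have "mdist X x j \<le> mdist X x y + mdist X y j"
        using K xy j by (auto intro: mdist_triangle)
      from mult_left_mono[OF this assms(3)]
      show "h x - C * mdist X x y \<le> \<phi> j + C * mdist X y j"
        using le[OF j, of x] by (simp add: distrib_left)
    qed
    then show "h x - h y \<le> C * mdist X x y" by simp
  qed
  then obtain a where a: "affine_on (mspace X) a" "lip_on C X (mspace X) a" "\<forall>k\<in>K. a k = h k"
    using lip_extension_scaled assms(3) by blast
  have up: "h k \<le> \<phi> k" if "k \<in> K" for k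
    using le[OF that, of k] that K(1) by (auto simp: subset_iff)
  have lo: "\<phi> k - \<eta> \<le> h k" if "k \<in> K" for k
    using al[OF that] by (intro ge) (simp add: algebra_simps)
  obtain k0 where "k0 \<in> K" using K_nonempty by auto
  then have eta: "\<eta> \<ge> 0" using up[of k0] lo[of k0] by simp
  have "\<bar>a x - \<phi> x\<bar> \<le> \<eta>" if x: "x \<in> mspace X" for x
  proof -
    have "a x \<le> \<phi> x"
      by (rule le_from_K[OF lip_cont[OF a(2)] a(1) cont aff _ x]) (use a(3) up in auto)
    moreover have "\<phi> x - \<eta> \<le> a x"
      by (rule le_from_K[OF _ _ lip_cont[OF a(2)] a(1) _ x])
        (use a(3) lo cont aff in \<open>auto intro: affine_on_diff continuous_on_diff\<close>)
    ultimately show ?thesis using eta by simp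
  qed
  then show ?thesis using a by blast
qed

text \<open>The distance of \<open>p x\<close> and \<open>q x\<close> need not be affine in
  \<open>x\<close>, but it is exhausted by the functions \<open>H (p x) - H (q x)\<close>, which are
  affine and therefore bounded from \<open>K\<close>.\<close>

lemma dist_affine_maps_le:
  assumes p: "p \<in> affine_maps X Y" and q: "q \<in> affine_maps X Y"
    and Y: "bauer_model Y M"
    and le: "\<And>k. k \<in> K \<Longrightarrow> mdist Y (p k) (q k) \<le> c" and x: "x \<in> mspace X"
  shows "mdist Y (p x) (q x) \<le> c"
proof (rule ccontr)
  interpret Y: bauer_model Y M by fact
  assume "\<not> ?thesis"
  then have "c < mdist Y (p x) (q x)" by simp
  then obtain H where H: "affine_on (mspace Y) H" "lip_on 1 Y (mspace Y) H" "c < H (p x) - H (q x)"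
    using Y.dist_attained affine_mapsD(3)[OF p x] affine_mapsD(3)[OF q x] by blast
  have "H (p x) - H (q x) \<le> c"
  proof (rule bound_from_K[of "\<lambda>x. H (p x) - H (q x)", OF _ _ _ x])
    show "continuous_on (mspace X) (\<lambda>x. H (p x) - H (q x))"
      using Y.continuous_compose[OF p Y.lip_cont[OF H(2)]] Y.continuous_compose[OF q Y.lip_cont[OF H(2)]]
      unfolding continuous_map_real_iff[OF top] by (rule continuous_on_diff)
    show "affine_on (mspace X) (\<lambda>x. H (p x) - H (q x))"
      using affine_mapsD(3)[OF p] affine_mapsD(3)[OF q]
      by (intro affine_on_diff affine_on_compose[OF _ H(1)] affine_mapsD(2)[OF p] affine_mapsD(2)[OF q])
        blast+
    fix k assume k: "k \<in> K"
    then have "k \<in> mspace X" using K by auto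
    then show "H (p k) - H (q k) \<le> c"
      using lip_onD[OF H(2) affine_mapsD(3)[OF p] affine_mapsD(3)[OF q], of k k] le[OF k] by simp
  qed
  then show False using H(3) by simp
qed

end

section \<open>The intertwining gap\<close>

text \<open>Gromov--Hausdorff correspondences between \<open>K\<close> and \<open>M\<close> of distortion at most \<open>\<delta>\<close>.\<close>

definition corr :: "real \<Rightarrow> 'a metric \<Rightarrow> 'a set \<Rightarrow> 'b metric \<Rightarrow> 'b set \<Rightarrow> ('a \<Rightarrow> 'b \<Rightarrow> bool) \<Rightarrow> bool" where
  "corr \<delta> X K Y M R \<longleftrightarrow>
    (\<forall>k\<in>K. \<exists>m\<in>M. R k m) \<and> (\<forall>m\<in>M. \<exists>k\<in>K. R k m) \<and>
    (\<forall>k\<in>K. \<forall>k'\<in>K. \<forall>m\<in>M. \<forall>m'\<in>M. R k m \<longrightarrow> R k' m' \<longrightarrow> \<bar>mdist X k k' - mdist Y m m'\<bar> \<le> \<delta>)"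

lemma corrD:
  assumes "corr \<delta> X K Y M R"
  shows "k \<in> K \<Longrightarrow> \<exists>m\<in>M. R k m" "m \<in> M \<Longrightarrow> \<exists>k\<in>K. R k m"
    "k \<in> K \<Longrightarrow> k' \<in> K \<Longrightarrow> m \<in> M \<Longrightarrow> m' \<in> M \<Longrightarrow> R k m \<Longrightarrow> R k' m' \<Longrightarrow>
      \<bar>mdist X k k' - mdist Y m m'\<bar> \<le> \<delta>"
  using assms unfolding corr_def by blast+

lemma corr_sym: "corr \<delta> X K Y M R \<Longrightarrow> corr \<delta> Y M X K (\<lambda>m k. R k m)"
  unfolding corr_def by (simp add: abs_minus_commute)

lemma isom_epsI:
  assumes "f \<in> affine_maps X Y" "g \<in> affine_maps Y X"
    "\<And>x x'. x \<in> mspace X \<Longrightarrow> x' \<in> mspace X \<Longrightarrow> \<bar>mdist Y (f x) (f x') - mdist X x x'\<bar> < \<epsilon>"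
    "\<And>y. y \<in> mspace Y \<Longrightarrow> mdist Y (f (g y)) y < \<epsilon>"
  shows "f \<in> isom_eps \<epsilon> X Y"
  using assms unfolding isom_eps_def by blast

lemma isom_eps_mono: "isom_eps \<epsilon> X Y \<subseteq> isom_eps \<epsilon>' X Y" if "\<epsilon> \<le> \<epsilon>'"
  using that unfolding isom_eps_def by (auto intro: less_le_trans) (meson less_le_trans)

lemma gap_le:
  assumes "\<epsilon> > 0" "f \<in> isom_eps \<epsilon> X Y" "g \<in> isom_eps \<epsilon> Y X"
  shows "intertwining_gap X Y \<le> \<epsilon>"
  unfolding intertwining_gap_def
  by (rule cInf_lower) (use assms in \<open>auto intro!: bdd_belowI[of _ 0]\<close>)

lemma gap_commute: "intertwining_gap X Y = intertwining_gap Y X"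
  unfolding intertwining_gap_def by (rule arg_cong[of _ _ Inf]) auto

lemma continuous_on_scaleR_lcs:
  fixes g :: "'a::topological_space \<Rightarrow> 'b::locally_convex_space"
  assumes "continuous_on S f" "continuous_on S g"
  shows "continuous_on S (\<lambda>x. f x *\<^sub>R g x)"
  unfolding continuous_on_def
proof
  fix x assume "x \<in> S"
  then have "(f \<longlongrightarrow> f x) (at x within S)" "(g \<longlongrightarrow> g x) (at x within S)"
    using assms by (simp_all add: continuous_on_def)
  then have "((\<lambda>x. (f x, g x)) \<longlongrightarrow> (f x, g x)) (at x within S)" by (rule tendsto_Pair)
  from filterlim_compose[OF tendsto_scaleR_Pair[of "f x" "g x", folded nhds_prod] this]
  show "((\<lambda>x. f x *\<^sub>R g x) \<longlongrightarrow> f x *\<^sub>R g x) (at x within S)" by simp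
qed

context compact_convex_space
begin

text \<open>Makes the infimum in \<open>intertwining_gap\<close> range over a nonempty set;
  \<open>Inf\<close> of the empty set would be an unspecified real number.\<close>

lemma isom_eps_const:
  assumes Y: "compact_convex_space Y"
  obtains \<epsilon> f where "\<epsilon> > 0" "f \<in> isom_eps \<epsilon> X Y"
proof -
  interpret Y: compact_convex_space Y by fact
  obtain p q where p: "p \<in> mspace X" and q: "q \<in> mspace Y" using nonempty Y.nonempty by auto
  obtain B where B: "B > 0" "\<And>x y. x \<in> mspace X \<Longrightarrow> y \<in> mspace X \<Longrightarrow> mdist X x y \<le> B"
    using compact_mdist_bounded[OF top comp] by blast
  obtain B' where B': "B' > 0" "\<And>x y. x \<in> mspace Y \<Longrightarrow> y \<in> mspace Y \<Longrightarrow> mdist Y x y \<le> B'"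
    using compact_mdist_bounded[OF Y.top Y.comp] by blast
  have "\<forall>x\<in>mspace X. \<forall>y\<in>mspace X. mdist X x y < B + B' + 1"
  proof (intro ballI)
    fix x y assume "x \<in> mspace X" "y \<in> mspace X"
    from B(2)[OF this] show "mdist X x y < B + B' + 1" using B'(1) by linarith
  qed
  moreover have "\<forall>y\<in>mspace Y. mdist Y q y < B + B' + 1"
  proof
    fix y assume "y \<in> mspace Y"
    from B'(2)[OF q this] show "mdist Y q y < B + B' + 1" using B(1) by linarith
  qed
  moreover have "(\<lambda>_. q) \<in> affine_maps X Y" "(\<lambda>_. p) \<in> affine_maps Y X"
    by (auto simp: affine_maps_def p q)
  ultimately have "(\<lambda>_. q) \<in> isom_eps (B + B' + 1) X Y"
    unfolding isom_eps_def using q by (auto intro!: bexI[of _ "\<lambda>_. p"])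
  then show thesis using that[of "B + B' + 1"] B(1) B'(1) by simp
qed

lemma gap_less:
  assumes Y: "compact_convex_space Y" and "intertwining_gap X Y < \<epsilon>"
  obtains f g where "f \<in> isom_eps \<epsilon> X Y" "g \<in> isom_eps \<epsilon> Y X"
proof -
  interpret Y: compact_convex_space Y by fact
  let ?S = "{\<epsilon>. \<epsilon> > 0 \<and> isom_eps \<epsilon> X Y \<times> isom_eps \<epsilon> Y X \<noteq> {}}"
  obtain a f b g where "a > 0" "f \<in> isom_eps a X Y" "b > 0" "g \<in> isom_eps b Y X"
    using isom_eps_const[OF Y] Y.isom_eps_const[OF compact_convex_space_axioms] by metis
  then have "max a b \<in> ?S"
    using isom_eps_mono[of a "max a b" X Y] isom_eps_mono[of b "max a b" Y X] by auto
  then have "?S \<noteq> {}" by blast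
  then obtain e where "e \<in> ?S" "e < \<epsilon>"
    using cInf_lessD[of ?S \<epsilon>] assms(2) unfolding intertwining_gap_def by blast
  then show thesis
    using that isom_eps_mono[of e \<epsilon> X Y] isom_eps_mono[of e \<epsilon> Y X] by fastforce
qed

lemma gap_nonneg:
  assumes "compact_convex_space Y"
  shows "0 \<le> intertwining_gap X Y"
proof (rule ccontr)
  assume "\<not> ?thesis"
  then have neg: "intertwining_gap X Y < 0" by simp
  obtain f g where f: "f \<in> isom_eps 0 X Y" using gap_less[OF assms neg] by blast
  obtain x where "x \<in> mspace X" using nonempty by auto
  then show False using f unfolding isom_eps_def by fastforce
qed

end

lemma isom_epsD:
  assumes "f \<in> isom_eps \<epsilon> X Y"
  shows "f \<in> affine_maps X Y"
    "x \<in> mspace X \<Longrightarrow> x' \<in> mspace X \<Longrightarrow> \<bar>mdist Y (f x) (f x') - mdist X x x'\<bar> < \<epsilon>"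
    "\<exists>g\<in>affine_maps Y X. \<forall>y\<in>mspace Y. mdist Y (f (g y)) y < \<epsilon>"
  using assms unfolding isom_eps_def by auto

text \<open>Distortions add up to \<open>a + b\<close>, but the approximate inverse costs
  \<open>a + 2 * b\<close>: an error \<open>a\<close> in \<open>Y\<close> is carried to
  \<open>Z\<close> by \<open>g\<close> with distortion \<open>b\<close>, and \<open>g\<close> has
  its own inversion error \<open>b\<close>.\<close>

lemma isom_eps_compose:
  assumes f: "f \<in> isom_eps a X Y" and g: "g \<in> isom_eps b Y Z"
  shows "(\<lambda>x. g (f x)) \<in> isom_eps (a + 2 * b) X Z"
proof -
  note F = isom_epsD[OF f] and G = isom_epsD[OF g]
  note fm = affine_mapsD(3)[OF F(1)] and gm = affine_mapsD(3)[OF G(1)]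
  obtain f' where f': "f' \<in> affine_maps Y X" "\<And>y. y \<in> mspace Y \<Longrightarrow> mdist Y (f (f' y)) y < a" using F(3) by auto
  obtain g' where g': "g' \<in> affine_maps Z Y" "\<And>y. y \<in> mspace Z \<Longrightarrow> mdist Z (g (g' y)) y < b" using G(3) by auto
  have "\<bar>mdist Z (g (f x)) (g (f x')) - mdist X x x'\<bar> < a + 2 * b" if "x \<in> mspace X" "x' \<in> mspace X" for x x'
    using F(2)[OF that] G(2)[OF fm fm, OF that] by linarith
  moreover have "mdist Z (g (f (f' (g' z)))) z < a + 2 * b" if z: "z \<in> mspace Z" for z
  proof -
    have g'z: "g' z \<in> mspace Y" using affine_mapsD(3)[OF g'(1) z] .
    then have "f (f' (g' z)) \<in> mspace Y" using fm affine_mapsD(3)[OF f'(1)] by blast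
    then show ?thesis
      using G(2)[OF _ g'z, of "f (f' (g' z))"] f'(2)[OF g'z] g'(2)[OF z]
        mdist_triangle[of "g (f (f' (g' z)))" Z "g (g' z)" z] gm g'z z by force
  qed
  moreover have "(\<lambda>z. f' (g' z)) \<in> affine_maps Z X" using affine_maps_compose[OF g'(1) f'(1)] .
  ultimately show ?thesis
    using affine_maps_compose[OF F(1) G(1)] by (intro isom_epsI)
qed

text \<open>The two composites carry the errors \<open>a + 2 * b\<close> and
  \<open>b + 2 * a\<close>, both at most \<open>2 * a + 2 * b\<close>; after doubling, the two
  slacks \<open>e / 4\<close> add up to \<open>e\<close>.\<close>

lemma gap_quasi_triangle:
  assumes X: "compact_convex_space X" and Y: "compact_convex_space Y" and Z: "compact_convex_space Z"
  shows "intertwining_gap X Z \<le> 2 * (intertwining_gap X Y + intertwining_gap Y Z)"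
proof (rule field_le_epsilon)
  fix e :: real assume e: "e > 0"
  define a where "a = intertwining_gap X Y + e / 4"
  define b where "b = intertwining_gap Y Z + e / 4"
  have a: "a > 0" and b: "b > 0"
    using compact_convex_space.gap_nonneg[OF X Y] compact_convex_space.gap_nonneg[OF Y Z] e
    by (auto simp: a_def b_def)
  obtain f f' where f: "f \<in> isom_eps a X Y" "f' \<in> isom_eps a Y X"
    using compact_convex_space.gap_less[OF X Y, of a] e by (auto simp: a_def)
  obtain g g' where g: "g \<in> isom_eps b Y Z" "g' \<in> isom_eps b Z Y"
    using compact_convex_space.gap_less[OF Y Z, of b] e by (auto simp: b_def)
  have "(\<lambda>x. g (f x)) \<in> isom_eps (2 * a + 2 * b) X Z"
    using isom_eps_compose[OF f(1) g(1)] isom_eps_mono[of "a + 2 * b" "2 * a + 2 * b" X Z] a by auto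
  moreover have "(\<lambda>x. f' (g' x)) \<in> isom_eps (2 * a + 2 * b) Z X"
    using isom_eps_compose[OF g(2) f(2)] isom_eps_mono[of "b + 2 * a" "2 * a + 2 * b" Z X] b by auto
  ultimately have "intertwining_gap X Z \<le> 2 * a + 2 * b" using a b by (intro gap_le) auto
  then show "intertwining_gap X Z \<le> 2 * (intertwining_gap X Y + intertwining_gap Y Z) + e"
    by (simp add: a_def b_def algebra_simps)
qed

section \<open>Affine isometries and the invariance of the gap\<close>

lemma isometry_continuous_map:
  assumes "f ` mspace X \<subseteq> mspace Y"
    "\<And>x x'. x \<in> mspace X \<Longrightarrow> x' \<in> mspace X \<Longrightarrow> mdist Y (f x) (f x') = mdist X x x'"
  shows "continuous_map (mtopology_of X) (mtopology_of Y) f"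
proof -
  have "Lipschitz_continuous_map X Y f"
    unfolding Lipschitz_continuous_map_def using assms by (auto intro!: exI[of _ 1])
  then show ?thesis by (rule Lipschitz_continuous_imp_continuous_map)
qed

definition inverse_isometries ::
  "'a::real_vector metric \<Rightarrow> 'b::real_vector metric \<Rightarrow> ('a \<Rightarrow> 'b) \<Rightarrow> ('b \<Rightarrow> 'a) \<Rightarrow> bool" where
  "inverse_isometries X Y f g \<longleftrightarrow> f \<in> affine_maps X Y \<and> g \<in> affine_maps Y X \<and>
    (\<forall>x\<in>mspace X. \<forall>x'\<in>mspace X. mdist Y (f x) (f x') = mdist X x x') \<and>
    (\<forall>y\<in>mspace Y. \<forall>y'\<in>mspace Y. mdist X (g y) (g y') = mdist Y y y') \<and>
    (\<forall>y\<in>mspace Y. f (g y) = y) \<and> (\<forall>x\<in>mspace X. g (f x) = x)"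

lemma inverse_isometriesD:
  assumes "inverse_isometries X Y f g"
  shows "f \<in> affine_maps X Y" "g \<in> affine_maps Y X"
    "\<And>x x'. x \<in> mspace X \<Longrightarrow> x' \<in> mspace X \<Longrightarrow> mdist Y (f x) (f x') = mdist X x x'"
    "\<And>y y'. y \<in> mspace Y \<Longrightarrow> y' \<in> mspace Y \<Longrightarrow> mdist X (g y) (g y') = mdist Y y y'"
    "\<And>y. y \<in> mspace Y \<Longrightarrow> f (g y) = y" "\<And>x. x \<in> mspace X \<Longrightarrow> g (f x) = x"
  using assms unfolding inverse_isometries_def by blast+

text \<open>Convexity of the source puts the combination of \<open>g x\<close> and
  \<open>g y\<close> back into the domain of \<open>f\<close>, where \<open>g\<close> undoes
  \<open>f\<close>; this makes the inverse affine.\<close>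

lemma affinely_isometric_maps:
  assumes "convex (mspace X)" "affinely_isometric X Y"
  shows "\<exists>f g. inverse_isometries X Y f g"
proof -
  obtain f where f: "bij_betw f (mspace X) (mspace Y)" "affine_on (mspace X) f"
    "\<And>x x'. x \<in> mspace X \<Longrightarrow> x' \<in> mspace X \<Longrightarrow> mdist Y (f x) (f x') = mdist X x x'"
    using assms unfolding affinely_isometric_def by blast
  define g where "g = inv_into (mspace X) f"
  have g: "\<And>y. y \<in> mspace Y \<Longrightarrow> f (g y) = y" "\<And>x. x \<in> mspace X \<Longrightarrow> g (f x) = x"
    "\<And>y. y \<in> mspace Y \<Longrightarrow> g y \<in> mspace X" "\<And>x. x \<in> mspace X \<Longrightarrow> f x \<in> mspace Y"
    using f(1) bij_betw_inv_into[OF f(1)]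
    by (auto simp: g_def bij_betw_inv_into_right bij_betw_inv_into_left bij_betw_apply)
  have "affine_on (mspace Y) g"
    unfolding affine_on_def
  proof (intro ballI allI impI)
    fix x y and u v :: real assume *: "x \<in> mspace Y" "y \<in> mspace Y" "0 \<le> u" "0 \<le> v" "u + v = 1"
    then have "g (u *\<^sub>R x + v *\<^sub>R y) = g (f (u *\<^sub>R g x + v *\<^sub>R g y))"
      using affine_onD[OF f(2) g(3) g(3), of x y u v] g(1) by simp
    also have "\<dots> = u *\<^sub>R g x + v *\<^sub>R g y"
      using * g(3) assms(1) by (intro g(2)) (auto simp: convex_def)
    finally show "g (u *\<^sub>R x + v *\<^sub>R y) = u *\<^sub>R g x + v *\<^sub>R g y" .
  qed
  moreover have d: "mdist X (g x) (g y) = mdist Y x y" if "x \<in> mspace Y" "y \<in> mspace Y" for x y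
    using f(3)[OF g(3) g(3), OF that] g(1) that by simp
  ultimately have ga: "g \<in> affine_maps Y X"
    unfolding affine_maps_def using g(3) isometry_continuous_map[of g Y X] by blast
  have "f \<in> affine_maps X Y"
    unfolding affine_maps_def using f(2,3) g(4) isometry_continuous_map[of f X Y] by blast
  then have "inverse_isometries X Y f g" unfolding inverse_isometries_def using ga f(3) d g(1,2) by blast
  then show ?thesis by blast
qed

lemma affinely_isometric_sym:
  assumes "convex (mspace X)" "affinely_isometric X Y"
  shows "affinely_isometric Y X"
proof -
  obtain f g where "inverse_isometries X Y f g"
    using affinely_isometric_maps[OF assms] by blast
  note fg = inverse_isometriesD[OF this]
  have "bij_betw g (mspace Y) (mspace X)"
    by (rule bij_betw_byWitness[where f' = f])
      (use fg(5,6) affine_mapsD(3)[OF fg(1)] affine_mapsD(3)[OF fg(2)] in auto)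
  then show ?thesis unfolding affinely_isometric_def using fg(4) affine_mapsD(2)[OF fg(2)] by blast
qed

lemma affinely_isometric_trans:
  assumes "affinely_isometric X Y" "affinely_isometric Y Z"
  shows "affinely_isometric X Z"
proof -
  obtain f where f: "bij_betw f (mspace X) (mspace Y)" "affine_on (mspace X) f"
    "\<And>x x'. x \<in> mspace X \<Longrightarrow> x' \<in> mspace X \<Longrightarrow> mdist Y (f x) (f x') = mdist X x x'"
    using assms(1) unfolding affinely_isometric_def by blast
  obtain g where g: "bij_betw g (mspace Y) (mspace Z)" "affine_on (mspace Y) g"
    "\<And>x x'. x \<in> mspace Y \<Longrightarrow> x' \<in> mspace Y \<Longrightarrow> mdist Z (g x) (g x') = mdist Y x x'"
    using assms(2) unfolding affinely_isometric_def by blast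
  have m: "f x \<in> mspace Y" if "x \<in> mspace X" for x using f(1) that by (rule bij_betwE[rule_format])
  have "bij_betw (\<lambda>x. g (f x)) (mspace X) (mspace Z)"
    using bij_betw_trans[OF f(1) g(1)] by (simp add: comp_def)
  moreover have "affine_on (mspace X) (\<lambda>x. g (f x))"
    using m by (intro affine_on_compose[OF f(2) g(2)]) blast
  ultimately show ?thesis unfolding affinely_isometric_def using f(3) g(3) m by (metis (no_types, lifting))
qed

lemma affinely_isometric_isom_eps:
  assumes "convex (mspace X)" "affinely_isometric X Y" "\<epsilon> > 0"
  shows "\<exists>f. f \<in> isom_eps \<epsilon> X Y"
proof -
  obtain f g where "inverse_isometries X Y f g"
    using affinely_isometric_maps[OF assms(1,2)] by blast
  note fg = inverse_isometriesD[OF this]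
  then have "f \<in> isom_eps \<epsilon> X Y"
    unfolding isom_eps_def using assms(3) by (auto intro!: bexI[of _ g])
  then show ?thesis by blast
qed

lemma gap_zero_if_isometric:
  assumes X: "compact_convex_space X" and Y: "compact_convex_space Y" and "affinely_isometric X Y"
  shows "intertwining_gap X Y = 0"
proof (rule antisym)
  interpret X: compact_convex_space X by fact
  interpret Y: compact_convex_space Y by fact
  show "intertwining_gap X Y \<le> 0"
  proof (rule field_le_epsilon)
    fix e :: real assume e: "e > 0"
    obtain f g where "f \<in> isom_eps e X Y" "g \<in> isom_eps e Y X"
      using affinely_isometric_isom_eps[OF X.conv assms(3) e]
        affinely_isometric_isom_eps[OF Y.conv affinely_isometric_sym[OF X.conv assms(3)] e] by blast
    then show "intertwining_gap X Y \<le> 0 + e" using gap_le[OF e] by simp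
  qed
qed (rule compact_convex_space.gap_nonneg[OF X Y])

lemma isom_eps_iso_invariant:
  assumes "convex (mspace X)" "affinely_isometric X X'" "convex (mspace Y)" "affinely_isometric Y Y'"
    and f: "f \<in> isom_eps \<epsilon> X Y"
  shows "\<exists>f'. f' \<in> isom_eps \<epsilon> X' Y'"
proof -
  obtain p q where "inverse_isometries X X' p q"
    using affinely_isometric_maps[OF assms(1,2)] by blast
  note p = inverse_isometriesD[OF this]
  obtain r s where "inverse_isometries Y Y' r s"
    using affinely_isometric_maps[OF assms(3,4)] by blast
  note r = inverse_isometriesD[OF this]
  note F = isom_epsD[OF f]
  obtain g where g: "g \<in> affine_maps Y X" "\<And>y. y \<in> mspace Y \<Longrightarrow> mdist Y (f (g y)) y < \<epsilon>"
    using F(3) by blast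
  note m = affine_mapsD(3)[OF p(1)] affine_mapsD(3)[OF p(2)] affine_mapsD(3)[OF r(1)]
    affine_mapsD(3)[OF r(2)] affine_mapsD(3)[OF g(1)] affine_mapsD(3)[OF F(1)]
  have "(\<lambda>x. r (f (q x))) \<in> affine_maps X' Y'" "(\<lambda>y. p (g (s y))) \<in> affine_maps Y' X'"
    using affine_maps_compose[OF affine_maps_compose[OF p(2) F(1)] r(1)]
      affine_maps_compose[OF affine_maps_compose[OF r(2) g(1)] p(1)] .
  moreover have "\<bar>mdist Y' (r (f (q x))) (r (f (q x'))) - mdist X' x x'\<bar> < \<epsilon>"
    if "x \<in> mspace X'" "x' \<in> mspace X'" for x x'
    using r(3)[OF m(6) m(6), OF m(2) m(2), OF that] F(2)[OF m(2) m(2), OF that] p(4)[OF that] by simp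
  moreover have "mdist Y' (r (f (q (p (g (s y)))))) y < \<epsilon>" if y: "y \<in> mspace Y'" for y
    using r(3)[OF m(6)[OF m(5)[OF m(4)[OF y]]] m(4)[OF y]] g(2)[OF m(4)[OF y]] r(5)[OF y]
      p(6)[OF m(5)[OF m(4)[OF y]]] by simp
  ultimately have "(\<lambda>x. r (f (q x))) \<in> isom_eps \<epsilon> X' Y'"
    by (rule isom_epsI)
  then show ?thesis by blast
qed

lemma gap_iso_invariant:
  assumes X: "convex (mspace X)" "convex (mspace X')" "affinely_isometric X X'"
    and Y: "convex (mspace Y)" "convex (mspace Y')" "affinely_isometric Y Y'"
  shows "intertwining_gap X Y = intertwining_gap X' Y'"
proof -
  note X' = affinely_isometric_sym[OF X(1,3)] and Y' = affinely_isometric_sym[OF Y(1,3)]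
  have "isom_eps \<epsilon> X Y \<times> isom_eps \<epsilon> Y X \<noteq> {} \<longleftrightarrow> isom_eps \<epsilon> X' Y' \<times> isom_eps \<epsilon> Y' X' \<noteq> {}" for \<epsilon>
    using isom_eps_iso_invariant[OF X(1,3) Y(1,3), of _ \<epsilon>] isom_eps_iso_invariant[OF Y(1,3) X(1,3), of _ \<epsilon>]
      isom_eps_iso_invariant[OF X(2) X' Y(2) Y', of _ \<epsilon>] isom_eps_iso_invariant[OF Y(2) Y' X(2) X', of _ \<epsilon>]
    unfolding Times_empty by fast
  then show ?thesis unfolding intertwining_gap_def by simp
qed

section \<open>Simplices at gap zero\<close>

text \<open>Powers of an isometry that misses a point would produce an infinite separated set.\<close>

lemma compact_isometry_surj:
  assumes top: "mtopology_of X = top_of_set (mspace X)" and comp: "compact (mspace X)"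
    and f: "\<And>x. x \<in> mspace X \<Longrightarrow> f x \<in> mspace X"
    and iso: "\<And>x x'. x \<in> mspace X \<Longrightarrow> x' \<in> mspace X \<Longrightarrow> mdist X (f x) (f x') = mdist X x x'"
    and x: "x \<in> mspace X"
  shows "\<exists>y\<in>mspace X. f y = x"
proof (rule ccontr)
  assume none: "\<not> ?thesis"
  have "lip_on 1 X (mspace X) (\<lambda>y. mdist X x (f y))"
  proof (rule lip_onI)
    fix y z assume yz: "y \<in> mspace X" "z \<in> mspace X"
    show "mdist X x (f y) - mdist X x (f z) \<le> 1 * mdist X y z"
      using mdist_triangle[OF x f[OF yz(2)] f[OF yz(1)]] iso[OF yz] by (simp add: mdist_commute)
  qed
  then have "continuous_on (mspace X) (\<lambda>y. mdist X x (f y))"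
    by (rule lip_on_continuous[OF top]) simp
  then obtain y0 where y0: "y0 \<in> mspace X" "\<And>y. y \<in> mspace X \<Longrightarrow> mdist X x (f y0) \<le> mdist X x (f y)"
    using continuous_attains_inf[OF comp] x by blast
  define \<delta> where "\<delta> = mdist X x (f y0)"
  have "f y0 \<noteq> x" using none y0(1) by blast
  then have \<delta>: "\<delta> > 0"
    using mdist_zero[OF x f[OF y0(1)]] mdist_nonneg[of X x "f y0"] unfolding \<delta>_def
    by (metis less_eq_real_def)
  have it: "(f ^^ n) z \<in> mspace X" if "z \<in> mspace X" for n z using that f by (induction n) auto
  \<comment> \<open>Applying the isometry shifts both indices, so every pair of orbit points reduces
    to \<open>x\<close> against a point of the image, which is at distance at least
    \<delta>.\<close>
  have sep: "\<delta> \<le> mdist X ((f ^^ m) x) ((f ^^ (m + Suc n)) x)" for m n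
  proof (induction m)
    case 0
    show ?case using y0(2)[OF it[OF x]] by (simp add: \<delta>_def)
  next
    case (Suc m)
    then show ?case using iso[OF it[OF x, of m] it[OF x, of "m + Suc n"]] by simp
  qed
  \<comment> \<open>Pigeonhole: two orbit points share a net point of mesh \<delta> / 2 and are then
    closer than \<delta>.\<close>
  obtain F where F: "finite F" "F \<subseteq> mspace X" "\<And>s. s \<in> mspace X \<Longrightarrow> \<exists>i\<in>F. mdist X i s < \<delta> / 2"
    using compact_finite_net[OF top comp subset_refl, of "\<delta> / 2"] \<delta> by auto
  have "\<forall>n. \<exists>i\<in>F. mdist X i ((f ^^ n) x) < \<delta> / 2" using F(3)[OF it[OF x]] by blast
  then obtain c where c: "\<And>n. c n \<in> F" "\<And>n. mdist X (c n) ((f ^^ n) x) < \<delta> / 2" by metis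
  have "finite (range c)" using F(1) c(1) by (meson finite_subset image_subsetI)
  then have "\<not> inj c" using finite_imageD infinite_UNIV_nat by blast
  then obtain m n where mn: "c m = c n" "m < n"
    unfolding inj_def by (metis linorder_neqE_nat)
  then obtain l where l: "n = m + Suc l" using less_imp_Suc_add by auto
  have cm: "c m \<in> mspace X" using c(1) F(2) by blast
  have "mdist X ((f ^^ m) x) ((f ^^ n) x) < \<delta>"
    using mdist_triangle[OF it[OF x, of m] cm it[OF x, of n]] c(2)[of m] c(2)[of n] mn(1)
    by (simp add: mdist_commute)
  then show False using sep[of m l] l by simp
qed

text \<open>The product of copies of \<open>mspace Y\<close> is compact by Tychonoff, and affineness
  and distortion at most \<open>1 / Suc n\<close> are closed conditions in it. The finite
  intersection property then yields a map satisfying all of them.\<close>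

lemma isometry_from_approximations:
  assumes X: "compact_convex_space X" and Y: "compact_convex_space Y"
    and ex: "\<And>\<epsilon>. \<epsilon> > 0 \<Longrightarrow> \<exists>f. f \<in> isom_eps \<epsilon> X Y"
  shows "\<exists>f. affine_on (mspace X) f \<and> (\<forall>x\<in>mspace X. f x \<in> mspace Y) \<and>
    (\<forall>x\<in>mspace X. \<forall>x'\<in>mspace X. mdist Y (f x) (f x') = mdist X x x')"
proof -
  interpret X: compact_convex_space X by fact
  interpret Y: compact_convex_space Y by fact
  define A where "A = (PiE UNIV (\<lambda>_. mspace Y) :: ('a \<Rightarrow> 'b) set)"
  have "compactin (product_topology (\<lambda>_. euclidean) UNIV) A"
    unfolding A_def by (subst compactin_PiE) (auto simp: Y.comp)
  then have A: "compact A" by (simp add: euclidean_product_topology)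
  have ev: "continuous_on S (\<lambda>f. f x)" for x :: 'a and S :: "('a \<Rightarrow> 'b) set"
    by (rule continuous_on_subset[OF continuous_on_product_coordinates]) simp
  define D where "D = (\<lambda>n x x'. A \<inter> (\<lambda>f. mdist Y (f x) (f x')) -`
      {mdist X x x' - 1 / real (Suc n) .. mdist X x x' + 1 / real (Suc n)})"
  have D: "closed (D n x x')" if "x \<in> mspace X" "x' \<in> mspace X" for n x x'
    unfolding D_def
  proof (rule continuous_closed_preimage)
    show "continuous_on A (\<lambda>f. mdist Y (f x) (f x'))"
      by (rule continuous_on_mdist[OF Y.top ev ev]) (auto simp: A_def)
    show "closed A" using A by (rule compact_imp_closed)
  qed simp
  define E where "E = (\<lambda>x x' u v. {f :: 'a \<Rightarrow> 'b. f (u *\<^sub>R x + v *\<^sub>R x') = u *\<^sub>R f x + v *\<^sub>R f x'})"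
  have E: "closed (E x x' u v)" for x x' u v
    unfolding E_def by (intro closed_Collect_eq continuous_on_add continuous_on_scaleR_lcs
        continuous_on_const ev)
  define I where "I = (\<lambda>n. (\<Inter>x\<in>mspace X. \<Inter>x'\<in>mspace X. D n x x') \<inter>
    (\<Inter>x\<in>mspace X. \<Inter>x'\<in>mspace X. \<Inter>u\<in>{0..}. \<Inter>v\<in>{v. 0 \<le> v \<and> u + v = 1}. E x x' u v))"
  have dec: "I n \<subseteq> I m" if "m \<le> n" for m n
  proof -
    have "1 / real (Suc n) \<le> 1 / real (Suc m)" using that by (simp add: frac_le)
    then have "{a - 1 / real (Suc n) .. a + 1 / real (Suc n)} \<subseteq>
        {a - 1 / real (Suc m) .. a + 1 / real (Suc m)}" for a
      unfolding atLeastatMost_subset_iff by linarith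
    then have "D n x x' \<subseteq> D m x x'" for x x'
      unfolding D_def by (intro Int_mono vimage_mono subset_refl)
    then show ?thesis unfolding I_def by (intro Int_mono INT_anti_mono subset_refl)
  qed
  have "A \<inter> (\<Inter>n\<in>UNIV. I n) \<noteq> {}"
  proof (rule compact_imp_fip_image[OF A])
    show "closed (I n)" for n unfolding I_def by (intro closed_Int closed_INT ballI D E)
    fix J :: "nat set" assume J: "finite J"
    \<comment> \<open>The conditions \<open>I n\<close> decrease, so the largest index of
      \<open>J\<close> is the strictest one; inserting 0 covers the empty \<open>J\<close>.\<close>
    define n where "n = Max (insert 0 J)"
    obtain f where f: "f \<in> isom_eps (1 / real (Suc n)) X Y" using ex[of "1 / real (Suc n)"] by auto
    obtain q where q: "q \<in> mspace Y" using Y.nonempty by auto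
    \<comment> \<open>Elements of \<open>A\<close> send the whole type into \<open>mspace Y\<close>,
      so \<open>f\<close> is replaced by a constant outside \<open>mspace X\<close>. The affine
      identities survive because \<open>mspace X\<close> is convex.\<close>
    define g where "g = (\<lambda>x. if x \<in> mspace X then f x else q)"
    note fm = affine_mapsD(3)[OF isom_epsD(1)[OF f]]
    have gA: "g \<in> A" using q fm unfolding A_def g_def by auto
    moreover have "g \<in> I n"
      unfolding I_def
    proof (intro IntI INT_I)
      fix x x' assume xx: "x \<in> mspace X" "x' \<in> mspace X"
      show "g \<in> D n x x'"
        using isom_epsD(2)[OF f xx] gA xx unfolding D_def by (simp add: g_def abs_less_iff)
      fix u v :: real assume "u \<in> {0..}" "v \<in> {v. 0 \<le> v \<and> u + v = 1}"
      then show "g \<in> E x x' u v"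
        using X.convD[OF xx, of u v] affine_onD[OF affine_mapsD(2)[OF isom_epsD(1)[OF f]] xx, of u v] xx
        unfolding E_def g_def by simp
    qed
    moreover have "I n \<subseteq> I j" if "j \<in> J" for j
      by (rule dec) (use J that in \<open>simp add: n_def\<close>)
    ultimately have "g \<in> A \<inter> (\<Inter>j\<in>J. I j)" unfolding Int_iff INT_iff by (meson subsetD)
    then show "A \<inter> (\<Inter>j\<in>J. I j) \<noteq> {}" by (metis empty_iff)
  qed
  then obtain f where "f \<in> A \<inter> (\<Inter>n\<in>UNIV. I n)" unfolding ex_in_conv[symmetric] by (rule exE)
  then have f: "f \<in> A" "\<And>n. f \<in> I n" by simp_all
  show ?thesis
  proof (intro exI[of _ f] conjI ballI)
    show "affine_on (mspace X) f"
    proof -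
      have "f \<in> E x x' u v" if "x \<in> mspace X" "x' \<in> mspace X" "u \<ge> 0" "v \<ge> 0" "u + v = 1" for x x' u v
        using f(2)[of 0, unfolded I_def, THEN IntD2, THEN INT_D, OF that(1), THEN INT_D, OF that(2),
          THEN INT_D, of u, THEN INT_D, of v] that(3-) by simp
      then show ?thesis unfolding E_def affine_on_def by simp
    qed
    show "f x \<in> mspace Y" for x using f(1) by (auto simp: A_def)
    fix x x' assume xx: "x \<in> mspace X" "x' \<in> mspace X"
    have b: "\<bar>mdist Y (f x) (f x') - mdist X x x'\<bar> \<le> 1 / real (Suc n)" for n
    proof -
      have "f \<in> D n x x'" using f(2)[of n] xx unfolding I_def by simp
      then show ?thesis unfolding D_def by (simp add: abs_le_iff)
    qed
    have "\<bar>mdist Y (f x) (f x') - mdist X x x'\<bar> \<le> 0"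
      by (rule LIMSEQ_le_const[OF LIMSEQ_Suc[OF lim_1_over_n]]) (use b in auto)
    then show "mdist Y (f x) (f x') = mdist X x x'" by simp
  qed
qed

text \<open>There are isometries in both directions, not known to be mutually inverse. Their
  composite is an isometric self-map of the compact \<open>Y\<close>, hence onto, and this makes
  \<open>f\<close> onto.\<close>

lemma isometric_if_gap_zero:
  assumes X: "compact_convex_space X" and Y: "compact_convex_space Y" and gap: "intertwining_gap X Y = 0"
  shows "affinely_isometric X Y"
proof -
  interpret X: compact_convex_space X by fact
  interpret Y: compact_convex_space Y by fact
  have ex: "\<exists>f. f \<in> isom_eps \<epsilon> X Y" "\<exists>f. f \<in> isom_eps \<epsilon> Y X" if "\<epsilon> > 0" for \<epsilon>
    using X.gap_less[OF Y, of \<epsilon>] gap that by auto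
  obtain f where f: "affine_on (mspace X) f" "\<And>x. x \<in> mspace X \<Longrightarrow> f x \<in> mspace Y"
    "\<And>x x'. x \<in> mspace X \<Longrightarrow> x' \<in> mspace X \<Longrightarrow> mdist Y (f x) (f x') = mdist X x x'"
    using isometry_from_approximations[OF X Y ex(1)] by blast
  obtain g where g: "\<And>y. y \<in> mspace Y \<Longrightarrow> g y \<in> mspace X"
    "\<And>y y'. y \<in> mspace Y \<Longrightarrow> y' \<in> mspace Y \<Longrightarrow> mdist X (g y) (g y') = mdist Y y y'"
    using isometry_from_approximations[OF Y X ex(2)] by blast
  have "inj_on f (mspace X)"
  proof (rule inj_onI)
    fix x x' assume "x \<in> mspace X" "x' \<in> mspace X" "f x = f x'"
    then show "x = x'" using f(3)[of x x'] f(2)[of x'] mdist_zero[of x X x'] by simp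
  qed
  moreover have "\<exists>x\<in>mspace X. f x = y" if "y \<in> mspace Y" for y
  proof -
    have "\<exists>y'\<in>mspace Y. f (g y') = y"
      by (rule compact_isometry_surj[OF Y.top Y.comp, where f = "\<lambda>y. f (g y)"]) (simp_all add: f g that)
    then show ?thesis using g(1) by blast
  qed
  ultimately have "bij_betw f (mspace X) (mspace Y)"
    unfolding bij_betw_def using f(2) by (simp add: set_eq_iff image_iff) metis
  then show ?thesis unfolding affinely_isometric_def by (intro exI[of _ f]) (simp add: f)
qed

section \<open>Correspondences of extreme boundaries\<close>

context bauer_model
begin

text \<open>The functions of a Lipschitz partition of unity on \<open>K\<close> are extended
  affinely. Positivity and the sum 1 pass from \<open>K\<close> to \<open>X\<close>; the support
  condition remains a statement about \<open>K\<close>.\<close>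

lemma affine_partition_of_unity:
  assumes "\<delta> > 0"
  shows "\<exists>F (\<Lambda> :: 'a \<Rightarrow> 'a \<Rightarrow> real). finite F \<and> F \<subseteq> K \<and>
    (\<forall>i\<in>F. affine_on (mspace X) (\<Lambda> i)) \<and> (\<forall>i\<in>F. continuous_on (mspace X) (\<Lambda> i)) \<and>
    (\<forall>i\<in>F. \<forall>x\<in>mspace X. 0 \<le> \<Lambda> i x) \<and> (\<forall>x\<in>mspace X. (\<Sum>i\<in>F. \<Lambda> i x) = 1) \<and>
    (\<forall>i\<in>F. \<forall>k\<in>K. \<delta> \<le> mdist X i k \<longrightarrow> \<Lambda> i k = 0)"
proof -
  obtain F where F: "finite F" "F \<subseteq> K" "\<And>s. s \<in> K \<Longrightarrow> \<exists>i\<in>F. mdist X i s < \<delta> / 2"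
    using compact_finite_net[OF top K(2,1), of "\<delta> / 2"] assms by auto
  have lip: "\<bar>mdist X i s - mdist X i t\<bar> \<le> mdist X s t" if "i \<in> F" "s \<in> K" "t \<in> K" for i s t
    using lip_onD[OF lip_on_mdist[OF K(1)], of i s t] that F(2) K(1) by auto
  obtain \<phi> C where phi: "C > 0" "\<forall>i\<in>F. \<forall>s\<in>K. \<forall>t\<in>K. \<bar>\<phi> i s - \<phi> i t\<bar> \<le> C * mdist X s t"
    "\<forall>i\<in>F. \<forall>s\<in>K. 0 \<le> \<phi> i s" "\<forall>s\<in>K. (\<Sum>i\<in>F. \<phi> i s) = 1"
    "\<forall>i\<in>F. \<forall>s\<in>K. \<delta> \<le> mdist X i s \<longrightarrow> \<phi> i s = 0"
    using partition_of_unity[of F \<delta> K "mdist X", OF F(1) assms F(3) lip mdist_nonneg] by blast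
  have "\<forall>i\<in>F. \<exists>H. affine_on (mspace X) H \<and> lip_on C X (mspace X) H \<and> (\<forall>k\<in>K. H k = \<phi> i k)"
    using phi(1,2) by (intro ballI lip_extension_scaled) (auto simp: lip_on_def)
  then obtain \<Lambda> where L: "\<And>i. i \<in> F \<Longrightarrow> affine_on (mspace X) (\<Lambda> i)"
    "\<And>i. i \<in> F \<Longrightarrow> lip_on C X (mspace X) (\<Lambda> i)" "\<And>i k. i \<in> F \<Longrightarrow> k \<in> K \<Longrightarrow> \<Lambda> i k = \<phi> i k"
    unfolding bchoice_iff by blast
  have c: "continuous_on (mspace X) (\<Lambda> i)" if "i \<in> F" for i using lip_cont[OF L(2)[OF that]] .
  have "(\<Sum>i\<in>F. \<Lambda> i x) = 1" if "x \<in> mspace X" for x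
    using eq_from_K[of "\<lambda>x. \<Sum>i\<in>F. \<Lambda> i x" "\<lambda>_. 1" x] that L(1,3) c phi(4)
    by (simp add: affine_on_sum continuous_on_sum)
  moreover have "0 \<le> \<Lambda> i x" if "i \<in> F" "x \<in> mspace X" for i x
    by (rule nonneg_from_K[OF c[OF that(1)] L(1)[OF that(1)] _ that(2)]) (use that L(3) phi(3) in simp)
  ultimately show ?thesis using F(1,2) L(1,3) c phi(5) by (intro exI[of _ F] exI[of _ \<Lambda>]) simp
qed

end

text \<open>The image of a point of \<open>K\<close> lies in the closed convex hull of the points of \<open>M\<close> that
  correspond to nearby points; this is expressed through affine functions.\<close>

definition follows_corr ::
  "real \<Rightarrow> 'a metric \<Rightarrow> 'a set \<Rightarrow> 'b::locally_convex_space metric \<Rightarrow> 'b set \<Rightarrow> ('a \<Rightarrow> 'b \<Rightarrow> bool) \<Rightarrow> ('a \<Rightarrow> 'b) \<Rightarrow> bool"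
where
  "follows_corr \<delta> X K Y M R f \<longleftrightarrow>
    (\<forall>b :: 'b \<Rightarrow> real. continuous_on (mspace Y) b \<longrightarrow> affine_on (mspace Y) b \<longrightarrow>
      (\<forall>k\<in>K. \<forall>c. (\<forall>k'\<in>K. \<forall>m\<in>M. R k' m \<longrightarrow> mdist X k' k < \<delta> \<longrightarrow> b m \<le> c) \<longrightarrow> b (f k) \<le> c))"

lemma follows_corrD:
  fixes b :: "'b::locally_convex_space \<Rightarrow> real"
  assumes "follows_corr \<delta> X K Y M R f" "continuous_on (mspace Y) b" "affine_on (mspace Y) b" "k \<in> K"
    "\<And>k' m. k' \<in> K \<Longrightarrow> m \<in> M \<Longrightarrow> R k' m \<Longrightarrow> mdist X k' k < \<delta> \<Longrightarrow> b m \<le> c"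
  shows "b (f k) \<le> c"
  using assms unfolding follows_corr_def by simp

text \<open>Each net point \<open>i\<close> is sent to a partner \<tau> \<open>i\<close>, and
  \<open>x\<close> to the mean of these with weights \<Lambda> \<open>i x\<close>. At a point of
  \<open>K\<close> only the net points closer than \<delta> carry weight.\<close>

lemma corr_affine_map:
  assumes X: "bauer_model X K" and Y: "bauer_model Y M" and R: "corr \<eta> X K Y M R" and \<delta>: "\<delta> > 0"
  shows "\<exists>f\<in>affine_maps X Y. follows_corr \<delta> X K Y M R f"
proof -
  interpret X: bauer_model X K by fact
  interpret Y: bauer_model Y M by fact
  obtain F and \<Lambda> :: "'a \<Rightarrow> 'a \<Rightarrow> real" where F: "finite F" "F \<subseteq> K"
    and L: "\<forall>i\<in>F. affine_on (mspace X) (\<Lambda> i)" "\<forall>i\<in>F. continuous_on (mspace X) (\<Lambda> i)"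
    "\<forall>i\<in>F. \<forall>x\<in>mspace X. 0 \<le> \<Lambda> i x" "\<forall>x\<in>mspace X. (\<Sum>i\<in>F. \<Lambda> i x) = 1"
    "\<forall>i\<in>F. \<forall>k\<in>K. \<delta> \<le> mdist X i k \<longrightarrow> \<Lambda> i k = 0"
    using X.affine_partition_of_unity[OF \<delta>] by blast
  note L = L[rule_format]
  have "\<forall>i\<in>F. \<exists>m. m \<in> M \<and> R i m" using corrD(1)[OF R] F(2) by blast
  then obtain \<tau> where \<tau>: "\<And>i. i \<in> F \<Longrightarrow> \<tau> i \<in> M" "\<And>i. i \<in> F \<Longrightarrow> R i (\<tau> i)"
    unfolding bchoice_iff by blast
  have tY: "\<tau> i \<in> mspace Y" if "i \<in> F" for i using \<tau>(1)[OF that] Y.K(1) by blast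
  define f where "f = (\<lambda>x. \<Sum>i\<in>F. \<Lambda> i x *\<^sub>R \<tau> i)"
  have fY: "f x \<in> mspace Y" if "x \<in> mspace X" for x
    unfolding f_def by (rule convex_sum[OF F(1) Y.conv L(4)[OF that] L(3)[OF _ that] tY])
  have fm: "f \<in> affine_maps X Y"
    unfolding affine_maps_def mem_Collect_eq
  proof
    show "affine_on (mspace X) f" unfolding f_def by (intro affine_on_sum affine_on_scaleR_right L(1))
    have "continuous_on (mspace X) f"
      unfolding f_def by (intro continuous_on_sum continuous_on_scaleR_lcs continuous_on_const L(2))
    then show "continuous_map (mtopology_of X) (mtopology_of Y) f"
      unfolding X.top Y.top using fY by (auto simp: continuous_map_in_subtopology)
  qed
  show ?thesis
    unfolding follows_corr_def
  proof (intro bexI[OF _ fm] allI impI ballI)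
    fix b :: "'b \<Rightarrow> real" and k c
    assume b: "continuous_on (mspace Y) b" "affine_on (mspace Y) b" and k: "k \<in> K"
      and le: "\<forall>k'\<in>K. \<forall>m\<in>M. R k' m \<longrightarrow> mdist X k' k < \<delta> \<longrightarrow> b m \<le> c"
    have kX: "k \<in> mspace X" using k X.K(1) by blast
    have "b (f k) = (\<Sum>i\<in>F. \<Lambda> i k * b (\<tau> i))"
      unfolding f_def by (rule affine_on_convex_sum[OF b(2) Y.conv F(1) tY L(3)[OF _ kX] L(4)[OF kX]])
    also have "\<dots> \<le> (\<Sum>i\<in>F. \<Lambda> i k * c)"
    proof (rule sum_mono)
      fix i assume i: "i \<in> F"
      show "\<Lambda> i k * b (\<tau> i) \<le> \<Lambda> i k * c"
      proof (cases "mdist X i k < \<delta>")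
        case True
        then show ?thesis
          using le \<tau> i F(2) L(3)[OF i kX] by (intro mult_left_mono) auto
      qed (use L(5)[OF i k] in simp)
    qed
    also have "\<dots> = c" using L(4)[OF kX] by (simp add: sum_distrib_right[symmetric])
    finally show "b (f k) \<le> c" .
  qed
qed

text \<open>Origin of 13: each map increases distances by at most 6 \<delta> and each composite
  moves points by at most 3 \<delta>. Going there and back, distances shrink by at most 6 \<delta> +
  2 * 3 \<delta> = 12 \<delta>, and one more \<delta> makes the inequalities strict.\<close>

lemma corr_gap_le:
  assumes X: "bauer_model X K" and Y: "bauer_model Y M" and R: "corr \<delta> X K Y M R" and \<delta>: "\<delta> > 0"
  shows "intertwining_gap X Y \<le> 13 * \<delta>"
proof -
  \<comment> \<open>\<open>half\<close>, \<open>close\<close> and \<open>lower\<close> quantify over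
    the spaces and their types, so that they apply in both directions between \<open>X\<close> and
    \<open>Y\<close>.\<close>
  have half: "\<exists>f\<in>affine_maps X Y.
      (\<forall>x\<in>mspace X. \<forall>x'\<in>mspace X. mdist Y (f x) (f x') \<le> mdist X x x' + 6 * \<delta>) \<and>
      follows_corr \<delta> X K Y M R f"
    if X: "bauer_model X K" and Y: "bauer_model Y M" and R: "corr \<delta> X K Y M R"
    for X :: "'c::locally_convex_space metric" and Y :: "'d::locally_convex_space metric" and K M R
  proof -
    interpret X: bauer_model X K by fact
    interpret Y: bauer_model Y M by fact
    obtain f where f: "f \<in> affine_maps X Y" "follows_corr \<delta> X K Y M R f"
      using corr_affine_map[OF X Y R \<delta>] by blast
    have "mdist Y (f x) (f x') \<le> mdist X x x' + 6 * \<delta>" if x: "x \<in> mspace X" "x' \<in> mspace X" for x x'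
    proof (rule ccontr)
      assume "\<not> ?thesis"
      then have "mdist X x x' + 6 * \<delta> < mdist Y (f x) (f x')" by simp
      then obtain b where b: "affine_on (mspace Y) b" "lip_on 1 Y (mspace Y) b"
        "mdist X x x' + 6 * \<delta> < b (f x) - b (f x')"
        using Y.dist_attained affine_mapsD(3)[OF f(1)] x by blast
      have mb: "affine_on (mspace Y) (\<lambda>y. - b y)" "continuous_on (mspace Y) (\<lambda>y. - b y)"
        using affine_on_minus[OF b(1)] Y.lip_cont[OF b(2)] by (auto intro: continuous_on_minus)
      \<comment> \<open>Two displacements of less than \<delta>, from \<open>k\<close> and
        \<open>k'\<close> to related points, plus the distortion \<delta> of the
        correspondence.\<close>
      have "b (f k) - b (f k') \<le> 1 * mdist X k k' + 3 * \<delta>" if k: "k \<in> K" "k' \<in> K" for k k'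
      proof -
        have "b (f k) \<le> b (f k') + mdist X k k' + 3 * \<delta>"
        proof (rule follows_corrD[OF f(2) Y.lip_cont[OF b(2)] b(1) k(1)])
          fix j m assume j: "j \<in> K" "m \<in> M" "R j m" "mdist X j k < \<delta>"
          have "- b (f k') \<le> - b m + mdist X k k' + 3 * \<delta>"
          proof (rule follows_corrD[OF f(2) mb(2,1) k(2)])
            fix j' m' assume j': "j' \<in> K" "m' \<in> M" "R j' m'" "mdist X j' k' < \<delta>"
            have "mdist X j j' \<le> mdist X j k + mdist X k k' + mdist X k' j'"
              using mdist_triangle[of j X k j'] mdist_triangle[of k X k' j']
                X.K_mspace[OF j(1)] X.K_mspace[OF j'(1)] X.K_mspace[OF k(1)] X.K_mspace[OF k(2)] by linarith
            moreover have "mdist Y m m' \<le> mdist X j j' + \<delta>"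
              using corrD(3)[OF R j(1) j'(1) j(2) j'(2) j(3) j'(3)] by simp
            moreover have "b m - b m' \<le> mdist Y m m'"
              using lip_onD[OF b(2) Y.K_mspace[OF j(2)] Y.K_mspace[OF j'(2)]] by simp
            ultimately show "- b m' \<le> - b m + mdist X k k' + 3 * \<delta>"
              using j(4) j'(4) by (simp add: mdist_commute)
          qed
          then show "b m \<le> b (f k') + mdist X k k' + 3 * \<delta>" by simp
        qed
        then show ?thesis by simp
      qed
      moreover have "continuous_on (mspace X) (\<lambda>x. b (f x))"
        using Y.continuous_compose[OF f(1) Y.lip_cont[OF b(2)]] by (simp add: continuous_map_real_iff[OF X.top])
      moreover have "affine_on (mspace X) (\<lambda>x. b (f x))"
        using affine_mapsD(3)[OF f(1)] by (intro affine_on_compose[OF affine_mapsD(2)[OF f(1)] b(1)]) blast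
      moreover note zero_le_one
      \<comment> \<open>The function \<open>b (f x)\<close> is almost 1-Lipschitz on
        \<open>K\<close> only, and \<open>mdist X\<close> is not affine in both variables, so the
        estimate does not pass to \<open>X\<close> as it stands. A genuinely 1-Lipschitz affine
        function within 3 \<delta> of it does the job; two points make 6 \<delta>.\<close>
      ultimately have "\<exists>a. affine_on (mspace X) a \<and> lip_on 1 X (mspace X) a \<and> (\<forall>x\<in>mspace X. \<bar>a x - b (f x)\<bar> \<le> 3 * \<delta>)"
        by (intro X.smooth_almost_lip)
      then obtain a where a: "lip_on 1 X (mspace X) a" "\<forall>x\<in>mspace X. \<bar>a x - b (f x)\<bar> \<le> 3 * \<delta>"
        by blast
      show False
        using lip_onD[OF a(1) x] a(2)[rule_format, OF x(1)] a(2)[rule_format, OF x(2)] b(3) by (auto simp: abs_le_iff)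
    qed
    then show ?thesis using f by blast
  qed
  have close: "mdist X (g (f x)) x \<le> 3 * \<delta>"
    if X: "bauer_model X K" and Y: "bauer_model Y M" and R: "corr \<delta> X K Y M R"
    and f: "f \<in> affine_maps X Y" and g: "g \<in> affine_maps Y X"
    and f2: "follows_corr \<delta> X K Y M R f" and g2: "follows_corr \<delta> Y M X K (\<lambda>m k. R k m) g"
    and x: "x \<in> mspace X"
    for X :: "'c::locally_convex_space metric" and Y :: "'d::locally_convex_space metric" and K M R f g x
  proof -
    interpret X: bauer_model X K by fact
    interpret Y: bauer_model Y M by fact
    show ?thesis
    proof (rule X.dist_affine_maps_le[OF affine_maps_compose[OF f g] affine_maps_id X _ x])
      fix k assume k: "k \<in> K"
      have kX: "k \<in> mspace X" using k X.K by blast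
      \<comment> \<open>The distance to \<open>k\<close> is affine, also after \<open>g\<close>. So
        \<open>follows_corr\<close> applies first to \<open>f\<close> at \<open>k\<close> and then
        to \<open>g\<close> at each \<open>m\<close> related to a point near \<open>k\<close>; two
        displacements and one distortion make 3 \<delta>.\<close>
      have "mdist X k (g (f k)) \<le> 3 * \<delta>"
      proof (rule follows_corrD[OF f2 _ _ k])
        show "continuous_on (mspace Y) (\<lambda>y. mdist X k (g y))"
          using X.continuous_compose[OF g X.continuous_mdist[OF kX]] by (simp add: continuous_map_real_iff[OF Y.top])
        show "affine_on (mspace Y) (\<lambda>y. mdist X k (g y))" by (rule X.affine_maps_comp_mdist[OF g k])
        fix k' m assume k': "k' \<in> K" and m: "m \<in> M" and r: "R k' m" "mdist X k' k < \<delta>"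
        show "mdist X k (g m) \<le> 3 * \<delta>"
        proof (rule follows_corrD[OF g2 X.continuous_mdist[OF kX] X.dist_from_K_affine[OF k] m])
          fix m' j assume j: "m' \<in> M" "j \<in> K" "R j m'" "mdist Y m' m < \<delta>"
          have "mdist X k j \<le> mdist X k k' + mdist X k' j"
            by (intro mdist_triangle X.K_mspace k k' j)
          moreover have "mdist X k' j \<le> mdist Y m m' + \<delta>"
            using corrD(3)[OF R k' j(2) m j(1)] r j(3) by auto
          ultimately show "mdist X k j \<le> 3 * \<delta>" using r j(4) by (simp add: mdist_commute)
        qed
      qed
      then show "mdist X (g (f k)) k \<le> 3 * \<delta>" by (simp add: mdist_commute)
    qed
  qed
  obtain f where f: "f \<in> affine_maps X Y" "follows_corr \<delta> X K Y M R f"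
      "\<forall>x\<in>mspace X. \<forall>x'\<in>mspace X. mdist Y (f x) (f x') \<le> mdist X x x' + 6 * \<delta>"
    using half[OF X Y R] by blast
  obtain g where g: "g \<in> affine_maps Y X" "follows_corr \<delta> Y M X K (\<lambda>m k. R k m) g"
      "\<forall>x\<in>mspace Y. \<forall>x'\<in>mspace Y. mdist X (g x) (g x') \<le> mdist Y x x' + 6 * \<delta>"
    using half[OF Y X corr_sym[OF R]] by blast
  note fl = f(3)[rule_format] and gl = g(3)[rule_format]
  have gf: "mdist X (g (f x)) x \<le> 3 * \<delta>" if "x \<in> mspace X" for x
    by (rule close[OF X Y R f(1) g(1) f(2) g(2) that])
  have fg: "mdist Y (f (g y)) y \<le> 3 * \<delta>" if "y \<in> mspace Y" for y
    by (rule close[OF Y X corr_sym[OF R] g(1) f(1) g(2) f(2) that])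
  have lower: "mdist X x x' \<le> mdist Y (f x) (f x') + 12 * \<delta>"
    if x: "x \<in> mspace X" "x' \<in> mspace X"
    and f: "f \<in> affine_maps X Y" and g: "g \<in> affine_maps Y X"
    and gf: "\<And>x. x \<in> mspace X \<Longrightarrow> mdist X (g (f x)) x \<le> 3 * \<delta>"
    and gl: "\<And>x x'. x \<in> mspace Y \<Longrightarrow> x' \<in> mspace Y \<Longrightarrow> mdist X (g x) (g x') \<le> mdist Y x x' + 6 * \<delta>"
    for X :: "'c::locally_convex_space metric" and Y :: "'d::locally_convex_space metric" and f g x x'
  proof -
    note m = affine_mapsD(3)[OF f x(1)] affine_mapsD(3)[OF f x(2)]
    note n = affine_mapsD(3)[OF g m(1)] affine_mapsD(3)[OF g m(2)]
    show ?thesis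
      using mdist_triangle[OF x(1) n(1) x(2)] mdist_triangle[OF n x(2)] gf[OF x(1)] gf[OF x(2)] gl[OF m]
      by (simp add: mdist_commute)
  qed
  show ?thesis
  proof (rule gap_le[of _ f _ _ g])
    show "0 < 13 * \<delta>" using \<delta> by simp
    show "f \<in> isom_eps (13 * \<delta>) X Y"
    proof (rule isom_epsI[OF f(1) g(1)])
      fix x x' assume x: "x \<in> mspace X" "x' \<in> mspace X"
      show "\<bar>mdist Y (f x) (f x') - mdist X x x'\<bar> < 13 * \<delta>"
        using fl[OF x] lower[OF x f(1) g(1) gf gl] \<delta> by auto
    next
      show "mdist Y (f (g y)) y < 13 * \<delta>" if "y \<in> mspace Y" for y using fg[OF that] \<delta> by simp
    qed
    show "g \<in> isom_eps (13 * \<delta>) Y X"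
    proof (rule isom_epsI[OF g(1) f(1)])
      fix x x' assume x: "x \<in> mspace Y" "x' \<in> mspace Y"
      show "\<bar>mdist X (g x) (g x') - mdist Y x x'\<bar> < 13 * \<delta>"
        using gl[OF x] lower[OF x g(1) f(1) fg fl] \<delta> by auto
    next
      show "mdist X (g (f y)) y < 13 * \<delta>" if "y \<in> mspace X" for y using gf[OF that] \<delta> by simp
    qed
  qed
qed

text \<open>The map \<open>g (f k)\<close> moves \<open>k\<close> by less than 2 \<epsilon>, so the
  affine function measuring the distance of \<open>k\<close> to \<open>g y\<close> is below 2
  \<epsilon> at \<open>y = f k\<close>, and hence at some \<open>m\<close> in \<open>M\<close>.
  Applying \<open>f\<close> and returning from \<open>f (g m)\<close> to \<open>m\<close> costs 2
  \<epsilon> more: 4 \<epsilon>. Two such displacements and the distortion \<epsilon> of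
  \<open>f\<close> make 9 \<epsilon>.\<close>

lemma isom_eps_corr:
  assumes X: "bauer_model X K" and Y: "bauer_model Y M" and f: "f \<in> isom_eps \<epsilon> X Y"
  shows "corr (9 * \<epsilon>) X K Y M (\<lambda>k m. mdist Y (f k) m < 4 * \<epsilon>)"
proof -
  interpret X: bauer_model X K by fact
  interpret Y: bauer_model Y M by fact
  note F = isom_epsD[OF f]
  obtain g where g: "g \<in> affine_maps Y X" "\<And>y. y \<in> mspace Y \<Longrightarrow> mdist Y (f (g y)) y < \<epsilon>"
    using F(3) by blast
  note fm = affine_mapsD(3)[OF F(1)] and gm = affine_mapsD(3)[OF g(1)]
  have KX: "k \<in> mspace X" if "k \<in> K" for k using that X.K(1) by blast
  have MY: "m \<in> mspace Y" if "m \<in> M" for m using that Y.K(1) by blast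
  obtain x0 where "x0 \<in> mspace X" using X.nonempty by blast
  then have eps: "\<epsilon> > 0" using F(2)[of x0 x0] fm[of x0] by simp
  show ?thesis
    unfolding corr_def
  proof (intro conjI ballI impI)
    fix k assume k: "k \<in> K"
    note kX = KX[OF k]
    have "mdist X (g (f k)) k < 2 * \<epsilon>"
      using F(2)[OF gm[OF fm[OF kX]] kX] g(2)[OF fm[OF kX]] by linarith
    then have "mdist X k (g (f k)) < 2 * \<epsilon>" by (simp add: mdist_commute)
    moreover have "continuous_on (mspace Y) (\<lambda>y. mdist X k (g y))"
      using X.continuous_compose[OF g(1) X.continuous_mdist[OF kX]] by (simp add: continuous_map_real_iff[OF Y.top])
    ultimately obtain m where m: "m \<in> M" "mdist X k (g m) < 2 * \<epsilon>"
      using Y.ex_K_less[OF _ X.affine_maps_comp_mdist[OF g(1) k] fm[OF kX]] by blast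
    have "mdist Y (f k) m \<le> mdist Y (f k) (f (g m)) + mdist Y (f (g m)) m"
      by (intro mdist_triangle fm gm kX MY m)
    then have "mdist Y (f k) m < 4 * \<epsilon>"
      using F(2)[OF kX gm[OF MY[OF m(1)]]] m(2) g(2)[OF MY[OF m(1)]] by linarith
    then show "\<exists>m\<in>M. mdist Y (f k) m < 4 * \<epsilon>" using m(1) by blast
  next
    fix m assume m: "m \<in> M"
    note mY = MY[OF m]
    have "mdist Y m (f (g m)) < \<epsilon>" using g(2)[OF mY] by (simp add: mdist_commute)
    moreover have "continuous_on (mspace X) (\<lambda>x. mdist Y m (f x))"
      using Y.continuous_compose[OF F(1) Y.continuous_mdist[OF mY]] by (simp add: continuous_map_real_iff[OF X.top])
    ultimately obtain k where k: "k \<in> K" "mdist Y m (f k) < \<epsilon>"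
      using X.ex_K_less[OF _ Y.affine_maps_comp_mdist[OF F(1) m] gm[OF mY]] by blast
    then show "\<exists>k\<in>K. mdist Y (f k) m < 4 * \<epsilon>" using eps by (intro bexI[of _ k]) (auto simp: mdist_commute)
  next
    fix k k' m m' assume k: "k \<in> K" "k' \<in> K" and m: "m \<in> M" "m' \<in> M"
      and d: "mdist Y (f k) m < 4 * \<epsilon>" "mdist Y (f k') m' < 4 * \<epsilon>"
    note ky = fm[OF KX[OF k(1)]] fm[OF KX[OF k(2)]] and my = MY[OF m(1)] MY[OF m(2)]
    show "\<bar>mdist X k k' - mdist Y m m'\<bar> \<le> 9 * \<epsilon>"
      using mdist_triangle[OF ky(1) my(1) ky(2)] mdist_triangle[OF my ky(2)]
        mdist_triangle[OF my(1) ky(1) my(2)] mdist_triangle[OF ky my(2)]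
        F(2)[OF KX[OF k(1)] KX[OF k(2)]] d
      by (simp add: mdist_commute abs_le_iff abs_less_iff)
  qed
qed

section \<open>The state space of the affine functions\<close>

text \<open>Pairs on which \<open>a\<close> increases by at least \<epsilon> form a compact set off
  the diagonal, so their distances are bounded below by some \<open>m > 0\<close> and the slope
  \<open>2 * B / m\<close> suffices for them. All other pairs are absorbed by \<epsilon>.\<close>

lemma continuous_almost_lip:
  fixes a :: "'a::locally_convex_space \<Rightarrow> real"
  assumes top: "mtopology_of X = top_of_set (mspace X)" and K: "K \<subseteq> mspace X" "compact K"
    and a: "continuous_on K a" and \<epsilon>: "\<epsilon> > 0"
  shows "\<exists>C\<ge>0. \<forall>k\<in>K. \<forall>k'\<in>K. a k - a k' \<le> C * mdist X k k' + \<epsilon>"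
proof -
  define f where "f = (\<lambda>p. a (fst p) - a (snd p))"
  define S where "S = (K \<times> K) \<inter> f -` {\<epsilon>..}"
  have KK: "compact (K \<times> K)" using K(2) by (intro compact_Times)
  have "continuous_on (K \<times> K) f"
    unfolding f_def
    by (intro continuous_on_diff continuous_on_compose2[OF a] continuous_on_fst continuous_on_snd
        continuous_on_id) auto
  then have "closed S"
    unfolding S_def by (intro continuous_closed_preimage compact_imp_closed[OF KK]) auto
  then have S: "compact S"
    using KK unfolding S_def by (metis closed_Int_compact inf.left_idem inf_commute)
  obtain B where B: "\<And>k. k \<in> K \<Longrightarrow> \<bar>a k\<bar> \<le> B"
    using compact_imp_bounded[OF compact_continuous_image[OF a K(2)]] by (auto simp: bounded_iff)
  show ?thesis
  proof (cases "S = {}")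
    case True
    have "a k - a k' \<le> 0 * mdist X k k' + \<epsilon>" if "k \<in> K" "k' \<in> K" for k k'
    proof (rule ccontr)
      assume "\<not> ?thesis"
      then have "(k, k') \<in> S" using that by (simp add: S_def f_def)
      then show False using True by blast
    qed
    then show ?thesis by blast
  next
    case False
    have SX: "fst ` S \<subseteq> mspace X" "snd ` S \<subseteq> mspace X" using K(1) by (auto simp: S_def)
    have "continuous_on S (\<lambda>p. mdist X (fst p) (snd p))"
      by (rule continuous_on_mdist[OF top _ _ SX]) (intro continuous_on_fst continuous_on_snd continuous_on_id)+
    then obtain p where p: "p \<in> S" "\<And>q. q \<in> S \<Longrightarrow> mdist X (fst p) (snd p) \<le> mdist X (fst q) (snd q)"
      using continuous_attains_inf[OF S False] by blast
    define m where "m = mdist X (fst p) (snd p)"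
    have "fst p \<noteq> snd p" using p(1) \<epsilon> by (auto simp: S_def f_def)
    then have "m \<noteq> 0" using SX p(1) unfolding m_def by (subst mdist_zero) auto
    then have m: "m > 0" using mdist_nonneg[of X "fst p" "snd p"] unfolding m_def by linarith
    have "a k - a k' \<le> 2 * \<bar>B\<bar> / m * mdist X k k' + \<epsilon>" if k: "k \<in> K" "k' \<in> K" for k k'
    proof (cases "(k, k') \<in> S")
      case True
      then have "m \<le> mdist X k k'" using p(2)[of "(k, k')"] by (simp add: m_def)
      then have "2 * \<bar>B\<bar> * 1 \<le> 2 * \<bar>B\<bar> * (mdist X k k' / m)" using m by (intro mult_left_mono) auto
      moreover have "a k - a k' \<le> 2 * \<bar>B\<bar>" using B[OF k(1)] B[OF k(2)] by linarith
      ultimately show ?thesis using \<epsilon> by simp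
    next
      case False
      then have "a k - a k' < \<epsilon>" using k by (simp add: S_def f_def)
      moreover have "0 \<le> 2 * \<bar>B\<bar> / m * mdist X k k'" using m by simp
      ultimately show ?thesis by linarith
    qed
    then show ?thesis using m by (intro exI[of _ "2 * \<bar>B\<bar> / m"]) simp
  qed
qed

text \<open>Formulas obtained for Lipschitz affine functions are extended to all continuous affine
  functions by this density.\<close>

lemma (in bauer_model) lip_affine_dense:
  fixes a :: "'a \<Rightarrow> real"
  assumes a: "continuous_on (mspace X) a" "affine_on (mspace X) a" and \<epsilon>: "\<epsilon> > 0"
  shows "\<exists>C\<ge>0. \<exists>H. affine_on (mspace X) H \<and> lip_on C X (mspace X) H \<and> (\<forall>x\<in>mspace X. \<bar>H x - a x\<bar> \<le> \<epsilon>)"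
proof -
  obtain C where C: "C \<ge> 0" "\<forall>k\<in>K. \<forall>k'\<in>K. a k - a k' \<le> C * mdist X k k' + \<epsilon>"
    using continuous_almost_lip[OF top K continuous_on_subset[OF a(1) K(1)] \<epsilon>] by blast
  have "\<exists>H. affine_on (mspace X) H \<and> lip_on C X (mspace X) H \<and> (\<forall>x\<in>mspace X. \<bar>H x - a x\<bar> \<le> \<epsilon>)"
    by (rule smooth_almost_lip[OF a C(1)]) (use C(2) in blast)
  then show ?thesis using C(1) by blast
qed

text \<open>Produces the normal form required by \<open>affine_functions\<close>, for which equality
  of functions is equality on \<open>C\<close>.\<close>

definition zero_outside :: "'a set \<Rightarrow> ('a \<Rightarrow> real) \<Rightarrow> 'a \<Rightarrow> real" where
  "zero_outside C f = (\<lambda>x. if x \<in> C then f x else 0)"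

lemma zero_outside_apply [simp]: "x \<in> C \<Longrightarrow> zero_outside C f x = f x"
  by (simp add: zero_outside_def)

lemma affine_functionsD:
  assumes "f \<in> affine_functions C"
  shows "continuous_on C f" "affine_on C f" "x \<notin> C \<Longrightarrow> f x = 0"
  using assms by (auto simp: affine_functions_def)

context compact_convex_space
begin

lemma zero_outside_affine:
  assumes "continuous_on (mspace X) f" "affine_on (mspace X) f"
  shows "zero_outside (mspace X) f \<in> affine_functions (mspace X)"
proof -
  have "continuous_on (mspace X) (zero_outside (mspace X) f)"
    using assms(1) by (rule continuous_on_eq) simp
  moreover have "affine_on (mspace X) (zero_outside (mspace X) f)"
    using affine_on_cong[OF conv, of "zero_outside (mspace X) f" f] assms(2) by simp
  ultimately show ?thesis by (simp add: affine_functions_def zero_outside_def)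
qed

lemma affine_functions_add: "f \<in> affine_functions (mspace X) \<Longrightarrow> g \<in> affine_functions (mspace X) \<Longrightarrow>
    f + g \<in> affine_functions (mspace X)"
  unfolding affine_functions_def plus_fun_def by (auto intro: affine_on_add continuous_on_add)

lemma affine_functions_scaleR: "f \<in> affine_functions (mspace X) \<Longrightarrow> c *\<^sub>R f \<in> affine_functions (mspace X)"
  unfolding affine_functions_def scaleR_fun_def
  by (auto intro: affine_on_cmult continuous_on_mult_left)

lemma affine_functions_zero: "0 \<in> affine_functions (mspace X)"
  unfolding affine_functions_def zero_fun_def by simp

lemma affine_functions_unit: "indicator (mspace X) \<in> affine_functions (mspace X)"
proof -
  have "indicator (mspace X) = zero_outside (mspace X) (\<lambda>_. 1)"
    by (auto simp: zero_outside_def indicator_def)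
  then show ?thesis using zero_outside_affine[of "\<lambda>_. 1"] by simp
qed

lemma Aff_simps: "elems (Aff X) = affine_functions (mspace X)" "ounit (Aff X) = indicator (mspace X)"
  by (simp_all add: Aff_def)

lemma stateD:
  assumes "\<sigma> \<in> state_space (Aff X)"
  shows "f \<in> affine_functions (mspace X) \<Longrightarrow> g \<in> affine_functions (mspace X) \<Longrightarrow> \<sigma> (f + g) = \<sigma> f + \<sigma> g"
    "f \<in> affine_functions (mspace X) \<Longrightarrow> \<sigma> (c *\<^sub>R f) = c * \<sigma> f"
    "f \<in> affine_functions (mspace X) \<Longrightarrow> 0 \<le> f \<Longrightarrow> 0 \<le> \<sigma> f"
    "\<sigma> (indicator (mspace X)) = 1" "f \<notin> affine_functions (mspace X) \<Longrightarrow> \<sigma> f = 0"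
  using assms unfolding state_space_def Aff_simps by simp_all

lemma state_sum:
  assumes \<sigma>: "\<sigma> \<in> state_space (Aff X)" and F: "finite F" "F \<subseteq> affine_functions (mspace X)"
  shows "(\<lambda>x. \<Sum>f\<in>F. c f * f x) \<in> affine_functions (mspace X)"
    and "\<sigma> (\<lambda>x. \<Sum>f\<in>F. c f * f x) = (\<Sum>f\<in>F. c f * \<sigma> f)"
proof -
  have "(\<lambda>x. \<Sum>f\<in>F. c f * f x) \<in> affine_functions (mspace X) \<and>
      \<sigma> (\<lambda>x. \<Sum>f\<in>F. c f * f x) = (\<Sum>f\<in>F. c f * \<sigma> f)"
    using F
  proof (induction F rule: finite_induct)
    case empty
    have "(\<lambda>x. \<Sum>f\<in>{}. c f * f x) = 0 *\<^sub>R indicator (mspace X)"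
      by (simp add: fun_eq_iff scaleR_fun_def)
    then show ?case
      using stateD(2)[OF \<sigma> affine_functions_unit, of 0] affine_functions_scaleR[OF affine_functions_unit, of 0]
      by simp
  next
    case (insert f F)
    have eq: "(\<lambda>x. \<Sum>g\<in>insert f F. c g * g x) = c f *\<^sub>R f + (\<lambda>x. \<Sum>g\<in>F. c g * g x)"
      using insert.hyps by (simp add: fun_eq_iff scaleR_fun_def)
    show ?case
      unfolding eq using insert affine_functions_scaleR[of f "c f"] affine_functions_add stateD(1,2)[OF \<sigma>]
      by simp
  qed
  then show "(\<lambda>x. \<Sum>f\<in>F. c f * f x) \<in> affine_functions (mspace X)"
    "\<sigma> (\<lambda>x. \<Sum>f\<in>F. c f * f x) = (\<Sum>f\<in>F. c f * \<sigma> f)" by auto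
qed

text \<open>For finitely many functions \<open>f\<close>, a minimiser of \<open>\<Sum> (f x - \<sigma> f)\<^sup>2\<close> is a point with \<open>f x = \<sigma> f\<close>:
  the first order condition says that an affine function is nonnegative, and \<open>\<sigma>\<close> is positive.\<close>

lemma state_eval_finite:
  assumes \<sigma>: "\<sigma> \<in> state_space (Aff X)" and F: "finite F" "F \<subseteq> affine_functions (mspace X)"
  shows "\<exists>x\<in>mspace X. \<forall>f\<in>F. f x = \<sigma> f"
proof -
  have Fc: "continuous_on (mspace X) f" "affine_on (mspace X) f" if "f \<in> F" for f
    using affine_functionsD F(2) that by blast+
  have "continuous_on (mspace X) (\<lambda>x. \<Sum>f\<in>F. (f x - \<sigma> f)\<^sup>2)"
    by (intro continuous_on_sum continuous_on_power continuous_on_diff continuous_on_const Fc)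
  then obtain x0 where x0: "x0 \<in> mspace X"
    "\<And>x. x \<in> mspace X \<Longrightarrow> (\<Sum>f\<in>F. (f x0 - \<sigma> f)\<^sup>2) \<le> (\<Sum>f\<in>F. (f x - \<sigma> f)\<^sup>2)"
    using continuous_attains_inf[OF comp nonempty] by blast
  define c where "c = (\<lambda>f. f x0 - \<sigma> f)"
  have first_order: "(\<Sum>f\<in>F. c f * (f y - f x0)) \<ge> 0" if y: "y \<in> mspace X" for y
  proof (rule ccontr)
    assume neg: "\<not> ?thesis"
    define P where "P = - (\<Sum>f\<in>F. c f * (f y - f x0))"
    define Q where "Q = (\<Sum>f\<in>F. (f y - f x0)\<^sup>2)"
    have P: "P > 0" using neg by (simp add: P_def)
    have Q: "Q \<ge> 0" by (simp add: Q_def sum_nonneg)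
    have ineq: "2 * t * P \<le> t\<^sup>2 * Q" if t: "0 \<le> t" "t \<le> 1" for t
    proof -
      have "(\<Sum>f\<in>F. (c f)\<^sup>2) \<le> (\<Sum>f\<in>F. (f (t *\<^sub>R y + (1 - t) *\<^sub>R x0) - \<sigma> f)\<^sup>2)"
        using x0(2)[OF convD[OF y x0(1), of t "1 - t"]] t by (simp add: c_def)
      also have "\<dots> = (\<Sum>f\<in>F. (c f + t * (f y - f x0))\<^sup>2)"
        using affine_onD[OF Fc(2) y x0(1), of _ t "1 - t"] t
        by (intro sum.cong refl arg_cong[of _ _ "\<lambda>z. z\<^sup>2"]) (simp add: c_def algebra_simps)
      also have "\<dots> = (\<Sum>f\<in>F. (c f)\<^sup>2 + 2 * t * (c f * (f y - f x0)) + t\<^sup>2 * (f y - f x0)\<^sup>2)"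
        by (intro sum.cong refl) (simp add: power2_eq_square algebra_simps)
      also have "\<dots> = (\<Sum>f\<in>F. (c f)\<^sup>2) - 2 * t * P + t\<^sup>2 * Q"
        unfolding P_def Q_def by (simp add: sum.distrib sum_distrib_left)
      finally show ?thesis by simp
    qed
    \<comment> \<open>Chosen so that \<open>t * Q\<close> stays below \<open>P\<close>, while
      minimality would force it to be at least \<open>2 * P\<close>.\<close>
    define t where "t = min 1 (P / (Q + 1))"
    have "t \<le> P / (Q + 1)" by (simp add: t_def)
    then have "t * (Q + 1) \<le> P" using Q by (simp add: le_divide_eq)
    moreover have "0 < t" "t \<le> 1" using P Q by (auto simp: t_def)
    ultimately have t: "0 < t" "t \<le> 1" "t * (Q + 1) \<le> P" by auto
    have "t * (2 * P) \<le> t * (t * Q)" using ineq[of t] t by (simp add: power2_eq_square mult_ac)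
    then have "2 * P \<le> t * Q" using t(1) by simp
    also have "\<dots> \<le> t * (Q + 1)" using t(1) by simp
    also have "\<dots> \<le> P" by (rule t(3))
    finally show False using P by simp
  qed
  define h where "h = (\<lambda>x. \<Sum>f\<in>F. c f * f x)"
  define v where "v = (\<Sum>f\<in>F. c f * f x0)"
  have h: "h \<in> affine_functions (mspace X)" "\<sigma> h = (\<Sum>f\<in>F. c f * \<sigma> f)"
    unfolding h_def by (rule state_sum[OF \<sigma> F])+
  have vi: "(- v) *\<^sub>R indicator (mspace X) \<in> affine_functions (mspace X)"
    by (intro affine_functions_scaleR affine_functions_unit)
  have "0 \<le> h + (- v) *\<^sub>R indicator (mspace X)"
    unfolding le_fun_def
  proof
    fix y
    show "0 y \<le> (h + (- v) *\<^sub>R indicator (mspace X)) y"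
    proof (cases "y \<in> mspace X")
      case True
      then show ?thesis
        using first_order[OF True] by (simp add: h_def v_def scaleR_fun_def right_diff_distrib sum_subtractf)
    next
      case False
      then show ?thesis using affine_functionsD(3)[OF h(1)] by (simp add: scaleR_fun_def)
    qed
  qed
  then have "0 \<le> \<sigma> (h + (- v) *\<^sub>R indicator (mspace X))"
    by (rule stateD(3)[OF \<sigma> affine_functions_add[OF h(1) vi]])
  also have "\<dots> = \<sigma> h - v"
    unfolding stateD(1)[OF \<sigma> h(1) vi] stateD(2)[OF \<sigma> affine_functions_unit] stateD(4)[OF \<sigma>] by simp
  also have "\<dots> = - (\<Sum>f\<in>F. (c f)\<^sup>2)"
    unfolding h(2) v_def sum_subtractf[symmetric] sum_negf[symmetric]
    by (intro sum.cong refl) (simp add: c_def power2_eq_square algebra_simps)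
  finally have "(\<Sum>f\<in>F. (c f)\<^sup>2) \<le> 0" by simp
  moreover have "(\<Sum>f\<in>F. (c f)\<^sup>2) \<ge> 0" by (simp add: sum_nonneg)
  ultimately have "(\<Sum>f\<in>F. (c f)\<^sup>2) = 0" by (rule order_antisym)
  then have "\<forall>f\<in>F. c f = 0" using F(1) by (simp add: sum_nonneg_eq_0_iff)
  then show ?thesis using x0(1) by (auto simp: c_def)
qed

text \<open>The sets on which \<open>f x\<close> equals \<sigma> \<open>f\<close> are closed, and
  \<open>state_eval_finite\<close> gives them the finite intersection property.\<close>

lemma state_eval:
  assumes \<sigma>: "\<sigma> \<in> state_space (Aff X)"
  shows "\<exists>x\<in>mspace X. \<forall>f\<in>affine_functions (mspace X). \<sigma> f = f x"
proof -
  have "mspace X \<inter> (\<Inter>f\<in>affine_functions (mspace X). mspace X \<inter> f -` {\<sigma> f}) \<noteq> {}"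
  proof (rule compact_imp_fip_image[OF comp])
    fix f assume "f \<in> affine_functions (mspace X)"
    then show "closed (mspace X \<inter> f -` {\<sigma> f})"
      by (intro continuous_closed_preimage compact_imp_closed[OF comp] closed_singleton)
        (rule affine_functionsD)
  next
    fix F assume F: "finite F" "F \<subseteq> affine_functions (mspace X)"
    obtain x where "x \<in> mspace X" "\<forall>f\<in>F. f x = \<sigma> f" using state_eval_finite[OF \<sigma> F] by blast
    then have "x \<in> mspace X \<inter> (\<Inter>f\<in>F. mspace X \<inter> f -` {\<sigma> f})" by simp
    then show "mspace X \<inter> (\<Inter>f\<in>F. mspace X \<inter> f -` {\<sigma> f}) \<noteq> {}" by (metis empty_iff)
  qed
  then obtain x where "x \<in> mspace X \<inter> (\<Inter>f\<in>affine_functions (mspace X). mspace X \<inter> f -` {\<sigma> f})"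
    unfolding ex_in_conv[symmetric] by (rule exE)
  then have x: "x \<in> mspace X \<inter> f -` {\<sigma> f}" if "f \<in> affine_functions (mspace X)" for f
    using that unfolding Int_iff INT_iff by blast
  then have "x \<in> mspace X" using affine_functions_zero by blast
  moreover have "\<sigma> f = f x" if "f \<in> affine_functions (mspace X)" for f
    using x[OF that] by simp
  ultimately show ?thesis by blast
qed

text \<open>The value 0 off \<open>affine_functions\<close> follows the convention of
  \<open>state_space\<close>, so that evaluations are literally states.\<close>

definition eval_state :: "'a \<Rightarrow> ('a \<Rightarrow> real) \<Rightarrow> real" where
  "eval_state x = (\<lambda>f. if f \<in> affine_functions (mspace X) then f x else 0)"

lemma eval_state_in: "x \<in> mspace X \<Longrightarrow> eval_state x \<in> state_space (Aff X)"
  unfolding state_space_def Aff_simps eval_state_def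
  using affine_functions_scaleR
  by (simp add: affine_functions_add affine_functions_unit le_fun_def) (simp add: scaleR_fun_def)

lemma state_space_eq: "state_space (Aff X) = eval_state ` mspace X"
proof
  show "state_space (Aff X) \<subseteq> eval_state ` mspace X"
  proof
    fix \<sigma> assume \<sigma>: "\<sigma> \<in> state_space (Aff X)"
    then obtain x where x: "x \<in> mspace X" "\<forall>f\<in>affine_functions (mspace X). \<sigma> f = f x"
      using state_eval by blast
    have "\<sigma> = eval_state x"
      using x(2) stateD(5)[OF \<sigma>] unfolding eval_state_def by (simp add: fun_eq_iff)
    then show "\<sigma> \<in> eval_state ` mspace X" using x(1) by blast
  qed
qed (use eval_state_in in blast)

end

section \<open>Representing measures\<close>

definition lipschitz_fun :: "'a metric \<Rightarrow> 'a set \<Rightarrow> ('a \<Rightarrow> real) \<Rightarrow> bool" where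
  "lipschitz_fun X K h \<longleftrightarrow> (\<exists>C\<ge>0. lip_on C X K h)"

lemma lipschitz_funI: "lip_on C X K h \<Longrightarrow> 0 \<le> C \<Longrightarrow> lipschitz_fun X K h"
  by (auto simp: lipschitz_fun_def)

lemma lipschitz_fun_const [simp]: "lipschitz_fun X K (\<lambda>_. c)"
  by (rule lipschitz_funI[of 0]) simp_all

lemma lipschitz_fun_add: "lipschitz_fun X K f \<Longrightarrow> lipschitz_fun X K g \<Longrightarrow> lipschitz_fun X K (\<lambda>x. f x + g x)"
  unfolding lipschitz_fun_def by (metis lip_on_add add_nonneg_nonneg)

lemma lipschitz_fun_cmult: "lipschitz_fun X K f \<Longrightarrow> lipschitz_fun X K (\<lambda>x. c * f x)"
  unfolding lipschitz_fun_def by (metis lip_on_cmult mult_nonneg_nonneg abs_ge_zero)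

lemma lipschitz_fun_sum: "(\<And>i. i \<in> I \<Longrightarrow> lipschitz_fun X K (f i)) \<Longrightarrow> lipschitz_fun X K (\<lambda>x. \<Sum>i\<in>I. f i x)"
  by (induction I rule: infinite_finite_induct) (auto intro: lipschitz_fun_add)

lemma lipschitz_fun_max:
  assumes "lipschitz_fun X K f"
  shows "lipschitz_fun X K (\<lambda>x. max c (f x))"
proof -
  obtain C where C: "C \<ge> 0" "lip_on C X K f" using assms by (auto simp: lipschitz_fun_def)
  have "\<bar>max c (f x) - max c (f y)\<bar> \<le> C * mdist X x y" if "x \<in> K" "y \<in> K" for x y
    using lip_onD[OF C(2) that] by (auto simp: max_def abs_le_iff)
  then show ?thesis using C(1) by (intro lipschitz_funI[of C]) (auto simp: lip_on_def)
qed

lemma lipschitz_fun_min: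
  assumes "lipschitz_fun X K f"
  shows "lipschitz_fun X K (\<lambda>x. min c (f x))"
proof -
  have "(\<lambda>x. min c (f x)) = (\<lambda>x. (-1) * max (- c) ((-1) * f x))" by (auto simp: min_def max_def)
  then show ?thesis using lipschitz_fun_cmult lipschitz_fun_max assms by metis
qed

text \<open>The truncated distance to \<open>K - U\<close>, positive on \<open>U\<close> because
  that set is compact. When \<open>K - U\<close> is empty there is no distance to take, and the
  constant 1 serves.\<close>

lemma lipschitz_bump:
  fixes X :: "'a::locally_convex_space metric"
  assumes top: "mtopology_of X = top_of_set (mspace X)" and K: "K \<subseteq> mspace X" "compact K" and U: "open U"
  shows "\<exists>\<psi>. lip_on 1 X K \<psi> \<and> (\<forall>x\<in>K. 0 \<le> \<psi> x \<and> \<psi> x \<le> 1 \<and> (x \<notin> U \<longrightarrow> \<psi> x = 0) \<and> (x \<in> U \<longrightarrow> 0 < \<psi> x))"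
proof (cases "K \<subseteq> U")
  case True
  then show ?thesis by (intro exI[of _ "\<lambda>_. 1"]) auto
next
  case False
  define T where "T = K - U"
  have T: "compact T" "T \<noteq> {}" "T \<subseteq> mspace X"
    using False K U compact_diff[of K U] by (auto simp: T_def)
  define g where "g = (\<lambda>x. INF y\<in>T. mdist X x y)"
  have le: "g x \<le> mdist X x y" if "y \<in> T" for x y
    unfolding g_def by (rule cINF_lower[OF _ that]) (auto intro: bdd_belowI2[of _ 0])
  have ge: "c \<le> g x" if "\<And>y. y \<in> T \<Longrightarrow> c \<le> mdist X x y" for x c
    unfolding g_def by (rule cINF_greatest[OF T(2) that])
  have g0: "0 \<le> g x" for x by (rule ge) simp
  have gl: "g x - g y \<le> mdist X x y" if xy: "x \<in> K" "y \<in> K" for x y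
  proof -
    have "g x - mdist X x y \<le> g y"
    proof (rule ge)
      fix z assume z: "z \<in> T"
      have "mdist X x z \<le> mdist X x y + mdist X y z"
        by (rule mdist_triangle) (use xy z K T in auto)
      then show "g x - mdist X x y \<le> mdist X y z" using le[OF z, of x] by simp
    qed
    then show ?thesis by simp
  qed
  have pos: "0 < g x" if x: "x \<in> K" "x \<in> U" for x
  proof -
    have "continuous_on T (mdist X x)"
      by (rule continuous_on_mdist[OF top]) (use x K T in auto)
    then obtain y where y: "y \<in> T" "\<And>z. z \<in> T \<Longrightarrow> mdist X x y \<le> mdist X x z"
      using continuous_attains_inf[OF T(1,2)] by blast
    have "x \<noteq> y" using x y(1) by (auto simp: T_def)
    then have "mdist X x y \<noteq> 0" using x K y(1) T by (subst mdist_zero) auto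
    then have "0 < mdist X x y" using mdist_nonneg[of X x y] by linarith
    also have "\<dots> \<le> g x" by (rule ge[OF y(2)])
    finally show ?thesis .
  qed
  have "lip_on 1 X K (\<lambda>x. min 1 (g x))"
  proof (rule lip_onI)
    fix x y assume "x \<in> K" "y \<in> K"
    from gl[OF this] show "min 1 (g x) - min 1 (g y) \<le> 1 * mdist X x y"
      using mdist_nonneg[of X x y] by linarith
  qed
  moreover have "g x = 0" if "x \<in> K" "x \<notin> U" for x
    using le[of x x] that K g0[of x] by (auto simp: T_def)
  ultimately show ?thesis using g0 pos by (intro exI[of _ "\<lambda>x. min 1 (g x)"]) auto
qed

text \<open>A positive normalised functional on the Lipschitz functions of \<open>K\<close>, for
  which a representing measure is built. By \<open>mono\<close> its value depends on the restriction
  to \<open>K\<close> only, so the functions may be arbitrary elsewhere.\<close>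

locale lipschitz_functional =
  fixes X :: "'a::locally_convex_space metric" and K :: "'a set" and \<Lambda> :: "('a \<Rightarrow> real) \<Rightarrow> real"
  assumes top: "mtopology_of X = top_of_set (mspace X)" and KX: "K \<subseteq> mspace X" and Kc: "compact K"
    and add: "lipschitz_fun X K f \<Longrightarrow> lipschitz_fun X K g \<Longrightarrow> \<Lambda> (\<lambda>x. f x + g x) = \<Lambda> f + \<Lambda> g"
    and cmult: "lipschitz_fun X K f \<Longrightarrow> \<Lambda> (\<lambda>x. c * f x) = c * \<Lambda> f"
    and mono: "lipschitz_fun X K f \<Longrightarrow> lipschitz_fun X K g \<Longrightarrow> (\<And>x. x \<in> K \<Longrightarrow> f x \<le> g x) \<Longrightarrow> \<Lambda> f \<le> \<Lambda> g"
    and one: "\<Lambda> (\<lambda>_. 1) = 1"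
begin

lemma closed_K: "closed K"
  using Kc by (rule compact_imp_closed)

lemma const: "\<Lambda> (\<lambda>_. c) = c"
  using cmult[of "\<lambda>_. 1" c] one by simp

lemma sum: "finite I \<Longrightarrow> (\<And>i. i \<in> I \<Longrightarrow> lipschitz_fun X K (f i)) \<Longrightarrow> \<Lambda> (\<lambda>x. \<Sum>i\<in>I. f i x) = (\<Sum>i\<in>I. \<Lambda> (f i))"
proof (induction I rule: finite_induct)
  case (insert i I)
  then show ?case using add[of "f i" "\<lambda>x. \<Sum>i\<in>I. f i x"] lipschitz_fun_sum[of I X K f] by simp
qed (simp add: const)

lemma cont: "lipschitz_fun X K f \<Longrightarrow> continuous_on K f"
  unfolding lipschitz_fun_def using lip_on_continuous[OF top _ KX] by blast

text \<open>Vanishing off \<open>U\<close> takes the place of compact support inside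
  \<open>U\<close>; where room is needed, a function is cut down by a small constant.\<close>

definition subordinate :: "'a set \<Rightarrow> ('a \<Rightarrow> real) set" where
  "subordinate U = {f. lipschitz_fun X K f \<and> (\<forall>x\<in>K. 0 \<le> f x \<and> f x \<le> 1 \<and> (x \<notin> U \<longrightarrow> f x = 0))}"

definition content :: "'a set \<Rightarrow> real" where
  "content U = (SUP f\<in>subordinate U. \<Lambda> f)"

lemma subordinateD:
  assumes "f \<in> subordinate U"
  shows "lipschitz_fun X K f" "x \<in> K \<Longrightarrow> 0 \<le> f x" "x \<in> K \<Longrightarrow> f x \<le> 1" "x \<in> K \<Longrightarrow> x \<notin> U \<Longrightarrow> f x = 0"
  using assms by (auto simp: subordinate_def)

lemma zero_subordinate: "(\<lambda>_. 0) \<in> subordinate U"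
  by (simp add: subordinate_def)

lemma content_ge: "f \<in> subordinate U \<Longrightarrow> \<Lambda> f \<le> content U"
  unfolding content_def
proof (rule cSUP_upper)
  show "bdd_above (\<Lambda> ` subordinate U)"
  proof (rule bdd_aboveI2)
    fix f assume f: "f \<in> subordinate U"
    show "\<Lambda> f \<le> 1"
      using mono[OF subordinateD(1)[OF f], of "\<lambda>_. 1"] subordinateD(3)[OF f] one by simp
  qed
qed

lemma content_le: "(\<And>f. f \<in> subordinate U \<Longrightarrow> \<Lambda> f \<le> c) \<Longrightarrow> content U \<le> c"
  unfolding content_def using zero_subordinate by (intro cSUP_least) auto

lemma content_nonneg: "0 \<le> content U"
  using content_ge[OF zero_subordinate] const by simp

lemma content_mono: "U \<inter> K \<subseteq> V \<Longrightarrow> content U \<le> content V"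
  by (rule content_le, rule content_ge) (auto simp: subordinate_def)

lemma content_empty: "U \<inter> K = {} \<Longrightarrow> content U = 0"
proof (rule antisym[OF content_le content_nonneg])
  fix f assume U: "U \<inter> K = {}" and f: "f \<in> subordinate U"
  have "\<Lambda> f \<le> \<Lambda> (\<lambda>_. 0)"
  proof (rule mono[OF subordinateD(1)[OF f]])
 fix x assume "x \<in> K"
    then have "x \<notin> U" using U by blast
    then show "f x \<le> 0" using subordinateD(4)[OF f \<open>x \<in> K\<close>] by simp
  qed simp
  then show "\<Lambda> f \<le> 0" by (simp add: const)
qed

lemma content_UNIV: "K \<subseteq> U \<Longrightarrow> content U = 1"
proof (rule antisym[OF content_le])
  fix f assume f: "f \<in> subordinate U"
  show "\<Lambda> f \<le> 1" using mono[OF subordinateD(1)[OF f], of "\<lambda>_. 1"] subordinateD(3)[OF f] one by simp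
next
  assume "K \<subseteq> U"
  then have "(\<lambda>_. 1) \<in> subordinate U" by (auto simp: subordinate_def)
  then have "\<Lambda> (\<lambda>_. 1) \<le> content U" by (rule content_ge)
  then show "1 \<le> content U" by (simp only: one)
qed

text \<open>Finitely many \<open>U n\<close> cover the compact set where \<open>f\<close> is at
  least \<epsilon>. Bumps for these sets have a sum at least \<open>c > 0\<close> there; scaled by
  \<open>1 / c\<close> and truncated at 1 they add up to at least 1, so \<open>f\<close> is at most
  \<epsilon> plus their sum.\<close>

lemma content_finite_cover:
  fixes U :: "nat \<Rightarrow> 'a set"
  assumes U: "\<And>n. open (U n)" and f: "f \<in> subordinate (\<Union>n. U n)" and \<epsilon>: "\<epsilon> > 0"
  shows "\<exists>N. \<Lambda> f \<le> \<epsilon> + (\<Sum>n<N. content (U n))"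
proof -
  define S where "S = K \<inter> f -` {\<epsilon>..}"
  have S: "compact S"
    unfolding S_def using continuous_closed_preimage[OF cont[OF subordinateD(1)[OF f]] closed_K, of "{\<epsilon>..}"] Kc
    by (metis closed_Int_compact closed_atLeast inf.left_idem inf_commute)
  have "S \<subseteq> (\<Union>n\<in>UNIV. U n)"
  proof
    fix x assume "x \<in> S"
    then have "x \<in> K" "f x \<noteq> 0" using \<epsilon> by (auto simp: S_def)
    then show "x \<in> (\<Union>n\<in>UNIV. U n)" using subordinateD(4)[OF f] by blast
  qed
  then obtain J where J: "finite J" "S \<subseteq> (\<Union>n\<in>J. U n)"
    using compactE_image[OF S, of UNIV U] U by auto
  define N where "N = Suc (Max (insert 0 J))"
  have JN: "n < N" if "n \<in> J" for n using J(1) that by (simp add: N_def le_imp_less_Suc)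
  have "\<forall>n. \<exists>\<psi>. lip_on 1 X K \<psi> \<and> (\<forall>x\<in>K. 0 \<le> \<psi> x \<and> \<psi> x \<le> 1 \<and> (x \<notin> U n \<longrightarrow> \<psi> x = 0) \<and> (x \<in> U n \<longrightarrow> 0 < \<psi> x))"
    using lipschitz_bump[OF top KX Kc U] by blast
  then obtain \<psi> where psi: "\<And>n. lip_on 1 X K (\<psi> n)"
    "\<And>n. \<forall>x\<in>K. 0 \<le> \<psi> n x \<and> \<psi> n x \<le> 1 \<and> (x \<notin> U n \<longrightarrow> \<psi> n x = 0) \<and> (x \<in> U n \<longrightarrow> 0 < \<psi> n x)"
    unfolding choice_iff by blast
  have lpsi: "lipschitz_fun X K (\<psi> n)" for n using psi(1) by (rule lipschitz_funI) simp
  have "\<exists>c>0. \<forall>x\<in>S. c \<le> (\<Sum>n<N. \<psi> n x)"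
  proof (cases "S = {}")
    case False
    have "continuous_on S (\<lambda>x. \<Sum>n<N. \<psi> n x)"
      by (intro continuous_on_sum continuous_on_subset[OF cont[OF lpsi]]) (auto simp: S_def)
    then obtain x where x: "x \<in> S" "\<forall>y\<in>S. (\<Sum>n<N. \<psi> n x) \<le> (\<Sum>n<N. \<psi> n y)"
      using continuous_attains_inf[OF S False] by blast
    have xK: "x \<in> K" using x(1) by (simp add: S_def)
    obtain n where n: "n \<in> J" "x \<in> U n" using x(1) J(2) by (meson UN_E subsetD)
    have "0 < \<psi> n x" using psi(2)[of n] xK n(2) by blast
    also have "\<psi> n x \<le> (\<Sum>n<N. \<psi> n x)"
      using psi(2) xK JN[OF n(1)] by (intro member_le_sum) auto
    finally show ?thesis using x(2) by blast
  qed (auto intro: exI[of _ 1])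
  then obtain c where c: "c > 0" "\<And>x. x \<in> S \<Longrightarrow> c \<le> (\<Sum>n<N. \<psi> n x)" by blast
  define h where "h = (\<lambda>n x. min 1 ((1 / c) * \<psi> n x))"
  have lh: "lipschitz_fun X K (h n)" for n
    unfolding h_def by (intro lipschitz_fun_min lipschitz_fun_cmult lpsi)
  have h: "h n \<in> subordinate (U n)" for n
    using lh psi(2)[of n] c(1) by (auto simp: subordinate_def h_def)
  have le: "f x \<le> \<epsilon> + (\<Sum>n<N. h n x)" if x: "x \<in> K" for x
  proof (cases "x \<in> S")
    case True
    have h0: "0 \<le> h n x" for n using subordinateD(2)[OF h x] .
    have "1 \<le> (\<Sum>n<N. h n x)"
    proof (cases "\<exists>n<N. (1 / c) * \<psi> n x \<ge> 1")
      case True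
      then obtain n where n: "n < N" "h n x = 1" by (auto simp: h_def)
      have "h n x \<le> (\<Sum>n<N. h n x)" using n(1) h0 by (intro member_le_sum) auto
      then show ?thesis using n(2) by simp
    next
      case False
      then have "(\<Sum>n<N. h n x) = (\<Sum>n<N. (1 / c) * \<psi> n x)"
        by (intro sum.cong refl) (auto simp: h_def min_def)
      also have "\<dots> = (1 / c) * (\<Sum>n<N. \<psi> n x)" by (simp only: sum_distrib_left)
      also have "\<dots> \<ge> (1 / c) * c" using c(1) c(2)[OF True] by (intro mult_left_mono) auto
      finally show ?thesis using c(1) by simp
    qed
    then show ?thesis using subordinateD(3)[OF f x] \<epsilon> by linarith
  next
    case False
    then have "f x < \<epsilon>" using x by (auto simp: S_def)
    moreover have "0 \<le> (\<Sum>n<N. h n x)" by (intro sum_nonneg subordinateD(2)[OF h x])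
    ultimately show ?thesis by linarith
  qed
  have "\<Lambda> f \<le> \<Lambda> (\<lambda>x. \<epsilon> + (\<Sum>n<N. h n x))"
    by (intro mono subordinateD(1)[OF f] lipschitz_fun_add lipschitz_fun_sum lipschitz_fun_const lh le)
  also have "\<dots> = \<epsilon> + (\<Sum>n<N. \<Lambda> (h n))"
    using add[OF lipschitz_fun_const lipschitz_fun_sum[of "{..<N}" X K h], of \<epsilon>] lh sum[of "{..<N}" h] const by simp
  also have "\<dots> \<le> \<epsilon> + (\<Sum>n<N. content (U n))"
    by (intro add_left_mono sum_mono content_ge h)
  finally show ?thesis by blast
qed

lemma content_countably_subadditive:
  fixes U :: "nat \<Rightarrow> 'a set"
  assumes U: "\<And>n. open (U n)"
  shows "ennreal (content (\<Union>n. U n)) \<le> (\<Sum>n. ennreal (content (U n)))"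
proof (cases "(\<Sum>n. ennreal (content (U n)))")
  case (real r)
  have "content (\<Union>n. U n) \<le> r"
  proof (rule content_le, rule field_le_epsilon)
    fix f and e :: real assume f: "f \<in> subordinate (\<Union>n. U n)" and e: "e > 0"
    obtain N where N: "\<Lambda> f \<le> e + (\<Sum>n<N. content (U n))" using content_finite_cover[OF U f e] by blast
    have "ennreal (\<Sum>n<N. content (U n)) = (\<Sum>n<N. ennreal (content (U n)))"
      by (simp add: content_nonneg)
    also have "\<dots> \<le> ennreal r" unfolding real(2)[symmetric] by (intro sum_le_suminf) auto
    finally have "(\<Sum>n<N. content (U n)) \<le> r" using real(1) by simp
    then show "\<Lambda> f \<le> r + e" using N by simp
  qed
  then show ?thesis unfolding real(2) by (rule ennreal_leI)
qed simp


section \<open>The outer measure and the Borel measure of a positive functional\<close>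

definition outer :: "'a set \<Rightarrow> real" where
  "outer A = (INF U\<in>{U. open U \<and> A \<subseteq> U}. content U)"

lemma outer_le: "open U \<Longrightarrow> A \<subseteq> U \<Longrightarrow> outer A \<le> content U"
  unfolding outer_def
  by (rule cINF_lower) (auto intro!: bdd_belowI2[of _ 0] content_nonneg)

lemma outer_ge: "(\<And>U. open U \<Longrightarrow> A \<subseteq> U \<Longrightarrow> c \<le> content U) \<Longrightarrow> c \<le> outer A"
  unfolding outer_def by (rule cINF_greatest) auto

lemma outer_nonneg: "0 \<le> outer A"
  by (rule outer_ge) (rule content_nonneg)

lemma outer_open: "open U \<Longrightarrow> outer U = content U"
  by (intro antisym outer_le outer_ge content_mono subset_refl le_infI1)

lemma outer_mono: "A \<subseteq> B \<Longrightarrow> outer A \<le> outer B"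
  by (rule outer_ge, rule outer_le) (assumption, rule subset_trans)

lemma outer_approx:
  assumes "e > 0"
  shows "\<exists>U. open U \<and> A \<subseteq> U \<and> content U \<le> outer A + e"
proof (rule ccontr)
  assume "\<not> ?thesis"
  then have "outer A + e \<le> content U" if "open U" "A \<subseteq> U" for U using that by (metis linear)
  then have "outer A + e \<le> outer A" by (rule outer_ge)
  then show False using assms by simp
qed

abbreviation outer_enn :: "'a set \<Rightarrow> ennreal" where
  "outer_enn A \<equiv> ennreal (outer A)"

lemma outer_countably_subadditive: "outer_enn (\<Union>n. A n) \<le> (\<Sum>n. outer_enn (A n))"
proof (rule ennreal_le_epsilon)
  fix e :: real assume e: "e > 0"
  have "\<forall>n. \<exists>U. open U \<and> A n \<subseteq> U \<and> content U \<le> outer (A n) + e * (1/2)^Suc n"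
    by (intro allI outer_approx) (use e in simp)
  then obtain U where "\<forall>n. open (U n) \<and> A n \<subseteq> U n \<and> content (U n) \<le> outer (A n) + e * (1/2)^Suc n"
    unfolding choice_iff by (rule exE)
  then have U: "\<And>n. open (U n)" "\<And>n. A n \<subseteq> U n" "\<And>n. content (U n) \<le> outer (A n) + e * (1/2)^Suc n"
    by simp_all
  have s1: "(\<lambda>n. e * (1/2)^Suc n) sums (e * 1)" by (rule sums_mult[OF power_half_series])
  have nn: "0 \<le> e * (1/2)^Suc n" for n using e by simp
  have geo: "(\<Sum>n. ennreal (e * (1/2)^Suc n)) = ennreal e"
    using suminf_ennreal_eq[OF nn s1] by (simp only: mult_1_right)
  have "outer (\<Union>n. A n) \<le> content (\<Union>n. U n)" using U(1,2) by (intro outer_le) auto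
  then have "outer_enn (\<Union>n. A n) \<le> ennreal (content (\<Union>n. U n))" by (rule ennreal_leI)
  also have "\<dots> \<le> (\<Sum>n. ennreal (content (U n)))" by (rule content_countably_subadditive[OF U(1)])
  also have "\<dots> \<le> (\<Sum>n. outer_enn (A n) + ennreal (e * (1/2)^Suc n))"
  proof (intro suminf_le summableI)
    fix n
    have "ennreal (content (U n)) \<le> ennreal (outer (A n) + e * (1/2)^Suc n)" by (rule ennreal_leI[OF U(3)])
    also have "\<dots> = outer_enn (A n) + ennreal (e * (1/2)^Suc n)" by (rule ennreal_plus[OF outer_nonneg nn])
    finally show "ennreal (content (U n)) \<le> outer_enn (A n) + ennreal (e * (1/2)^Suc n)" .
  qed
  also have "\<dots> = (\<Sum>n. outer_enn (A n)) + (\<Sum>n. ennreal (e * (1/2)^Suc n))"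
    by (intro suminf_add[symmetric] summableI)
  finally show "outer_enn (\<Union>n. A n) \<le> (\<Sum>n. outer_enn (A n)) + ennreal e" unfolding geo .
qed

lemma outer_empty: "outer {} = 0"
  using outer_open[of "{}"] content_empty[of "{}"] by simp

lemma outer_measure_space: "outer_measure_space (Pow UNIV) outer_enn"
  unfolding outer_measure_space_def positive_def increasing_def countably_subadditive_def
  using outer_countably_subadditive by (auto simp: outer_empty intro!: ennreal_leI outer_mono)

text \<open>Countable subadditivity on two open covers, padded with empty sets.\<close>

lemma outer_subadditive: "outer (A \<union> B) \<le> outer A + outer B"
proof (rule field_le_epsilon)
  fix e :: real assume e: "e > 0"
  obtain U where U: "open U" "A \<subseteq> U" "content U \<le> outer A + e / 2" using outer_approx[of "e / 2" A] e by auto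
  obtain V where V: "open V" "B \<subseteq> V" "content V \<le> outer B + e / 2" using outer_approx[of "e / 2" B] e by auto
  define W where "W = (\<lambda>n::nat. if n = 0 then U else if n = 1 then V else {})"
  have W: "(\<Union>n. W n) = U \<union> V" by (auto simp: W_def split: if_splits)
  have W2: "content (W n) = 0" if "n \<notin> {0, 1}" for n using that by (simp add: W_def content_empty)
  have "(\<lambda>n. content (W n)) sums (\<Sum>n\<in>{0, 1}. content (W n))"
    by (rule sums_finite) (use W2 in auto)
  moreover have "(\<Sum>n\<in>{0, 1}. content (W n)) = content U + content V" by (simp add: W_def)
  ultimately have "(\<lambda>n. content (W n)) sums (content U + content V)" by simp
  from suminf_ennreal_eq[OF content_nonneg this]
  have "(\<Sum>n. ennreal (content (W n))) = ennreal (content U + content V)" .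
  moreover have "open (W n)" for n using U V by (simp add: W_def)
  ultimately have "ennreal (content (U \<union> V)) \<le> ennreal (content U + content V)"
    using content_countably_subadditive[of W] W by simp
  then have "content (U \<union> V) \<le> content U + content V"
    using content_nonneg[of U] content_nonneg[of V] by (simp add: ennreal_le_iff del: ennreal_plus)
  then show "outer (A \<union> B) \<le> outer A + outer B + e"
    using outer_le[OF open_Un[OF U(1) V(1)] Un_mono[OF U(2) V(2)]] U(3) V(3) by simp
qed

text \<open>The nontrivial half of the Caratheodory criterion. If \<open>f\<close> is subordinate to
  \<open>V \<inter> U\<close>, then \<open>A - U\<close> lies in the open set \<open>W\<close> where
  \<open>f\<close> is small. The part of \<open>f\<close> above \<open>e\<close> lives off
  \<open>W\<close>, so adding it to any function subordinate to \<open>W\<close> keeps the sum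
  subordinate to \<open>V\<close>.\<close>

lemma outer_split_open:
  assumes U: "open U"
  shows "outer (A \<inter> U) + outer (A - U) \<le> outer A"
proof (rule outer_ge)
  fix V assume V: "open V" "A \<subseteq> V"
  have "content (V \<inter> U) \<le> content V - outer (A - U)"
  proof (rule content_le, rule field_le_epsilon)
    fix f and e :: real assume f: "f \<in> subordinate (V \<inter> U)" and e: "e > 0"
    have "openin (top_of_set K) (K \<inter> f -` {..<e})"
      using cont[OF subordinateD(1)[OF f]] by (rule continuous_openin_preimage_gen) simp
    then obtain G where G: "open G" "K \<inter> f -` {..<e} = K \<inter> G" unfolding openin_open by blast
    \<comment> \<open>The set \<open>G\<close> is determined by its trace on \<open>K\<close> only;
      adding the complement of \<open>K\<close> catches the points of \<open>A - U\<close> outside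
      \<open>K\<close> and does not affect the content.\<close>
    define W where "W = V \<inter> (G \<union> - K)"
    have W: "open W" using V(1) G(1) closed_K by (auto simp: W_def)
    have "A - U \<subseteq> W"
    proof
      fix x assume x: "x \<in> A - U"
      have "x \<in> G" if xK: "x \<in> K"
      proof -
        have "f x = 0" using subordinateD(4)[OF f xK] x by blast
        then have "x \<in> K \<inter> f -` {..<e}" using e xK by simp
        then show ?thesis using G(2) by blast
      qed
      then show "x \<in> W" using x V(2) by (auto simp: W_def)
    qed
    then have "outer (A - U) \<le> content W" by (rule outer_le[OF W])
    moreover have "content W \<le> content V - \<Lambda> f + e"
    proof (rule content_le)
      fix g assume g: "g \<in> subordinate W"
      define f' where "f' = (\<lambda>x. max 0 (f x + (- e)))"
      have lf': "lipschitz_fun X K f'"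
        unfolding f'_def by (intro lipschitz_fun_max lipschitz_fun_add subordinateD(1)[OF f] lipschitz_fun_const)
      have sub: "(\<lambda>x. f' x + g x) \<in> subordinate V"
        unfolding subordinate_def mem_Collect_eq
      proof (intro conjI ballI lipschitz_fun_add lf' subordinateD(1)[OF g])
        fix x assume x: "x \<in> K"
        show "0 \<le> f' x + g x" using subordinateD(2)[OF g x] by (simp add: f'_def)
        show "f' x + g x \<le> 1"
        proof (cases "f x < e")
          case True
          then show ?thesis using subordinateD(3)[OF g x] by (simp add: f'_def)
        next
          case False
          then have "x \<notin> K \<inter> f -` {..<e}" by simp
          then have "x \<notin> W" using x G(2) by (auto simp: W_def)
          then show ?thesis using subordinateD(4)[OF g x] subordinateD(3)[OF f x] e by (simp add: f'_def)
        qed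
        show "x \<notin> V \<longrightarrow> f' x + g x = 0"
          using subordinateD(4)[OF f x] subordinateD(4)[OF g x] e by (auto simp: f'_def W_def)
      qed
      have "\<Lambda> f + (- e) = \<Lambda> (\<lambda>x. f x + (- e))"
        using add[OF subordinateD(1)[OF f] lipschitz_fun_const, of "- e"] const by simp
      also have "\<dots> \<le> \<Lambda> f'"
        by (rule mono[OF lipschitz_fun_add[OF subordinateD(1)[OF f] lipschitz_fun_const] lf'])
          (simp add: f'_def)
      finally have "\<Lambda> f + (- e) \<le> \<Lambda> f'" .
      moreover have "\<Lambda> f' + \<Lambda> g \<le> content V"
        using content_ge[OF sub] add[OF lf' subordinateD(1)[OF g]] by simp
      ultimately show "\<Lambda> g \<le> content V - \<Lambda> f + e" by simp
    qed
    ultimately show "\<Lambda> f \<le> content V - outer (A - U) + e" by simp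
  qed
  moreover have "outer (A \<inter> U) \<le> content (V \<inter> U)" using U V by (intro outer_le) auto
  ultimately show "outer (A \<inter> U) + outer (A - U) \<le> content V" by simp
qed

lemma open_in_lambda_system: "open U \<Longrightarrow> U \<in> lambda_system UNIV (Pow UNIV) outer_enn"
proof -
  assume U: "open U"
  have "outer_enn (U \<inter> A) + outer_enn ((UNIV - U) \<inter> A) = outer_enn A" for A
  proof -
    have "outer A \<le> outer (A \<inter> U) + outer (A - U)"
      using outer_subadditive[of "A \<inter> U" "A - U"] by (simp add: Int_Diff_Un)
    then have "outer (A \<inter> U) + outer (A - U) = outer A" using outer_split_open[OF U, of A] by simp
    moreover have "U \<inter> A = A \<inter> U" "(UNIV - U) \<inter> A = A - U" by auto
    ultimately show ?thesis by (simp add: outer_nonneg ennreal_plus[symmetric] del: ennreal_plus)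
  qed
  then show ?thesis by (simp add: lambda_system_def)
qed

definition repr_measure :: "'a measure" where
  "repr_measure = measure_of UNIV (sets borel) outer_enn"

lemma sets_repr_measure: "sets repr_measure = sets borel"
  unfolding repr_measure_def using sets.sigma_sets_eq[of borel] by (simp add: sets_measure_of)

text \<open>The Caratheodory sets form a sigma-algebra containing the open sets, hence all Borel
  sets, and the outer measure is countably additive on them.\<close>

lemma emeasure_repr_measure:
  assumes "A \<in> sets borel"
  shows "emeasure repr_measure A = outer_enn A"
  unfolding repr_measure_def
proof (rule emeasure_measure_of_sigma[OF _ _ _ assms])
  define L where "L = lambda_system UNIV (Pow UNIV) outer_enn"
  have ms: "measure_space UNIV L outer_enn"
    unfolding L_def
    by (rule sigma_algebra.caratheodory_lemma[OF sigma_algebra_Pow outer_measure_space])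
  then interpret L: sigma_algebra UNIV L by (simp add: measure_space_def)
  have sub: "sets borel \<subseteq> L"
  proof -
    have "sigma_sets UNIV {U. open U} \<subseteq> L"
      by (rule L.sigma_sets_subset) (use open_in_lambda_system in \<open>unfold L_def, blast\<close>)
    then show ?thesis by (simp add: borel_def)
  qed
  show "sigma_algebra UNIV (sets borel)" using sets.sigma_algebra_axioms[of borel] by simp
  show "positive (sets borel) outer_enn" by (simp add: positive_def outer_empty)
  have "countably_additive L outer_enn" using ms by (simp add: measure_space_def)
  then show "countably_additive (sets borel) outer_enn"
    using sub unfolding countably_additive_def by (meson subset_trans subsetD)
qed

lemma emeasure_repr_open: "open U \<Longrightarrow> emeasure repr_measure U = ennreal (content U)"
  by (simp add: emeasure_repr_measure outer_open)

lemma prob_space_repr_measure: "prob_space repr_measure"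
proof (rule prob_spaceI)
  have "space repr_measure = UNIV" using sets_eq_imp_space_eq[OF sets_repr_measure] by simp
  then show "emeasure repr_measure (space repr_measure) = 1"
    by (simp add: emeasure_repr_open content_UNIV)
qed

lemma emeasure_repr_measure_K: "emeasure repr_measure K = 1"
proof -
  interpret prob_space repr_measure by (rule prob_space_repr_measure)
  have sp: "space repr_measure = UNIV" using sets_eq_imp_space_eq[OF sets_repr_measure] by simp
  have "emeasure repr_measure (- K) = 0"
    using emeasure_repr_open[of "- K"] closed_K content_empty[of "- K"] by (simp add: open_Compl)
  then have "measure repr_measure (- K) = 0" by (simp add: measure_def)
  moreover have "K \<in> sets repr_measure" using closed_K by (simp add: sets_repr_measure)
  ultimately have "measure repr_measure K = 1"
    using prob_compl[of K] sp by (simp add: Compl_eq_Diff_UNIV)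
  then show ?thesis by (simp add: emeasure_eq_measure)
qed

end

lemma set_integrable_continuous_prob:
  fixes f :: "'a::topological_space \<Rightarrow> real"
  assumes \<mu>: "sets \<mu> = sets borel" "prob_space \<mu>" and K: "compact K" "closed K" and f: "continuous_on K f"
  shows "set_integrable \<mu> K f"
proof -
  interpret prob_space \<mu> by fact
  have "(\<lambda>x. indicator K x *\<^sub>R f x) \<in> borel_measurable borel"
    using borel_measurable_continuous_on_indicator[OF _ f] K(2) by simp
  then have m: "(\<lambda>x. indicator K x *\<^sub>R f x) \<in> borel_measurable \<mu>"
    using measurable_cong_sets[OF \<mu>(1) refl] by blast
  obtain B where B: "\<And>x. x \<in> K \<Longrightarrow> \<bar>f x\<bar> \<le> B"
    using compact_imp_bounded[OF compact_continuous_image[OF f K(1)]] by (auto simp: bounded_iff)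
  show ?thesis
    unfolding set_integrable_def
    by (rule integrable_const_bound[where B = "\<bar>B\<bar>", OF _ m])
      (use B in \<open>auto simp: indicator_def intro!: AE_I2 order_trans[OF B]\<close>)
qed

lemma prob_space_set_integral_const:
  assumes "sets \<mu> = sets borel" "prob_space \<mu>" "emeasure \<mu> K = 1" "closed K"
  shows "(LINT x:K|\<mu>. c) = (c::real)"
proof -
  interpret prob_space \<mu> by fact
  have "measure \<mu> K = 1" using assms(3) by (simp add: measure_def)
  moreover have "K \<in> sets \<mu>" using assms(1,4) by simp
  ultimately show ?thesis by (simp add: set_lebesgue_integral_def)
qed

section \<open>Integrals against the measure of a positive functional\<close>

context lipschitz_functional
begin

lemma integrable_repr: "lipschitz_fun X K h \<Longrightarrow> set_integrable repr_measure K h"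
  by (rule set_integrable_continuous_prob[OF sets_repr_measure prob_space_repr_measure Kc closed_K cont])

text \<open>The layer cake formula with \<open>n\<close> layers turns bounds on \<open>content\<close> into a bound on \<open>\<Lambda>\<close>.\<close>

lemma functional_le_integral_approx:
  assumes h: "lipschitz_fun X K h" "\<And>x. x \<in> K \<Longrightarrow> 0 \<le> h x" "\<And>x. x \<in> K \<Longrightarrow> h x \<le> 1" and n: "n > 0"
  shows "\<Lambda> h \<le> (LINT x:K|repr_measure. h x) + 1 / real n"
proof -
  interpret prob_space repr_measure by (rule prob_space_repr_measure)
  \<comment> \<open>The slice of \<open>n * h\<close> between the heights \<open>j\<close> and
    \<open>j + 1\<close>; it is subordinate to the set where \<open>h\<close> exceeds
    \<open>j / n\<close>.\<close>
  define f where "f = (\<lambda>j x. max 0 (min 1 (real n * h x + (- real j))))"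
  have lf: "lipschitz_fun X K (f j)" for j
    unfolding f_def
    by (intro lipschitz_fun_max lipschitz_fun_min lipschitz_fun_add lipschitz_fun_cmult h(1) lipschitz_fun_const)
  have sumf: "real n * h x = (\<Sum>j<n. f j x)" if x: "x \<in> K" for x
  proof -
    have "(\<Sum>j<m. f j x) = min (real m) (real n * h x)" for m
      using h(2)[OF x] by (induction m) (auto simp: f_def min_def max_def)
    moreover have "real n * h x \<le> real n * 1" using h(3)[OF x] by (intro mult_left_mono) auto
    ultimately show ?thesis by (simp add: min_def)
  qed
  have "\<forall>j. \<exists>U. open U \<and> K \<inter> h -` {real j / real n<..} = K \<inter> U"
  proof
    fix j :: nat
    have "openin (top_of_set K) (K \<inter> h -` {real j / real n<..})"
      using cont[OF h(1)] by (rule continuous_openin_preimage_gen) simp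
    then show "\<exists>U. open U \<and> K \<inter> h -` {real j / real n<..} = K \<inter> U" unfolding openin_open by blast
  qed
  then obtain U where "\<forall>j. open (U j) \<and> K \<inter> h -` {real j / real n<..} = K \<inter> U j"
    unfolding choice_iff by (rule exE)
  then have U: "\<And>j. open (U j)" "\<And>j. K \<inter> h -` {real j / real n<..} = K \<inter> U j" by simp_all
  have inU: "x \<in> U j \<longleftrightarrow> real j < real n * h x" if "x \<in> K" for x j
  proof -
    have "x \<in> U j \<longleftrightarrow> x \<in> K \<inter> h -` {real j / real n<..}" using U(2)[of j] that by simp
    also have "\<dots> \<longleftrightarrow> real j < real n * h x" using that n by (simp add: divide_less_eq mult.commute)
    finally show ?thesis .
  qed
  have sub: "f j \<in> subordinate (U j)" for j
    using lf inU by (auto simp: subordinate_def f_def)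
  have KU: "K \<inter> U j \<in> sets repr_measure" for j
    using closed_K U(1) by (simp add: sets_repr_measure)
  have mU: "content (U j) = measure repr_measure (K \<inter> U j)" for j
  proof -
    have "measure repr_measure (U j) = content (U j)"
      using emeasure_repr_open[OF U(1)] content_nonneg by (simp add: measure_def)
    moreover have "measure repr_measure (U j) = measure repr_measure (K \<inter> U j)"
    proof (rule finite_measure_eq_AE)
      have "AE x in repr_measure. x \<in> K"
        using emeasure_repr_measure_K closed_K
        by (intro AE_in_set_eq_1[THEN iffD2]) (simp_all add: measure_def sets_repr_measure)
      then show "AE x in repr_measure. (x \<in> U j) = (x \<in> K \<inter> U j)" by (rule AE_mp) (auto intro!: AE_I2)
    qed (use KU U(1) in \<open>auto simp: sets_repr_measure\<close>)
    ultimately show ?thesis by simp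
  qed
  have "real n * \<Lambda> h = \<Lambda> (\<lambda>x. real n * h x)" using cmult[OF h(1)] by simp
  also have "\<dots> \<le> \<Lambda> (\<lambda>x. \<Sum>j<n. f j x)"
    by (intro mono lipschitz_fun_cmult h(1) lipschitz_fun_sum lf) (simp add: sumf)
  also have "\<dots> = (\<Sum>j<n. \<Lambda> (f j))" by (rule sum) (auto intro: lf)
  also have "\<dots> \<le> (\<Sum>j<n. content (U j))" by (intro sum_mono content_ge sub)
  also have "\<dots> = (\<Sum>j<n. LINT x|repr_measure. indicator (K \<inter> U j) x)"
    unfolding mU using KU by simp
  also have "\<dots> = (LINT x|repr_measure. (\<Sum>j<n. indicator (K \<inter> U j) x))"
    using KU by (intro Bochner_Integration.integral_sum[symmetric]) (auto simp: emeasure_eq_measure)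
  \<comment> \<open>The number of indices \<open>j\<close> with \<open>j < n * h x\<close> is at
    most \<open>n * h x + 1\<close>; the surplus 1 becomes the error \<open>1 / n\<close>.\<close>
  also have "\<dots> \<le> (LINT x|repr_measure. indicator K x *\<^sub>R (real n * h x + 1))"
  proof (rule integral_mono)
    show "integrable repr_measure (\<lambda>x. \<Sum>j<n. indicat_real (K \<inter> U j) x)"
      using KU by (intro Bochner_Integration.integrable_sum) (auto simp: emeasure_eq_measure)
    show "integrable repr_measure (\<lambda>x. indicator K x *\<^sub>R (real n * h x + 1))"
      using integrable_repr[of "\<lambda>x. real n * h x + 1"] h(1)
      by (simp add: set_integrable_def lipschitz_fun_add lipschitz_fun_cmult)
    fix x
    show "(\<Sum>j<n. indicat_real (K \<inter> U j) x) \<le> indicator K x *\<^sub>R (real n * h x + 1)"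
    proof (cases "x \<in> K")
      case True
      have "(\<Sum>j<m. indicat_real (K \<inter> U j) x) \<le> min (real m) (real n * h x + 1)" for m
      proof (induction m)
        case (Suc m)
        have "indicat_real (K \<inter> U m) x = (if real m < real n * h x then 1 else 0)"
          using inU[OF True] True by (simp add: indicator_def)
        then show ?case using Suc.IH unfolding sum.lessThan_Suc by (auto simp only: min_def of_nat_Suc split: if_splits)
      next
        case 0
        have "0 \<le> real n * h x" using h(2)[OF True] by simp
        then show ?case by simp
      qed
      from this[of n] show ?thesis using True by simp
    qed simp
  qed
  also have "\<dots> = (LINT x:K|repr_measure. real n * h x) + (LINT x:K|repr_measure. 1)"
    using integrable_repr[of "\<lambda>x. real n * h x"] integrable_repr[of "\<lambda>_. 1"] h(1)
    unfolding set_lebesgue_integral_def[symmetric] by (intro set_integral_add) (auto intro: lipschitz_fun_cmult)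
  also have "\<dots> = real n * (LINT x:K|repr_measure. h x) + 1"
    using prob_space_set_integral_const[OF sets_repr_measure prob_space_repr_measure emeasure_repr_measure_K closed_K]
    by simp
  finally have "real n * \<Lambda> h \<le> real n * ((LINT x:K|repr_measure. h x) + 1 / real n)"
    using n by (simp add: distrib_left)
  then show ?thesis using n by simp
qed

lemma functional_le_integral:
  assumes h: "lipschitz_fun X K h" "\<And>x. x \<in> K \<Longrightarrow> 0 \<le> h x" "\<And>x. x \<in> K \<Longrightarrow> h x \<le> 1"
  shows "\<Lambda> h \<le> (LINT x:K|repr_measure. h x)"
proof (rule field_le_epsilon)
  fix e :: real assume "e > 0"
  then obtain n where "n > 0" "1 / real n < e"
    by (metis nat_approx_posE zero_less_Suc)
  then show "\<Lambda> h \<le> (LINT x:K|repr_measure. h x) + e"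
    using functional_le_integral_approx[OF h, of n] by simp
qed

text \<open>The reverse inequality is the upper bound applied to \<open>1 - h\<close>.\<close>

lemma functional_eq_integral_unit:
  assumes h: "lipschitz_fun X K h" "\<And>x. x \<in> K \<Longrightarrow> 0 \<le> h x" "\<And>x. x \<in> K \<Longrightarrow> h x \<le> 1"
  shows "\<Lambda> h = (LINT x:K|repr_measure. h x)"
proof (rule antisym[OF functional_le_integral[OF h]])
  have l: "lipschitz_fun X K (\<lambda>x. 1 + (- 1) * h x)"
    by (intro lipschitz_fun_add lipschitz_fun_cmult h(1) lipschitz_fun_const)
  have "\<Lambda> (\<lambda>x. 1 + (- 1) * h x) \<le> (LINT x:K|repr_measure. 1 + (- 1) * h x)"
    by (rule functional_le_integral[OF l]) (use h(2,3) in auto)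
  also have "\<dots> = (LINT x:K|repr_measure. 1) + (LINT x:K|repr_measure. (- 1) * h x)"
    by (intro set_integral_add integrable_repr lipschitz_fun_const lipschitz_fun_cmult h(1))
  also have "\<dots> = 1 - (LINT x:K|repr_measure. h x)"
    using prob_space_set_integral_const[OF sets_repr_measure prob_space_repr_measure emeasure_repr_measure_K closed_K]
    by (simp only: set_integral_mult_right)
  finally show "(LINT x:K|repr_measure. h x) \<le> \<Lambda> h"
    using add[OF lipschitz_fun_const lipschitz_fun_cmult[OF h(1)], of 1 "- 1"] cmult[OF h(1), of "- 1"] const[of 1]
    by simp
qed

text \<open>The affine change \<open>1 / 2 + h / (2 * B)\<close> moves the values into the unit
  interval, where the formula is known.\<close>

lemma functional_eq_integral:
  assumes h: "lipschitz_fun X K h"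
  shows "\<Lambda> h = (LINT x:K|repr_measure. h x)"
proof -
  obtain B where B: "B > 0" "\<And>x. x \<in> K \<Longrightarrow> \<bar>h x\<bar> \<le> B"
    using compact_imp_bounded[OF compact_continuous_image[OF cont[OF h] Kc]] by (auto simp: bounded_pos)
  define g where "g = (\<lambda>x. 1 / 2 + (1 / (2 * B)) * h x)"
  have g: "lipschitz_fun X K g"
    unfolding g_def by (intro lipschitz_fun_add lipschitz_fun_cmult h lipschitz_fun_const)
  have "\<Lambda> g = (LINT x:K|repr_measure. g x)"
  proof (rule functional_eq_integral_unit[OF g])
    fix x assume "x \<in> K"
    then have "\<bar>(1 / (2 * B)) * h x\<bar> \<le> 1 / 2" using B by (simp add: abs_mult field_simps)
    then show "0 \<le> g x" "g x \<le> 1" unfolding g_def by linarith+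
  qed
  also have "\<dots> = (LINT x:K|repr_measure. 1 / 2) + (LINT x:K|repr_measure. (1 / (2 * B)) * h x)"
    unfolding g_def by (intro set_integral_add integrable_repr lipschitz_fun_const lipschitz_fun_cmult h)
  also have "\<dots> = 1 / 2 + (1 / (2 * B)) * (LINT x:K|repr_measure. h x)"
    using prob_space_set_integral_const[OF sets_repr_measure prob_space_repr_measure emeasure_repr_measure_K closed_K, of "1 / 2"]
    by (simp only: set_integral_mult_right)
  finally have "\<Lambda> g = \<dots>" .
  moreover have "\<Lambda> g = 1 / 2 + (1 / (2 * B)) * \<Lambda> h"
    unfolding g_def using add[OF lipschitz_fun_const lipschitz_fun_cmult[OF h], of "1 / 2" "1 / (2 * B)"]
      cmult[OF h, of "1 / (2 * B)"] const[of "1 / 2"] by simp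
  ultimately show ?thesis using B(1) by simp
qed

end

text \<open>Two measures with the same integrals of Lipschitz functions agree on closed sets, since the
  indicator of a closed set is a decreasing limit of Lipschitz functions.\<close>

lemma measure_eq_by_lipschitz:
  fixes X :: "'a::locally_convex_space metric"
  assumes top: "mtopology_of X = top_of_set (mspace X)" and K: "K \<subseteq> mspace X" "compact K"
    and \<mu>: "sets \<mu> = sets borel" "prob_space \<mu>" "emeasure \<mu> K = 1"
    and \<nu>: "sets \<nu> = sets borel" "prob_space \<nu>" "emeasure \<nu> K = 1"
    and eq: "\<And>h. lipschitz_fun X K h \<Longrightarrow> (LINT x:K|\<mu>. h x) = (LINT x:K|\<nu>. h x)"
  shows "\<mu> = \<nu>"
proof -
  have cK: "closed K" using K(2) by (rule compact_imp_closed)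
  have open_eq: "measure \<mu> (K \<inter> U) = measure \<nu> (K \<inter> U)" if U: "open U" for U
  proof -
    obtain \<psi> where psi: "lip_on 1 X K \<psi>"
      "\<forall>x\<in>K. 0 \<le> \<psi> x \<and> \<psi> x \<le> 1 \<and> (x \<notin> U \<longrightarrow> \<psi> x = 0) \<and> (x \<in> U \<longrightarrow> 0 < \<psi> x)"
      using lipschitz_bump[OF top K U] by blast
    \<comment> \<open>On \<open>K\<close> these functions increase to the indicator of
      \<open>K \<inter> U\<close>. The comparison runs over open sets, the intersection-stable
      generator of the Borel sets.\<close>
    define h where "h = (\<lambda>n x. min 1 (real n * \<psi> x))"
    have l: "lipschitz_fun X K (h n)" for n
      unfolding h_def by (intro lipschitz_fun_min lipschitz_fun_cmult lipschitz_funI[OF psi(1)]) simp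
    have conv: "(\<lambda>n. LINT x:K|M. h n x) \<longlonglongrightarrow> measure M (K \<inter> U)"
      if M: "sets M = sets borel" "prob_space M" for M
    proof -
      interpret prob_space M by fact
      have KU: "K \<inter> U \<in> sets M" using cK U M(1) by simp
      have "(\<lambda>n. LINT x|M. indicator K x *\<^sub>R h n x) \<longlonglongrightarrow> (LINT x|M. indicator (K \<inter> U) x)"
      proof (rule integral_dominated_convergence[where w = "\<lambda>_. 1"])
        show "indicat_real (K \<inter> U) \<in> borel_measurable M" using KU by simp
        fix n
        have "continuous_on K (h n)"
          using l[of n] unfolding lipschitz_fun_def using lip_on_continuous[OF top _ K(1)] by blast
        from set_integrable_continuous_prob[OF M K(2) cK this]
        show "(\<lambda>x. indicator K x *\<^sub>R h n x) \<in> borel_measurable M" by (simp add: set_integrable_def)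
        show "AE x in M. norm (indicator K x *\<^sub>R h n x) \<le> 1"
          using psi(2) by (intro AE_I2) (auto simp: h_def indicator_def)
      next
        show "AE x in M. (\<lambda>n. indicator K x *\<^sub>R h n x) \<longlonglongrightarrow> indicat_real (K \<inter> U) x"
        proof (rule AE_I2)
          fix x
          show "(\<lambda>n. indicator K x *\<^sub>R h n x) \<longlonglongrightarrow> indicat_real (K \<inter> U) x"
          proof (cases "x \<in> K \<and> x \<in> U")
            case True
            then have p: "0 < \<psi> x" using psi(2) by blast
            then obtain N where N: "1 / \<psi> x < real N" using reals_Archimedean2 by blast
            have "h n x = 1" if "n \<ge> N" for n
            proof -
              have "1 < real N * \<psi> x" using N p by (simp add: divide_less_eq)
              also have "\<dots> \<le> real n * \<psi> x" using that p by (intro mult_right_mono) auto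
              finally show ?thesis by (simp add: h_def)
            qed
            then have "\<forall>\<^sub>F n in sequentially. indicator K x *\<^sub>R h n x = 1"
              using True by (auto simp: eventually_sequentially)
            then show ?thesis using True by (simp add: tendsto_eventually)
          next
            case False
            then have "indicator K x *\<^sub>R h n x = 0" for n
              using psi(2) by (auto simp: h_def indicator_def)
            then show ?thesis using False by (auto simp: indicator_def)
          qed
        qed
      qed simp
      then show ?thesis using KU by (simp add: set_lebesgue_integral_def)
    qed
    show ?thesis
      using LIMSEQ_unique[OF conv[OF \<mu>(1,2)]] conv[OF \<nu>(1,2)] eq[OF l] by simp
  qed
  have AEK: "measure M A = measure M (K \<inter> A)"
    if M: "sets M = sets borel" "prob_space M" "emeasure M K = 1" and A: "A \<in> sets borel" for M A
  proof -
    interpret prob_space M by fact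
    have "AE x in M. x \<in> K"
      using M(3) cK by (intro AE_in_set_eq_1[THEN iffD2]) (simp_all add: measure_def M(1))
    then have "AE x in M. (x \<in> A) = (x \<in> K \<inter> A)" by (rule AE_mp) (auto intro!: AE_I2)
    then show ?thesis by (rule finite_measure_eq_AE) (use A cK M(1) in auto)
  qed
  interpret M: prob_space \<mu> by fact
  interpret N: prob_space \<nu> by fact
  show ?thesis
  proof (rule measure_eqI_generator_eq[where E = "{U. open U}" and \<Omega> = UNIV and A = "\<lambda>_. UNIV"])
    show "Int_stable {U::'a set. open U}" by (auto simp: Int_stable_def)
    show "sets \<mu> = sigma_sets UNIV {U. open U}" "sets \<nu> = sigma_sets UNIV {U. open U}"
      using \<mu>(1) \<nu>(1) by (simp_all add: borel_def)
    fix U assume "U \<in> {U::'a set. open U}"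
    then have U: "open U" by simp
    show "emeasure \<mu> U = emeasure \<nu> U"
      using AEK[OF \<mu>, of U] AEK[OF \<nu>, of U] open_eq[OF U] U
      by (simp add: M.emeasure_eq_measure N.emeasure_eq_measure)
  qed (auto simp: M.emeasure_eq_measure)
qed

section \<open>Metric Bauer simplices\<close>

text \<open>\<open>boundary_measures\<close> for a general set \<open>K\<close>, to be used before
  \<open>K\<close> is known to be the extreme boundary.\<close>

definition concentrated :: "'a::topological_space set \<Rightarrow> 'a measure \<Rightarrow> bool" where
  "concentrated K \<mu> \<longleftrightarrow> sets \<mu> = sets borel \<and> prob_space \<mu> \<and> emeasure \<mu> K = 1"

lemma boundary_measures_eq: "boundary_measures C = {\<mu>. concentrated (extreme_boundary C) \<mu>}"
  by (simp add: boundary_measures_def concentrated_def)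

lemma concentrated_AE:
  assumes "concentrated K \<mu>" "closed K"
  shows "AE x in \<mu>. x \<in> K"
proof -
  interpret prob_space \<mu> using assms by (simp add: concentrated_def)
  show ?thesis
    using assms by (intro AE_in_set_eq_1[THEN iffD2]) (simp_all add: concentrated_def measure_def)
qed

lemma concentrated_integral_eq:
  fixes f :: "'a::topological_space \<Rightarrow> real"
  assumes \<mu>: "concentrated K \<mu>" "closed K" and f: "f \<in> borel_measurable \<mu>"
  shows "(LINT x|\<mu>. f x) = (LINT x:K|\<mu>. f x)"
  unfolding set_lebesgue_integral_def
proof (rule integral_cong_AE)
  have "K \<in> sets \<mu>" using assms by (simp add: concentrated_def)
  then show "(\<lambda>x. indicator K x *\<^sub>R f x) \<in> borel_measurable \<mu>"
    using f by (intro borel_measurable_scaleR borel_measurable_indicator)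
  show "AE x in \<mu>. f x = indicator K x *\<^sub>R f x"
    using concentrated_AE[OF \<mu>] by (rule AE_mp) (auto intro!: AE_I2)
qed (rule f)

lemma concentrated_integral_const:
  "concentrated K \<mu> \<Longrightarrow> closed K \<Longrightarrow> (LINT x:K|\<mu>. c) = (c::real)"
  using prob_space_set_integral_const by (auto simp: concentrated_def)

lemma concentrated_integrable:
  fixes f :: "'a::topological_space \<Rightarrow> real"
  shows "concentrated K \<mu> \<Longrightarrow> compact K \<Longrightarrow> closed K \<Longrightarrow> continuous_on K f \<Longrightarrow> set_integrable \<mu> K f"
  using set_integrable_continuous_prob by (auto simp: concentrated_def)

lemma concentrated_integral_mono:
  fixes f g :: "'a::topological_space \<Rightarrow> real"
  assumes "concentrated K \<mu>" "compact K" "closed K" "continuous_on K f" "continuous_on K g"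
    "\<And>x. x \<in> K \<Longrightarrow> f x \<le> g x"
  shows "(LINT x:K|\<mu>. f x) \<le> (LINT x:K|\<mu>. g x)"
  using assms by (intro set_integral_mono concentrated_integrable)

lemma concentrated_integral_diff:
  fixes f g :: "'a::topological_space \<Rightarrow> real"
  assumes "concentrated K \<mu>" "compact K" "closed K" "continuous_on K f" "continuous_on K g"
  shows "(LINT x:K|\<mu>. f x - g x) = (LINT x:K|\<mu>. f x) - (LINT x:K|\<mu>. g x)"
  using assms by (intro set_integral_diff concentrated_integrable)

lemma concentrated_integral_add:
  fixes f g :: "'a::topological_space \<Rightarrow> real"
  assumes "concentrated K \<mu>" "compact K" "closed K" "continuous_on K f" "continuous_on K g"
  shows "(LINT x:K|\<mu>. f x + g x) = (LINT x:K|\<mu>. f x) + (LINT x:K|\<mu>. g x)"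
  using assms by (intro set_integral_add concentrated_integrable)

lemma concentrated_integral_close:
  fixes f g :: "'a::topological_space \<Rightarrow> real"
  assumes \<mu>: "concentrated K \<mu>" and K: "compact K" "closed K" and f: "continuous_on K f" and g: "continuous_on K g"
    and le: "\<And>x. x \<in> K \<Longrightarrow> \<bar>f x - g x\<bar> \<le> e"
  shows "\<bar>(LINT x:K|\<mu>. f x) - (LINT x:K|\<mu>. g x)\<bar> \<le> e"
proof -
  have "(LINT x:K|\<mu>. f x - g x) \<le> (LINT x:K|\<mu>. e)"
    using le by (intro concentrated_integral_mono[OF \<mu> K] continuous_on_diff f g continuous_on_const) (auto simp: abs_le_iff)
  moreover have "(LINT x:K|\<mu>. - e) \<le> (LINT x:K|\<mu>. f x - g x)"
    using le by (intro concentrated_integral_mono[OF \<mu> K] continuous_on_diff f g continuous_on_const) (force simp: abs_le_iff)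
  ultimately show ?thesis
    using concentrated_integral_diff[OF \<mu> K f g] concentrated_integral_const[OF \<mu> K(2)] by (simp add: abs_le_iff)
qed

lemma set_integral_cong_on:
  "(\<And>x. x \<in> K \<Longrightarrow> f x = g x) \<Longrightarrow> (LINT x:K|\<mu>. f x) = (LINT x:K|\<mu>. (g x :: real))"
  unfolding set_lebesgue_integral_def by (intro Bochner_Integration.integral_cong refl) (auto simp: indicator_def)

lemma (in compact_convex_space) affine_functions_measurable:
  assumes "f \<in> affine_functions (mspace X)" "sets \<mu> = sets borel"
  shows "f \<in> borel_measurable \<mu>"
proof -
  have "(\<lambda>x. indicator (mspace X) x *\<^sub>R f x) \<in> borel_measurable borel"
    using borel_measurable_continuous_on_indicator[OF _ affine_functionsD(1)[OF assms(1)]]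
      compact_imp_closed[OF comp] by simp
  moreover have "(\<lambda>x. indicator (mspace X) x *\<^sub>R f x) = f"
    using affine_functionsD(3)[OF assms(1)] by (auto simp: indicator_def fun_eq_iff)
  ultimately show ?thesis using measurable_cong_sets[OF assms(2) refl] by auto
qed

section \<open>From the boundary model to representing measures\<close>

context bauer_model
begin

lemma closed_K: "closed K"
  using K(2) by (rule compact_imp_closed)

lemma cont_K: "continuous_on (mspace X) H \<Longrightarrow> continuous_on K H"
  using K(1) by (rule continuous_on_subset[rotated])

text \<open>Continuous affine extensions agree on \<open>mspace X\<close>, so the choice does not
  matter there, and the value at a point is linear and monotone in \<open>h\<close>.\<close>

definition lip_ext :: "('a \<Rightarrow> real) \<Rightarrow> 'a \<Rightarrow> real" where
  "lip_ext h = (SOME H. affine_on (mspace X) H \<and> continuous_on (mspace X) H \<and> (\<forall>k\<in>K. H k = h k))"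

lemma lip_ext:
  assumes "lipschitz_fun X K h"
  shows "affine_on (mspace X) (lip_ext h)" "continuous_on (mspace X) (lip_ext h)"
    "k \<in> K \<Longrightarrow> lip_ext h k = h k"
proof -
  obtain C where C: "C \<ge> 0" "lip_on C X K h" using assms by (auto simp: lipschitz_fun_def)
  obtain H where H: "affine_on (mspace X) H" "lip_on C X (mspace X) H" "\<forall>k\<in>K. H k = h k"
    using lip_extension_scaled[OF C(2,1)] by blast
  have "\<exists>H. affine_on (mspace X) H \<and> continuous_on (mspace X) H \<and> (\<forall>k\<in>K. H k = h k)"
    using H lip_cont[OF H(2)] by blast
  then have "affine_on (mspace X) (lip_ext h) \<and> continuous_on (mspace X) (lip_ext h) \<and> (\<forall>k\<in>K. lip_ext h k = h k)"
    unfolding lip_ext_def by (rule someI_ex)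
  then show "affine_on (mspace X) (lip_ext h)" "continuous_on (mspace X) (lip_ext h)"
    "k \<in> K \<Longrightarrow> lip_ext h k = h k"
    by simp_all
qed

lemma lip_ext_eq:
  assumes "lipschitz_fun X K h" "affine_on (mspace X) G" "continuous_on (mspace X) G"
    "\<And>k. k \<in> K \<Longrightarrow> G k = h k" "x \<in> mspace X"
  shows "lip_ext h x = G x"
  by (rule eq_from_K[OF lip_ext(2)[OF assms(1)] lip_ext(1)[OF assms(1)] assms(3,2) _ assms(5)])
    (simp add: lip_ext(3)[OF assms(1)] assms(4))

lemma lipschitz_functional_lip_ext:
  assumes x: "x \<in> mspace X"
  shows "lipschitz_functional X K (\<lambda>h. lip_ext h x)"
proof
  fix f g assume f: "lipschitz_fun X K f" and g: "lipschitz_fun X K g"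
  show "lip_ext (\<lambda>x. f x + g x) x = lip_ext f x + lip_ext g x"
    by (rule lip_ext_eq[OF lipschitz_fun_add[OF f g] affine_on_add[OF lip_ext(1)[OF f] lip_ext(1)[OF g]]
          continuous_on_add[OF lip_ext(2)[OF f] lip_ext(2)[OF g]] _ x])
      (simp add: lip_ext(3)[OF f] lip_ext(3)[OF g])
  show "lip_ext f x \<le> lip_ext g x" if "\<And>x. x \<in> K \<Longrightarrow> f x \<le> g x"
    by (rule le_from_K[OF lip_ext(2)[OF f] lip_ext(1)[OF f] lip_ext(2)[OF g] lip_ext(1)[OF g] _ x])
      (simp add: lip_ext(3)[OF f] lip_ext(3)[OF g] that)
next
  fix f c assume f: "lipschitz_fun X K f"
  show "lip_ext (\<lambda>x. c * f x) x = c * lip_ext f x"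
    by (rule lip_ext_eq[OF lipschitz_fun_cmult[OF f] affine_on_cmult[OF lip_ext(1)[OF f]]
          continuous_on_mult_left[OF lip_ext(2)[OF f]] _ x])
      (simp add: lip_ext(3)[OF f])
next
  show "lip_ext (\<lambda>_. 1) x = 1"
    by (rule lip_ext_eq[OF lipschitz_fun_const affine_on_const continuous_on_const _ x]) simp
qed (rule top K)+

text \<open>The functional sending \<open>h\<close> to \<open>lip_ext h x\<close> has a representing
  measure on \<open>K\<close>. It reproduces Lipschitz affine functions, and by density all
  continuous affine ones.\<close>

lemma repr_measure_exists:
  assumes x: "x \<in> mspace X"
  shows "\<exists>\<mu>. concentrated K \<mu> \<and>
    (\<forall>a :: 'a \<Rightarrow> real. continuous_on (mspace X) a \<longrightarrow> affine_on (mspace X) a \<longrightarrow> (LINT y:K|\<mu>. a y) = a x)"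
proof -
  interpret L: lipschitz_functional X K "\<lambda>h. lip_ext h x" by (rule lipschitz_functional_lip_ext[OF x])
  define \<mu> where "\<mu> = L.repr_measure"
  have \<mu>: "concentrated K \<mu>"
    unfolding concentrated_def \<mu>_def
    using L.sets_repr_measure L.prob_space_repr_measure L.emeasure_repr_measure_K by blast
  have lip: "(LINT y:K|\<mu>. H y) = H x"
    if H: "affine_on (mspace X) H" "lip_on C X (mspace X) H" "C \<ge> 0" for H C
  proof -
    have l: "lipschitz_fun X K H" using lip_on_subset[OF H(2) K(1)] H(3) by (rule lipschitz_funI)
    have "(LINT y:K|\<mu>. H y) = lip_ext H x" unfolding \<mu>_def by (rule L.functional_eq_integral[OF l, symmetric])
    also have "\<dots> = H x" by (rule lip_ext_eq[OF l H(1) lip_cont[OF H(2)] _ x]) simp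
    finally show ?thesis .
  qed
  have "(LINT y:K|\<mu>. a y) = a x" if a: "continuous_on (mspace X) a" "affine_on (mspace X) a" for a :: "'a \<Rightarrow> real"
  proof -
    have "\<bar>(LINT y:K|\<mu>. a y) - a x\<bar> \<le> 0"
    proof (rule field_le_epsilon)
      fix e :: real assume e: "e > 0"
      have "e / 2 > 0" using e by simp
      then obtain C H where H: "C \<ge> 0" "affine_on (mspace X) H" "lip_on C X (mspace X) H"
        "\<forall>x\<in>mspace X. \<bar>H x - a x\<bar> \<le> e / 2"
        using lip_affine_dense[OF a] by blast
      have "\<bar>(LINT y:K|\<mu>. H y) - (LINT y:K|\<mu>. a y)\<bar> \<le> e / 2"
        by (rule concentrated_integral_close[OF \<mu> K(2) closed_K cont_K[OF lip_cont[OF H(3)]] cont_K[OF a(1)]])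
          (use H(4) K_mspace in blast)
      moreover have "\<bar>H x - a x\<bar> \<le> e / 2" using H(4) x by blast
      ultimately show "\<bar>(LINT y:K|\<mu>. a y) - a x\<bar> \<le> 0 + e"
        using lip[OF H(2,3,1)] by linarith
    qed
    then show ?thesis by simp
  qed
  then show ?thesis using \<mu> by blast
qed

text \<open>The distance to \<open>k\<close> is affine, nonnegative and zero at \<open>k\<close>, so
  it is zero at both ends of any open segment through \<open>k\<close>.\<close>

lemma K_extreme:
  assumes k: "k \<in> K"
  shows "k extreme_point_of mspace X"
  unfolding extreme_point_of_def
proof (intro conjI ballI notI)
  show kX: "k \<in> mspace X" using k by (rule K_mspace)
  fix a b assume ab: "a \<in> mspace X" "b \<in> mspace X" "k \<in> open_segment a b"
  then obtain u where u: "0 < u" "u < 1" "a \<noteq> b" "k = (1 - u) *\<^sub>R a + u *\<^sub>R b" by (auto simp: in_segment)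
  have "mdist X k ((1 - u) *\<^sub>R a + u *\<^sub>R b) = (1 - u) *\<^sub>R mdist X k a + u *\<^sub>R mdist X k b"
    by (rule affine_onD[OF dist_from_K_affine[OF k] ab(1,2)]) (use u in auto)
  then have "(1 - u) * mdist X k a + u * mdist X k b = 0" using kX by (simp add: u(4)[symmetric])
  moreover have "0 \<le> (1 - u) * mdist X k a" "0 \<le> u * mdist X k b" using u by auto
  ultimately have "(1 - u) * mdist X k a = 0" "u * mdist X k b = 0" by linarith+
  then have "mdist X k a = 0" "mdist X k b = 0" using u by auto
  then have "k = a" "k = b" using kX ab by auto
  then show False using u(3) by simp
qed

lemma affine_separates:
  assumes "x \<in> mspace X" "z \<in> mspace X" "\<And>a. a \<in> affine_functions (mspace X) \<Longrightarrow> a x = a z"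
  shows "x = z"
proof (rule ccontr)
  assume "x \<noteq> z"
  then have "mdist X x z \<noteq> 0" using assms(1,2) by simp
  then have "0 < mdist X x z" using mdist_nonneg[of X x z] by linarith
  then obtain H where H: "affine_on (mspace X) H" "lip_on 1 X (mspace X) H" "0 < H x - H z"
    using dist_attained[OF assms(1,2)] by blast
  show False using assms(3)[OF zero_outside_affine[OF lip_cont[OF H(2)] H(1)]] H(3) assms(1,2) by simp
qed

text \<open>If \<open>f\<close> is affine with values in \<open>(0,1)\<close>, then \<open>x\<close> is a convex combination of the barycentres of the
  normalised measures \<open>f \<mu>\<close> and \<open>(1 - f) \<mu>\<close>; at an extreme point both equal \<open>x\<close>, so \<open>f\<close> has
  variance zero.\<close>

lemma weighted_barycentre:
  assumes \<mu>: "concentrated K \<mu>" and f: "continuous_on (mspace X) f" "\<And>y. y \<in> K \<Longrightarrow> 0 \<le> f y"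
    and u: "(LINT y:K|\<mu>. f y) = u" "u > 0"
  shows "\<exists>z\<in>mspace X. \<forall>a\<in>affine_functions (mspace X). (LINT y:K|\<mu>. f y * a y) = u * a z"
proof -
  note int = concentrated_integrable[OF \<mu> K(2) closed_K]
  have fa: "set_integrable \<mu> K (\<lambda>y. f y * a y)" if "a \<in> affine_functions (mspace X)" for a
    by (intro int continuous_on_mult cont_K f(1) affine_functionsD(1)[OF that])
  \<comment> \<open>The barycentre is found as the point at which this state evaluates, so that no
    integral in the ambient vector space is taken.\<close>
  define \<sigma> where "\<sigma> = (\<lambda>a. if a \<in> affine_functions (mspace X) then (LINT y:K|\<mu>. f y * a y) / u else 0)"
  have "\<sigma> \<in> state_space (Aff X)"
    unfolding state_space_def Aff_simps mem_Collect_eq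
  proof (intro conjI ballI allI impI)
    fix a b c assume a: "a \<in> affine_functions (mspace X)"
    show "\<sigma> (c *\<^sub>R a) = c * \<sigma> a"
    proof -
      have "(LINT y:K|\<mu>. f y * (c *\<^sub>R a) y) = (LINT y:K|\<mu>. c * (f y * a y))"
        by (intro set_integral_cong_on) (simp add: scaleR_fun_def)
      also have "\<dots> = c * (LINT y:K|\<mu>. f y * a y)" by (rule set_integral_mult_right)
      finally show ?thesis using a affine_functions_scaleR[OF a] by (simp add: \<sigma>_def)
    qed
    show "0 \<le> \<sigma> a" if "0 \<le> a"
    proof -
      have "(LINT y:K|\<mu>. 0) \<le> (LINT y:K|\<mu>. f y * a y)"
      proof (rule set_integral_mono[OF _ fa[OF a]])
        show "set_integrable \<mu> K (\<lambda>y. 0::real)" by (intro int continuous_on_const)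
        show "0 \<le> f y * a y" if "y \<in> K" for y
          using f(2)[OF that] \<open>0 \<le> a\<close> by (simp add: le_fun_def)
      qed
      then show ?thesis using u(2) by (simp add: \<sigma>_def concentrated_integral_const[OF \<mu> closed_K])
    qed
    show "\<sigma> (a + b) = \<sigma> a + \<sigma> b" if b: "b \<in> affine_functions (mspace X)"
    proof -
      have "(LINT y:K|\<mu>. f y * (a + b) y) = (LINT y:K|\<mu>. f y * a y + f y * b y)"
        by (intro set_integral_cong_on) (simp add: distrib_left)
      also have "\<dots> = (LINT y:K|\<mu>. f y * a y) + (LINT y:K|\<mu>. f y * b y)"
        by (rule set_integral_add(2)[OF fa[OF a] fa[OF b]])
      finally show ?thesis using a b affine_functions_add[OF a b] by (simp add: \<sigma>_def add_divide_distrib)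
    qed
  next
    have "(LINT y:K|\<mu>. f y * indicator (mspace X) y) = (LINT y:K|\<mu>. f y)"
      by (intro set_integral_cong_on) (simp add: K_mspace)
    then show "\<sigma> (indicator (mspace X)) = 1" using u affine_functions_unit by (simp add: \<sigma>_def)
  qed (simp add: \<sigma>_def)
  then obtain z where z: "z \<in> mspace X" "\<forall>a\<in>affine_functions (mspace X). \<sigma> a = a z"
    using state_eval by blast
  have "(LINT y:K|\<mu>. f y * a y) = u * a z" if "a \<in> affine_functions (mspace X)" for a
    using z(2) that u(2) by (simp add: \<sigma>_def field_simps)
  then show ?thesis using z(1) by blast
qed

lemma extreme_variance_zero:
  fixes f :: "'a \<Rightarrow> real"
  assumes x: "x extreme_point_of mspace X" and \<mu>: "concentrated K \<mu>"
    and rep: "\<forall>a :: 'a \<Rightarrow> real. continuous_on (mspace X) a \<longrightarrow> affine_on (mspace X) a \<longrightarrow> (LINT y:K|\<mu>. a y) = a x"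
    and f: "continuous_on (mspace X) f" "affine_on (mspace X) f" "\<And>y. y \<in> mspace X \<Longrightarrow> 0 < f y \<and> f y < 1"
  shows "AE y in \<mu>. f y = f x"
proof -
  note int = concentrated_integrable[OF \<mu> K(2) closed_K]
  define u where "u = f x"
  have xX: "x \<in> mspace X" using x by (simp add: extreme_point_of_def)
  have u: "0 < u" "u < 1" using f(3)[OF xX] by (auto simp: u_def)
  have fK: "0 < f y \<and> f y < 1" if "y \<in> K" for y using f(3)[OF K_mspace[OF that]] .
  have fint: "(LINT y:K|\<mu>. f y) = u" using rep f(1,2) by (simp add: u_def)
  have gint: "(LINT y:K|\<mu>. 1 - f y) = 1 - u"
    using concentrated_integral_diff[OF \<mu> K(2) closed_K continuous_on_const cont_K[OF f(1)], of 1]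
      concentrated_integral_const[OF \<mu> closed_K, of 1] fint by simp
  obtain x1 where x1: "x1 \<in> mspace X" "\<forall>a\<in>affine_functions (mspace X). (LINT y:K|\<mu>. f y * a y) = u * a x1"
    using weighted_barycentre[OF \<mu> f(1) _ fint u(1)] fK by (auto simp: less_imp_le)
  obtain x2 where x2: "x2 \<in> mspace X"
    "\<forall>a\<in>affine_functions (mspace X). (LINT y:K|\<mu>. (1 - f y) * a y) = (1 - u) * a x2"
    using weighted_barycentre[OF \<mu> continuous_on_diff[OF continuous_on_const f(1)] _ gint] fK u by (auto simp: less_imp_le)
  have zX: "u *\<^sub>R x1 + (1 - u) *\<^sub>R x2 \<in> mspace X" using convD[OF x1(1) x2(1)] u by simp
  have xz: "x = u *\<^sub>R x1 + (1 - u) *\<^sub>R x2"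
  proof (rule affine_separates[OF xX zX])
    fix a assume a: "a \<in> affine_functions (mspace X)"
    note ac = affine_functionsD(1,2)[OF a]
    have "a x = (LINT y:K|\<mu>. a y)" using rep ac by simp
    also have "\<dots> = (LINT y:K|\<mu>. f y * a y + (1 - f y) * a y)"
      by (intro set_integral_cong_on) (simp add: algebra_simps)
    also have "\<dots> = (LINT y:K|\<mu>. f y * a y) + (LINT y:K|\<mu>. (1 - f y) * a y)"
      by (intro concentrated_integral_add[OF \<mu> K(2) closed_K] continuous_on_mult continuous_on_diff continuous_on_const cont_K f(1) ac(1))
    also have "\<dots> = u * a x1 + (1 - u) * a x2" using x1(2) x2(2) a by simp
    also have "\<dots> = a (u *\<^sub>R x1 + (1 - u) *\<^sub>R x2)"
      using affine_onD[OF ac(2) x1(1) x2(1), of u "1 - u"] u by simp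
    finally show "a x = a (u *\<^sub>R x1 + (1 - u) *\<^sub>R x2)" .
  qed
  have "x1 = x2"
  proof (rule ccontr)
    assume ne: "x1 \<noteq> x2"
    have "x = (1 - (1 - u)) *\<^sub>R x1 + (1 - u) *\<^sub>R x2" using xz by simp
    then have "x \<in> open_segment x1 x2"
      unfolding in_segment using ne u by (intro conjI exI[of _ "1 - u"]) auto
    then show False using x x1(1) x2(1) by (auto simp: extreme_point_of_def)
  qed
  then have x1x: "x1 = x" using xz by (simp add: scaleR_left_distrib[symmetric])
  \<comment> \<open>The weighted integral identity for the test function \<open>f\<close> itself, at
    the point \<open>x1 = x\<close>: the second moment equals the square of the mean.\<close>
  have sq: "(LINT y:K|\<mu>. f y * f y) = u * u"
  proof -
    have "(LINT y:K|\<mu>. f y * f y) = (LINT y:K|\<mu>. f y * zero_outside (mspace X) f y)"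
      by (intro set_integral_cong_on) (simp add: K_mspace)
    also have "\<dots> = u * zero_outside (mspace X) f x"
      using x1(2) zero_outside_affine[OF f(1,2)] x1x by simp
    finally show ?thesis using xX by (simp add: u_def)
  qed
  have "(LINT y:K|\<mu>. (f y - u)\<^sup>2) = (LINT y:K|\<mu>. f y * f y - (2 * u * f y - u * u))"
    by (intro set_integral_cong_on) (simp add: power2_eq_square algebra_simps)
  also have "\<dots> = (LINT y:K|\<mu>. f y * f y) - ((LINT y:K|\<mu>. 2 * u * f y) - (LINT y:K|\<mu>. u * u))"
    by (subst concentrated_integral_diff[OF \<mu> K(2) closed_K],
        (intro continuous_on_mult continuous_on_diff continuous_on_const cont_K f(1))+,
        subst concentrated_integral_diff[OF \<mu> K(2) closed_K],
        (intro continuous_on_mult continuous_on_diff continuous_on_const cont_K f(1))+) simp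
  also have "\<dots> = 0"
    using sq fint concentrated_integral_const[OF \<mu> closed_K, of "u * u"] by (simp only: set_integral_mult_right)
  finally have zero: "(LINT y|\<mu>. indicator K y *\<^sub>R (f y - u)\<^sup>2) = 0" by (simp add: set_lebesgue_integral_def)
  have "set_integrable \<mu> K (\<lambda>y. (f y - u)\<^sup>2)"
    by (intro int continuous_on_power continuous_on_diff continuous_on_const cont_K f(1))
  then have "AE y in \<mu>. indicator K y *\<^sub>R (f y - u)\<^sup>2 = 0"
    using zero integral_nonneg_eq_0_iff_AE[of \<mu> "\<lambda>y. indicator K y *\<^sub>R (f y - u)\<^sup>2"]
    by (simp add: set_integrable_def)
  with concentrated_AE[OF \<mu> closed_K] show ?thesis
    by eventually_elim (simp add: u_def)
qed

text \<open>For each \<open>j\<close> in \<open>K\<close> the distance to \<open>j\<close> has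
  variance zero under a measure representing \<open>x\<close>, so almost every \<open>y\<close> has
  \<open>mdist X j y = mdist X j x\<close>. Uncountably many null sets cannot be discarded at once,
  hence the compactness argument: some \<open>k\<close> in \<open>K\<close> satisfies all these
  equations, and the one for \<open>j = k\<close> reads \<open>mdist X k x = 0\<close>.\<close>

lemma extreme_in_K:
  assumes x: "x extreme_point_of mspace X"
  shows "x \<in> K"
proof -
  have xX: "x \<in> mspace X" using x by (simp add: extreme_point_of_def)
  obtain \<mu> where \<mu>: "concentrated K \<mu>"
    and rep: "\<forall>a :: 'a \<Rightarrow> real. continuous_on (mspace X) a \<longrightarrow> affine_on (mspace X) a \<longrightarrow> (LINT y:K|\<mu>. a y) = a x"
    using repr_measure_exists[OF xX] by blast
  interpret prob_space \<mu> using \<mu> by (simp add: concentrated_def)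
  obtain B where B: "B > 0" "\<And>x y. x \<in> mspace X \<Longrightarrow> y \<in> mspace X \<Longrightarrow> mdist X x y \<le> B"
    using compact_mdist_bounded[OF top comp] by blast
  have ae: "AE y in \<mu>. mdist X j y = mdist X j x" if j: "j \<in> K" for j
  proof -
    \<comment> \<open>The values lie between 1/3 and 2/3, well inside the open unit interval that
      \<open>extreme_variance_zero\<close> asks for.\<close>
    define f where "f = (\<lambda>y. 1 / 3 + (1 / (3 * B)) * mdist X j y)"
    have "AE y in \<mu>. f y = f x"
    proof (rule extreme_variance_zero[OF x \<mu> rep])
      show "continuous_on (mspace X) f"
        unfolding f_def by (intro continuous_on_add continuous_on_const continuous_on_mult continuous_mdist K_mspace j)
      show "affine_on (mspace X) f"
        unfolding f_def by (intro affine_on_add affine_on_const affine_on_cmult dist_from_K_affine j)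
      fix y assume "y \<in> mspace X"
      then have "mdist X j y / B \<le> 1" "0 \<le> mdist X j y / B" using B K_mspace[OF j] by auto
      then show "0 < f y \<and> f y < 1" by (simp add: f_def)
    qed
    then show ?thesis using B(1) by (simp add: f_def)
  qed
  have "K \<inter> (\<Inter>j\<in>K. K \<inter> mdist X j -` {mdist X j x}) \<noteq> {}"
  proof (rule compact_imp_fip_image[OF K(2)])
    fix j assume "j \<in> K"
    then show "closed (K \<inter> mdist X j -` {mdist X j x})"
      by (intro continuous_closed_preimage cont_K continuous_mdist K_mspace closed_K closed_singleton)
  next
    fix J assume J: "finite J" "J \<subseteq> K"
    have "AE y in \<mu>. \<forall>j\<in>J. mdist X j y = mdist X j x" using J ae by (intro AE_finite_allI) auto
    with concentrated_AE[OF \<mu> closed_K] have aeJ: "AE y in \<mu>. y \<in> K \<and> (\<forall>j\<in>J. mdist X j y = mdist X j x)"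
      by eventually_elim simp
    have "\<exists>y. y \<in> K \<and> (\<forall>j\<in>J. mdist X j y = mdist X j x)"
    proof (rule ccontr)
      assume neg: "\<not> ?thesis"
      have "AE y in \<mu>. False" by (rule eventually_mono[OF aeJ]) (use neg in blast)
      then show False by (simp add: AE_False)
    qed
    then obtain y where y: "y \<in> K \<and> (\<forall>j\<in>J. mdist X j y = mdist X j x)" by (rule exE)
    have "y \<in> K \<inter> (\<Inter>j\<in>J. K \<inter> mdist X j -` {mdist X j x})"
      unfolding Int_iff INT_iff vimage_singleton_eq using y by simp
    then show "K \<inter> (\<Inter>j\<in>J. K \<inter> mdist X j -` {mdist X j x}) \<noteq> {}" by (metis empty_iff)
  qed
  then obtain k where "k \<in> K \<inter> (\<Inter>j\<in>K. K \<inter> mdist X j -` {mdist X j x})"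
    unfolding ex_in_conv[symmetric] by (rule exE)
  then have k: "k \<in> K" and "k \<in> K \<inter> mdist X k -` {mdist X k x}"
    unfolding Int_iff INT_iff by blast+
  then have "mdist X k k = mdist X k x" by simp
  then have dkx: "mdist X k x = 0" using mdist_self[OF K_mspace[OF k]] by simp
  have "k = x" using mdist_zero[OF K_mspace[OF k] xX] dkx by blast
  then show ?thesis using k by simp
qed

lemma extreme_boundary_eq: "extreme_boundary (mspace X) = K"
  unfolding extreme_boundary_def using K_extreme extreme_in_K by blast

lemma represents_iff:
  assumes \<mu>: "concentrated K \<mu>" and x: "x \<in> mspace X"
  shows "represents (mspace X) \<mu> x \<longleftrightarrow>
    (\<forall>a :: 'a \<Rightarrow> real. continuous_on (mspace X) a \<longrightarrow> affine_on (mspace X) a \<longrightarrow> (LINT y:K|\<mu>. a y) = a x)"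
proof -
  have eq: "(LINT y|\<mu>. f y) = (LINT y:K|\<mu>. f y)" if "f \<in> affine_functions (mspace X)" for f
    using affine_functions_measurable[OF that] \<mu>
    by (intro concentrated_integral_eq[OF \<mu> closed_K]) (simp add: concentrated_def)
  show ?thesis
  proof
    assume r: "represents (mspace X) \<mu> x"
    show "\<forall>a :: 'a \<Rightarrow> real. continuous_on (mspace X) a \<longrightarrow> affine_on (mspace X) a \<longrightarrow> (LINT y:K|\<mu>. a y) = a x"
    proof (intro allI impI)
      fix a :: "'a \<Rightarrow> real" assume a: "continuous_on (mspace X) a" "affine_on (mspace X) a"
      note z = zero_outside_affine[OF a]
      have "(LINT y:K|\<mu>. a y) = (LINT y:K|\<mu>. zero_outside (mspace X) a y)"
        by (intro set_integral_cong_on) (simp add: K_mspace)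
      also have "\<dots> = zero_outside (mspace X) a x"
        using r z eq[OF z] by (simp add: represents_def)
      finally show "(LINT y:K|\<mu>. a y) = a x" using x by simp
    qed
  next
    assume r: "\<forall>a :: 'a \<Rightarrow> real. continuous_on (mspace X) a \<longrightarrow> affine_on (mspace X) a \<longrightarrow> (LINT y:K|\<mu>. a y) = a x"
    show "represents (mspace X) \<mu> x"
      unfolding represents_def
    proof
      fix f assume f: "f \<in> affine_functions (mspace X)"
      show "(LINT y|\<mu>. f y) = f x" using r affine_functionsD(1,2)[OF f] eq[OF f] by simp
    qed
  qed
qed

lemma represents_lip_ext:
  assumes \<mu>: "concentrated K \<mu>" and x: "x \<in> mspace X" and r: "represents (mspace X) \<mu> x"
    and h: "lipschitz_fun X K h"
  shows "(LINT y:K|\<mu>. h y) = lip_ext h x"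
proof -
  have "(LINT y:K|\<mu>. h y) = (LINT y:K|\<mu>. lip_ext h y)"
    by (intro set_integral_cong_on) (simp add: lip_ext(3)[OF h])
  also have "\<dots> = lip_ext h x" using r lip_ext(1,2)[OF h] unfolding represents_iff[OF \<mu> x] by blast
  finally show ?thesis .
qed

text \<open>Uniqueness: a measure representing \<open>x\<close> must integrate each Lipschitz
  function \<open>h\<close> to \<open>lip_ext h x\<close>, and these integrals determine it.\<close>

lemma choquet: "choquet_simplex (mspace X)"
  unfolding choquet_simplex_def
proof (intro conjI ballI)
  fix x assume x: "x \<in> mspace X"
  obtain \<mu> where \<mu>: "concentrated K \<mu>"
    and r: "\<forall>a :: 'a \<Rightarrow> real. continuous_on (mspace X) a \<longrightarrow> affine_on (mspace X) a \<longrightarrow> (LINT y:K|\<mu>. a y) = a x"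
    using repr_measure_exists[OF x] by blast
  show "\<exists>!\<mu>. \<mu> \<in> boundary_measures (mspace X) \<and> represents (mspace X) \<mu> x"
    unfolding boundary_measures_eq extreme_boundary_eq mem_Collect_eq
  proof (rule ex1I)
    show "concentrated K \<mu> \<and> represents (mspace X) \<mu> x" using \<mu> r represents_iff[OF \<mu> x] by blast
    fix \<nu> assume \<nu>: "concentrated K \<nu> \<and> represents (mspace X) \<nu> x"
    show "\<nu> = \<mu>"
    proof (rule measure_eq_by_lipschitz[OF top K])
      fix h assume h: "lipschitz_fun X K h"
      show "(LINT y:K|\<nu>. h y) = (LINT y:K|\<mu>. h y)"
        using represents_lip_ext[OF _ x _ h] \<nu> \<mu> r represents_iff[OF \<mu> x] by simp
    qed (use \<mu> \<nu> in \<open>simp_all add: concentrated_def\<close>)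
  qed
qed (rule nonempty comp conv)+

text \<open>The integral of a test function is the value of its affine extension at the represented
  point, so the Wasserstein supremum runs over the differences \<open>H x - H y\<close> with
  \<open>H\<close> affine and 1-Lipschitz.\<close>

lemma wasserstein_eq:
  assumes \<mu>: "concentrated K \<mu>" "represents (mspace X) \<mu> x" and \<nu>: "concentrated K \<nu>" "represents (mspace X) \<nu> y"
    and x: "x \<in> mspace X" and y: "y \<in> mspace X"
    and \<rho>: "mspace \<rho> = K" "\<And>j k. j \<in> K \<Longrightarrow> k \<in> K \<Longrightarrow> mdist \<rho> j k = mdist X j k"
  shows "wasserstein \<rho> \<mu> \<nu> = mdist X x y"
proof -
  define F where "F = {f :: 'a \<Rightarrow> real. \<forall>x\<in>mspace \<rho>. \<forall>y\<in>mspace \<rho>. \<bar>f x - f y\<bar> \<le> mdist \<rho> x y}"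
  define I where "I = (\<lambda>f :: 'a \<Rightarrow> real. \<bar>(LINT x:K|\<mu>. f x) - (LINT x:K|\<nu>. f x)\<bar>)"
  have F: "f \<in> F \<longleftrightarrow> lip_on 1 X K f" for f using \<rho> by (auto simp: F_def lip_on_def)
  have w: "wasserstein \<rho> \<mu> \<nu> = (SUP f\<in>F. I f)"
    unfolding wasserstein_def F_def I_def \<rho>(1) ..
  have I: "I H = \<bar>H x - H y\<bar>" if "affine_on (mspace X) H" "continuous_on (mspace X) H" for H
    using that \<mu>(2) \<nu>(2) unfolding represents_iff[OF \<mu>(1) x] represents_iff[OF \<nu>(1) y] I_def by simp
  have le: "I f \<le> mdist X x y" if f: "f \<in> F" for f
  proof -
    obtain H where H: "affine_on (mspace X) H" "lip_on 1 X (mspace X) H" "\<forall>k\<in>K. H k = f k"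
      using lip_extension[of f] f F[of f] by blast
    have "I f = I H"
      unfolding I_def using H(3) by (intro arg_cong[of _ _ abs] arg_cong2[of _ _ _ _ minus] set_integral_cong_on) auto
    also have "\<dots> \<le> mdist X x y" using I[OF H(1) lip_cont[OF H(2)]] lip_onD[OF H(2) x y] by simp
    finally show ?thesis .
  qed
  show ?thesis
  proof (rule antisym)
    show "wasserstein \<rho> \<mu> \<nu> \<le> mdist X x y"
      unfolding w
    proof (rule cSUP_least)
      have "(\<lambda>_. 0) \<in> F" by (simp add: F)
      then show "F \<noteq> {}" by blast
    qed (rule le)
    show "mdist X x y \<le> wasserstein \<rho> \<mu> \<nu>"
    proof (rule ccontr)
      assume "\<not> ?thesis"
      then have "wasserstein \<rho> \<mu> \<nu> < mdist X x y" by simp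
      then obtain H where H: "affine_on (mspace X) H" "lip_on 1 X (mspace X) H" "wasserstein \<rho> \<mu> \<nu> < H x - H y"
        using dist_attained[OF x y] by blast
      have "H \<in> F" using lip_on_subset[OF H(2) K(1)] by (simp add: F)
      then have "I H \<le> wasserstein \<rho> \<mu> \<nu>"
        unfolding w by (rule cSUP_upper) (auto intro!: bdd_aboveI2[of _ _ "mdist X x y"] le)
      then show False using H(3) I[OF H(1) lip_cont[OF H(2)]] by simp
    qed
  qed
qed

theorem metric_bauer_simplex: "metric_bauer_simplex X"
  unfolding metric_bauer_simplex_def bauer_simplex_def extreme_boundary_eq boundary_measures_eq
proof (intro conjI exI[of _ "submetric X K"] ballI impI)
  show "mtopology_of (submetric X K) = top_of_set K"
    using K(1) by (simp add: mtopology_of_submetric top subtopology_subtopology Int_absorb1)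
  show m: "mspace (submetric X K) = K" using K(1) by auto
  fix x y \<mu> \<nu>
  assume "x \<in> mspace X" "y \<in> mspace X" "\<mu> \<in> {\<mu>. concentrated K \<mu>}" "\<nu> \<in> {\<mu>. concentrated K \<mu>}"
    "represents (mspace X) \<mu> x" "represents (mspace X) \<nu> y"
  then show "mdist X x y = wasserstein (submetric X K) \<mu> \<nu>"
    using m by (intro wasserstein_eq[symmetric]) auto
qed (rule ccms choquet K)+

end

text \<open>The convex combination of two measures, as a bind over a Bernoulli choice. It is what
  makes integration against representing measures affine in the represented point.\<close>

lemma mixture_exists:
  fixes \<mu> \<nu> :: "'a::topological_space measure"
  assumes \<mu>: "concentrated K \<mu>" and \<nu>: "concentrated K \<nu>" and K: "closed K" and u: "0 \<le> u" "0 \<le> v" "u + v = 1"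
  shows "\<exists>\<kappa>. concentrated K \<kappa> \<and> (\<forall>(f :: 'a \<Rightarrow> real) B. f \<in> borel_measurable borel \<longrightarrow> (\<forall>x. \<bar>f x\<bar> \<le> B) \<longrightarrow>
    (LINT x|\<kappa>. f x) = u * (LINT x|\<mu>. f x) + v * (LINT x|\<nu>. f x))"
proof -
  define N where "N = (\<lambda>b. if b then \<mu> else \<nu>)"
  define p where "p = bernoulli_pmf u"
  have v: "v = 1 - u" "u \<le> 1" using u by auto
  have sets: "sets (N b) = sets borel" and prob: "prob_space (N b)" and K1: "emeasure (N b) K = 1" for b
    using \<mu> \<nu> by (auto simp: N_def concentrated_def)
  have sub: "subprob_space (N b)" for b
    by (rule prob_space_imp_subprob_space[OF prob])
  have N: "N \<in> measurable (measure_pmf p) (subprob_algebra borel)"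
    using sets sub by (auto simp: space_subprob_algebra)
  define \<kappa> where "\<kappa> = measure_pmf p \<bind> N"
  have s\<kappa>: "sets \<kappa> = sets borel"
    unfolding \<kappa>_def by (rule sets_bind) (auto simp: sets)
  have pk: "prob_space \<kappa>"
    unfolding \<kappa>_def by (rule measure_pmf.prob_space_bind[OF _ N]) (simp add: prob)
  have ek: "emeasure \<kappa> K = 1"
    unfolding \<kappa>_def using K by (subst emeasure_bind[OF _ N]) (simp_all add: K1)
  have mix: "(LINT x|\<kappa>. f x) = u * (LINT x|\<mu>. f x) + v * (LINT x|\<nu>. f x)"
    if f: "f \<in> borel_measurable borel" "\<And>x. \<bar>f x\<bar> \<le> B" for f :: "'a \<Rightarrow> real" and B
  proof -
    have "(LINT x|\<kappa>. f x) = (LINT b|measure_pmf p. LINT x|N b. f x)"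
      unfolding \<kappa>_def
    proof (rule integral_bind[OF f(1) _ N])
      show "\<bar>f x\<bar> \<le> B" for x by (rule f(2))
      show "finite_measure (measure_pmf p)" by unfold_locales
      show "AE x in measure_pmf p. emeasure (N x) (space (N x)) \<le> ennreal 1"
        by (intro AE_I2) (simp add: prob_space.emeasure_space_1[OF prob])
    qed
    also have "\<dots> = u * (LINT x|\<mu>. f x) + v * (LINT x|\<nu>. f x)"
      unfolding p_def using u v by (simp add: N_def mult.commute)
    finally show ?thesis .
  qed
  have "\<forall>(f :: 'a \<Rightarrow> real) B. f \<in> borel_measurable borel \<longrightarrow> (\<forall>x. \<bar>f x\<bar> \<le> B) \<longrightarrow>
    (LINT x|\<kappa>. f x) = u * (LINT x|\<mu>. f x) + v * (LINT x|\<nu>. f x)"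
    by (intro allI impI, rule mix) auto
  moreover have "concentrated K \<kappa>" using s\<kappa> pk ek by (simp add: concentrated_def)
  ultimately show ?thesis by (intro exI[of _ \<kappa>] conjI)
qed

lemma return_concentrated:
  assumes "k \<in> K" "closed K"
  shows "concentrated K (return borel k)"
  using assms by (simp add: concentrated_def prob_space_return)

text \<open>With \<open>M x\<close> the unique measure representing \<open>x\<close>, the integral
  \<open>I x f\<close> extends \<open>f\<close> from \<open>K\<close>. It is 1-Lipschitz since the
  metric is a supremum over such \<open>f\<close>, it restricts to \<open>f\<close> since
  \<open>M k\<close> is the Dirac measure, and it is affine since mixtures of representing measures
  represent mixtures.\<close>

theorem bauer_model_of_simplex:
  fixes X :: "'a::locally_convex_space metric"
  assumes X: "metric_bauer_simplex X"
  shows "bauer_model X (extreme_boundary (mspace X))"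
proof -
  define K where "K = extreme_boundary (mspace X)"
  interpret compact_convex_space X
    using X by unfold_locales (simp add: metric_bauer_simplex_def)
  have KX: "K \<subseteq> mspace X" by (auto simp: K_def extreme_boundary_def extreme_point_of_def)
  have Kc: "compact K" using X by (simp add: K_def metric_bauer_simplex_def bauer_simplex_def)
  have cK: "closed K" using Kc by (rule compact_imp_closed)
  obtain \<rho> where \<rho>: "mspace \<rho> = K" "mtopology_of \<rho> = top_of_set K"
    "\<And>x y \<mu> \<nu>. x \<in> mspace X \<Longrightarrow> y \<in> mspace X \<Longrightarrow> concentrated K \<mu> \<Longrightarrow> concentrated K \<nu> \<Longrightarrow>
       represents (mspace X) \<mu> x \<Longrightarrow> represents (mspace X) \<nu> y \<Longrightarrow> mdist X x y = wasserstein \<rho> \<mu> \<nu>"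
    using X unfolding metric_bauer_simplex_def K_def boundary_measures_eq by (auto simp del: mdist_zero)
  have ex1: "\<exists>!\<mu>. concentrated K \<mu> \<and> represents (mspace X) \<mu> x" if "x \<in> mspace X" for x
    using X that unfolding metric_bauer_simplex_def bauer_simplex_def choquet_simplex_def boundary_measures_eq K_def
    by simp
  define M where "M = (\<lambda>x. THE \<mu>. concentrated K \<mu> \<and> represents (mspace X) \<mu> x)"
  have M: "concentrated K (M x)" "represents (mspace X) (M x) x" if "x \<in> mspace X" for x
    using theI'[OF ex1[OF that]] by (simp_all add: M_def)
  have Mu: "\<mu> = M x" if "x \<in> mspace X" "concentrated K \<mu>" "represents (mspace X) \<mu> x" for x \<mu>
    using ex1[OF that(1)] that M by blast
  have Mint: "(LINT y:K|M x. a y) = a x"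
    if x: "x \<in> mspace X" and a: "continuous_on (mspace X) a" "affine_on (mspace X) a" for x and a :: "'a \<Rightarrow> real"
  proof -
    note z = zero_outside_affine[OF a]
    have "(LINT y:K|M x. a y) = (LINT y:K|M x. zero_outside (mspace X) a y)"
      using KX by (intro set_integral_cong_on) auto
    also have "\<dots> = (LINT y|M x. zero_outside (mspace X) a y)"
      using affine_functions_measurable[OF z] M(1)[OF x]
      by (intro concentrated_integral_eq[OF M(1)[OF x] cK, symmetric]) (simp add: concentrated_def)
    also have "\<dots> = a x" using M(2)[OF x] z x by (simp add: represents_def)
    finally show ?thesis .
  qed
  define F where "F = {f :: 'a \<Rightarrow> real. lip_on 1 \<rho> K f}"
  define I where "I = (\<lambda>x (f :: 'a \<Rightarrow> real). LINT k:K|M x. f k)"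
  have Fc: "continuous_on K f" if "f \<in> F" for f
    using lip_on_continuous[of \<rho> 1 K f] \<rho>(1,2) that by (simp add: F_def)
  have dist: "mdist X x y = (SUP f\<in>F. \<bar>I x f - I y f\<bar>)" if "x \<in> mspace X" "y \<in> mspace X" for x y
    using \<rho>(3)[OF that M(1) M(1) M(2) M(2), OF that that] unfolding wasserstein_def F_def I_def lip_on_def \<rho>(1)
    by simp
  obtain B where B: "B > 0" "\<And>j k. j \<in> K \<Longrightarrow> k \<in> K \<Longrightarrow> mdist \<rho> j k \<le> B"
    using compact_mdist_bounded[of \<rho>] \<rho>(1,2) Kc by metis
  have bdd: "bdd_above ((\<lambda>f. \<bar>I x f - I y f\<bar>) ` F)" if x: "x \<in> mspace X" and y: "y \<in> mspace X" for x y
  proof (rule bdd_aboveI2)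
    fix f assume f: "f \<in> F"
    have "K \<noteq> {}"
    proof
      assume "K = {}"
      then show False using M(1)[OF x] by (simp add: concentrated_def)
    qed
    then obtain k0 where k0: "k0 \<in> K" by blast
    have le: "\<bar>f k - f k0\<bar> \<le> B" if "k \<in> K" for k
      using lip_onD[of 1 \<rho> K f k k0] f that k0 B(2)[OF that k0] by (simp add: F_def)
    have "\<bar>I z f - f k0\<bar> \<le> B" if z: "z \<in> mspace X" for z
      using concentrated_integral_close[OF M(1)[OF z] Kc cK Fc[OF f] continuous_on_const le]
        concentrated_integral_const[OF M(1)[OF z] cK] by (simp add: I_def)
    from this[OF x] this[OF y] show "\<bar>I x f - I y f\<bar> \<le> 2 * B" by linarith
  qed
  have lipI: "lip_on 1 X (mspace X) (\<lambda>x. I x f)" if f: "f \<in> F" for f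
    unfolding lip_on_def using cSUP_upper[OF f bdd] dist by simp
  have Md: "M k = return borel k" if k: "k \<in> K" for k
  proof (rule Mu[symmetric])
    show "k \<in> mspace X" using k KX by blast
    show "concentrated K (return borel k)" using k cK by (rule return_concentrated)
    show "represents (mspace X) (return borel k) k"
      unfolding represents_def using affine_functions_measurable[of _ borel]
      by (auto intro!: integral_return)
  qed
  have Ik: "I k f = f k" if k: "k \<in> K" and f: "f \<in> F" for k f
  proof -
    have "(\<lambda>x. indicator K x *\<^sub>R f x) \<in> borel_measurable borel"
      using borel_measurable_continuous_on_indicator[OF _ Fc[OF f]] cK by simp
    then show ?thesis
      unfolding I_def Md[OF k] set_lebesgue_integral_def using k by (subst integral_return) auto
  qed
  \<comment> \<open>The function \<open>mdist \<rho> j\<close> is itself a test function and attains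
    the supremum for points of \<open>K\<close>; so \<rho> is the restriction of the metric of
    \<open>X\<close>.\<close>
  have dK: "mdist X j k = mdist \<rho> j k" if j: "j \<in> K" and k: "k \<in> K" for j k
  proof (rule antisym)
    have jX: "j \<in> mspace X" "k \<in> mspace X" using j k KX by auto
    show "mdist X j k \<le> mdist \<rho> j k"
      unfolding dist[OF jX]
    proof (rule cSUP_least)
      have "(\<lambda>_. 0) \<in> F" by (simp add: F_def)
      then show "F \<noteq> {}" by blast
      fix f assume f: "f \<in> F"
      show "\<bar>I j f - I k f\<bar> \<le> mdist \<rho> j k"
        using lip_onD[of 1 \<rho> K f j k] f j k by (simp add: Ik F_def)
    qed
    have "mdist \<rho> j \<in> F" using lip_on_mdist[of K \<rho> j] \<rho>(1) j by (simp add: F_def)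
    from lip_onD[OF lipI[OF this] jX] show "mdist \<rho> j k \<le> mdist X j k"
      using j k \<rho>(1) by (simp add: Ik[OF _ \<open>mdist \<rho> j \<in> F\<close>])
  qed
  have F': "f \<in> F \<longleftrightarrow> lip_on 1 X K f" for f using dK by (auto simp: F_def lip_on_def)
  have affI: "affine_on (mspace X) (\<lambda>x. I x f)" if f: "f \<in> F" for f
    unfolding affine_on_def
  proof (intro ballI allI impI)
    fix x y and u v :: real assume x: "x \<in> mspace X" and y: "y \<in> mspace X" and u: "0 \<le> u" "0 \<le> v" "u + v = 1"
    obtain \<kappa> where \<kappa>: "concentrated K \<kappa>"
      "\<forall>(f :: 'a \<Rightarrow> real) B. f \<in> borel_measurable borel \<longrightarrow> (\<forall>x. \<bar>f x\<bar> \<le> B) \<longrightarrow>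
        (LINT x|\<kappa>. f x) = u * (LINT z|M x. f z) + v * (LINT z|M y. f z)"
      using mixture_exists[OF M(1)[OF x] M(1)[OF y] cK u] by blast
    have zX: "u *\<^sub>R x + v *\<^sub>R y \<in> mspace X" by (rule convD[OF x y u])
    have "represents (mspace X) \<kappa> (u *\<^sub>R x + v *\<^sub>R y)"
      unfolding represents_def
    proof
      fix a assume a: "a \<in> affine_functions (mspace X)"
      obtain B where B: "\<And>x. x \<in> mspace X \<Longrightarrow> \<bar>a x\<bar> \<le> B"
        using compact_imp_bounded[OF compact_continuous_image[OF affine_functionsD(1)[OF a] comp]]
        by (auto simp: bounded_iff)
      have aB: "\<bar>a x\<bar> \<le> max 0 B" for x
        using affine_functionsD(3)[OF a, of x] by (cases "x \<in> mspace X") (auto intro: order_trans[OF B])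
      have "(LINT x|\<kappa>. a x) = u * (LINT z|M x. a z) + v * (LINT z|M y. a z)"
        by (rule \<kappa>(2)[rule_format, OF affine_functions_measurable[OF a refl] aB])
      also have "\<dots> = u * a x + v * a y" using M(2)[OF x] M(2)[OF y] a by (simp add: represents_def)
      also have "\<dots> = a (u *\<^sub>R x + v *\<^sub>R y)" using affine_onD[OF affine_functionsD(2)[OF a] x y u] by simp
      finally show "(LINT x|\<kappa>. a x) = a (u *\<^sub>R x + v *\<^sub>R y)" .
    qed
    then have M\<kappa>: "M (u *\<^sub>R x + v *\<^sub>R y) = \<kappa>" using Mu[OF zX \<kappa>(1)] by simp
    define g where "g = (\<lambda>x. indicator K x *\<^sub>R f x)"
    have g: "g \<in> borel_measurable borel"
      unfolding g_def using borel_measurable_continuous_on_indicator[OF _ Fc[OF f]] cK by simp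
    obtain B where B: "\<And>x. x \<in> K \<Longrightarrow> \<bar>f x\<bar> \<le> B"
      using compact_imp_bounded[OF compact_continuous_image[OF Fc[OF f] Kc]] by (auto simp: bounded_iff)
    have gB: "\<bar>g x\<bar> \<le> max 0 B" for x
      by (cases "x \<in> K") (auto simp: g_def intro: order_trans[OF B])
    have "(LINT x|\<kappa>. g x) = u * (LINT z|M x. g z) + v * (LINT z|M y. g z)"
      by (rule \<kappa>(2)[rule_format, OF g gB])
    then show "I (u *\<^sub>R x + v *\<^sub>R y) f = u *\<^sub>R I x f + v *\<^sub>R I y f"
      by (simp add: I_def M\<kappa> set_lebesgue_integral_def g_def)
  qed
  show ?thesis
    unfolding K_def[symmetric]
  proof unfold_locales
    show "K \<subseteq> mspace X" "compact K" by (rule KX Kc)+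
    fix h assume "lip_on 1 X K h"
    then have h: "h \<in> F" by (simp add: F')
    then show "\<exists>H. affine_on (mspace X) H \<and> lip_on 1 X (mspace X) H \<and> (\<forall>k\<in>K. H k = h k)"
      using affI lipI Ik by (intro exI[of _ "\<lambda>x. I x h"]) auto
  next
    fix H :: "'a \<Rightarrow> real" and x
    assume H: "continuous_on (mspace X) H" "affine_on (mspace X) H" and pos: "\<And>k. k \<in> K \<Longrightarrow> 0 \<le> H k"
      and x: "x \<in> mspace X"
    have "(LINT k:K|M x. 0) \<le> (LINT k:K|M x. H k)"
      using pos by (intro concentrated_integral_mono[OF M(1)[OF x] Kc cK] continuous_on_const continuous_on_subset[OF H(1) KX])
    then show "0 \<le> H x" using Mint[OF x H] concentrated_integral_const[OF M(1)[OF x] cK, of 0] by simp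
  next
    fix x y c assume x: "x \<in> mspace X" and y: "y \<in> mspace X" and c: "c < mdist X x y"
    have "F \<noteq> {}"
    proof -
      have "(\<lambda>_. 0) \<in> F" by (simp add: F_def)
      then show ?thesis by blast
    qed
    then obtain f where f: "f \<in> F" "c < \<bar>I x f - I y f\<bar>"
      using c less_cSUP_iff[OF _ bdd[OF x y]] unfolding dist[OF x y] by blast
    show "\<exists>H. affine_on (mspace X) H \<and> lip_on 1 X (mspace X) H \<and> c < H x - H y"
    proof (cases "c < I x f - I y f")
      case True
      then show ?thesis using affI[OF f(1)] lipI[OF f(1)] by blast
    next
      case False
      then have "c < - I x f - (- I y f)" using f(2) by linarith
      moreover have "lip_on 1 X (mspace X) (\<lambda>x. - I x f)"
        using lip_on_cmult[OF lipI[OF f(1)], of "-1"] by simp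
      ultimately show ?thesis using affine_on_minus[OF affI[OF f(1)]] by blast
    qed
  qed
qed

section \<open>The quantum intertwining gap\<close>

lemma lip_const_le_iff:
  assumes "C \<ge> 0"
  shows "lip_const X f \<le> ennreal C \<longleftrightarrow> lip_on C X (mspace X) f"
proof
  assume le: "lip_const X f \<le> ennreal C"
  show "lip_on C X (mspace X) f"
    unfolding lip_on_def
  proof (intro ballI)
    fix x y assume xy: "x \<in> mspace X" "y \<in> mspace X"
    show "\<bar>f x - f y\<bar> \<le> C * mdist X x y"
    proof (cases "x = y")
      case False
      then have "mdist X x y \<noteq> 0" using xy by simp
      then have d: "mdist X x y > 0" using mdist_nonneg[of X x y] by linarith
      have "ennreal (\<bar>f x - f y\<bar> / mdist X x y) \<le> lip_const X f"
        unfolding lip_const_def by (rule SUP_upper2[of "(x, y)"]) (use xy False in auto)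
      also note le
      finally have "\<bar>f x - f y\<bar> / mdist X x y \<le> C" using assms by (simp add: ennreal_le_iff)
      then show ?thesis using d by (simp add: divide_le_eq)
    qed (use xy in simp)
  qed
next
  assume l: "lip_on C X (mspace X) f"
  show "lip_const X f \<le> ennreal C"
    unfolding lip_const_def
  proof (rule SUP_least, clarify)
    fix x y assume xy: "x \<in> mspace X" "y \<in> mspace X" "x \<noteq> y"
    then have "mdist X x y \<noteq> 0" by simp
    then have d: "mdist X x y > 0" using mdist_nonneg[of X x y] by linarith
    show "ennreal (\<bar>f x - f y\<bar> / mdist X x y) \<le> ennreal C"
      using lip_onD[OF l xy(1,2)] d by (intro ennreal_leI) (simp add: divide_le_eq)
  qed
qed

lemma lip_on_zero_outside: "lip_on C X (mspace X) (zero_outside (mspace X) f) \<longleftrightarrow> lip_on C X (mspace X) f"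
  by (simp add: lip_on_def)

lemma lip_rho_le:
  "(\<And>x. x \<in> elems E \<Longrightarrow> L x \<le> 1 \<Longrightarrow> \<bar>\<sigma> x - \<tau> x\<bar> \<le> c) \<Longrightarrow> lip_rho E L \<sigma> \<tau> \<le> ennreal c"
  unfolding lip_rho_def by (rule SUP_least) (auto intro: ennreal_leI)

lemma lip_rho_leD:
  assumes "lip_rho E L \<sigma> \<tau> \<le> ennreal c" "c \<ge> 0" "x \<in> elems E" "L x \<le> 1"
  shows "\<bar>\<sigma> x - \<tau> x\<bar> \<le> c"
proof -
  have "ennreal \<bar>\<sigma> x - \<tau> x\<bar> \<le> lip_rho E L \<sigma> \<tau>"
    unfolding lip_rho_def by (rule SUP_upper) (use assms in simp)
  also note assms(1)
  finally show ?thesis using assms(2) by (simp add: ennreal_le_iff)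
qed

context bauer_model
begin

lemma dist_attained_Aff:
  assumes x: "x \<in> mspace X" "y \<in> mspace X" and c: "c < mdist X x y"
  shows "\<exists>a\<in>affine_functions (mspace X). lip_on 1 X (mspace X) a \<and> c < a x - a y"
proof -
  obtain H where H: "affine_on (mspace X) H" "lip_on 1 X (mspace X) H" "c < H x - H y"
    using dist_attained[OF assms] by blast
  then show ?thesis
    using zero_outside_affine[OF lip_cont[OF H(2)] H(1)] x
    by (intro bexI[of _ "zero_outside (mspace X) H"]) (simp_all add: lip_on_zero_outside)
qed

lemma lip_rho_eval:
  assumes x: "x \<in> mspace X" and y: "y \<in> mspace X"
  shows "lip_rho (Aff X) (lip_const X) (eval_state x) (eval_state y) = ennreal (mdist X x y)"
proof (rule antisym)
  have one: "lip_const X a \<le> 1 \<longleftrightarrow> lip_on 1 X (mspace X) a" for a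
    using lip_const_le_iff[of 1 X a] by simp
  show "lip_rho (Aff X) (lip_const X) (eval_state x) (eval_state y) \<le> ennreal (mdist X x y)"
  proof (rule lip_rho_le)
    fix a assume "a \<in> elems (Aff X)" "lip_const X a \<le> 1"
    then show "\<bar>eval_state x a - eval_state y a\<bar> \<le> mdist X x y"
      using lip_onD[of 1 X "mspace X" a x y] x y one[of a] by (simp add: Aff_simps eval_state_def)
  qed
  show "ennreal (mdist X x y) \<le> lip_rho (Aff X) (lip_const X) (eval_state x) (eval_state y)"
  proof (rule ccontr)
    assume "\<not> ?thesis"
    then have lt: "lip_rho (Aff X) (lip_const X) (eval_state x) (eval_state y) < ennreal (mdist X x y)" by simp
    then obtain r where r: "r \<ge> 0" "lip_rho (Aff X) (lip_const X) (eval_state x) (eval_state y) = ennreal r"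
      by (cases "lip_rho (Aff X) (lip_const X) (eval_state x) (eval_state y)") auto
    then have "r < mdist X x y" using lt by (simp add: ennreal_less_iff)
    then obtain a where a: "a \<in> affine_functions (mspace X)" "lip_on 1 X (mspace X) a" "r < a x - a y"
      using dist_attained_Aff[OF x y] by blast
    have "\<bar>eval_state x a - eval_state y a\<bar> \<le> r"
      by (rule lip_rho_leD[of "Aff X" "lip_const X"]) (use r a one in \<open>simp_all add: Aff_simps\<close>)
    then show False using a by (simp add: eval_state_def)
  qed
qed

lemma eval_state_inj: "x \<in> mspace X \<Longrightarrow> y \<in> mspace X \<Longrightarrow> eval_state x = eval_state y \<Longrightarrow> x = y"
  by (rule affine_separates) (auto simp: eval_state_def fun_eq_iff split: if_splits)

lemma eval_state_affine: "affine_on (mspace X) eval_state"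
  unfolding affine_on_def
proof (intro ballI allI impI)
  fix x y and u v :: real assume *: "x \<in> mspace X" "y \<in> mspace X" "0 \<le> u" "0 \<le> v" "u + v = 1"
  have "eval_state (u *\<^sub>R x + v *\<^sub>R y) f = u * eval_state x f + v * eval_state y f" for f
    using affine_onD[OF affine_functionsD(2) *, of f] by (simp add: eval_state_def)
  then show "eval_state (u *\<^sub>R x + v *\<^sub>R y) = u *\<^sub>R eval_state x + v *\<^sub>R eval_state y"
    by (simp add: fun_eq_iff scaleR_fun_def)
qed

lemma Metric_space_states:
  "Metric_space (state_space (Aff X)) (\<lambda>\<sigma> \<tau>. enn2real (lip_rho (Aff X) (lip_const X) \<sigma> \<tau>))"
  (is "Metric_space ?S ?d")
proof
  have dist: "?d (eval_state x) (eval_state y) = mdist X x y" if "x \<in> mspace X" "y \<in> mspace X" for x y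
    using lip_rho_eval[OF that] by simp
  show "0 \<le> ?d \<sigma> \<tau>" for \<sigma> \<tau> by simp
  show "?d \<sigma> \<tau> = ?d \<tau> \<sigma>" for \<sigma> \<tau> by (simp add: lip_rho_def abs_minus_commute)
  show "?d \<sigma> \<tau> = 0 \<longleftrightarrow> \<sigma> = \<tau>" if st: "\<sigma> \<in> ?S" "\<tau> \<in> ?S" for \<sigma> \<tau>
  proof -
    obtain x y where "x \<in> mspace X" "\<sigma> = eval_state x" "y \<in> mspace X" "\<tau> = eval_state y"
      using st unfolding state_space_eq by blast
    then show ?thesis using dist mdist_zero[of x X y] eval_state_inj[of x y] by auto
  qed
  show "?d \<sigma> \<upsilon> \<le> ?d \<sigma> \<tau> + ?d \<tau> \<upsilon>" if st: "\<sigma> \<in> ?S" "\<tau> \<in> ?S" "\<upsilon> \<in> ?S" for \<sigma> \<tau> \<upsilon>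
  proof -
    obtain x y z where "x \<in> mspace X" "\<sigma> = eval_state x" "y \<in> mspace X" "\<tau> = eval_state y"
      "z \<in> mspace X" "\<upsilon> = eval_state z"
      using st unfolding state_space_eq by blast
    then show ?thesis using dist mdist_triangle by simp
  qed
qed

lemma state_metric_simps:
  "mspace (state_metric (Aff X) (lip_const X)) = eval_state ` mspace X"
  "x \<in> mspace X \<Longrightarrow> y \<in> mspace X \<Longrightarrow>
    mdist (state_metric (Aff X) (lip_const X)) (eval_state x) (eval_state y) = mdist X x y"
  unfolding state_metric_def Metric_space.mspace_metric[OF Metric_space_states]
    Metric_space.mdist_metric[OF Metric_space_states]
  by (simp_all add: state_space_eq lip_rho_eval)

lemma affinely_isometric_states: "affinely_isometric X (state_metric (Aff X) (lip_const X))"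
  unfolding affinely_isometric_def
proof (intro exI[of _ eval_state] conjI ballI)
  show "bij_betw eval_state (mspace X) (mspace (state_metric (Aff X) (lip_const X)))"
    unfolding state_metric_simps(1) by (intro inj_on_imp_bij_betw inj_onI eval_state_inj)
qed (simp_all add: eval_state_affine state_metric_simps)

lemma convex_states: "convex (mspace (state_metric (Aff X) (lip_const X)))"
  unfolding state_metric_simps(1) convex_def
proof (intro ballI allI impI)
  fix s t and u v :: real
  assume st: "s \<in> eval_state ` mspace X" "t \<in> eval_state ` mspace X" and u: "0 \<le> u" "0 \<le> v" "u + v = 1"
  obtain x y where xy: "x \<in> mspace X" "s = eval_state x" "y \<in> mspace X" "t = eval_state y" using st by blast
  have "u *\<^sub>R s + v *\<^sub>R t = eval_state (u *\<^sub>R x + v *\<^sub>R y)"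
    using affine_onD[OF eval_state_affine xy(1,3) u] xy(2,4) by simp
  then show "u *\<^sub>R s + v *\<^sub>R t \<in> eval_state ` mspace X" using convD[OF xy(1,3) u] by simp
qed

text \<open>A Krein--Milman statement with uniform error: the identity is approximated by an affine
  map into the hull of finitely many boundary points. Closeness is checked on \<open>K\<close>,
  where the distance to \<open>k\<close> is affine.\<close>

lemma finite_rank_approximation:
  assumes "\<delta> > 0"
  shows "\<exists>F (\<Lambda> :: 'a \<Rightarrow> 'a \<Rightarrow> real). finite F \<and> F \<subseteq> K \<and>
    (\<forall>i\<in>F. \<forall>x\<in>mspace X. 0 \<le> \<Lambda> i x) \<and> (\<forall>x\<in>mspace X. (\<Sum>i\<in>F. \<Lambda> i x) = 1) \<and>
    (\<forall>x\<in>mspace X. mdist X (\<Sum>i\<in>F. \<Lambda> i x *\<^sub>R i) x \<le> \<delta>)"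
proof -
  obtain F and \<Lambda> :: "'a \<Rightarrow> 'a \<Rightarrow> real" where F: "finite F" "F \<subseteq> K"
    and L: "\<forall>i\<in>F. affine_on (mspace X) (\<Lambda> i)" "\<forall>i\<in>F. continuous_on (mspace X) (\<Lambda> i)"
    "\<forall>i\<in>F. \<forall>x\<in>mspace X. 0 \<le> \<Lambda> i x" "\<forall>x\<in>mspace X. (\<Sum>i\<in>F. \<Lambda> i x) = 1"
    "\<forall>i\<in>F. \<forall>k\<in>K. \<delta> \<le> mdist X i k \<longrightarrow> \<Lambda> i k = 0"
    using affine_partition_of_unity[OF assms] by blast
  note L' = L[rule_format]
  have FX: "i \<in> mspace X" if "i \<in> F" for i using that F(2) by (intro K_mspace) blast
  define P where "P = (\<lambda>x. \<Sum>i\<in>F. \<Lambda> i x *\<^sub>R i)"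
  have PX: "P x \<in> mspace X" if "x \<in> mspace X" for x
    unfolding P_def by (rule convex_sum[OF F(1) conv L'(4)[OF that] L'(3)[OF _ that] FX])
  have "continuous_on (mspace X) P"
    unfolding P_def by (intro continuous_on_sum continuous_on_scaleR_lcs continuous_on_const L'(2))
  moreover have "affine_on (mspace X) P" unfolding P_def by (intro affine_on_sum affine_on_scaleR_right L'(1))
  ultimately have P: "P \<in> affine_maps X X"
    using PX unfolding affine_maps_def top by (auto simp: continuous_map_in_subtopology)
  have "mdist X (P x) x \<le> \<delta>" if x: "x \<in> mspace X" for x
  proof (rule dist_affine_maps_le[OF P affine_maps_id bauer_model_axioms _ x])
    fix k assume k: "k \<in> K"
    note kX = K_mspace[OF k]
    have "mdist X k (P k) = (\<Sum>i\<in>F. \<Lambda> i k * mdist X k i)"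
      unfolding P_def
      by (rule affine_on_convex_sum[OF dist_from_K_affine[OF k] conv F(1) FX L'(3)[OF _ kX] L'(4)[OF kX]])
    also have "\<dots> \<le> (\<Sum>i\<in>F. \<Lambda> i k * \<delta>)"
    proof (rule sum_mono)
      fix i assume i: "i \<in> F"
      show "\<Lambda> i k * mdist X k i \<le> \<Lambda> i k * \<delta>"
      proof (cases "\<delta> \<le> mdist X i k")
        case False
        then show ?thesis using L'(3)[OF i kX] by (intro mult_left_mono) (auto simp: mdist_commute)
      qed (use L'(5)[OF i k] in simp)
    qed
    also have "\<dots> = \<delta>" using L'(4)[OF kX] by (simp add: sum_distrib_right[symmetric])
    finally show "mdist X (P k) k \<le> \<delta>" by (simp add: mdist_commute)
  qed
  then show ?thesis using F L(3,4) unfolding P_def by (intro exI[of _ F] exI[of _ \<Lambda>]) simp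
qed

end

theorem quantum_gap_eq:
  assumes "bauer_model X K" "bauer_model Y M"
  shows "quantum_gap (Aff X) (lip_const X) (Aff Y) (lip_const Y) = intertwining_gap X Y"
proof -
  interpret X: bauer_model X K by fact
  interpret Y: bauer_model Y M by fact
  show ?thesis
    unfolding quantum_gap_def
    by (rule gap_iso_invariant[OF X.conv X.convex_states X.affinely_isometric_states
          Y.conv Y.convex_states Y.affinely_isometric_states, symmetric])
qed

section \<open>The quantum Gromov--Hausdorff distance\<close>

text \<open>An abstract proximity relation between two simplices, as obtained from a metric on the state
  space of the direct sum. Although the distance to a state of the other simplex is only convex,
  points of the boundary of one simplex are close to the boundary of the other one.\<close>

locale proximity = X: bauer_model X K + Y: bauer_model Y M
  for X :: "'a::locally_convex_space metric" and K and Y :: "'b::locally_convex_space metric" and M +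
  fixes near :: "'a \<Rightarrow> 'b \<Rightarrow> real \<Rightarrow> bool" and \<epsilon> :: real
  assumes eps: "\<epsilon> > 0"
    and distort: "x \<in> mspace X \<Longrightarrow> x' \<in> mspace X \<Longrightarrow> y \<in> mspace Y \<Longrightarrow> y' \<in> mspace Y \<Longrightarrow>
      near x y e \<Longrightarrow> near x' y' e' \<Longrightarrow> \<bar>mdist X x x' - mdist Y y y'\<bar> \<le> e + e'"
    and move_X: "x \<in> mspace X \<Longrightarrow> x' \<in> mspace X \<Longrightarrow> y \<in> mspace Y \<Longrightarrow> near x y e \<Longrightarrow> mdist X x x' \<le> r \<Longrightarrow>
      near x' y (e + r)"
    and move_Y: "x \<in> mspace X \<Longrightarrow> y \<in> mspace Y \<Longrightarrow> y' \<in> mspace Y \<Longrightarrow> near x y e \<Longrightarrow> mdist Y y y' \<le> r \<Longrightarrow>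
      near x y' (e + r)"
    and combine: "finite I \<Longrightarrow> (\<And>i. i \<in> I \<Longrightarrow> p i \<in> mspace X) \<Longrightarrow> (\<And>i. i \<in> I \<Longrightarrow> i \<in> mspace Y) \<Longrightarrow>
      (\<And>i. i \<in> I \<Longrightarrow> 0 \<le> c i) \<Longrightarrow> sum c I = 1 \<Longrightarrow> (\<And>i. i \<in> I \<Longrightarrow> near (p i) i e) \<Longrightarrow>
      near (\<Sum>i\<in>I. c i *\<^sub>R p i) (\<Sum>i\<in>I. c i *\<^sub>R i) e"
    and combine': "finite J \<Longrightarrow> (\<And>i. i \<in> J \<Longrightarrow> q i \<in> mspace Y) \<Longrightarrow> (\<And>i. i \<in> J \<Longrightarrow> i \<in> mspace X) \<Longrightarrow>
      (\<And>i. i \<in> J \<Longrightarrow> 0 \<le> c' i) \<Longrightarrow> sum c' J = 1 \<Longrightarrow> (\<And>i. i \<in> J \<Longrightarrow> near i (q i) e) \<Longrightarrow>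
      near (\<Sum>i\<in>J. c' i *\<^sub>R i) (\<Sum>i\<in>J. c' i *\<^sub>R q i) e"
    and ex_Y: "x \<in> mspace X \<Longrightarrow> \<exists>y\<in>mspace Y. near x y \<epsilon>"
    and ex_X: "y \<in> mspace Y \<Longrightarrow> \<exists>x\<in>mspace X. near x y \<epsilon>"
begin

text \<open>A point near \<open>k\<close> is approximated within \<epsilon> by a mean
  \<open>z\<close> of points \<open>i\<close> of \<open>M\<close>. Their partners \<open>p i\<close>
  have a mean \<open>w\<close> near \<open>z\<close>, whence \<open>mdist X k w\<close> is at most 3
  \<epsilon>. The distance to \<open>k\<close> is affine, so some \<open>p i\<close> is within 3
  \<epsilon> of \<open>k\<close>, and the corresponding \<open>i\<close> is near \<open>k\<close>
  with 4 \<epsilon>.\<close>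

lemma boundary_near:
  assumes k: "k \<in> K"
  shows "\<exists>m\<in>M. near k m (4 * \<epsilon>)"
proof -
  note kX = X.K_mspace[OF k]
  obtain y where y: "y \<in> mspace Y" "near k y \<epsilon>" using ex_Y[OF kX] by blast
  obtain F and \<Lambda> :: "'b \<Rightarrow> 'b \<Rightarrow> real" where F: "finite F" "F \<subseteq> M"
    and L: "\<forall>i\<in>F. \<forall>x\<in>mspace Y. 0 \<le> \<Lambda> i x" "\<forall>x\<in>mspace Y. (\<Sum>i\<in>F. \<Lambda> i x) = 1"
    "\<forall>x\<in>mspace Y. mdist Y (\<Sum>i\<in>F. \<Lambda> i x *\<^sub>R i) x \<le> \<epsilon>"
    using Y.finite_rank_approximation[OF eps] by blast
  define c where "c = (\<lambda>i. \<Lambda> i y)"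
  have c: "\<And>i. i \<in> F \<Longrightarrow> 0 \<le> c i" "sum c F = 1" using L(1,2) y(1) by (auto simp: c_def)
  have FY: "i \<in> mspace Y" if "i \<in> F" for i using that F(2) by (intro Y.K_mspace) blast
  define z where "z = (\<Sum>i\<in>F. c i *\<^sub>R i)"
  have zY: "z \<in> mspace Y" unfolding z_def by (rule convex_sum[OF F(1) Y.conv c(2,1) FY])
  have "mdist Y y z \<le> \<epsilon>" using L(3) y(1) by (simp add: z_def c_def mdist_commute)
  then have kz: "near k z (\<epsilon> + \<epsilon>)" by (rule move_Y[OF kX y(1) zY y(2)])
  have "\<forall>i\<in>F. \<exists>x. x \<in> mspace X \<and> near x i \<epsilon>" using ex_X FY by blast
  then obtain p where "\<forall>i\<in>F. p i \<in> mspace X \<and> near (p i) i \<epsilon>"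
    unfolding bchoice_iff by (rule exE)
  then have p: "\<And>i. i \<in> F \<Longrightarrow> p i \<in> mspace X" "\<And>i. i \<in> F \<Longrightarrow> near (p i) i \<epsilon>" by simp_all
  define w where "w = (\<Sum>i\<in>F. c i *\<^sub>R p i)"
  have wX: "w \<in> mspace X" unfolding w_def by (rule convex_sum[OF F(1) X.conv c(2,1) p(1)])
  have "near w z \<epsilon>" unfolding w_def z_def by (rule combine[OF F(1) p(1) FY c(1,2) p(2)])
  then have "\<bar>mdist X k w - mdist Y z z\<bar> \<le> (\<epsilon> + \<epsilon>) + \<epsilon>" by (rule distort[OF kX wX zY zY kz])
  then have kw: "mdist X k w \<le> 3 * \<epsilon>" using zY by simp
  have "mdist X k w = (\<Sum>i\<in>F. c i * mdist X k (p i))"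
    unfolding w_def
    by (rule affine_on_convex_sum[OF X.dist_from_K_affine[OF k] X.conv F(1) p(1) c(1,2)])
  then have le: "(\<Sum>i\<in>F. c i * mdist X k (p i)) \<le> 3 * \<epsilon>" using kw by simp
  have "\<exists>i\<in>F. mdist X k (p i) \<le> 3 * \<epsilon>"
  proof (rule ccontr)
    assume neg: "\<not> ?thesis"
    \<comment> \<open>Strictness of the inequality between the means needs an index with nonzero
      weight.\<close>
    obtain j where j: "j \<in> F" "c j \<noteq> 0" using c(2) by (metis sum.neutral zero_neq_one)
    have "3 * \<epsilon> = (\<Sum>i\<in>F. c i * (3 * \<epsilon>))" using c(2) by (simp add: sum_distrib_right[symmetric])
    also have "\<dots> < (\<Sum>i\<in>F. c i * mdist X k (p i))"
    proof (rule sum_strict_mono_ex1[OF F(1)])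
      show "\<forall>i\<in>F. c i * (3 * \<epsilon>) \<le> c i * mdist X k (p i)"
        using neg c(1) by (intro ballI mult_left_mono) (auto simp: not_le less_imp_le)
      have "3 * \<epsilon> < mdist X k (p j)" using neg j(1) by (simp add: not_le)
      moreover have "0 < c j" using c(1)[OF j(1)] j(2) by simp
      ultimately have "c j * (3 * \<epsilon>) < c j * mdist X k (p j)" by (rule mult_strict_left_mono)
      then show "\<exists>i\<in>F. c i * (3 * \<epsilon>) < c i * mdist X k (p i)" using j(1) by blast
    qed
    finally show False using le by simp
  qed
  then obtain i where i: "i \<in> F" "mdist X k (p i) \<le> 3 * \<epsilon>" by blast
  have "mdist X (p i) k \<le> 3 * \<epsilon>" using i(2) by (simp add: mdist_commute)
  then have "near k i (\<epsilon> + 3 * \<epsilon>)" by (rule move_X[OF p(1)[OF i(1)] kX FY[OF i(1)] p(2)[OF i(1)]])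
  then show ?thesis using i(1) F(2) by (intro bexI[of _ i]) auto
qed

lemma proximity_swap: "proximity Y M X K (\<lambda>y x. near x y) \<epsilon>"
proof (unfold_locales, goal_cases)
  case (2 x x' y y' e e')
  then show ?case using distort[of y y' x x' e e'] by (simp add: abs_minus_commute)
next
  case (3 x x' y e r)
  then show ?case using move_Y by blast
next
  case (4 x y y' e r)
  then show ?case using move_X by blast
qed (fact eps | rule combine' combine | fact ex_X ex_Y | assumption)+

lemma boundary_corr: "corr (8 * \<epsilon>) X K Y M (\<lambda>k m. near k m (4 * \<epsilon>))"
  unfolding corr_def
proof (intro conjI ballI impI)
  show "\<exists>k\<in>K. near k m (4 * \<epsilon>)" if "m \<in> M" for m
    by (rule proximity.boundary_near[OF proximity_swap that])
  fix k k' m m' assume "k \<in> K" "k' \<in> K" "m \<in> M" "m' \<in> M" "near k m (4 * \<epsilon>)" "near k' m' (4 * \<epsilon>)"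
  then show "\<bar>mdist X k k' - mdist Y m m'\<bar> \<le> 8 * \<epsilon>"
    using distort[of k k' m m' "4 * \<epsilon>" "4 * \<epsilon>"] by (simp add: X.K_mspace Y.K_mspace)
qed (rule boundary_near)

end

section \<open>Lip-norms on the direct sum\<close>

locale bauer_pair = X: bauer_model X K + Y: bauer_model Y M
  for X :: "'a::locally_convex_space metric" and K and Y :: "'b::locally_convex_space metric" and M
begin

abbreviation "A \<equiv> affine_functions (mspace X)"
abbreviation "B \<equiv> affine_functions (mspace Y)"
abbreviation "E \<equiv> direct_sum (Aff X) (Aff Y)"

definition left :: "'a \<Rightarrow> ('a \<Rightarrow> real) \<times> ('b \<Rightarrow> real) \<Rightarrow> real" where
  "left x = (\<lambda>p. if p \<in> A \<times> B then fst p x else 0)"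

definition right :: "'b \<Rightarrow> ('a \<Rightarrow> real) \<times> ('b \<Rightarrow> real) \<Rightarrow> real" where
  "right y = (\<lambda>p. if p \<in> A \<times> B then snd p y else 0)"

lemma elems_E: "elems E = A \<times> B" "ounit E = (indicator (mspace X), indicator (mspace Y))"
  by (simp_all add: direct_sum_def Aff_def)

lemma left_states_eq: "left_states (Aff X) (Aff Y) = left ` mspace X"
proof -
  have "(\<lambda>p. if p \<in> elems (Aff X) \<times> elems (Aff Y) then X.eval_state x (fst p) else 0) = left x" for x
    by (auto simp: left_def Aff_def X.eval_state_def fun_eq_iff)
  then show ?thesis unfolding left_states_def X.state_space_eq image_image by simp
qed

lemma right_states_eq: "right_states (Aff X) (Aff Y) = right ` mspace Y"
proof -
  have "(\<lambda>p. if p \<in> elems (Aff X) \<times> elems (Aff Y) then Y.eval_state y (snd p) else 0) = right y" for y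
    by (auto simp: right_def Aff_def Y.eval_state_def fun_eq_iff)
  then show ?thesis unfolding right_states_def Y.state_space_eq image_image by simp
qed

end

lemma hausdorff_distD:
  assumes "hausdorff_dist d S T < c"
  shows "s \<in> S \<Longrightarrow> \<exists>t\<in>T. d s t < c" "t \<in> T \<Longrightarrow> \<exists>s\<in>S. d s t < c"
proof -
  have 1: "(SUP a\<in>S. INF b\<in>T. d a b) < c" "(SUP b\<in>T. INF a\<in>S. d a b) < c"
    using assms by (simp_all add: hausdorff_dist_def)
  show "\<exists>t\<in>T. d s t < c" if "s \<in> S"
  proof -
    have "(INF b\<in>T. d s b) \<le> (SUP a\<in>S. INF b\<in>T. d a b)" using that by (rule SUP_upper)
    then have "(INF b\<in>T. d s b) < c" using 1(1) by (rule le_less_trans)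
    then show ?thesis by (simp add: INF_less_iff)
  qed
  show "\<exists>s\<in>S. d s t < c" if "t \<in> T"
  proof -
    have "(INF a\<in>S. d a t) \<le> (SUP b\<in>T. INF a\<in>S. d a b)" using that by (rule SUP_upper)
    then have "(INF a\<in>S. d a t) < c" using 1(2) by (rule le_less_trans)
    then show ?thesis by (simp add: INF_less_iff)
  qed
qed

context bauer_pair
begin

text \<open>For \<open>e \<ge> 0\<close>, the states \<open>left x\<close> and
  \<open>right y\<close> are within \<open>e\<close> in the dual metric of \<open>L\<close>, stated
  with real numbers.\<close>

definition proximate :: "(('a \<Rightarrow> real) \<times> ('b \<Rightarrow> real) \<Rightarrow> ennreal) \<Rightarrow> 'a \<Rightarrow> 'b \<Rightarrow> real \<Rightarrow> bool" where
  "proximate L x y e \<longleftrightarrow> (\<forall>a\<in>A. \<forall>b\<in>B. L (a, b) \<le> 1 \<longrightarrow> \<bar>a x - b y\<bar> \<le> e)"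

lemma quotient_left:
  assumes "induces_quotients (Aff X) (lip_const X) (Aff Y) (lip_const Y) L"
  shows "a \<in> A \<Longrightarrow> lip_const X a = (INF b\<in>B. L (a, b))" "b \<in> B \<Longrightarrow> lip_const Y b = (INF a\<in>A. L (a, b))"
  using assms by (simp_all add: induces_quotients_def Aff_def)

text \<open>Multiplying by \<open>\<theta> < 1\<close> makes the quotient seminorm strictly smaller than \<open>1\<close>, so that a
  partner \<open>b\<close> with \<open>L (a, b) \<le> 1\<close> exists.\<close>

lemma dist_attained_quotient:
  assumes L: "induces_quotients (Aff X) (lip_const X) (Aff Y) (lip_const Y) L"
    and x: "x \<in> mspace X" "x' \<in> mspace X" and c: "c \<ge> 0" "c < mdist X x x'"
  shows "\<exists>a\<in>A. \<exists>b\<in>B. L (a, b) \<le> 1 \<and> c < a x - a x'"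
proof -
  obtain a where a: "a \<in> A" "lip_on 1 X (mspace X) a" "c < a x - a x'"
    using X.dist_attained_Aff[OF x c(2)] by blast
  define D where "D = a x - a x'"
  have D: "c < D" "D > 0" using a(3) c(1) by (auto simp: D_def)
  define \<theta> where "\<theta> = (c + D) / (2 * D)"
  have \<theta>: "0 \<le> \<theta>" "\<theta> < 1" "c < \<theta> * D" using D c(1) by (auto simp: \<theta>_def field_simps)
  have ta: "\<theta> *\<^sub>R a \<in> A" by (rule X.affine_functions_scaleR[OF a(1)])
  have "lip_on \<theta> X (mspace X) (\<theta> *\<^sub>R a)"
    using lip_on_cmult[OF a(2), of \<theta>] \<theta>(1) by (simp add: scaleR_fun_def)
  then have "lip_const X (\<theta> *\<^sub>R a) \<le> ennreal \<theta>" using \<theta>(1) by (simp add: lip_const_le_iff)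
  also have "\<dots> < 1" using \<theta>(1,2) by simp
  finally have "(INF b\<in>B. L (\<theta> *\<^sub>R a, b)) < 1" using quotient_left(1)[OF L ta] by simp
  then obtain b where "b \<in> B" "L (\<theta> *\<^sub>R a, b) < 1" by (auto simp: INF_less_iff)
  moreover have "c < (\<theta> *\<^sub>R a) x - (\<theta> *\<^sub>R a) x'"
    using \<theta>(3) by (simp add: D_def scaleR_fun_def right_diff_distrib)
  ultimately show ?thesis using ta by (intro bexI[of _ "\<theta> *\<^sub>R a"] bexI[of _ b]) auto
qed

lemma proximate_dist_le:
  assumes L: "induces_quotients (Aff X) (lip_const X) (Aff Y) (lip_const Y) L"
    and x: "x \<in> mspace X" "x' \<in> mspace X" and y: "y \<in> mspace Y" "y' \<in> mspace Y"
    and p: "proximate L x y e" "proximate L x' y' e'"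
  shows "mdist X x x' \<le> mdist Y y y' + e + e'"
proof (rule ccontr)
  assume "\<not> ?thesis"
  \<comment> \<open>\<open>dist_attained_quotient\<close> wants a nonnegative bound. If
    \<open>x = x'\<close>, one admissible pair shows that \<open>e\<close> and \<open>e'\<close> are
    nonnegative, which contradicts the assumption.\<close>
  then have lt: "max 0 (mdist Y y y' + e + e') < mdist X x x'"
  proof -
    assume *: "\<not> mdist X x x' \<le> mdist Y y y' + e + e'"
    show ?thesis
    proof (cases "x = x'")
      case True
      have "mdist X x x' = 0" using True x by simp
      moreover have "lip_const X (0 *\<^sub>R indicator (mspace X)) = 0"
        using lip_const_le_iff[of 0 X "0 *\<^sub>R indicator (mspace X)"] by (simp add: lip_on_def scaleR_fun_def)
      then have "(INF b\<in>B. L (0 *\<^sub>R indicator (mspace X), b)) < 1"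
        using quotient_left(1)[OF L X.affine_functions_scaleR[OF X.affine_functions_unit, of 0]] by simp
      then obtain b where b: "b \<in> B" "L (0 *\<^sub>R indicator (mspace X), b) < 1" by (auto simp: INF_less_iff)
      have "0 \<le> e" "0 \<le> e'"
        using p b X.affine_functions_scaleR[OF X.affine_functions_unit, of 0] unfolding proximate_def
        by (meson abs_ge_zero less_imp_le order_trans)+
      ultimately show ?thesis using * mdist_nonneg[of Y y y'] by linarith
    next
      case False
      then have "mdist X x x' \<noteq> 0" using x by simp
      then show ?thesis using * mdist_nonneg[of X x x'] by linarith
    qed
  qed
  then obtain a b where ab: "a \<in> A" "b \<in> B" "L (a, b) \<le> 1" "max 0 (mdist Y y y' + e + e') < a x - a x'"
    using dist_attained_quotient[OF L x, of "max 0 (mdist Y y y' + e + e')"] by auto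
  have "lip_const Y b \<le> L (a, b)" unfolding quotient_left(2)[OF L ab(2)] using ab(1) by (rule INF_lower)
  then have "lip_const Y b \<le> ennreal 1" using ab(3) by simp
  then have "lip_on 1 Y (mspace Y) b" by (simp only: lip_const_le_iff[OF zero_le_one])
  then have "\<bar>b y - b y'\<bar> \<le> mdist Y y y'" using lip_onD y by fastforce
  moreover have "\<bar>a x - b y\<bar> \<le> e" "\<bar>a x' - b y'\<bar> \<le> e'" using p ab(1-3) by (auto simp: proximate_def)
  ultimately show False using ab(4) by linarith
qed

lemma quotient_Lip:
  assumes L: "induces_quotients (Aff X) (lip_const X) (Aff Y) (lip_const Y) L"
    and ab: "a \<in> A" "b \<in> B" "L (a, b) \<le> 1"
  shows "lip_on 1 X (mspace X) a" "lip_on 1 Y (mspace Y) b"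
proof -
  have "lip_const X a \<le> L (a, b)" unfolding quotient_left(1)[OF L ab(1)] using ab(2) by (rule INF_lower)
  then have "lip_const X a \<le> ennreal 1" using ab(3) by simp
  then show "lip_on 1 X (mspace X) a" by (simp only: lip_const_le_iff[OF zero_le_one])
  have "lip_const Y b \<le> L (a, b)" unfolding quotient_left(2)[OF L ab(2)] using ab(1) by (rule INF_lower)
  then have "lip_const Y b \<le> ennreal 1" using ab(3) by simp
  then show "lip_on 1 Y (mspace Y) b" by (simp only: lip_const_le_iff[OF zero_le_one])
qed

lemma combination_close:
  fixes a :: "'c::real_vector \<Rightarrow> real" and b :: "'d::real_vector \<Rightarrow> real"
  assumes "affine_on C a" "convex C" "affine_on D b" "convex D" "finite I"
    "\<And>i. i \<in> I \<Longrightarrow> p i \<in> C" "\<And>i. i \<in> I \<Longrightarrow> q i \<in> D" "\<And>i. i \<in> I \<Longrightarrow> 0 \<le> c i" "sum c I = 1"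
    "\<And>i. i \<in> I \<Longrightarrow> \<bar>a (p i) - b (q i)\<bar> \<le> e"
  shows "\<bar>a (\<Sum>i\<in>I. c i *\<^sub>R p i) - b (\<Sum>i\<in>I. c i *\<^sub>R q i)\<bar> \<le> e"
proof -
  have "a (\<Sum>i\<in>I. c i *\<^sub>R p i) - b (\<Sum>i\<in>I. c i *\<^sub>R q i) = (\<Sum>i\<in>I. c i * (a (p i) - b (q i)))"
    using affine_on_convex_sum[OF assms(1,2,5,6,8,9)] affine_on_convex_sum[OF assms(3-5,7-9)]
    by (simp add: right_diff_distrib sum_subtractf)
  also have "\<bar>\<dots>\<bar> \<le> (\<Sum>i\<in>I. \<bar>c i * (a (p i) - b (q i))\<bar>)" by (rule sum_abs)
  also have "\<dots> \<le> (\<Sum>i\<in>I. c i * e)"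
    using assms(8,10) by (intro sum_mono) (simp add: abs_mult mult_left_mono)
  also have "\<dots> = e" using assms(9) by (simp add: sum_distrib_right[symmetric])
  finally show ?thesis .
qed

end

lemma bauer_pair_swap_quotients:
  assumes "induces_quotients (Aff X) (lip_const X) (Aff Y) (lip_const Y) L"
  shows "induces_quotients (Aff Y) (lip_const Y) (Aff X) (lip_const X) (\<lambda>(b, a). L (a, b))"
  using assms by (simp add: induces_quotients_def)

text \<open>A Lip-norm close to the infimum provides the relation \<open>proximate L\<close>. It is
  stable under moving points because admissible pairs consist of 1-Lipschitz functions, and under
  mixing because these are affine.\<close>

lemma dist_q_corr:
  assumes X: "bauer_model X K" and Y: "bauer_model Y M" and \<epsilon>: "\<epsilon> > 0"
    and lt: "dist_q (Aff X) (lip_const X) (Aff Y) (lip_const Y) < ennreal \<epsilon>"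
  shows "\<exists>R. corr (8 * \<epsilon>) X K Y M R"
proof -
  interpret bauer_pair X K Y M using X Y by (simp add: bauer_pair_def)
  interpret S: bauer_pair Y M X K using X Y by (simp add: bauer_pair_def)
  obtain L where L: "induces_quotients (Aff X) (lip_const X) (Aff Y) (lip_const Y) L"
    "hausdorff_dist (lip_rho E L) (left ` mspace X) (right ` mspace Y) < ennreal \<epsilon>"
    using lt unfolding dist_q_def INF_less_iff left_states_eq right_states_eq by blast
  note L' = bauer_pair_swap_quotients[OF L(1)]
  have swap: "S.proximate (\<lambda>(b, a). L (a, b)) y x e" if p: "proximate L x y e" for x y e
    unfolding S.proximate_def
  proof (intro ballI impI)
    fix b a assume "b \<in> B" "a \<in> A" "(case (b, a) of (b, a) \<Rightarrow> L (a, b)) \<le> 1"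
    then have "\<bar>a x - b y\<bar> \<le> e" using p by (simp add: proximate_def)
    then show "\<bar>b y - a x\<bar> \<le> e" by (simp add: abs_minus_commute)
  qed
  have near: "proximate L x y \<epsilon>" if close: "lip_rho E L (left x) (right y) < ennreal \<epsilon>" for x y
    unfolding proximate_def
  proof (intro ballI impI)
    fix a b assume ab: "a \<in> A" "b \<in> B" "L (a, b) \<le> 1"
    have "\<bar>left x (a, b) - right y (a, b)\<bar> \<le> \<epsilon>"
      by (rule lip_rho_leD[OF less_imp_le[OF close]]) (use ab \<epsilon> in \<open>simp_all add: elems_E\<close>)
    then show "\<bar>a x - b y\<bar> \<le> \<epsilon>" using ab by (simp add: left_def right_def)
  qed
  have "proximity X K Y M (proximate L) \<epsilon>"
  proof (unfold_locales, goal_cases)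
    case 1
    show ?case by fact
  next
    case (2 x x' y y' e e')
    show ?case
      using proximate_dist_le[OF L(1) 2] S.proximate_dist_le[OF L' 2(3,4,1,2) swap[OF 2(5)] swap[OF 2(6)]] by linarith
  next
    case (3 x x' y e r)
    show ?case
      unfolding proximate_def
    proof (intro ballI impI)
      fix a b assume ab: "a \<in> A" "b \<in> B" "L (a, b) \<le> 1"
      have "\<bar>a x - b y\<bar> \<le> e" using 3(4) ab by (simp add: proximate_def)
      moreover have "\<bar>a x - a x'\<bar> \<le> r" using lip_onD[OF quotient_Lip(1)[OF L(1) ab] 3(1,2)] 3(5) by simp
      ultimately show "\<bar>a x' - b y\<bar> \<le> e + r" by linarith
    qed
  next
    case (4 x y y' e r)
    show ?case
      unfolding proximate_def
    proof (intro ballI impI)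
      fix a b assume ab: "a \<in> A" "b \<in> B" "L (a, b) \<le> 1"
      have "\<bar>a x - b y\<bar> \<le> e" using 4(4) ab by (simp add: proximate_def)
      moreover have "\<bar>b y - b y'\<bar> \<le> r" using lip_onD[OF quotient_Lip(2)[OF L(1) ab] 4(2,3)] 4(5) by simp
      ultimately show "\<bar>a x - b y'\<bar> \<le> e + r" by linarith
    qed
  next
    case (5 I p c e)
    show ?case
      unfolding proximate_def
    proof (intro ballI impI)
      fix a b assume ab: "a \<in> A" "b \<in> B" "L (a, b) \<le> 1"
      show "\<bar>a (\<Sum>i\<in>I. c i *\<^sub>R p i) - b (\<Sum>i\<in>I. c i *\<^sub>R i)\<bar> \<le> e"
        by (rule combination_close[OF affine_functionsD(2)[OF ab(1)] X.conv affine_functionsD(2)[OF ab(2)] Y.conv 5(1,2,3,4,5)])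
          (use 5(6) ab in \<open>auto simp: proximate_def\<close>)
    qed
  next
    case (6 I q c e)
    show ?case
      unfolding proximate_def
    proof (intro ballI impI)
      fix a b assume ab: "a \<in> A" "b \<in> B" "L (a, b) \<le> 1"
      show "\<bar>a (\<Sum>i\<in>I. c i *\<^sub>R i) - b (\<Sum>i\<in>I. c i *\<^sub>R q i)\<bar> \<le> e"
        by (rule combination_close[OF affine_functionsD(2)[OF ab(1)] X.conv affine_functionsD(2)[OF ab(2)] Y.conv 6(1,3,2,4,5)])
          (use 6(6) ab in \<open>auto simp: proximate_def\<close>)
    qed
  next
    case (7 x)
    then show ?case using hausdorff_distD(1)[OF L(2)] near by fast
  next
    case (8 y)
    then show ?case using hausdorff_distD(2)[OF L(2)] near by fast
  qed
  from proximity.boundary_corr[OF this] show ?thesis by blast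
qed

text \<open>A continuous map from a compact space onto a Hausdorff space is a quotient map, so both
  topologies are the quotient topology of \<open>s\<close>. This compares metric topologies with
  inherited ones.\<close>

lemma compact_quotient_topologies_eq:
  assumes T: "compact_space T" and Y: "Hausdorff_space Y1" "Hausdorff_space Y2" "topspace Y1 = topspace Y2"
    and s: "continuous_map T Y1 s" "continuous_map T Y2 s" "s ` topspace T = topspace Y1"
  shows "Y1 = Y2"
proof -
  have "quotient_map T Y1 s" "quotient_map T Y2 s"
    using assms by (auto intro!: T1_Spaces.continuous_imp_quotient_map)
  then have "openin Y1 U \<longleftrightarrow> openin Y2 U" if "U \<subseteq> topspace Y1" for U
    using that Y(3) unfolding quotient_map_def by metis
  then show ?thesis unfolding topology_eq using Y(3) openin_subset by metis
qed

lemma Hausdorff_space_top_of_set: "Hausdorff_space (top_of_set (S :: 'a::t2_space set))"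
proof (rule Hausdorff_space_subtopology)
  show "Hausdorff_space (euclidean :: 'a topology)"
    unfolding Hausdorff_space_def
  proof (intro allI impI)
    fix x y :: 'a assume "x \<in> topspace euclidean \<and> y \<in> topspace euclidean \<and> x \<noteq> y"
    then obtain U V where "open U" "open V" "x \<in> U" "y \<in> V" "U \<inter> V = {}" using hausdorff[of x y] by auto
    then show "\<exists>U V. openin euclidean U \<and> openin euclidean V \<and> x \<in> U \<and> y \<in> V \<and> disjnt U V"
      by (intro exI[of _ U] exI[of _ V]) (simp add: disjnt_def)
  qed
qed

lemma (in compact_convex_space) affine_function_bounded:
  assumes "a \<in> affine_functions (mspace X)"
  obtains r where "r > 0" "\<forall>x. \<bar>a x\<bar> \<le> r"
proof -
  obtain B where B: "B > 0" "\<And>x. x \<in> mspace X \<Longrightarrow> \<bar>a x\<bar> \<le> B"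
    using compact_imp_bounded[OF compact_continuous_image[OF affine_functionsD(1)[OF assms] comp]]
    by (auto simp: bounded_pos)
  have "\<bar>a x\<bar> \<le> B" for x using B affine_functionsD(3)[OF assms, of x] by (cases "x \<in> mspace X") auto
  then show thesis using that B(1) by blast
qed

text \<open>Dividing by \<open>t\<close> gives a state, hence a point evaluation. If
  \<open>t = 0\<close>, every \<open>a\<close> lies between multiples of the unit, on which the
  functional vanishes.\<close>

lemma (in compact_convex_space) positive_functional_eval:
  assumes add: "\<And>a b. a \<in> affine_functions (mspace X) \<Longrightarrow> b \<in> affine_functions (mspace X) \<Longrightarrow> \<tau> (a + b) = \<tau> a + \<tau> b"
    and scale: "\<And>c a. a \<in> affine_functions (mspace X) \<Longrightarrow> \<tau> (c *\<^sub>R a) = c * \<tau> a"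
    and pos: "\<And>a. a \<in> affine_functions (mspace X) \<Longrightarrow> 0 \<le> a \<Longrightarrow> 0 \<le> \<tau> a"
    and t: "\<tau> (indicator (mspace X)) = (t::real)"
  shows "\<exists>x\<in>mspace X. \<forall>a\<in>affine_functions (mspace X). \<tau> a = t * a x"
proof (cases "t = 0")
  case True
  have "\<tau> a = 0" if a: "a \<in> affine_functions (mspace X)" for a
  proof -
    obtain r where r: "r > 0" "\<forall>x. \<bar>a x\<bar> \<le> r" using affine_function_bounded[OF a] by blast
    note u = affine_functions_scaleR[OF affine_functions_unit, of r]
    have "0 \<le> r *\<^sub>R indicator (mspace X) + c *\<^sub>R a" if "c = 1 \<or> c = -1" for c
      using r(2) that affine_functionsD(3)[OF a]
      by (auto simp: le_fun_def scaleR_fun_def indicator_def abs_le_iff) (smt (verit))+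
    from pos[OF affine_functions_add[OF u affine_functions_scaleR[OF a]] this]
    have "0 \<le> c * \<tau> a" if "c = 1 \<or> c = -1" for c
      using add[OF u affine_functions_scaleR[OF a]] scale[OF a] scale[OF affine_functions_unit] t True that by simp
    from this[of 1] this[of "-1"] show ?thesis by simp
  qed
  then show ?thesis using nonempty True by auto
next
  case False
  have "0 \<le> t" using pos[OF affine_functions_unit] t by (simp add: le_fun_def)
  then have t0: "t > 0" using False by simp
  define \<sigma> where "\<sigma> = (\<lambda>a. if a \<in> affine_functions (mspace X) then \<tau> a / t else 0)"
  have "\<sigma> \<in> state_space (Aff X)"
    unfolding state_space_def Aff_simps mem_Collect_eq \<sigma>_def
    using t0 t by (simp add: add scale pos affine_functions_add affine_functions_scaleR affine_functions_unit add_divide_distrib)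
  then obtain x where x: "x \<in> mspace X" "\<forall>a\<in>affine_functions (mspace X). \<sigma> a = a x" using state_eval by blast
  have "\<tau> a = t * a x" if "a \<in> affine_functions (mspace X)" for a
    using x(2) that t0 by (simp add: \<sigma>_def field_simps)
  then show ?thesis using x(1) by blast
qed

text \<open>The conditions \<open>lift\<close> and \<open>restrict\<close> give every Lipschitz
  affine function on one side a partner with the same constant on the other; thus both quotient
  seminorms come out exactly. The map \<open>g\<close> supplies a state of \<open>X\<close> near
  each state of \<open>Y\<close>.\<close>

locale bauer_bridge = bauer_pair X K Y M
  for X :: "'a::locally_convex_space metric" and K and Y :: "'b::locally_convex_space metric" and M +
  fixes f :: "'a \<Rightarrow> 'b" and g :: "'b \<Rightarrow> 'a" and \<delta> :: real
  assumes f: "f \<in> affine_maps X Y" and g: "g \<in> affine_maps Y X" and \<delta>: "\<delta> > 0"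
    and lift: "0 \<le> C \<Longrightarrow> affine_on (mspace X) a \<Longrightarrow> lip_on C X (mspace X) a \<Longrightarrow>
      \<exists>b. affine_on (mspace Y) b \<and> lip_on C Y (mspace Y) b \<and> (\<forall>x\<in>mspace X. \<bar>a x - b (f x)\<bar> \<le> C * \<delta>)"
    and restrict: "0 \<le> C \<Longrightarrow> affine_on (mspace Y) b \<Longrightarrow> lip_on C Y (mspace Y) b \<Longrightarrow>
      \<exists>a. affine_on (mspace X) a \<and> lip_on C X (mspace X) a \<and> (\<forall>x\<in>mspace X. \<bar>a x - b (f x)\<bar> \<le> C * \<delta>)"
    and section_close: "y \<in> mspace Y \<Longrightarrow> mdist Y (f (g y)) y \<le> \<delta>"
begin

lemma fY: "x \<in> mspace X \<Longrightarrow> f x \<in> mspace Y" and gX: "y \<in> mspace Y \<Longrightarrow> g y \<in> mspace X"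
  using affine_mapsD(3) f g by blast+

definition L :: "('a \<Rightarrow> real) \<times> ('b \<Rightarrow> real) \<Rightarrow> ennreal" where
  "L p = max (max (lip_const X (fst p)) (lip_const Y (snd p)))
    (SUP x\<in>mspace X. ennreal (\<bar>fst p x - snd p (f x)\<bar> / \<delta>))"

lemma L_le_iff:
  assumes C: "C \<ge> 0"
  shows "L (a, b) \<le> ennreal C \<longleftrightarrow> lip_on C X (mspace X) a \<and> lip_on C Y (mspace Y) b \<and>
    (\<forall>x\<in>mspace X. \<bar>a x - b (f x)\<bar> \<le> C * \<delta>)"
proof -
  have "ennreal (\<bar>a x - b (f x)\<bar> / \<delta>) \<le> ennreal C \<longleftrightarrow> \<bar>a x - b (f x)\<bar> \<le> C * \<delta>" for x
    using C \<delta> by (simp add: ennreal_le_iff pos_divide_le_eq)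
  then show ?thesis by (simp add: L_def SUP_le_iff lip_const_le_iff[OF C])
qed

lemma L_add: "L (a + a', b + b') \<le> L (a, b) + L (a', b')"
proof (cases "L (a, b) = \<top> \<or> L (a', b') = \<top>")
  case False
  then obtain C C' where C: "C \<ge> 0" "L (a, b) = ennreal C" "C' \<ge> 0" "L (a', b') = ennreal C'"
    by (cases "L (a, b)"; cases "L (a', b')") auto
  have 1: "lip_on C X (mspace X) a" "lip_on C Y (mspace Y) b" "\<forall>x\<in>mspace X. \<bar>a x - b (f x)\<bar> \<le> C * \<delta>"
    using L_le_iff[OF C(1), of a b] C(2) by auto
  have 2: "lip_on C' X (mspace X) a'" "lip_on C' Y (mspace Y) b'" "\<forall>x\<in>mspace X. \<bar>a' x - b' (f x)\<bar> \<le> C' * \<delta>"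
    using L_le_iff[OF C(3), of a' b'] C(4) by auto
  have "\<bar>(a + a') x - (b + b') (f x)\<bar> \<le> (C + C') * \<delta>" if "x \<in> mspace X" for x
    using 1(3)[rule_format, OF that] 2(3)[rule_format, OF that] by (simp add: distrib_right abs_le_iff)
  then have "L (a + a', b + b') \<le> ennreal (C + C')"
    using lip_on_add[OF 1(1) 2(1)] lip_on_add[OF 1(2) 2(2)] C
    by (subst L_le_iff) (simp_all add: plus_fun_def)
  then show ?thesis using C by simp
qed auto

lemma L_scaleR_le:
  assumes "c \<noteq> 0 \<or> L (a, b) \<noteq> \<top>"
  shows "L (c *\<^sub>R a, c *\<^sub>R b) \<le> ennreal \<bar>c\<bar> * L (a, b)"
proof (cases "L (a, b)")
  case (real C)
  have 1: "lip_on C X (mspace X) a" "lip_on C Y (mspace Y) b" "\<forall>x\<in>mspace X. \<bar>a x - b (f x)\<bar> \<le> C * \<delta>"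
    using L_le_iff[OF real(1), of a b] real(2) by auto
  have "\<bar>(c *\<^sub>R a) x - (c *\<^sub>R b) (f x)\<bar> \<le> \<bar>c\<bar> * C * \<delta>" if "x \<in> mspace X" for x
    using mult_left_mono[OF 1(3)[rule_format, OF that] abs_ge_zero[of c]]
    by (simp add: scaleR_fun_def right_diff_distrib[symmetric] abs_mult mult.assoc)
  then have "L (c *\<^sub>R a, c *\<^sub>R b) \<le> ennreal (\<bar>c\<bar> * C)"
    using lip_on_cmult[OF 1(1), of c] lip_on_cmult[OF 1(2), of c] real(1)
    by (subst L_le_iff) (simp_all add: scaleR_fun_def)
  then show ?thesis using real by (simp add: ennreal_mult)
next
  case top
  then show ?thesis using assms by (simp add: ennreal_mult_top)
qed

lemma L_zero: "L (0, 0) = 0"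
proof -
  have "L (0, 0) \<le> ennreal 0" by (subst L_le_iff) (simp_all add: lip_on_def)
  then show ?thesis by simp
qed

text \<open>One inequality is \<open>L_scaleR_le\<close>, the other is the same for
  \<open>inverse c\<close> and the scaled pair; the scalar 0 has no inverse and is treated
  separately.\<close>

lemma L_scaleR: "L (c *\<^sub>R a, c *\<^sub>R b) = ennreal \<bar>c\<bar> * L (a, b)"
proof (cases "c = 0")
  case True
  then show ?thesis using L_zero by simp
next
  case False
  have "L (inverse c *\<^sub>R (c *\<^sub>R a), inverse c *\<^sub>R (c *\<^sub>R b)) \<le> ennreal \<bar>inverse c\<bar> * L (c *\<^sub>R a, c *\<^sub>R b)"
    by (rule L_scaleR_le) (use False in simp)
  then have "L (a, b) \<le> ennreal \<bar>inverse c\<bar> * L (c *\<^sub>R a, c *\<^sub>R b)" using False by simp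
  then have "ennreal \<bar>c\<bar> * L (a, b) \<le> ennreal \<bar>c\<bar> * (ennreal \<bar>inverse c\<bar> * L (c *\<^sub>R a, c *\<^sub>R b))"
    by (rule mult_left_mono) simp
  also have "\<dots> = L (c *\<^sub>R a, c *\<^sub>R b)"
    using False by (simp add: mult.assoc[symmetric] ennreal_mult[symmetric] abs_mult[symmetric])
  finally show ?thesis using L_scaleR_le[of c a b] False by (intro antisym) simp_all
qed

lemma unit_scaleR: "c *\<^sub>R ounit E = (c *\<^sub>R indicator (mspace X), c *\<^sub>R indicator (mspace Y))"
  by (simp add: elems_E)

text \<open>Vanishing Lipschitz constants leave one constant on each side; the deviation along
  \<open>f\<close> forces them to agree, so the kernel is one-dimensional.\<close>

lemma L_kernel: "{p \<in> elems E. L p = 0} = range (\<lambda>c. c *\<^sub>R ounit E)"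
proof (intro equalityI subsetI)
  fix p assume "p \<in> {p \<in> elems E. L p = 0}"
  then obtain a b where p: "p = (a, b)" "a \<in> A" "b \<in> B" "L (a, b) = 0" by (auto simp: elems_E)
  have l: "lip_on 0 X (mspace X) a" "lip_on 0 Y (mspace Y) b" "\<forall>x\<in>mspace X. \<bar>a x - b (f x)\<bar> \<le> 0 * \<delta>"
    using L_le_iff[of 0 a b] p(4) by auto
  obtain x0 where x0: "x0 \<in> mspace X" using X.nonempty by auto
  define c where "c = a x0"
  have "a x = c" if "x \<in> mspace X" for x using lip_onD[OF l(1) that x0] by (simp add: c_def)
  then have "a = c *\<^sub>R indicator (mspace X)"
    using affine_functionsD(3)[OF p(2)] by (auto simp: fun_eq_iff scaleR_fun_def indicator_def)
  moreover have "b y = c" if "y \<in> mspace Y" for y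
    using lip_onD[OF l(2) that fY[OF x0]] l(3) x0 by (simp add: c_def)
  then have "b = c *\<^sub>R indicator (mspace Y)"
    using affine_functionsD(3)[OF p(3)] by (auto simp: fun_eq_iff scaleR_fun_def indicator_def)
  ultimately show "p \<in> range (\<lambda>c. c *\<^sub>R ounit E)" unfolding unit_scaleR p(1) by blast
next
  fix p assume "p \<in> range (\<lambda>c. c *\<^sub>R ounit E)"
  then obtain c where p: "p = (c *\<^sub>R indicator (mspace X), c *\<^sub>R indicator (mspace Y))" unfolding unit_scaleR by blast
  have "L p \<le> ennreal 0"
    unfolding p by (subst L_le_iff) (simp_all add: lip_on_def scaleR_fun_def fY)
  then show "p \<in> {p \<in> elems E. L p = 0}"
    using X.affine_functions_scaleR[OF X.affine_functions_unit] Y.affine_functions_scaleR[OF Y.affine_functions_unit]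
    by (simp add: elems_E p)
qed

lemma L_finite:
  assumes "a \<in> A" "b \<in> B" "lip_on C X (mspace X) a" "lip_on C' Y (mspace Y) b"
  shows "\<exists>D>0. L (a, b) \<le> ennreal D"
proof -
  obtain r where r: "r > 0" "\<forall>x. \<bar>a x\<bar> \<le> r" using X.affine_function_bounded[OF assms(1)] by blast
  obtain s where s: "s > 0" "\<forall>x. \<bar>b x\<bar> \<le> s" using Y.affine_function_bounded[OF assms(2)] by blast
  define D where "D = \<bar>C\<bar> + \<bar>C'\<bar> + (r + s) / \<delta>"
  have rs: "(r + s) / \<delta> > 0" using r s \<delta> by simp
  have D: "D > 0" "C \<le> D" "C' \<le> D" "(r + s) / \<delta> \<le> D" using rs unfolding D_def by linarith+
  have "\<bar>a x - b (f x)\<bar> \<le> D * \<delta>" for x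
  proof -
    have "\<bar>a x - b (f x)\<bar> \<le> r + s" using r(2)[rule_format, of x] s(2)[rule_format, of "f x"] by linarith
    also have "\<dots> \<le> D * \<delta>" using D(4) \<delta> by (simp add: divide_le_eq)
    finally show ?thesis .
  qed
  then have "L (a, b) \<le> ennreal D"
    using lip_on_mono[OF assms(3) D(2)] lip_on_mono[OF assms(4) D(3)] D(1) by (subst L_le_iff) auto
  then show ?thesis using D(1) by blast
qed

lemma order_unit_space: "is_order_unit_space E"
  unfolding is_order_unit_space_def elems_E
proof (intro conjI ballI impI)
  have sA: "subspace A" unfolding subspace_def
    using X.affine_functions_zero X.affine_functions_add X.affine_functions_scaleR by blast
  have sB: "subspace B" unfolding subspace_def
    using Y.affine_functions_zero Y.affine_functions_add Y.affine_functions_scaleR by blast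
  show "subspace (A \<times> B)" using sA sB by (rule subspace_Times)
  show "(indicator (mspace X), indicator (mspace Y)) \<in> A \<times> B"
    using X.affine_functions_unit Y.affine_functions_unit by simp
  fix p assume "p \<in> A \<times> B"
  then obtain a b where p: "p = (a, b)" "a \<in> A" "b \<in> B" by blast
  obtain r where r: "r > 0" "\<forall>x. \<bar>a x\<bar> \<le> r" using X.affine_function_bounded[OF p(2)] by blast
  obtain s where s: "s > 0" "\<forall>x. \<bar>b x\<bar> \<le> s" using Y.affine_function_bounded[OF p(3)] by blast
  have "a x \<le> max r s * indicator (mspace X) x" for x
    using r(2)[rule_format, of x] affine_functionsD(3)[OF p(2), of x] by (cases "x \<in> mspace X") auto
  moreover have "b y \<le> max r s * indicator (mspace Y) y" for y
    using s(2)[rule_format, of y] affine_functionsD(3)[OF p(3), of y] by (cases "y \<in> mspace Y") auto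
  ultimately have "p \<le> max r s *\<^sub>R (indicator (mspace X), indicator (mspace Y))"
    by (simp add: p(1) less_eq_prod_def le_fun_def scaleR_fun_def)
  then show "\<exists>r. p \<le> r *\<^sub>R (indicator (mspace X), indicator (mspace Y))" by blast
  show "p \<le> 0" if le: "\<forall>r>0. p \<le> r *\<^sub>R (indicator (mspace X), indicator (mspace Y))"
  proof -
    have le': "a x \<le> r * indicator (mspace X) x" "b y \<le> r * indicator (mspace Y) y" if "r > 0" for r x y
      using le that by (auto simp: p(1) less_eq_prod_def le_fun_def scaleR_fun_def)
    have "a x \<le> 0" for x
    proof (rule field_le_epsilon)
      fix e :: real assume e: "e > 0"
      have "e * indicator (mspace X) x \<le> e * 1" using e by (intro mult_left_mono) (auto simp: indicator_def)
      then show "a x \<le> 0 + e" using le'(1)[OF e, of x] by simp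
    qed
    moreover have "b y \<le> 0" for y
    proof (rule field_le_epsilon)
      fix e :: real assume e: "e > 0"
      have "e * indicator (mspace Y) y \<le> e * 1" using e by (intro mult_left_mono) (auto simp: indicator_def)
      then show "b y \<le> 0 + e" using le'(2)[OF e, of y] by simp
    qed
    ultimately show ?thesis by (simp add: p(1) less_eq_prod_def le_fun_def)
  qed
qed

text \<open>A state of the direct sum is a convex combination, with weight \<open>fst w\<close>, of
  evaluations on the two sides. The parameter set \<open>W\<close> is compact; at the weights 0 and
  1 the parametrisation is not injective.\<close>

definition state :: "real \<times> 'a \<times> 'b \<Rightarrow> ('a \<Rightarrow> real) \<times> ('b \<Rightarrow> real) \<Rightarrow> real" where
  "state w = (\<lambda>p. if p \<in> A \<times> B then fst w * fst p (fst (snd w)) + (1 - fst w) * snd p (snd (snd w)) else 0)"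

definition W :: "(real \<times> 'a \<times> 'b) set" where
  "W = {0..1} \<times> mspace X \<times> mspace Y"

lemma state_apply: "a \<in> A \<Longrightarrow> b \<in> B \<Longrightarrow> state (t, x, y) (a, b) = t * a x + (1 - t) * b y"
  by (simp add: state_def)

lemma state_space_E: "state_space E = state ` W"
proof (intro equalityI subsetI)
  fix \<sigma> assume "\<sigma> \<in> state_space E"
  then have add: "\<And>a b a' b'. a \<in> A \<Longrightarrow> b \<in> B \<Longrightarrow> a' \<in> A \<Longrightarrow> b' \<in> B \<Longrightarrow>
      \<sigma> (a + a', b + b') = \<sigma> (a, b) + \<sigma> (a', b')"
    and scale: "\<And>c a b. a \<in> A \<Longrightarrow> b \<in> B \<Longrightarrow> \<sigma> (c *\<^sub>R a, c *\<^sub>R b) = c * \<sigma> (a, b)"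
    and pos: "\<And>a b. a \<in> A \<Longrightarrow> b \<in> B \<Longrightarrow> 0 \<le> a \<Longrightarrow> 0 \<le> b \<Longrightarrow> 0 \<le> \<sigma> (a, b)"
    and one: "\<sigma> (indicator (mspace X), indicator (mspace Y)) = 1"
    and out: "\<And>p. p \<notin> A \<times> B \<Longrightarrow> \<sigma> p = 0"
    unfolding state_space_def elems_E by (auto simp: less_eq_prod_def)
  note zX = X.affine_functions_zero and zY = Y.affine_functions_zero
  define t where "t = \<sigma> (indicator (mspace X), 0)"
  obtain x where x: "x \<in> mspace X" "\<forall>a\<in>A. \<sigma> (a, 0) = t * a x"
    using X.positive_functional_eval[of "\<lambda>a. \<sigma> (a, 0)" t] add[OF _ zY _ zY] scale[OF _ zY] pos[OF _ zY]
    by (auto simp: t_def)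
  have t1: "\<sigma> (0, indicator (mspace Y)) = 1 - t"
    using add[OF X.affine_functions_unit zY zX Y.affine_functions_unit] one by (simp add: t_def)
  obtain y where y: "y \<in> mspace Y" "\<forall>b\<in>B. \<sigma> (0, b) = (1 - t) * b y"
    using Y.positive_functional_eval[of "\<lambda>b. \<sigma> (0, b)" "1 - t"] add[OF zX _ zX] scale[OF zX] pos[OF zX] t1 by auto
  have "0 \<le> t" "0 \<le> 1 - t"
    using pos[OF X.affine_functions_unit zY] pos[OF zX Y.affine_functions_unit] t1
    by (auto simp: t_def le_fun_def)
  then have "(t, x, y) \<in> W" using x(1) y(1) by (simp add: W_def)
  moreover have "\<sigma> p = state (t, x, y) p" for p
  proof (cases "p \<in> A \<times> B")
    case True
    then obtain a b where p: "p = (a, b)" "a \<in> A" "b \<in> B" by blast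
    have "\<sigma> (a, b) = \<sigma> (a, 0) + \<sigma> (0, b)" using add[OF p(2) zY zX p(3)] by simp
    then show ?thesis using x(2) y(2) p by (simp add: state_apply)
  qed (simp add: out state_def)
  then have "\<sigma> = state (t, x, y)" by (rule ext)
  ultimately show "\<sigma> \<in> state ` W" by (rule image_eqI[rotated])
next
  fix \<sigma> assume "\<sigma> \<in> state ` W"
  then obtain t x y where w: "\<sigma> = state (t, x, y)" "0 \<le> t" "t \<le> 1" "x \<in> mspace X" "y \<in> mspace Y" by (auto simp: W_def)
  show "\<sigma> \<in> state_space E"
    unfolding state_space_def elems_E mem_Collect_eq
  proof (intro conjI ballI allI impI)
    fix p assume "p \<in> A \<times> B"
    then obtain a b where p: "p = (a, b)" "a \<in> A" "b \<in> B" by blast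
    show "\<sigma> (p + q) = \<sigma> p + \<sigma> q" if "q \<in> A \<times> B" for q
    proof -
      obtain a' b' where q: "q = (a', b')" "a' \<in> A" "b' \<in> B" using \<open>q \<in> A \<times> B\<close> by blast
      show ?thesis
        using p q X.affine_functions_add Y.affine_functions_add by (simp add: w(1) state_apply algebra_simps)
    qed
    show "\<sigma> (c *\<^sub>R p) = c * \<sigma> p" for c
      using p X.affine_functions_scaleR Y.affine_functions_scaleR
      by (simp add: w(1) state_apply) (simp add: scaleR_fun_def algebra_simps)
    show "0 \<le> \<sigma> p" if "0 \<le> p"
      using that p w(2,3) by (simp add: w(1) state_apply less_eq_prod_def le_fun_def)
  next
    show "\<sigma> (indicator (mspace X), indicator (mspace Y)) = 1"
      using X.affine_functions_unit Y.affine_functions_unit w(4,5) by (simp add: w(1) state_apply)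
    show "\<sigma> p = 0" if "p \<notin> A \<times> B" for p using that by (simp add: w(1) state_def)
  qed
qed

lemma L_le_oneD:
  assumes "L (a, b) \<le> 1"
  shows "lip_on 1 X (mspace X) a" "lip_on 1 Y (mspace Y) b" "x \<in> mspace X \<Longrightarrow> \<bar>a x - b (f x)\<bar> \<le> \<delta>"
  using L_le_iff[of 1 a b] assms by auto

text \<open>Makes the parametrisation by \<open>W\<close> continuous for the metric of states. The
  constant \<open>D\<close> bounds the difference of \<open>a x\<close> and \<open>b y\<close> over
  all admissible pairs: the deviation \<delta> along \<open>f\<close> plus a diameter bound of
  \<open>Y\<close>.\<close>

lemma lip_rho_state_le:
  shows "\<exists>D>0. \<forall>t x y t' x' y'. (t, x, y) \<in> W \<longrightarrow> (t', x', y') \<in> W \<longrightarrow>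
    lip_rho E L (state (t, x, y)) (state (t', x', y')) \<le> ennreal (mdist X x x' + mdist Y y y' + \<bar>t - t'\<bar> * D)"
proof -
  obtain BY where BY: "BY > 0" "\<And>y y'. y \<in> mspace Y \<Longrightarrow> y' \<in> mspace Y \<Longrightarrow> mdist Y y y' \<le> BY"
    using compact_mdist_bounded[OF Y.top Y.comp] by blast
  define D where "D = \<delta> + BY"
  have D: "D > 0" using \<delta> BY by (simp add: D_def)
  have "lip_rho E L (state (t, x, y)) (state (t', x', y')) \<le> ennreal (mdist X x x' + mdist Y y y' + \<bar>t - t'\<bar> * D)"
    if w: "(t, x, y) \<in> W" "(t', x', y') \<in> W" for t x y t' x' y'
  proof (rule lip_rho_le)
    have x: "x \<in> mspace X" "x' \<in> mspace X" and y: "y \<in> mspace Y" "y' \<in> mspace Y" and t': "0 \<le> t'" "t' \<le> 1"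
      using w by (auto simp: W_def)
    fix p assume "p \<in> elems E" "L p \<le> 1"
    then obtain a b where p: "p = (a, b)" "a \<in> A" "b \<in> B" "L (a, b) \<le> 1" by (auto simp: elems_E)
    note l = L_le_oneD[OF p(4)]
    have 1: "\<bar>a x - a x'\<bar> \<le> mdist X x x'" "\<bar>b y - b y'\<bar> \<le> mdist Y y y'"
      using lip_onD[OF l(1) x] lip_onD[OF l(2) y] by simp_all
    have "\<bar>b (f x) - b y\<bar> \<le> BY" using lip_onD[OF l(2) fY[OF x(1)] y(1)] BY(2)[OF fY[OF x(1)] y(1)] by simp
    then have 2: "\<bar>a x - b y\<bar> \<le> D" using l(3)[OF x(1)] unfolding D_def by linarith
    have "state (t, x, y) p - state (t', x', y') p =
        t' * (a x - a x') + (1 - t') * (b y - b y') + (t - t') * (a x - b y)"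
      using p by (simp add: state_apply algebra_simps)
    also have "\<bar>\<dots>\<bar> \<le> \<bar>t' * (a x - a x')\<bar> + \<bar>(1 - t') * (b y - b y')\<bar> + \<bar>(t - t') * (a x - b y)\<bar>" by linarith
    also have "\<dots> \<le> 1 * mdist X x x' + 1 * mdist Y y y' + \<bar>t - t'\<bar> * D"
      unfolding abs_mult using 1 2 t' by (intro add_mono mult_mono) auto
    finally show "\<bar>state (t, x, y) p - state (t', x', y') p\<bar> \<le> mdist X x x' + mdist Y y y' + \<bar>t - t'\<bar> * D" by simp
  qed
  then show ?thesis using D by blast
qed

lemma lip_rho_finite: "\<sigma> \<in> state_space E \<Longrightarrow> \<tau> \<in> state_space E \<Longrightarrow> lip_rho E L \<sigma> \<tau> < \<infinity>"
proof -
  assume st: "\<sigma> \<in> state_space E" "\<tau> \<in> state_space E"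
  obtain w w' where w: "w \<in> W" "\<sigma> = state w" "w' \<in> W" "\<tau> = state w'" using st unfolding state_space_E by blast
  obtain D where "\<forall>t x y t' x' y'. (t, x, y) \<in> W \<longrightarrow> (t', x', y') \<in> W \<longrightarrow>
    lip_rho E L (state (t, x, y)) (state (t', x', y')) \<le> ennreal (mdist X x x' + mdist Y y y' + \<bar>t - t'\<bar> * D)"
    using lip_rho_state_le by blast
  then have "\<exists>r. lip_rho E L \<sigma> \<tau> \<le> ennreal r" using w by (cases w; cases w') blast
  then show ?thesis by (auto intro: le_less_trans)
qed

text \<open>Vanishing distance compares the states on pairs with \<open>L\<close> at most 1. Pairs
  of Lipschitz affine functions can be scaled to such pairs, and they approximate all pairs
  uniformly.\<close>

lemma states_separated:
  assumes st: "\<sigma> \<in> state_space E" "\<tau> \<in> state_space E" and zero: "lip_rho E L \<sigma> \<tau> = 0"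
  shows "\<sigma> = \<tau>"
proof
  obtain t x y where s: "\<sigma> = state (t, x, y)" "0 \<le> t" "t \<le> 1" "x \<in> mspace X" "y \<in> mspace Y"
    using st(1) unfolding state_space_E W_def by auto
  obtain t' x' y' where s': "\<tau> = state (t', x', y')" "0 \<le> t'" "t' \<le> 1" "x' \<in> mspace X" "y' \<in> mspace Y"
    using st(2) unfolding state_space_E W_def by auto
  fix p
  show "\<sigma> p = \<tau> p"
  proof (cases "p \<in> A \<times> B")
    case True
    then obtain a b where p: "p = (a, b)" "a \<in> A" "b \<in> B" by blast
    have "\<bar>\<sigma> p - \<tau> p\<bar> \<le> 0"
    proof (rule field_le_epsilon)
      fix e :: real assume "e > 0"
      then have e: "e / 2 > 0" by simp
      obtain C H where H: "C \<ge> 0" "affine_on (mspace X) H" "lip_on C X (mspace X) H" "\<forall>x\<in>mspace X. \<bar>H x - a x\<bar> \<le> e / 2"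
        using X.lip_affine_dense[OF affine_functionsD(1,2)[OF p(2)] e] by blast
      obtain C' G where G: "C' \<ge> 0" "affine_on (mspace Y) G" "lip_on C' Y (mspace Y) G" "\<forall>x\<in>mspace Y. \<bar>G x - b x\<bar> \<le> e / 2"
        using Y.lip_affine_dense[OF affine_functionsD(1,2)[OF p(3)] e] by blast
      define H0 where "H0 = zero_outside (mspace X) H"
      define G0 where "G0 = zero_outside (mspace Y) G"
      have H0: "H0 \<in> A" "lip_on C X (mspace X) H0" "\<forall>x\<in>mspace X. \<bar>H0 x - a x\<bar> \<le> e / 2"
        using X.zero_outside_affine[OF X.lip_cont[OF H(3)] H(2)] H(3,4) by (simp_all add: H0_def lip_on_zero_outside)
      have G0: "G0 \<in> B" "lip_on C' Y (mspace Y) G0" "\<forall>x\<in>mspace Y. \<bar>G0 x - b x\<bar> \<le> e / 2"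
        using Y.zero_outside_affine[OF Y.lip_cont[OF G(3)] G(2)] G(3,4) by (simp_all add: G0_def lip_on_zero_outside)
      obtain D where D: "D > 0" "L (H0, G0) \<le> ennreal D" using L_finite[OF H0(1) G0(1) H0(2) G0(2)] by blast
      define q where "q = (inverse D *\<^sub>R H0, inverse D *\<^sub>R G0)"
      have "L q \<le> ennreal (inverse D) * ennreal D"
        unfolding q_def L_scaleR using D by (intro mult_mono) auto
      also have "\<dots> = 1" using D(1) by (simp add: ennreal_mult[symmetric])
      finally have Lq: "L q \<le> 1" .
      have qE: "q \<in> elems E" using X.affine_functions_scaleR[OF H0(1)] Y.affine_functions_scaleR[OF G0(1)] by (simp add: q_def elems_E)
      have "\<bar>\<sigma> q - \<tau> q\<bar> \<le> 0" by (rule lip_rho_leD[of E L]) (simp_all add: zero qE Lq)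
      moreover have sc: "state (s, u, v) q = inverse D * (s * H0 u + (1 - s) * G0 v)" for s u v
      proof -
        have "state (s, u, v) q = s * (inverse D * H0 u) + (1 - s) * (inverse D * G0 v)"
          using qE unfolding q_def elems_E mem_Times_iff
          by (simp add: state_apply) (simp add: scaleR_fun_def)
        then show ?thesis by (simp add: distrib_left mult.left_commute)
      qed
      ultimately have eq: "t * H0 x + (1 - t) * G0 y = t' * H0 x' + (1 - t') * G0 y'"
        using D(1) unfolding s(1) s'(1) sc by simp
      have close: "\<bar>(s * H0 u + (1 - s) * G0 v) - (s * a u + (1 - s) * b v)\<bar> \<le> e / 2"
        if s: "0 \<le> s" "s \<le> 1" and uv: "u \<in> mspace X" "v \<in> mspace Y" for s u v
      proof -
        have "(s * H0 u + (1 - s) * G0 v) - (s * a u + (1 - s) * b v) = s * (H0 u - a u) + (1 - s) * (G0 v - b v)"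
          by (simp add: algebra_simps)
        also have "\<bar>\<dots>\<bar> \<le> s * \<bar>H0 u - a u\<bar> + (1 - s) * \<bar>G0 v - b v\<bar>"
          using s abs_triangle_ineq[of "s * (H0 u - a u)" "(1 - s) * (G0 v - b v)"] by (simp add: abs_mult)
        also have "\<dots> \<le> s * (e / 2) + (1 - s) * (e / 2)"
          using s uv H0(3) G0(3) by (intro add_mono mult_left_mono) auto
        also have "\<dots> = e / 2" unfolding distrib_right[symmetric] by simp
        finally show ?thesis .
      qed
      show "\<bar>\<sigma> p - \<tau> p\<bar> \<le> 0 + e"
        using close[OF s(2-5)] close[OF s'(2-5)] eq unfolding s(1) s'(1) p(1) state_apply[OF p(2,3)] by linarith
    qed
    then show ?thesis by simp
  qed (simp add: s(1) s'(1) state_def)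
qed

abbreviation "rho \<sigma> \<tau> \<equiv> enn2real (lip_rho E L \<sigma> \<tau>)"

lemma Metric_space_E: "Metric_space (state_space E) rho"
proof
  show "0 \<le> rho \<sigma> \<tau>" for \<sigma> \<tau> by simp
  show "rho \<sigma> \<tau> = rho \<tau> \<sigma>" for \<sigma> \<tau> by (simp add: lip_rho_def abs_minus_commute)
  fix \<sigma> \<tau> assume st: "\<sigma> \<in> state_space E" "\<tau> \<in> state_space E"
  have "lip_rho E L \<sigma> \<sigma> \<le> ennreal 0" by (rule lip_rho_le) simp
  then have "lip_rho E L \<sigma> \<sigma> = 0" by simp
  moreover have "lip_rho E L \<sigma> \<tau> = 0" if "rho \<sigma> \<tau> = 0"
    using that lip_rho_finite[OF st] by (auto simp: enn2real_eq_0_iff)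
  ultimately show "rho \<sigma> \<tau> = 0 \<longleftrightarrow> \<sigma> = \<tau>" using states_separated[OF st] by auto
  fix \<upsilon> assume u: "\<upsilon> \<in> state_space E"
  have fin: "lip_rho E L \<sigma> \<tau> = ennreal (rho \<sigma> \<tau>)" "lip_rho E L \<tau> \<upsilon> = ennreal (rho \<tau> \<upsilon>)"
    using ennreal_enn2real[OF lip_rho_finite[OF st, unfolded infinity_ennreal_def], symmetric]
      ennreal_enn2real[OF lip_rho_finite[OF st(2) u, unfolded infinity_ennreal_def], symmetric] .
  have "lip_rho E L \<sigma> \<upsilon> \<le> ennreal (rho \<sigma> \<tau> + rho \<tau> \<upsilon>)"
  proof (rule lip_rho_le)
    fix p assume p: "p \<in> elems E" "L p \<le> 1"
    have "\<bar>\<sigma> p - \<tau> p\<bar> \<le> rho \<sigma> \<tau>" by (rule lip_rho_leD[OF eq_refl[OF fin(1)] enn2real_nonneg p])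
    moreover have "\<bar>\<tau> p - \<upsilon> p\<bar> \<le> rho \<tau> \<upsilon>" by (rule lip_rho_leD[OF eq_refl[OF fin(2)] enn2real_nonneg p])
    ultimately show "\<bar>\<sigma> p - \<upsilon> p\<bar> \<le> rho \<sigma> \<tau> + rho \<tau> \<upsilon>" by linarith
  qed
  then show "rho \<sigma> \<upsilon> \<le> rho \<sigma> \<tau> + rho \<tau> \<upsilon>" by (intro enn2real_leI) auto
qed

lemma state_continuous: "continuous_on W state"
proof (rule continuous_on_coordinatewise_then_product)
  fix p
  show "continuous_on W (\<lambda>w. state w p)"
  proof (cases "p \<in> A \<times> B")
    case True
    then have "continuous_on (mspace X) (fst p)" "continuous_on (mspace Y) (snd p)"
      using affine_functionsD(1) by (auto simp: mem_Times_iff)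
    then have "continuous_on W (\<lambda>w. fst p (fst (snd w)))" "continuous_on W (\<lambda>w. snd p (snd (snd w)))"
      by (auto simp: W_def intro!: continuous_on_compose2[of "mspace X" "fst p"] continuous_on_compose2[of "mspace Y" "snd p"]
          continuous_on_fst continuous_on_snd continuous_on_id)
    then show ?thesis
      using True by (simp add: state_def) (intro continuous_on_add continuous_on_mult continuous_on_diff
          continuous_on_const continuous_on_fst continuous_on_id)
  qed (simp add: state_def)
qed

lemma compact_W: "compact W"
  unfolding W_def by (intro compact_Times compact_Icc X.comp Y.comp)

text \<open>The compact set \<open>W\<close> is mapped onto the state space by \<open>state\<close>,
  continuously for the weak topology and for the metric, so both are its quotient topology.\<close>

lemma mtopology_E: "Metric_space.mtopology (state_space E) rho = top_of_set (state_space E)"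
proof (rule compact_quotient_topologies_eq[of "top_of_set W" _ _ state, symmetric])
  interpret M: Metric_space "state_space E" rho by (rule Metric_space_E)
  show "compact_space (top_of_set W)" using compact_W by (simp add: compact_space_subtopology)
  show "Hausdorff_space (top_of_set (state_space E))"
    by (rule Hausdorff_space_top_of_set)
  show "Hausdorff_space M.mtopology" by (rule M.Hausdorff_space_mtopology)
  show "topspace (top_of_set (state_space E)) = topspace M.mtopology" by simp
  show "state ` topspace (top_of_set W) = topspace (top_of_set (state_space E))" by (simp add: state_space_E)
  show "continuous_map (top_of_set W) (top_of_set (state_space E)) state"
    using state_continuous by (auto simp: continuous_map_in_subtopology state_space_E)
  obtain D where D: "D > 0" "\<forall>t x y t' x' y'. (t, x, y) \<in> W \<longrightarrow> (t', x', y') \<in> W \<longrightarrow>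
    lip_rho E L (state (t, x, y)) (state (t', x', y')) \<le> ennreal (mdist X x x' + mdist Y y y' + \<bar>t - t'\<bar> * D)"
    using lip_rho_state_le by blast
  show "continuous_map (top_of_set W) M.mtopology state"
    unfolding M.continuous_map_to_metric
  proof (intro ballI allI impI)
    fix w and e :: real assume w: "w \<in> topspace (top_of_set W)" and e: "e > 0"
    obtain t x y where wt: "w = (t, x, y)" by (cases w)
    have txy: "x \<in> mspace X" "y \<in> mspace Y" "(t, x, y) \<in> W" using w by (auto simp: wt W_def)
    define h where "h = (\<lambda>v :: real \<times> 'a \<times> 'b. mdist X x (fst (snd v)) + mdist Y y (snd (snd v)) + \<bar>t - fst v\<bar> * D)"
    have "continuous_on W h"
      unfolding h_def
      by (intro continuous_on_add continuous_on_mult continuous_on_rabs continuous_on_diff continuous_on_const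
          continuous_on_fst continuous_on_snd continuous_on_id continuous_on_mdist[OF X.top] continuous_on_mdist[OF Y.top])
        (use txy in \<open>auto simp: W_def\<close>)
    then have "openin (top_of_set W) (W \<inter> h -` {..<e})" by (rule continuous_openin_preimage_gen) simp
    moreover have "w \<in> W \<inter> h -` {..<e}" using txy e by (simp add: h_def wt)
    moreover have "state v \<in> M.mball (state w) e" if v: "v \<in> W \<inter> h -` {..<e}" for v
    proof -
      obtain t' x' y' where vt: "v = (t', x', y')" by (cases v)
      have vW: "(t', x', y') \<in> W" using v vt by simp
      have hv: "mdist X x x' + mdist Y y y' + \<bar>t - t'\<bar> * D < e" using v by (simp add: h_def vt)
      have "rho (state w) (state v) \<le> mdist X x x' + mdist Y y y' + \<bar>t - t'\<bar> * D"
        using D(2) txy(3) vW unfolding wt vt by (intro enn2real_leI) (auto simp: less_imp_le[OF D(1)])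
      then have "rho (state w) (state v) < e" using hv by linarith
      moreover have "state w \<in> state_space E" "state v \<in> state_space E"
        using w v unfolding state_space_E by auto
      ultimately show ?thesis unfolding M.in_mball by blast
    qed
    ultimately show "\<exists>U. openin (top_of_set W) U \<and> w \<in> U \<and> (\<forall>v\<in>U. state v \<in> M.mball (state w) e)" by blast
  qed
qed

lemma lip_norm_L: "lip_norm E L"
  unfolding lip_norm_def
proof (intro conjI ballI allI)
  show "L (p + q) \<le> L p + L q" if "p \<in> elems E" "q \<in> elems E" for p q
    using L_add[of "fst p" "fst q" "snd p" "snd q"] by (cases p; cases q) simp
  show "L (c *\<^sub>R p) = ennreal \<bar>c\<bar> * L p" if "p \<in> elems E" for c p
    using L_scaleR[of c "fst p" "snd p"] by (cases p) simp
qed (fact order_unit_space L_kernel lip_rho_finite Metric_space_E mtopology_E)+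

text \<open>The infimum is attained at the partner function from \<open>lift\<close> or
  \<open>restrict\<close>: its Lipschitz constant and the deviation do not raise \<open>L\<close>
  above the given constant.\<close>

lemma induces_quotients_L: "induces_quotients (Aff X) (lip_const X) (Aff Y) (lip_const Y) L"
  unfolding induces_quotients_def
proof (intro conjI ballI)
  fix a assume "a \<in> elems (Aff X)"
  then have a: "a \<in> A" by (simp add: Aff_def)
  have "(INF b\<in>elems (Aff Y). L (a, b)) \<le> lip_const X a"
  proof (cases "lip_const X a")
    case (real C)
    then have l: "lip_on C X (mspace X) a" using lip_const_le_iff[of C X a] by simp
    obtain b where b: "affine_on (mspace Y) b" "lip_on C Y (mspace Y) b" "\<forall>x\<in>mspace X. \<bar>a x - b (f x)\<bar> \<le> C * \<delta>"
      using lift[OF real(1) affine_functionsD(2)[OF a] l] by blast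
    have "L (a, zero_outside (mspace Y) b) \<le> ennreal C"
      using l b(2,3) by (subst L_le_iff[OF real(1)]) (simp add: lip_on_zero_outside fY)
    then show ?thesis
      unfolding real(2) using Y.zero_outside_affine[OF Y.lip_cont[OF b(2)] b(1)]
      by (intro INF_lower2[of "zero_outside (mspace Y) b"]) (auto simp: Aff_def)
  qed simp
  moreover have "lip_const X a \<le> (INF b\<in>elems (Aff Y). L (a, b))"
    by (rule INF_greatest) (simp add: L_def max.coboundedI1)
  ultimately show "lip_const X a = (INF b\<in>elems (Aff Y). L (a, b))" by (rule antisym[rotated])
next
  fix b assume "b \<in> elems (Aff Y)"
  then have b: "b \<in> B" by (simp add: Aff_def)
  have "(INF a\<in>elems (Aff X). L (a, b)) \<le> lip_const Y b"
  proof (cases "lip_const Y b")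
    case (real C)
    then have l: "lip_on C Y (mspace Y) b" using lip_const_le_iff[of C Y b] by simp
    obtain a where a: "affine_on (mspace X) a" "lip_on C X (mspace X) a" "\<forall>x\<in>mspace X. \<bar>a x - b (f x)\<bar> \<le> C * \<delta>"
      using restrict[OF real(1) affine_functionsD(2)[OF b] l] by blast
    have "L (zero_outside (mspace X) a, b) \<le> ennreal C"
      using l a(2,3) by (subst L_le_iff[OF real(1)]) (simp add: lip_on_zero_outside)
    then show ?thesis
      unfolding real(2) using X.zero_outside_affine[OF X.lip_cont[OF a(2)] a(1)]
      by (intro INF_lower2[of "zero_outside (mspace X) a"]) (auto simp: Aff_def)
  qed simp
  moreover have "lip_const Y b \<le> (INF a\<in>elems (Aff X). L (a, b))"
    by (rule INF_greatest) (simp add: L_def max.coboundedI1)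
  ultimately show "lip_const Y b = (INF a\<in>elems (Aff X). L (a, b))" by (rule antisym[rotated])
qed

text \<open>A point \<open>x\<close> is matched with \<open>f x\<close> at cost \<delta>, a point
  \<open>y\<close> with \<open>g y\<close> at cost 2 \<delta>: the deviation along \<open>f\<close>
  and the distance from \<open>f (g y)\<close> to \<open>y\<close>.\<close>

lemma dist_q_le: "dist_q (Aff X) (lip_const X) (Aff Y) (lip_const Y) \<le> ennreal (2 * \<delta>)"
proof -
  have lr: "lip_rho E L (left x) (right (f x)) \<le> ennreal (2 * \<delta>)" if x: "x \<in> mspace X" for x
  proof (rule lip_rho_le)
    fix p assume "p \<in> elems E" "L p \<le> 1"
    then obtain a b where p: "p = (a, b)" "a \<in> A" "b \<in> B" "L (a, b) \<le> 1" by (auto simp: elems_E)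
    then show "\<bar>left x p - right (f x) p\<bar> \<le> 2 * \<delta>"
      using L_le_oneD(3)[OF p(4) x] \<delta> by (simp add: left_def right_def)
  qed
  have rl: "lip_rho E L (left (g y)) (right y) \<le> ennreal (2 * \<delta>)" if y: "y \<in> mspace Y" for y
  proof (rule lip_rho_le)
    fix p assume "p \<in> elems E" "L p \<le> 1"
    then obtain a b where p: "p = (a, b)" "a \<in> A" "b \<in> B" "L (a, b) \<le> 1" by (auto simp: elems_E)
    note l = L_le_oneD[OF p(4)]
    have "\<bar>b (f (g y)) - b y\<bar> \<le> \<delta>" using lip_onD[OF l(2) fY[OF gX[OF y]] y] section_close[OF y] by simp
    then show "\<bar>left (g y) p - right y p\<bar> \<le> 2 * \<delta>"
      using l(3)[OF gX[OF y]] p by (simp add: left_def right_def abs_le_iff)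
  qed
  have "hausdorff_dist (lip_rho E L) (left_states (Aff X) (Aff Y)) (right_states (Aff X) (Aff Y)) \<le> ennreal (2 * \<delta>)"
    unfolding hausdorff_dist_def left_states_eq right_states_eq
  proof (intro max.boundedI SUP_least)
    fix s assume "s \<in> left ` mspace X"
    then obtain x where x: "x \<in> mspace X" "s = left x" by blast
    show "(INF b\<in>right ` mspace Y. lip_rho E L s b) \<le> ennreal (2 * \<delta>)"
      using lr[OF x(1)] fY[OF x(1)] unfolding x(2) by (intro INF_lower2[of "right (f x)"]) auto
  next
    fix s assume "s \<in> right ` mspace Y"
    then obtain y where y: "y \<in> mspace Y" "s = right y" by blast
    show "(INF a\<in>left ` mspace X. lip_rho E L a s) \<le> ennreal (2 * \<delta>)"
      using rl[OF y(1)] gX[OF y(1)] unfolding y(2) by (intro INF_lower2[of "left (g y)"]) auto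
  qed
  then show ?thesis
    unfolding dist_q_def using lip_norm_L induces_quotients_L by (intro INF_lower2[of L]) auto
qed

end

text \<open>The partner of \<open>a\<close> is a smoothing of its composite with \<open>g\<close>.
  Since \<open>g\<close> increases distances by at most 3 \<epsilon>, the smoothing costs 3
  \<epsilon>, and \<open>g (f x)\<close> differs from \<open>x\<close> by at most 2 \<epsilon>. This
  gives the bridge parameter 5 \<epsilon>, which \<open>dist_q_le\<close> doubles.\<close>

lemma isom_eps_dist_q:
  assumes X: "bauer_model X K" and Y: "bauer_model Y M" and f: "f \<in> isom_eps \<epsilon> X Y"
  shows "dist_q (Aff X) (lip_const X) (Aff Y) (lip_const Y) \<le> ennreal (10 * \<epsilon>)"
proof -
  interpret bauer_pair X K Y M using X Y by (simp add: bauer_pair_def)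
  note F = isom_epsD[OF f]
  obtain g where g: "g \<in> affine_maps Y X" "\<And>y. y \<in> mspace Y \<Longrightarrow> mdist Y (f (g y)) y < \<epsilon>"
    using F(3) by blast
  note fm = affine_mapsD(3)[OF F(1)] and gm = affine_mapsD(3)[OF g(1)]
  obtain x0 where "x0 \<in> mspace X" using X.nonempty by blast
  then have eps: "\<epsilon> > 0" using F(2)[of x0 x0] fm[of x0] by simp
  have gd: "mdist X (g y) (g y') \<le> mdist Y y y' + 3 * \<epsilon>" if y: "y \<in> mspace Y" "y' \<in> mspace Y" for y y'
  proof -
    note fg = fm[OF gm[OF y(1)]] fm[OF gm[OF y(2)]]
    show ?thesis
      using F(2)[OF gm[OF y(1)] gm[OF y(2)]] mdist_triangle[OF fg(1) y(1) fg(2)] mdist_triangle[OF y fg(2)]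
        g(2)[OF y(1)] g(2)[OF y(2)] by (simp add: mdist_commute abs_less_iff)
  qed
  have gfd: "mdist X (g (f x)) x \<le> 2 * \<epsilon>" if x: "x \<in> mspace X" for x
    using F(2)[OF gm[OF fm[OF x]] x] g(2)[OF fm[OF x]] by linarith
  have "bauer_bridge X K Y M f g (5 * \<epsilon>)"
  proof unfold_locales
    show "f \<in> affine_maps X Y" "g \<in> affine_maps Y X" by (rule F(1) g(1))+
    show "5 * \<epsilon> > 0" using eps by simp
    show "mdist Y (f (g y)) y \<le> 5 * \<epsilon>" if "y \<in> mspace Y" for y using g(2)[OF that] eps by simp
    fix C :: real assume C: "0 \<le> C"
    show "\<exists>b. affine_on (mspace Y) b \<and> lip_on C Y (mspace Y) b \<and> (\<forall>x\<in>mspace X. \<bar>a x - b (f x)\<bar> \<le> C * (5 * \<epsilon>))"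
      if a: "affine_on (mspace X) a" "lip_on C X (mspace X) a" for a
    proof -
      have "\<exists>b. affine_on (mspace Y) b \<and> lip_on C Y (mspace Y) b \<and> (\<forall>y\<in>mspace Y. \<bar>b y - a (g y)\<bar> \<le> C * (3 * \<epsilon>))"
      proof (rule Y.smooth_almost_lip[OF _ _ C])
        show "continuous_on (mspace Y) (\<lambda>y. a (g y))"
          using X.continuous_compose[OF g(1) X.lip_cont[OF a(2)]] by (simp add: continuous_map_real_iff[OF Y.top])
        show "affine_on (mspace Y) (\<lambda>y. a (g y))"
          by (rule affine_on_compose[OF affine_mapsD(2)[OF g(1)] a(1)]) (use gm in blast)
        fix k k' assume k: "k \<in> M" "k' \<in> M"
        note kY = Y.K_mspace[OF k(1)] Y.K_mspace[OF k(2)]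
        have "a (g k) - a (g k') \<le> C * mdist X (g k) (g k')" using lip_onD[OF a(2) gm[OF kY(1)] gm[OF kY(2)]] by simp
        also have "\<dots> \<le> C * (mdist Y k k' + 3 * \<epsilon>)" by (rule mult_left_mono[OF gd[OF kY] C])
        finally show "a (g k) - a (g k') \<le> C * mdist Y k k' + C * (3 * \<epsilon>)" by (simp add: distrib_left)
      qed
      then obtain b where b: "affine_on (mspace Y) b" "lip_on C Y (mspace Y) b" "\<forall>y\<in>mspace Y. \<bar>b y - a (g y)\<bar> \<le> C * (3 * \<epsilon>)"
        by blast
      have "\<bar>a x - b (f x)\<bar> \<le> C * (5 * \<epsilon>)" if x: "x \<in> mspace X" for x
      proof -
        have "\<bar>a (g (f x)) - a x\<bar> \<le> C * mdist X (g (f x)) x" by (rule lip_onD[OF a(2) gm[OF fm[OF x]] x])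
        also have "\<dots> \<le> C * (2 * \<epsilon>)" by (rule mult_left_mono[OF gfd[OF x] C])
        finally have "\<bar>a (g (f x)) - a x\<bar> \<le> C * (2 * \<epsilon>)" .
        moreover have "\<bar>b (f x) - a (g (f x))\<bar> \<le> C * (3 * \<epsilon>)" using b(3) fm[OF x] by blast
        ultimately show ?thesis by (simp add: abs_le_iff)
      qed
      then show ?thesis using b(1,2) by blast
    qed
    show "\<exists>a. affine_on (mspace X) a \<and> lip_on C X (mspace X) a \<and> (\<forall>x\<in>mspace X. \<bar>a x - b (f x)\<bar> \<le> C * (5 * \<epsilon>))"
      if b: "affine_on (mspace Y) b" "lip_on C Y (mspace Y) b" for b
    proof -
      have "\<exists>a. affine_on (mspace X) a \<and> lip_on C X (mspace X) a \<and> (\<forall>x\<in>mspace X. \<bar>a x - b (f x)\<bar> \<le> C * (5 * \<epsilon>))"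
      proof (rule X.smooth_almost_lip[OF _ _ C])
        show "continuous_on (mspace X) (\<lambda>x. b (f x))"
          using Y.continuous_compose[OF F(1) Y.lip_cont[OF b(2)]] by (simp add: continuous_map_real_iff[OF X.top])
        show "affine_on (mspace X) (\<lambda>x. b (f x))"
          by (rule affine_on_compose[OF affine_mapsD(2)[OF F(1)] b(1)]) (use fm in blast)
        fix k k' assume k: "k \<in> K" "k' \<in> K"
        note kX = X.K_mspace[OF k(1)] X.K_mspace[OF k(2)]
        have "b (f k) - b (f k') \<le> C * mdist Y (f k) (f k')" using lip_onD[OF b(2) fm[OF kX(1)] fm[OF kX(2)]] by simp
        also have "\<dots> \<le> C * (mdist X k k' + 5 * \<epsilon>)" using F(2)[OF kX] eps by (intro mult_left_mono C) linarith
        finally show "b (f k) - b (f k') \<le> C * mdist X k k' + C * (5 * \<epsilon>)" by (simp add: distrib_left)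
      qed
      then show ?thesis .
    qed
  qed
  from bauer_bridge.dist_q_le[OF this] show ?thesis by simp
qed

section \<open>Simplices with a prescribed boundary metric\<close>

lemma convex_closure_fun:
  fixes S :: "('i \<Rightarrow> real) set"
  assumes "convex S"
  shows "convex (closure S)"
  unfolding convex_def
proof (intro ballI allI impI)
  fix x y and u v :: real assume xy: "x \<in> closure S" "y \<in> closure S" and uv: "0 \<le> u" "0 \<le> v" "u + v = 1"
  define m where "m = (\<lambda>p. u *\<^sub>R fst p + v *\<^sub>R (snd p :: 'i \<Rightarrow> real))"
  have "continuous_on UNIV m"
    unfolding m_def
    by (intro continuous_on_add continuous_on_scaleR_lcs continuous_on_const continuous_on_fst continuous_on_snd continuous_on_id)
  moreover have "m ` (S \<times> S) \<subseteq> closure S"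
    using assms uv closure_subset by (force simp: m_def convex_def)
  ultimately have "m ` closure (S \<times> S) \<subseteq> closure S"
    by (intro image_closure_subset) (auto intro: continuous_on_subset)
  moreover have "(x, y) \<in> closure (S \<times> S)" using xy by (simp add: closure_Times)
  ultimately show "u *\<^sub>R x + v *\<^sub>R y \<in> closure S" unfolding m_def by force
qed

text \<open>A totally bounded pseudometric on the natural numbers: the data of a compact metric space
  together with a dense sequence.\<close>

locale totally_bounded_pseudometric =
  fixes d :: "nat \<Rightarrow> nat \<Rightarrow> real"
  assumes d_refl: "d i i = 0" and d_sym: "d i j = d j i" and d_triangle: "d i k \<le> d i j + d j k"
    and totally_bounded: "\<epsilon> > 0 \<Longrightarrow> \<exists>F. finite F \<and> (\<forall>j. \<exists>i\<in>F. d i j < \<epsilon>)"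
begin

lemma d_nonneg: "0 \<le> d i j"
  using d_triangle[of i i j] d_sym[of i j] d_refl[of i] by simp

lemma d_bounded: "\<exists>B>0. \<forall>i j. d i j \<le> B"
proof -
  obtain F where F: "finite F" "\<And>j. \<exists>i\<in>F. d i j < 1" using totally_bounded[of 1] by auto
  define C where "C = (\<Sum>i\<in>F. \<Sum>j\<in>F. d i j)"
  have "d i j \<le> C + 2" for i j
  proof -
    obtain p q where pq: "p \<in> F" "d p i < 1" "q \<in> F" "d q j < 1" using F(2) by metis
    have "d p q \<le> (\<Sum>j\<in>F. d p j)" using pq F(1) d_nonneg by (intro member_le_sum) auto
    also have "\<dots> \<le> C"
      unfolding C_def using pq F(1) d_nonneg by (intro member_le_sum[of p F "\<lambda>i. \<Sum>j\<in>F. d i j"]) (auto intro: sum_nonneg)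
    finally show ?thesis
      using d_triangle[of i j p] d_triangle[of p j q] d_sym[of i p] pq by linarith
  qed
  moreover have "C \<ge> 0" unfolding C_def by (intro sum_nonneg d_nonneg)
  ultimately show ?thesis by (intro exI[of _ "C + 2"]) auto
qed

definition nonexp :: "(nat \<Rightarrow> real) \<Rightarrow> bool" where
  "nonexp h \<longleftrightarrow> (\<forall>i j. h i - h j \<le> d i j)"

lemma nonexpD: "nonexp h \<Longrightarrow> \<bar>h i - h j\<bar> \<le> d i j"
  unfolding nonexp_def by (metis abs_le_iff d_sym minus_diff_eq)

text \<open>Lower envelopes of finitely many cones with rational heights. There are countably many,
  and by total boundedness they are uniformly dense in the nonexpansive functions.\<close>

definition cone_min :: "(rat \<times> nat) list \<Rightarrow> nat \<Rightarrow> real" where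
  "cone_min l j = Min ((\<lambda>p. real_of_rat (fst p) + d (snd p) j) ` set l)"

lemma nonexp_cone_min:
  assumes "l \<noteq> []"
  shows "nonexp (cone_min l)"
  unfolding nonexp_def
proof (intro allI)
  fix i j
  have "cone_min l j \<in> (\<lambda>p. real_of_rat (fst p) + d (snd p) j) ` set l"
    unfolding cone_min_def using assms by (intro Min_in) auto
  then obtain p where p: "p \<in> set l" "cone_min l j = real_of_rat (fst p) + d (snd p) j" by blast
  have "cone_min l i \<le> real_of_rat (fst p) + d (snd p) i"
    unfolding cone_min_def using p(1) by (intro Min_le) auto
  then show "cone_min l i - cone_min l j \<le> d i j"
    using p(2) d_triangle[of "snd p" i j] d_sym[of i j] by linarith
qed

lemma cone_min_dense:
  assumes h: "nonexp h" and e: "e > 0"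
  shows "\<exists>l. l \<noteq> [] \<and> (\<forall>j. \<bar>h j - cone_min l j\<bar> \<le> e)"
proof -
  have e4: "e / 4 > 0" using e by simp
  obtain F where F: "finite F" "\<forall>j. \<exists>i\<in>F. d i j < e / 4" using totally_bounded[OF e4] by blast
  obtain xs where xs: "set xs = F" using finite_list[OF F(1)] by blast
  have "\<forall>i. \<exists>q. h i < real_of_rat q \<and> real_of_rat q < h i + e / 4"
    using of_rat_dense e4 by (intro allI) (meson less_add_same_cancel1)
  then obtain q where "\<forall>i. h i < real_of_rat (q i) \<and> real_of_rat (q i) < h i + e / 4"
    unfolding choice_iff by (rule exE)
  then have q: "\<And>i. h i < real_of_rat (q i)" "\<And>i. real_of_rat (q i) < h i + e / 4" by simp_all
  define l where "l = map (\<lambda>i. (q i, i)) xs"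
  have "xs \<noteq> []" using xs F(2) by auto
  then have l: "l \<noteq> []" by (simp add: l_def)
  have "\<bar>h j - cone_min l j\<bar> \<le> e" for j
  proof -
    have "cone_min l j \<in> (\<lambda>p. real_of_rat (fst p) + d (snd p) j) ` set l"
      unfolding cone_min_def using l by (intro Min_in) auto
    then obtain i where i: "i \<in> F" "cone_min l j = real_of_rat (q i) + d i j" using xs by (auto simp: l_def)
    have "h j \<le> cone_min l j" using i(2) q(1)[of i] nonexpD[OF h, of j i] d_sym[of i j] by linarith
    moreover obtain i' where i': "i' \<in> F" "d i' j < e / 4" using F(2) by blast
    have "cone_min l j \<le> real_of_rat (q i') + d i' j"
      unfolding cone_min_def using i'(1) xs by (intro Min_le) (auto simp: l_def image_image)
    then have "cone_min l j \<le> h j + e"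
      using q(2)[of i'] i'(2) nonexpD[OF h, of i' j] e by linarith
    ultimately show ?thesis by linarith
  qed
  then show ?thesis using l by blast
qed

lemma dense_nonexp_sequence:
  "\<exists>g :: nat \<Rightarrow> nat \<Rightarrow> real. (\<forall>n. nonexp (g n)) \<and> (\<forall>h e. nonexp h \<longrightarrow> e > 0 \<longrightarrow> (\<exists>n. \<forall>j. \<bar>h j - g n j\<bar> \<le> e))"
proof -
  define S where "S = cone_min ` {l. l \<noteq> []}"
  have "countable S" unfolding S_def by (intro countable_image countableI_type)
  moreover have "cone_min [(0, 0)] \<in> S" unfolding S_def by blast
  then have ne: "S \<noteq> {}" by blast
  ultimately have r: "range (from_nat_into S) = S" by (rule range_from_nat_into[rotated])
  have "nonexp (from_nat_into S n)" for n
    using from_nat_into[OF ne, of n] nonexp_cone_min by (auto simp: S_def)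
  moreover have "\<exists>n. \<forall>j. \<bar>h j - from_nat_into S n j\<bar> \<le> e" if h: "nonexp h" and e: "e > 0" for h and e :: real
  proof -
    obtain l where l: "l \<noteq> []" "\<forall>j. \<bar>h j - cone_min l j\<bar> \<le> e" using cone_min_dense[OF h e] by blast
    have "cone_min l \<in> S" unfolding S_def using l(1) by blast
    then have "cone_min l \<in> range (from_nat_into S)" unfolding r .
    then obtain n where "cone_min l = from_nat_into S n" by blast
    then show ?thesis using l(2) by (intro exI[of _ n]) simp
  qed
  ultimately show ?thesis by blast
qed

definition g :: "nat \<Rightarrow> nat \<Rightarrow> real" where
  "g = (SOME g. (\<forall>n. nonexp (g n)) \<and> (\<forall>h e. nonexp h \<longrightarrow> e > 0 \<longrightarrow> (\<exists>n. \<forall>j. \<bar>h j - g n j\<bar> \<le> e)))"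

lemma g: "nonexp (g n)" "nonexp h \<Longrightarrow> e > 0 \<Longrightarrow> \<exists>n. \<forall>j. \<bar>h j - g n j\<bar> \<le> e"
proof -
  have "(\<forall>n. nonexp (g n)) \<and> (\<forall>h e. nonexp h \<longrightarrow> e > 0 \<longrightarrow> (\<exists>n. \<forall>j. \<bar>h j - g n j\<bar> \<le> e))"
    unfolding g_def by (rule someI_ex[OF dense_nonexp_sequence])
  then show "nonexp (g n)" "nonexp h \<Longrightarrow> e > 0 \<Longrightarrow> \<exists>n. \<forall>j. \<bar>h j - g n j\<bar> \<le> e" by simp_all
qed

definition \<Phi> :: "nat \<Rightarrow> nat \<Rightarrow> real" where
  "\<Phi> j = (\<lambda>n. g n j)"

definition Z :: "(nat \<Rightarrow> real) set" where
  "Z = closure (convex hull (range \<Phi>))"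

lemma \<Phi>_Z: "\<Phi> j \<in> Z"
  unfolding Z_def by (intro subsetD[OF closure_subset] hull_inc rangeI)

lemma convex_Z: "convex Z"
  unfolding Z_def by (intro convex_closure_fun convex_convex_hull)

text \<open>The part of \<open>Z\<close> where \<open>H\<close> is at most \<open>c\<close> is
  convex and closed, hence all of \<open>Z\<close>. Estimates on \<open>Z\<close> are reduced to the
  points \<Phi> \<open>j\<close> in this way.\<close>

lemma affine_le_hull:
  fixes H :: "(nat \<Rightarrow> real) \<Rightarrow> real"
  assumes H: "continuous_on Z H" "affine_on Z H" and le: "\<And>j. H (\<Phi> j) \<le> c" and x: "x \<in> Z"
  shows "H x \<le> c"
proof -
  have hull_Z: "convex hull (range \<Phi>) \<subseteq> Z" unfolding Z_def by (rule closure_subset)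
  have "convex {x \<in> Z. H x \<le> c}"
    unfolding convex_def
  proof (intro ballI allI impI)
    fix x y and u v :: real
    assume xy: "x \<in> {x \<in> Z. H x \<le> c}" "y \<in> {x \<in> Z. H x \<le> c}" and uv: "0 \<le> u" "0 \<le> v" "u + v = 1"
    have "H (u *\<^sub>R x + v *\<^sub>R y) = u * H x + v * H y" using affine_onD[OF H(2)] xy uv by simp
    also have "\<dots> \<le> u * c + v * c" using xy uv by (intro add_mono mult_left_mono) auto
    also have "\<dots> = c" using uv by (simp add: distrib_right[symmetric])
    finally show "u *\<^sub>R x + v *\<^sub>R y \<in> {x \<in> Z. H x \<le> c}"
      using convex_Z xy uv by (simp add: convex_def)
  qed
  then have sub: "convex hull (range \<Phi>) \<subseteq> {x \<in> Z. H x \<le> c}"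
    using le \<Phi>_Z by (intro hull_minimal) auto
  have "closed {x \<in> Z. H x \<le> c}"
  proof -
    have "{x \<in> Z. H x \<le> c} = Z \<inter> H -` {..c}" by auto
    moreover have "closed (Z \<inter> H -` {..c})"
      by (rule continuous_closed_preimage[OF H(1)]) (simp_all add: Z_def)
    ultimately show ?thesis by simp
  qed
  then have "Z \<subseteq> {x \<in> Z. H x \<le> c}" using closure_minimal[OF sub] by (simp add: Z_def)
  then show ?thesis using x by blast
qed

lemma coord_continuous: "continuous_on S (\<lambda>x :: nat \<Rightarrow> real. x n)"
  by (rule continuous_on_subset[OF continuous_on_product_coordinates]) simp

lemma coord_affine: "affine_on S (\<lambda>x :: nat \<Rightarrow> real. x n)"
  by (simp add: affine_on_def scaleR_fun_def)

text \<open>Two passes through \<open>affine_le_hull\<close>, one variable at a time.\<close>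

lemma coord_diff_le:
  assumes "\<And>i j. g n i - g n j \<le> c" "x \<in> Z" "y \<in> Z"
  shows "x n - y n \<le> c"
proof -
  have 1: "x n - \<Phi> j n \<le> c" if "x \<in> Z" for x j
    by (rule affine_le_hull[of "\<lambda>x. x n - \<Phi> j n", OF _ _ _ that])
      (use assms(1) in \<open>auto intro!: affine_on_diff coord_affine continuous_on_diff coord_continuous continuous_on_const simp: \<Phi>_def\<close>)
  show ?thesis
    by (rule affine_le_hull[of "\<lambda>y. x n - y n", OF _ _ _ assms(3)])
      (use 1[OF assms(2)] in \<open>auto intro!: affine_on_diff coord_affine continuous_on_diff coord_continuous continuous_on_const\<close>)
qed

section \<open>Compactness and the supremum metric on the hull\<close>

lemma compact_Z: "compact Z"
proof -
  obtain B where B: "B > 0" "\<And>i j. d i j \<le> B" using d_bounded by blast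
  have "g n i - g n j \<le> B" for n i j using nonexpD[OF g(1), of n i j] B(2)[of i j] by linarith
  from coord_diff_le[OF this] have le: "x n - y n \<le> B" if "x \<in> Z" "y \<in> Z" for x y n using that by blast
  define I where "I = (\<lambda>n. {\<Phi> 0 n - B .. \<Phi> 0 n + B})"
  have "compactin (product_topology (\<lambda>_. euclidean) UNIV) (PiE UNIV I)"
    by (subst compactin_PiE) (simp add: I_def)
  then have cI: "compact (PiE UNIV I)" by (simp add: euclidean_product_topology)
  have "x n \<in> I n" if "x \<in> Z" for x n
    using le[OF that \<Phi>_Z, of n 0] le[OF \<Phi>_Z that, of 0 n] by (auto simp: I_def)
  then have "Z \<subseteq> PiE UNIV I" by auto
  moreover have "closed Z" by (simp add: Z_def)
  ultimately show ?thesis using closed_Int_compact[OF _ cI, of Z] by (simp add: Int_absorb2)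
qed

text \<open>The value 0 off \<open>Z\<close> keeps \<open>D\<close> nonnegative everywhere, as
  \<open>Metric_space\<close> demands, even where the coordinates differ unboundedly.\<close>

definition D :: "(nat \<Rightarrow> real) \<Rightarrow> (nat \<Rightarrow> real) \<Rightarrow> real" where
  "D x y = (if x \<in> Z \<and> y \<in> Z then SUP n. \<bar>x n - y n\<bar> else 0)"

lemma D_upper:
  assumes "x \<in> Z" "y \<in> Z"
  shows "\<bar>x n - y n\<bar> \<le> D x y"
proof -
  obtain B where B: "B > 0" "\<And>i j. d i j \<le> B" using d_bounded by blast
  have gB: "g n i - g n j \<le> B" for n i j using nonexpD[OF g(1), of n i j] B(2)[of i j] by linarith
  have "\<bar>x n - y n\<bar> \<le> B" for n
    using coord_diff_le[OF gB assms, of n] coord_diff_le[OF gB assms(2,1), of n] by (simp add: abs_le_iff)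
  then have "\<bar>x n - y n\<bar> \<le> (SUP n. \<bar>x n - y n\<bar>)" by (intro cSUP_upper bdd_aboveI2) auto
  then show ?thesis using assms by (simp add: D_def)
qed

lemma D_least: "x \<in> Z \<Longrightarrow> y \<in> Z \<Longrightarrow> (\<And>n. \<bar>x n - y n\<bar> \<le> c) \<Longrightarrow> D x y \<le> c"
  unfolding D_def by (auto intro: cSUP_least)

lemma D_nonneg: "0 \<le> D x y"
proof (cases "x \<in> Z \<and> y \<in> Z")
  case True
  then show ?thesis using D_upper[of x y 0] by linarith
qed (auto simp: D_def)

lemma Metric_space_Z: "Metric_space Z D"
proof
  show "0 \<le> D x y" for x y by (rule D_nonneg)
  show "D x y = D y x" for x y by (simp add: D_def abs_minus_commute)
  show "D x y = 0 \<longleftrightarrow> x = y" if "x \<in> Z" "y \<in> Z" for x y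
  proof
    assume "D x y = 0"
    then have "x n = y n" for n using D_upper[OF that, of n] by simp
    then show "x = y" by (rule ext)
  next
    assume "x = y"
    then have "D x y \<le> 0" using that by (intro D_least) auto
    then show "D x y = 0" using D_nonneg[of x y] by simp
  qed
  show "D x z \<le> D x y + D y z" if "x \<in> Z" "y \<in> Z" "z \<in> Z" for x y z
  proof (rule D_least[OF that(1,3)])
    fix n
    show "\<bar>x n - z n\<bar> \<le> D x y + D y z"
      using D_upper[OF that(1,2), of n] D_upper[OF that(2,3), of n] by linarith
  qed
qed

text \<open>The function \<open>d i\<close> is nonexpansive, so some \<open>g n\<close> is uniformly
  close to it, and the coordinate \<open>n\<close> already sees almost the full distance from
  \<open>i\<close> to \<open>j\<close>.\<close>

lemma D_\<Phi>: "D (\<Phi> i) (\<Phi> j) = d i j"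
proof (rule antisym)
  show "D (\<Phi> i) (\<Phi> j) \<le> d i j"
    by (rule D_least[OF \<Phi>_Z \<Phi>_Z]) (simp add: \<Phi>_def nonexpD[OF g(1)])
  show "d i j \<le> D (\<Phi> i) (\<Phi> j)"
  proof (rule field_le_epsilon)
    fix e :: real assume "e > 0"
    then have e: "e / 2 > 0" by simp
    have "nonexp (d i)" unfolding nonexp_def using d_triangle[of i] d_sym by (metis add.commute diff_le_eq)
    then obtain n where n: "\<forall>k. \<bar>d i k - g n k\<bar> \<le> e / 2" using g(2)[OF _ e] by blast
    have "d i j - d i i \<le> \<bar>g n i - g n j\<bar> + e"
      using n[rule_format, of i] n[rule_format, of j] by linarith
    then show "d i j \<le> D (\<Phi> i) (\<Phi> j) + e"
      using D_upper[OF \<Phi>_Z \<Phi>_Z, of i n j] by (simp add: \<Phi>_def d_refl)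
  qed
qed

text \<open>The coordinate \<open>n\<close> is an affine extension of \<open>g n\<close>. If
  \<open>g (\<iota> n)\<close> converges uniformly to \<open>h\<close>, the corresponding
  coordinates converge uniformly on \<open>Z\<close>, by \<open>affine_le_hull\<close>, and their
  limit extends \<open>h\<close>.\<close>

lemma nonexp_extension:
  assumes h: "nonexp h"
  shows "\<exists>H. affine_on Z H \<and> continuous_on Z H \<and> (\<forall>x\<in>Z. \<forall>y\<in>Z. \<bar>H x - H y\<bar> \<le> D x y) \<and> (\<forall>j. H (\<Phi> j) = h j)"
proof -
  define e where "e = (\<lambda>n::nat. inverse (real (Suc n)))"
  have e0: "e n > 0" for n by (simp add: e_def)
  have e_lim: "e \<longlonglongrightarrow> 0" unfolding e_def by (rule LIMSEQ_inverse_real_of_nat)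
  have "\<forall>n. \<exists>i. \<forall>j. \<bar>h j - g i j\<bar> \<le> e n" using g(2)[OF h e0] by blast
  then obtain \<iota> where "\<forall>n. \<forall>j. \<bar>h j - g (\<iota> n) j\<bar> \<le> e n" unfolding choice_iff by (rule exE)
  then have \<iota>: "\<bar>h j - g (\<iota> n) j\<bar> \<le> e n" for n j by blast
  have close: "x (\<iota> n) - x (\<iota> m) \<le> e n + e m" if "x \<in> Z" for x n m
  proof (rule affine_le_hull[OF _ _ _ that])
    show "continuous_on Z (\<lambda>x. x (\<iota> n) - x (\<iota> m))" by (intro continuous_on_diff coord_continuous)
    show "affine_on Z (\<lambda>x. x (\<iota> n) - x (\<iota> m))" by (intro affine_on_diff coord_affine)
    fix j
    show "\<Phi> j (\<iota> n) - \<Phi> j (\<iota> m) \<le> e n + e m" using \<iota>[of j n] \<iota>[of j m] by (simp add: \<Phi>_def abs_le_iff)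
  qed
  have conv: "convergent (\<lambda>n. x (\<iota> n))" if x: "x \<in> Z" for x
  proof (rule Cauchy_convergent, rule CauchyI)
    fix r :: real assume r: "r > 0"
    have "\<forall>\<^sub>F n in sequentially. e n < r / 2" using e_lim r by (intro order_tendstoD(2)) auto
    then obtain N where N: "\<And>n. n \<ge> N \<Longrightarrow> e n < r / 2" by (auto simp: eventually_sequentially)
    have "\<bar>x (\<iota> m) - x (\<iota> n)\<bar> < r" if "m \<ge> N" "n \<ge> N" for m n
      using close[OF x, of m n] close[OF x, of n m] N[OF that(1)] N[OF that(2)] by linarith
    then show "\<exists>M. \<forall>m\<ge>M. \<forall>n\<ge>M. norm (x (\<iota> m) - x (\<iota> n)) < r" by auto
  qed
  define H :: "(nat \<Rightarrow> real) \<Rightarrow> real" where "H = (\<lambda>x. lim (\<lambda>n. x (\<iota> n)))"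
  have H: "(\<lambda>n. x (\<iota> n)) \<longlonglongrightarrow> H x" if "x \<in> Z" for x
    unfolding H_def using conv[OF that] by (simp add: convergent_LIMSEQ_iff)
  have unif: "\<bar>x (\<iota> n) - H x\<bar> \<le> e n" if x: "x \<in> Z" for x n
  proof (rule LIMSEQ_le)
    show "(\<lambda>m. \<bar>x (\<iota> n) - x (\<iota> m)\<bar>) \<longlonglongrightarrow> \<bar>x (\<iota> n) - H x\<bar>" by (intro tendsto_intros H[OF x])
    show "(\<lambda>m. e n + e m) \<longlonglongrightarrow> e n" using tendsto_add[OF tendsto_const e_lim, of "e n"] by simp
    show "\<exists>N. \<forall>m\<ge>N. \<bar>x (\<iota> n) - x (\<iota> m)\<bar> \<le> e n + e m"
      using close[OF x, of n] close[OF x, of _ n] by (intro exI[of _ 0]) (auto simp: abs_le_iff add.commute)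
  qed
  have "uniform_limit Z (\<lambda>n x. x (\<iota> n)) H sequentially"
  proof (rule uniform_limitI)
    fix r :: real assume "r > 0"
    then have "\<forall>\<^sub>F n in sequentially. e n < r" using e_lim by (intro order_tendstoD(2)) auto
    then show "\<forall>\<^sub>F n in sequentially. \<forall>x\<in>Z. dist (x (\<iota> n)) (H x) < r"
      by eventually_elim (use unif in \<open>auto simp: dist_real_def intro: le_less_trans\<close>)
  qed
  then have "continuous_on Z H"
    by (rule uniform_limit_theorem[rotated]) (simp_all add: coord_continuous)
  moreover have "affine_on Z H"
    unfolding affine_on_def
  proof (intro ballI allI impI)
    fix x y and u v :: real assume xy: "x \<in> Z" "y \<in> Z" and uv: "0 \<le> u" "0 \<le> v" "u + v = 1"
    have "u *\<^sub>R x + v *\<^sub>R y \<in> Z" using convex_Z xy uv by (simp add: convex_def)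
    from H[OF this] have "(\<lambda>n. u * x (\<iota> n) + v * y (\<iota> n)) \<longlonglongrightarrow> H (u *\<^sub>R x + v *\<^sub>R y)"
      by (simp add: scaleR_fun_def)
    moreover have "(\<lambda>n. u * x (\<iota> n) + v * y (\<iota> n)) \<longlonglongrightarrow> u * H x + v * H y"
      by (intro tendsto_intros H xy)
    ultimately show "H (u *\<^sub>R x + v *\<^sub>R y) = u *\<^sub>R H x + v *\<^sub>R H y"
      using LIMSEQ_unique by auto
  qed
  moreover have "\<bar>H x - H y\<bar> \<le> D x y" if "x \<in> Z" "y \<in> Z" for x y
  proof (rule LIMSEQ_le_const2)
    show "(\<lambda>n. \<bar>x (\<iota> n) - y (\<iota> n)\<bar>) \<longlonglongrightarrow> \<bar>H x - H y\<bar>" by (intro tendsto_intros H[OF that(1)] H[OF that(2)])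
    show "\<exists>N. \<forall>n\<ge>N. \<bar>x (\<iota> n) - y (\<iota> n)\<bar> \<le> D x y" by (intro exI[of _ 0] allI impI D_upper that)
  qed
  moreover have "H (\<Phi> j) = h j" for j
  proof (rule LIMSEQ_unique[OF H[OF \<Phi>_Z, of j]])
    have "(\<lambda>n. g (\<iota> n) j - h j) \<longlonglongrightarrow> 0"
      by (rule Lim_null_comparison[OF _ e_lim]) (use \<iota>[of j] in \<open>simp add: abs_minus_commute\<close>)
    then show "(\<lambda>n. \<Phi> j (\<iota> n)) \<longlonglongrightarrow> h j" unfolding \<Phi>_def by (rule LIM_zero_cancel)
  qed
  ultimately show ?thesis by (intro exI[of _ H] conjI ballI allI)
qed

text \<open>Serves the continuity of \<open>D\<close> in the product topology: simultaneously for
  all \<open>n\<close>, the coordinate \<open>x n\<close> is up to a constant within \<delta> of a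
  combination \<open>P n\<close> of the same finitely many continuous functions, with coefficients
  bounded by \<open>B\<close>.\<close>

lemma D_continuity_bound:
  assumes "\<delta> > 0"
  shows "\<exists>(F :: nat set) (\<Lambda> :: nat \<Rightarrow> (nat \<Rightarrow> real) \<Rightarrow> real) B. finite F \<and> (\<forall>i\<in>F. continuous_on Z (\<Lambda> i)) \<and>
    (\<forall>x\<in>Z. \<forall>y\<in>Z. D x y \<le> 2 * \<delta> + B * (\<Sum>i\<in>F. \<bar>\<Lambda> i x - \<Lambda> i y\<bar>))"
proof -
  obtain B where B: "B > 0" "\<And>i j. d i j \<le> B" using d_bounded by blast
  have d2: "\<delta> / 2 > 0" using assms by simp
  obtain F where F: "finite F" "\<forall>j. \<exists>i\<in>F. d i j < \<delta> / 2" using totally_bounded[OF d2] by blast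
  have lip: "\<bar>d i s - d i t\<bar> \<le> d s t" for i s t
    using d_triangle[of i s t] d_triangle[of i t s] d_sym[of s t] by linarith
  obtain \<phi> C where phi: "C > 0" "\<forall>i\<in>F. \<forall>s\<in>UNIV. \<forall>t\<in>UNIV. \<bar>\<phi> i s - \<phi> i t\<bar> \<le> C * d s t"
    "\<forall>i\<in>F. \<forall>s\<in>UNIV. 0 \<le> \<phi> i s" "\<forall>s\<in>UNIV. (\<Sum>i\<in>F. \<phi> i s) = 1"
    "\<forall>i\<in>F. \<forall>s\<in>UNIV. \<delta> \<le> d i s \<longrightarrow> \<phi> i s = 0"
    using partition_of_unity[of F \<delta> UNIV d] F(1,2) assms lip d_nonneg by auto
  have "\<forall>i\<in>F. \<exists>H. affine_on Z H \<and> continuous_on Z H \<and> (\<forall>j. H (\<Phi> j) = \<phi> i j)"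
  proof
    fix i assume i: "i \<in> F"
    have "nonexp (\<lambda>s. \<phi> i s / C)"
      unfolding nonexp_def
    proof (intro allI)
      fix s t
      have "\<phi> i s - \<phi> i t \<le> C * d s t" using phi(2) i by (auto simp: abs_le_iff)
      then show "\<phi> i s / C - \<phi> i t / C \<le> d s t"
        using phi(1) by (simp add: diff_divide_distrib[symmetric] pos_divide_le_eq mult.commute)
    qed
    then obtain H where "affine_on Z H" "continuous_on Z H" "\<forall>j. H (\<Phi> j) = \<phi> i j / C"
      using nonexp_extension by blast
    then show "\<exists>H. affine_on Z H \<and> continuous_on Z H \<and> (\<forall>j. H (\<Phi> j) = \<phi> i j)"
      using phi(1) by (intro exI[of _ "\<lambda>x. C * H x"]) (auto intro: affine_on_cmult continuous_on_mult_left)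
  qed
  then obtain \<Lambda> where "\<forall>i\<in>F. affine_on Z (\<Lambda> i) \<and> continuous_on Z (\<Lambda> i) \<and> (\<forall>j. \<Lambda> i (\<Phi> j) = \<phi> i j)"
    unfolding bchoice_iff by (rule exE)
  then have L: "\<And>i. i \<in> F \<Longrightarrow> affine_on Z (\<Lambda> i)" "\<And>i. i \<in> F \<Longrightarrow> continuous_on Z (\<Lambda> i)"
    "\<And>i j. i \<in> F \<Longrightarrow> \<Lambda> i (\<Phi> j) = \<phi> i j" by simp_all
  \<comment> \<open>Adding constants keeps a function nonexpansive, so the values
    \<open>g n i\<close> are unbounded in \<open>n\<close>; the differences
    \<open>g n i - g n 0\<close> are bounded by \<open>B\<close>.\<close>
  define P where "P = (\<lambda>n x. \<Sum>i\<in>F. \<Lambda> i x * (g n i - g n 0))"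
  have Pc: "continuous_on Z (P n)" "affine_on Z (P n)" for n
    unfolding P_def mult.commute[of _ "g n _ - g n 0"]
    by (intro continuous_on_sum continuous_on_mult continuous_on_const L(2), simp)
      (intro affine_on_sum affine_on_cmult L(1), simp)
  have P\<Phi>: "\<bar>\<Phi> j n - g n 0 - P n (\<Phi> j)\<bar> \<le> \<delta>" for n j
  proof -
    have one: "(\<Sum>i\<in>F. \<phi> i j) = 1" using phi(4) by simp
    have "P n (\<Phi> j) = (\<Sum>i\<in>F. \<phi> i j * (g n i - g n 0))" by (simp add: P_def L(3))
    moreover have "\<Phi> j n - g n 0 = (\<Sum>i\<in>F. \<phi> i j * (g n j - g n 0))"
      using one by (simp add: sum_distrib_right[symmetric] \<Phi>_def)
    ultimately have "\<Phi> j n - g n 0 - P n (\<Phi> j) = (\<Sum>i\<in>F. \<phi> i j * (g n j - g n 0)) - (\<Sum>i\<in>F. \<phi> i j * (g n i - g n 0))"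
      by simp
    also have "\<dots> = (\<Sum>i\<in>F. \<phi> i j * (g n j - g n i))"
      unfolding sum_subtractf[symmetric] by (intro sum.cong refl) (simp add: algebra_simps)
    also have "\<bar>\<dots>\<bar> \<le> (\<Sum>i\<in>F. \<bar>\<phi> i j * (g n j - g n i)\<bar>)" by (rule sum_abs)
    also have "\<dots> \<le> (\<Sum>i\<in>F. \<phi> i j * \<delta>)"
    proof (rule sum_mono)
      fix i assume i: "i \<in> F"
      show "\<bar>\<phi> i j * (g n j - g n i)\<bar> \<le> \<phi> i j * \<delta>"
      proof (cases "\<delta> \<le> d i j")
        case True
        then show ?thesis using phi(5) i by simp
      next
        case False
        have "0 \<le> \<phi> i j" using phi(3) i by simp
        moreover have "\<bar>g n j - g n i\<bar> \<le> \<delta>" using nonexpD[OF g(1), of n j i] d_sym[of i j] False by linarith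
        ultimately show ?thesis by (simp add: abs_mult mult_left_mono)
      qed
    qed
    also have "\<dots> = \<delta>" using one by (simp add: sum_distrib_right[symmetric])
    finally show ?thesis .
  qed
  have PZ: "\<bar>x n - g n 0 - P n x\<bar> \<le> \<delta>" if x: "x \<in> Z" for x n
  proof -
    have "x n - g n 0 - P n x \<le> \<delta>"
      by (rule affine_le_hull[OF _ _ _ x]) (use P\<Phi> in \<open>auto intro!: continuous_on_diff coord_continuous
        continuous_on_const affine_on_diff coord_affine Pc simp: abs_le_iff\<close>)
    moreover have "P n x - (x n - g n 0) \<le> \<delta>"
      by (rule affine_le_hull[OF _ _ _ x]) (use P\<Phi> in \<open>auto intro!: continuous_on_diff coord_continuous
        continuous_on_const affine_on_diff coord_affine Pc simp: abs_le_iff\<close>)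
    ultimately show ?thesis by linarith
  qed
  have "D x y \<le> 2 * \<delta> + B * (\<Sum>i\<in>F. \<bar>\<Lambda> i x - \<Lambda> i y\<bar>)" if "x \<in> Z" "y \<in> Z" for x y
  proof (rule D_least[OF that])
    fix n
    have "P n x - P n y = (\<Sum>i\<in>F. (\<Lambda> i x - \<Lambda> i y) * (g n i - g n 0))"
      by (simp only: P_def left_diff_distrib sum_subtractf)
    then have "\<bar>P n x - P n y\<bar> \<le> (\<Sum>i\<in>F. \<bar>(\<Lambda> i x - \<Lambda> i y) * (g n i - g n 0)\<bar>)"
      by (simp only: sum_abs)
    also have "\<dots> \<le> (\<Sum>i\<in>F. B * \<bar>\<Lambda> i x - \<Lambda> i y\<bar>)"
    proof (rule sum_mono)
      fix i
      have "\<bar>g n i - g n 0\<bar> \<le> B" using nonexpD[OF g(1), of n i 0] B(2)[of i 0] by linarith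
      then show "\<bar>(\<Lambda> i x - \<Lambda> i y) * (g n i - g n 0)\<bar> \<le> B * \<bar>\<Lambda> i x - \<Lambda> i y\<bar>"
        unfolding abs_mult mult.commute[of B] by (rule mult_left_mono) simp
    qed
    also have "\<dots> = B * (\<Sum>i\<in>F. \<bar>\<Lambda> i x - \<Lambda> i y\<bar>)" by (simp only: sum_distrib_left)
    finally show "\<bar>x n - y n\<bar> \<le> 2 * \<delta> + B * (\<Sum>i\<in>F. \<bar>\<Lambda> i x - \<Lambda> i y\<bar>)"
      using PZ[OF that(1), of n] PZ[OF that(2), of n] by linarith
  qed
  then show ?thesis using F(1) L(2) by (intro exI[of _ F] exI[of _ \<Lambda>] exI[of _ B]) simp
qed

text \<open>The identity is continuous from the compact inherited topology to the Hausdorff metric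
  topology, so the two agree.\<close>

lemma mtopology_Z: "Metric_space.mtopology Z D = top_of_set Z"
proof (rule compact_quotient_topologies_eq[of "top_of_set Z" _ _ "\<lambda>x. x", symmetric])
  interpret M: Metric_space Z D by (rule Metric_space_Z)
  show "compact_space (top_of_set Z)" using compact_Z by (simp add: compact_space_subtopology)
  show "Hausdorff_space (top_of_set Z)" by (rule Hausdorff_space_top_of_set)
  show "Hausdorff_space M.mtopology" by (rule M.Hausdorff_space_mtopology)
  show "topspace (top_of_set Z) = topspace M.mtopology" by simp
  show "(\<lambda>x. x) ` topspace (top_of_set Z) = topspace (top_of_set Z)" by simp
  show "continuous_map (top_of_set Z) (top_of_set Z) (\<lambda>x. x)" by simp
  show "continuous_map (top_of_set Z) M.mtopology (\<lambda>x. x)"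
    unfolding M.continuous_map_to_metric
  proof (intro ballI allI impI)
    fix x and e :: real assume "x \<in> topspace (top_of_set Z)" and e: "e > 0"
    then have x: "x \<in> Z" by simp
    have e4: "e / 4 > 0" using e by simp
    obtain F :: "nat set" and \<Lambda> :: "nat \<Rightarrow> (nat \<Rightarrow> real) \<Rightarrow> real" and B where F: "finite F"
      "\<forall>i\<in>F. continuous_on Z (\<Lambda> i)"
      "\<forall>x\<in>Z. \<forall>y\<in>Z. D x y \<le> 2 * (e / 4) + B * (\<Sum>i\<in>F. \<bar>\<Lambda> i x - \<Lambda> i y\<bar>)"
      using D_continuity_bound[OF e4] by (elim exE conjE)
    define h where "h = (\<lambda>y. 2 * (e / 4) + B * (\<Sum>i\<in>F. \<bar>\<Lambda> i x - \<Lambda> i y\<bar>))"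
    have "continuous_on Z h"
      unfolding h_def using F(2)
      by (intro continuous_on_add continuous_on_mult continuous_on_const continuous_on_sum continuous_on_rabs continuous_on_diff) auto
    then have "openin (top_of_set Z) (Z \<inter> h -` {..<e})" by (rule continuous_openin_preimage_gen) simp
    moreover have "x \<in> Z \<inter> h -` {..<e}" using x e by (simp add: h_def)
    moreover have "y \<in> M.mball x e" if "y \<in> Z \<inter> h -` {..<e}" for y
    proof -
      have yZ: "y \<in> Z" and hy: "h y < e" using that by simp_all
      have "D x y \<le> h y" unfolding h_def using F(3) x yZ by simp
      then have "D x y < e" using hy by linarith
      then show ?thesis unfolding M.in_mball using x yZ by simp
    qed
    ultimately show "\<exists>U. openin (top_of_set Z) U \<and> x \<in> U \<and> (\<forall>y\<in>U. y \<in> M.mball x e)"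
      by (intro exI[of _ "Z \<inter> h -` {..<e}"] conjI ballI)
  qed
qed

definition Zm :: "(nat \<Rightarrow> real) metric" where
  "Zm = metric (Z, D)"

lemma Zm: "mspace Zm = Z" "mdist Zm = D" "mtopology_of Zm = top_of_set Z"
  unfolding Zm_def Metric_space.mspace_metric[OF Metric_space_Z] Metric_space.mdist_metric[OF Metric_space_Z]
    Metric_space.mtopology_of[OF Metric_space_Z] mtopology_Z by (rule refl)+

definition KZ :: "(nat \<Rightarrow> real) set" where
  "KZ = closure (range \<Phi>)"

lemma KZ_subset: "KZ \<subseteq> Z"
  unfolding KZ_def
proof (rule closure_minimal)
  show "range \<Phi> \<subseteq> Z" by (intro image_subsetI \<Phi>_Z)
  show "closed Z" by (simp add: Z_def)
qed

lemma \<Phi>_KZ: "\<Phi> j \<in> KZ"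
  unfolding KZ_def by (rule subsetD[OF closure_subset]) (rule rangeI)

text \<open>An extension of \<open>h\<close> is determined along \<Phi> and agrees with
  \<open>h\<close> on the closure by continuity. Distances are attained by the coordinates and their
  negatives, which are affine and 1-Lipschitz.\<close>

lemma bauer_model_Z: "bauer_model Zm KZ"
proof unfold_locales
  show "compact_convex_metric_space Zm"
    unfolding compact_convex_metric_space_def Zm using \<Phi>_Z[of 0] compact_Z convex_Z by (simp add: ex_in_conv[symmetric] exI)
  show "KZ \<subseteq> mspace Zm" unfolding Zm by (rule KZ_subset)
  have "closed KZ" by (simp add: KZ_def)
  then show "compact KZ" using closed_Int_compact[OF _ compact_Z] KZ_subset by (metis inf.absorb1)
  fix h assume h: "lip_on 1 Zm KZ h"
  have "nonexp (\<lambda>j. h (\<Phi> j))"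
    unfolding nonexp_def
  proof (intro allI)
    fix i j
    show "h (\<Phi> i) - h (\<Phi> j) \<le> d i j"
      using lip_onD[OF h \<Phi>_KZ \<Phi>_KZ, of i j] by (simp add: Zm D_\<Phi>)
  qed
  then obtain H where H: "affine_on Z H" "continuous_on Z H" "\<forall>x\<in>Z. \<forall>y\<in>Z. \<bar>H x - H y\<bar> \<le> D x y"
    "\<forall>j. H (\<Phi> j) = h (\<Phi> j)" using nonexp_extension by blast
  have "continuous_on KZ (\<lambda>x. H x - h x)"
  proof (intro continuous_on_diff continuous_on_subset[OF H(2) KZ_subset])
    show "continuous_on KZ h"
      by (rule lip_on_continuous[OF _ h]) (simp_all add: Zm KZ_subset)
  qed
  then have "closed (KZ \<inter> (\<lambda>x. H x - h x) -` {0})"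
    by (rule continuous_closed_preimage[OF _ \<open>closed KZ\<close> closed_singleton])
  moreover have "range \<Phi> \<subseteq> KZ \<inter> (\<lambda>x. H x - h x) -` {0}" using \<Phi>_KZ H(4) by auto
  ultimately have "KZ \<subseteq> KZ \<inter> (\<lambda>x. H x - h x) -` {0}"
    unfolding KZ_def[of] by (intro closure_minimal)
  then have "\<forall>k\<in>KZ. H k = h k" by auto
  moreover have "lip_on 1 Zm (mspace Zm) H" using H(3) by (simp add: lip_on_def Zm)
  ultimately show "\<exists>H. affine_on (mspace Zm) H \<and> lip_on 1 Zm (mspace Zm) H \<and> (\<forall>k\<in>KZ. H k = h k)"
    using H(1) unfolding Zm(1) by blast
next
  fix H :: "(nat \<Rightarrow> real) \<Rightarrow> real" and x
  assume H: "continuous_on (mspace Zm) H" "affine_on (mspace Zm) H" "\<And>k. k \<in> KZ \<Longrightarrow> 0 \<le> H k" "x \<in> mspace Zm"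
  have "- H x \<le> 0"
    using affine_le_hull[of "\<lambda>x. - H x" 0 x] H \<Phi>_KZ unfolding Zm
    by (simp add: affine_on_minus continuous_on_minus)
  then show "0 \<le> H x" by simp
next
  fix x y c assume "x \<in> mspace Zm" "y \<in> mspace Zm" and c: "c < mdist Zm x y"
  then have xy: "x \<in> Z" "y \<in> Z" by (simp_all add: Zm)
  have lip: "lip_on 1 Zm (mspace Zm) (\<lambda>x. x n)" for n
    unfolding lip_on_def Zm using D_upper by simp
  have lip': "lip_on 1 Zm (mspace Zm) (\<lambda>x. - x n)" for n
    using lip_on_cmult[OF lip, of "-1"] by simp
  have "\<exists>n. c < \<bar>x n - y n\<bar>"
  proof (rule ccontr)
    assume "\<not> ?thesis"
    then have "D x y \<le> c" by (intro D_least xy) (simp add: not_less)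
    then show False using c by (simp add: Zm)
  qed
  then obtain n where "c < x n - y n \<or> c < - x n - (- y n)" by (auto simp: abs_if split: if_splits)
  then show "\<exists>H. affine_on (mspace Zm) H \<and> lip_on 1 Zm (mspace Zm) H \<and> c < H x - H y"
    using lip[of n] lip'[of n] coord_affine[of "mspace Zm" n] affine_on_minus[OF coord_affine[of "mspace Zm" n]] by blast
qed

lemma \<Phi>_dense:
  assumes z: "z \<in> KZ" and e: "e > 0"
  shows "\<exists>j. D z (\<Phi> j) < e"
proof -
  interpret M: Metric_space Z D by (rule Metric_space_Z)
  have zZ: "z \<in> Z" using z KZ_subset by blast
  have "openin (top_of_set Z) (M.mball z e)" unfolding mtopology_Z[symmetric] by (rule M.openin_mball)
  then obtain U where U: "open U" "M.mball z e = Z \<inter> U" unfolding openin_open by blast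
  have "z \<in> M.mball z e" using zZ e by simp
  then have "z \<in> U" using U(2) by blast
  then have "U \<inter> range \<Phi> \<noteq> {}" using z U(1) unfolding KZ_def by (metis IntI empty_iff open_Int_closure_eq_empty)
  then obtain j where "\<Phi> j \<in> U" by blast
  then have "\<Phi> j \<in> M.mball z e" using U(2) \<Phi>_Z by blast
  then show ?thesis by auto
qed

end

theorem realization:
  assumes "totally_bounded_pseudometric d"
  shows "\<exists>(X :: (nat \<Rightarrow> real) metric) K \<Phi>. bauer_model X K \<and> range \<Phi> \<subseteq> K \<and>
    (\<forall>i j. mdist X (\<Phi> i) (\<Phi> j) = d i j) \<and> (\<forall>z\<in>K. \<forall>e>0. \<exists>j. mdist X z (\<Phi> j) < e)"
proof -
  interpret totally_bounded_pseudometric d by fact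
  show ?thesis
    using bauer_model_Z \<Phi>_KZ D_\<Phi> \<Phi>_dense
    by (intro exI[of _ Zm] exI[of _ KZ] exI[of _ \<Phi>]) (auto simp: Zm)
qed

section \<open>Limits of chains of correspondences\<close>

text \<open>Subtracting or adding the tail \<open>2 * (1/2) ^ n\<close> makes the sequence monotone,
  which yields the rate together with the limit.\<close>

lemma geometric_steps_limit:
  fixes a :: "nat \<Rightarrow> real"
  assumes "\<And>n. \<bar>a n - a (Suc n)\<bar> \<le> (1/2) ^ n"
  shows "\<exists>l. a \<longlonglongrightarrow> l \<and> (\<forall>n. \<bar>a n - l\<bar> \<le> 2 * (1/2) ^ n)"
proof -
  define b where "b = (\<lambda>n. a n - 2 * (1/2) ^ n)"
  define c where "c = (\<lambda>n. a n + 2 * (1/2) ^ n)"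
  have "b n \<le> b (Suc n)" for n using assms[of n] by (simp add: b_def abs_le_iff)
  then have b: "incseq b" by (rule incseq_SucI)
  have "c (Suc n) \<le> c n" for n using assms[of n] by (simp add: c_def abs_le_iff)
  then have c: "decseq c" by (rule decseq_SucI)
  have bc: "b n \<le> c n" for n by (simp add: b_def c_def)
  have "b n \<le> c 0" for n using bc[of n] decseqD[OF c, of 0 n] by simp
  then obtain l where l: "b \<longlonglongrightarrow> l" "\<forall>n. b n \<le> l" using incseq_convergent[OF b] by blast
  have z: "(\<lambda>n. 2 * (1/2) ^ n) \<longlonglongrightarrow> (0 :: real)"
    using tendsto_mult_right_zero[OF LIMSEQ_power_zero[of "1/2 :: real"], of 2] by simp
  have al: "a \<longlonglongrightarrow> l" using tendsto_add[OF l(1) z] by (simp add: b_def)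
  have "c \<longlonglongrightarrow> l" using tendsto_add[OF al z] by (simp add: c_def)
  then have "l \<le> c n" for n using decseq_ge[OF c] by simp
  then have "\<bar>a n - l\<bar> \<le> 2 * (1/2) ^ n" for n
    using l(2)[rule_format, of n] by (simp add: b_def c_def abs_le_iff algebra_simps)
  then show ?thesis using al by (intro exI[of _ l]) simp
qed

locale corr_chain =
  fixes X :: "nat \<Rightarrow> 'a::locally_convex_space metric" and K :: "nat \<Rightarrow> 'a set"
    and R :: "nat \<Rightarrow> 'a \<Rightarrow> 'a \<Rightarrow> bool"
  assumes model: "bauer_model (X n) (K n)"
    and step: "corr ((1/2) ^ n) (X n) (K n) (X (Suc n)) (K (Suc n)) (R n)"
begin

definition thread :: "(nat \<Rightarrow> 'a) \<Rightarrow> bool" where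
  "thread T \<longleftrightarrow> (\<forall>n. T n \<in> K n \<and> R n (T n) (T (Suc n)))"

lemma thread_in: "thread T \<Longrightarrow> T n \<in> K n"
  by (simp add: thread_def)

text \<open>Every point of \<open>K (Suc n)\<close> has a partner in \<open>K n\<close>, so a tail
  is prolonged downwards one level at a time; \<open>F\<close> is generalised because each step
  changes it.\<close>

lemma thread_backwards:
  assumes "\<forall>m\<ge>n. F m \<in> K m \<and> R m (F m) (F (Suc m))"
  shows "\<exists>T. thread T \<and> (\<forall>m\<ge>n. T m = F m)"
  using assms
proof (induction n arbitrary: F)
  case 0
  then show ?case by (intro exI[of _ F]) (simp add: thread_def)
next
  case (Suc n)
  then have "F (Suc n) \<in> K (Suc n)" by simp
  then obtain q where q: "q \<in> K n" "R n q (F (Suc n))" using corrD(2)[OF step] by blast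
  have "\<forall>m\<ge>n. (F(n := q)) m \<in> K m \<and> R m ((F(n := q)) m) ((F(n := q)) (Suc m))"
  proof (intro allI impI)
    fix m assume "n \<le> m"
    then show "(F(n := q)) m \<in> K m \<and> R m ((F(n := q)) m) ((F(n := q)) (Suc m))"
      using q Suc.prems by (cases "m = n") auto
  qed
  from Suc.IH[OF this] obtain T where T: "thread T" "\<forall>m\<ge>n. T m = (F(n := q)) m" by blast
  then show ?case by (intro exI[of _ T]) simp
qed

text \<open>Upwards from \<open>p\<close> by dependent choice, then downwards by
  \<open>thread_backwards\<close>.\<close>

lemma thread_through:
  assumes "p \<in> K n"
  shows "\<exists>T. thread T \<and> T n = p"
proof -
  have "\<exists>f. \<forall>k. (f k \<in> K (n + k) \<and> (k = 0 \<longrightarrow> f k = p)) \<and> R (n + k) (f k) (f (Suc k))"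
  proof (rule dependent_nat_choice)
    show "\<exists>x. x \<in> K (n + 0) \<and> (0 = (0::nat) \<longrightarrow> x = p)" using assms by simp
    fix x k assume "x \<in> K (n + k) \<and> (k = 0 \<longrightarrow> x = p)"
    then show "\<exists>y. (y \<in> K (n + Suc k) \<and> (Suc k = 0 \<longrightarrow> y = p)) \<and> R (n + k) x y"
      using corrD(1)[OF step, of x "n + k"] by auto
  qed
  then obtain f where f: "\<forall>k. (f k \<in> K (n + k) \<and> (k = 0 \<longrightarrow> f k = p)) \<and> R (n + k) (f k) (f (Suc k))"
    by (rule exE)
  have "\<forall>m\<ge>n. f (m - n) \<in> K m \<and> R m (f (m - n)) (f (Suc m - n))"
  proof (intro allI impI)
    fix m assume "n \<le> m"
    then show "f (m - n) \<in> K m \<and> R m (f (m - n)) (f (Suc m - n))"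
      using f[rule_format, of "m - n"] by (simp add: Suc_diff_le)
  qed
  from thread_backwards[OF this] obtain T where T: "thread T" "\<forall>m\<ge>n. T m = f (m - n)" by blast
  have "T n = p" using T(2) f[rule_format, of 0] by simp
  then show ?thesis using T(1) by blast
qed

text \<open>One thread through each point of a finite net of each \<open>K n\<close>, of mesh
  \<open>(1/2) ^ n\<close>. They are enumerated because the realisation takes a pseudometric on the
  natural numbers.\<close>

lemma countable_threads:
  "\<exists>T. (\<forall>j :: nat. thread (T j)) \<and>
    (\<forall>n. \<exists>F. finite F \<and> (\<forall>k\<in>K n. \<exists>j\<in>F. mdist (X n) (T j n) k < (1/2) ^ n))"
proof -
  have "\<forall>n. \<exists>N. finite N \<and> N \<subseteq> K n \<and> (\<forall>k\<in>K n. \<exists>p\<in>N. mdist (X n) p k < (1/2) ^ n)"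
  proof
    fix n
    interpret M: bauer_model "X n" "K n" by (rule model)
    have pos: "(0 :: real) < (1/2) ^ n" by simp
    show "\<exists>N. finite N \<and> N \<subseteq> K n \<and> (\<forall>k\<in>K n. \<exists>p\<in>N. mdist (X n) p k < (1/2) ^ n)"
    proof (rule compact_finite_net[OF M.top M.K(2) M.K(1) pos])
      fix N assume "finite N" "N \<subseteq> K n" "\<And>k. k \<in> K n \<Longrightarrow> \<exists>p\<in>N. mdist (X n) p k < (1/2) ^ n"
      then show ?thesis by (intro exI[of _ N]) simp
    qed
  qed
  then obtain N where "\<forall>n. finite (N n) \<and> N n \<subseteq> K n \<and> (\<forall>k\<in>K n. \<exists>p\<in>N n. mdist (X n) p k < (1/2) ^ n)"
    unfolding choice_iff by (rule exE)
  then have N: "\<And>n. finite (N n)" "\<And>n. N n \<subseteq> K n"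
    "\<And>n k. k \<in> K n \<Longrightarrow> \<exists>p\<in>N n. mdist (X n) p k < (1/2) ^ n" by simp_all
  define t where "t = (\<lambda>(n, p). SOME T. thread T \<and> T n = p)"
  have t: "thread (t (n, p)) \<and> t (n, p) n = p" if "p \<in> K n" for n p
    unfolding t_def prod.case by (rule someI_ex[OF thread_through[OF that]])
  define S where "S = t ` Sigma UNIV N"
  have "countable S"
    unfolding S_def by (intro countable_image countable_SIGMA[OF countableI_type countable_finite] N(1))
  obtain k0 where k0: "k0 \<in> K 0" using bauer_model.K_nonempty[OF model] by blast
  then obtain p0 where "p0 \<in> N 0" using N(3) by blast
  then have ne: "S \<noteq> {}" unfolding S_def by blast
  define T where "T = from_nat_into S"
  have "range T = S" unfolding T_def by (rule range_from_nat_into[OF ne \<open>countable S\<close>])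
  have "thread (T j)" for j
  proof -
    have "T j \<in> S" unfolding T_def by (rule from_nat_into[OF ne])
    then obtain n p where np: "p \<in> N n" "T j = t (n, p)" unfolding S_def by (elim imageE SigmaE) simp
    have "p \<in> K n" using np(1) N(2) by blast
    then show ?thesis using t np(2) by simp
  qed
  moreover have "\<exists>F. finite F \<and> (\<forall>k\<in>K n. \<exists>j\<in>F. mdist (X n) (T j n) k < (1/2) ^ n)" for n
  proof -
    have "\<forall>p\<in>N n. \<exists>j. T j = t (n, p)"
    proof
      fix p assume "p \<in> N n"
      then have "t (n, p) \<in> range T" unfolding \<open>range T = S\<close> S_def by (intro imageI SigmaI UNIV_I)
      then obtain j where "t (n, p) = T j" by (rule rangeE)
      then show "\<exists>j. T j = t (n, p)" by (intro exI[of _ j]) simp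
    qed
    then obtain J where J: "\<forall>p\<in>N n. T (J p) = t (n, p)" unfolding bchoice_iff by (rule exE)
    have "\<forall>k\<in>K n. \<exists>j\<in>J ` N n. mdist (X n) (T j n) k < (1/2) ^ n"
    proof
      fix k assume "k \<in> K n"
      then obtain p where p: "p \<in> N n" "mdist (X n) p k < (1/2) ^ n" using N(3) by blast
      have "p \<in> K n" using p(1) N(2) by blast
      then have "T (J p) n = p" using t J p(1) by simp
      then show "\<exists>j\<in>J ` N n. mdist (X n) (T j n) k < (1/2) ^ n" using p by (intro bexI[of _ "J p"]) auto
    qed
    then show ?thesis using N(1) by (intro exI[of _ "J ` N n"]) simp
  qed
  ultimately show ?thesis by (intro exI[of _ T]) simp
qed

theorem chain_limit:
  "\<exists>(Z :: (nat \<Rightarrow> real) metric) M. bauer_model Z M \<and> (\<forall>n. intertwining_gap (X n) Z \<le> 78 * (1/2) ^ n)"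
proof -
  obtain T where T: "\<forall>j :: nat. thread (T j)"
    and net: "\<forall>n. \<exists>F. finite F \<and> (\<forall>k\<in>K n. \<exists>j\<in>F. mdist (X n) (T j n) k < (1/2) ^ n)"
    using countable_threads by blast
  have TK: "T j n \<in> K n" for j n using T thread_in by blast
  have TX: "T j n \<in> mspace (X n)" for j n using bauer_model.K_mspace[OF model TK] .
  define a where "a = (\<lambda>i j n. mdist (X n) (T i n) (T j n))"
  have "\<bar>a i j n - a i j (Suc n)\<bar> \<le> (1/2) ^ n" for i j n
    unfolding a_def by (rule corrD(3)[OF step TK TK TK TK]) (use T in \<open>simp_all add: thread_def\<close>)
  then have "\<forall>i. \<forall>j. \<exists>l. a i j \<longlonglongrightarrow> l \<and> (\<forall>n. \<bar>a i j n - l\<bar> \<le> 2 * (1/2) ^ n)"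
    using geometric_steps_limit by simp
  then obtain d where "\<forall>i. \<forall>j. a i j \<longlonglongrightarrow> d i j \<and> (\<forall>n. \<bar>a i j n - d i j\<bar> \<le> 2 * (1/2) ^ n)"
    unfolding choice_iff by (rule exE)
  then have lim: "a i j \<longlonglongrightarrow> d i j" and close: "\<bar>a i j n - d i j\<bar> \<le> 2 * (1/2) ^ n" for i j n by simp_all
  have pm: "totally_bounded_pseudometric d"
  proof
    show "d i i = 0" for i
    proof -
      have "a i i = (\<lambda>_. 0)" by (simp add: a_def TX fun_eq_iff)
      then show ?thesis using lim[of i i] by (simp add: LIMSEQ_const_iff)
    qed
    show "d i j = d j i" for i j
    proof -
      have "a i j = a j i" by (simp add: a_def mdist_commute)
      then show ?thesis using lim[of i j] lim[of j i] LIMSEQ_unique by simp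
    qed
    show "d i k \<le> d i j + d j k" for i j k
      by (rule LIMSEQ_le[OF lim tendsto_add[OF lim lim]]) (simp add: a_def mdist_triangle TX)
    fix \<epsilon> :: real assume "\<epsilon> > 0"
    then have "\<epsilon> / 3 > 0" by simp
    \<comment> \<open>The net at level \<open>n\<close> contributes \<open>(1/2) ^ n\<close> and the
      passage to the limit \<open>2 * (1/2) ^ n\<close>, together less than \<epsilon>.\<close>
    then obtain n where n: "(1/2) ^ n < \<epsilon> / 3"
      using real_arch_pow_inv[of "\<epsilon> / 3" "1/2"] by auto
    obtain F where F: "finite F" "\<forall>k\<in>K n. \<exists>j\<in>F. mdist (X n) (T j n) k < (1/2) ^ n" using net by blast
    have "\<exists>i\<in>F. d i j < \<epsilon>" for j
    proof -
      obtain i where i: "i \<in> F" "a i j n < (1/2) ^ n" using F(2) TK[of j n] by (auto simp: a_def)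
      have "d i j < \<epsilon>" using i(2) close[of i j n] n by linarith
      then show ?thesis using i(1) by blast
    qed
    then show "\<exists>F. finite F \<and> (\<forall>j. \<exists>i\<in>F. d i j < \<epsilon>)" using F(1) by blast
  qed
  obtain Z :: "(nat \<Rightarrow> real) metric" and M \<Phi> where Z: "bauer_model Z M"
    and \<Phi>: "range \<Phi> \<subseteq> M" "\<forall>i j. mdist Z (\<Phi> i) (\<Phi> j) = d i j" "\<forall>z\<in>M. \<forall>e>0. \<exists>j. mdist Z z (\<Phi> j) < e"
    using realization[OF pm] by (elim exE conjE)
  interpret Z: bauer_model Z M by (rule Z)
  have \<Phi>M: "\<Phi> j \<in> M" for j using \<Phi>(1) by blast
  have near: "\<bar>mdist Y x x' - mdist Y y y'\<bar> \<le> mdist Y x y + mdist Y x' y'"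
    if "x \<in> mspace Y" "x' \<in> mspace Y" "y \<in> mspace Y" "y' \<in> mspace Y" for Y :: "'z metric" and x x' y y'
    using mdist_triangle[OF that(1,3,2)] mdist_triangle[OF that(3,4,2)]
      mdist_triangle[OF that(3,1,4)] mdist_triangle[OF that(1,2,4)]
    by (simp add: mdist_commute abs_le_iff)
  have "intertwining_gap (X n) Z \<le> 78 * (1/2) ^ n" for n
  proof -
    interpret X: bauer_model "X n" "K n" by (rule model)
    define h :: real where "h = (1/2) ^ n"
    have h: "h > 0" by (simp add: h_def)
    have cl: "\<bar>mdist (X n) (T i n) (T j n) - mdist Z (\<Phi> i) (\<Phi> j)\<bar> \<le> 2 * h" for i j
      using close[of i j n] \<Phi>(2) by (simp add: a_def h_def)
    \<comment> \<open>Points are related if they lie within \<open>h\<close> of the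
      \<open>n\<close>-th entry and of the limit point of a common thread. The displacements cost
      \<open>2 * h\<close> on each side and \<open>cl\<close> another \<open>2 * h\<close>;
      \<open>corr_gap_le\<close> turns 6 into 13 * 6 = 78.\<close>
    have "corr (6 * h) (X n) (K n) Z M (\<lambda>k z. \<exists>j. mdist (X n) k (T j n) \<le> h \<and> mdist Z z (\<Phi> j) \<le> h)"
      unfolding corr_def
    proof (intro conjI ballI impI)
      fix k assume "k \<in> K n"
      then obtain j where "mdist (X n) (T j n) k < h" using net unfolding h_def by blast
      then show "\<exists>z\<in>M. \<exists>j. mdist (X n) k (T j n) \<le> h \<and> mdist Z z (\<Phi> j) \<le> h"
        using h Z.K_mspace[OF \<Phi>M] by (intro bexI[of _ "\<Phi> j"] exI[of _ j] \<Phi>M) (simp add: mdist_commute)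
    next
      fix z assume "z \<in> M"
      then obtain j where "mdist Z z (\<Phi> j) < h" using \<Phi>(3) h by blast
      then show "\<exists>k\<in>K n. \<exists>j. mdist (X n) k (T j n) \<le> h \<and> mdist Z z (\<Phi> j) \<le> h"
        using h TX by (intro bexI[of _ "T j n"] exI[of _ j] TK) simp
    next
      fix k k' z z' assume mem: "k \<in> K n" "k' \<in> K n" "z \<in> M" "z' \<in> M"
        and "\<exists>j. mdist (X n) k (T j n) \<le> h \<and> mdist Z z (\<Phi> j) \<le> h"
          "\<exists>j. mdist (X n) k' (T j n) \<le> h \<and> mdist Z z' (\<Phi> j) \<le> h"
      then obtain i j where ij: "mdist (X n) k (T i n) \<le> h" "mdist Z z (\<Phi> i) \<le> h"
        "mdist (X n) k' (T j n) \<le> h" "mdist Z z' (\<Phi> j) \<le> h" by blast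
      have "\<bar>mdist (X n) k k' - mdist (X n) (T i n) (T j n)\<bar> \<le> 2 * h"
        using near[OF X.K_mspace[OF mem(1)] X.K_mspace[OF mem(2)] TX TX, of i j] ij by linarith
      moreover have "\<bar>mdist Z z z' - mdist Z (\<Phi> i) (\<Phi> j)\<bar> \<le> 2 * h"
        using near[OF Z.K_mspace[OF mem(3)] Z.K_mspace[OF mem(4)] Z.K_mspace[OF \<Phi>M] Z.K_mspace[OF \<Phi>M], of i j] ij
        by linarith
      ultimately show "\<bar>mdist (X n) k k' - mdist Z z z'\<bar> \<le> 6 * h" using cl[of i j] by linarith
    qed
    from corr_gap_le[OF model Z this] show ?thesis using h by (simp add: h_def)
  qed
  then show ?thesis using Z by blast
qed

end

section \<open>Isomorphism classes\<close>

lemma simplex_compact_convex: "metric_bauer_simplex X \<Longrightarrow> compact_convex_space X"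
  by (simp add: metric_bauer_simplex_def compact_convex_space_def)

lemma affinely_isometric_refl: "affinely_isometric X X"
  unfolding affinely_isometric_def by (rule exI[of _ "\<lambda>x. x"]) (simp add: affine_on_def bij_betw_def)

lemma iso_class_eq:
  assumes "convex (mspace X)" "affinely_isometric X Y"
  shows "iso_class X = iso_class Y"
  unfolding iso_class_def
  using affinely_isometric_trans[OF assms(2)] affinely_isometric_trans[OF affinely_isometric_sym[OF assms]]
  by blast

lemma exists_sequence_copy:
  fixes X :: "'a::locally_convex_space metric"
  assumes X: "metric_bauer_simplex X"
  shows "\<exists>Z :: (nat \<Rightarrow> real) metric. metric_bauer_simplex Z \<and> affinely_isometric X Z"
proof -
  define K where "K = extreme_boundary (mspace X)"
  have XK: "bauer_model X K" unfolding K_def by (rule bauer_model_of_simplex[OF X])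
  have "corr ((1/2) ^ n) X K X K (=)" for n by (simp add: corr_def)
  then have "corr_chain (\<lambda>_. X) (\<lambda>_. K) (\<lambda>_. (=))" using XK by (simp add: corr_chain_def)
  from corr_chain.chain_limit[OF this] obtain Z :: "(nat \<Rightarrow> real) metric" and M
    where Z: "bauer_model Z M" "\<forall>n. intertwining_gap X Z \<le> 78 * (1/2) ^ n" by blast
  have ZS: "metric_bauer_simplex Z" by (rule bauer_model.metric_bauer_simplex[OF Z(1)])
  note cX = simplex_compact_convex[OF X] and cZ = simplex_compact_convex[OF ZS]
  have "(\<lambda>n. 78 * (1/2) ^ n) \<longlonglongrightarrow> (0 :: real)"
    using tendsto_mult_right_zero[OF LIMSEQ_power_zero[of "1/2 :: real"], of 78] by simp
  then have "intertwining_gap X Z \<le> 0" by (rule LIMSEQ_le_const) (use Z(2) in blast)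
  then have "intertwining_gap X Z = 0" using compact_convex_space.gap_nonneg[OF cX cZ] by simp
  then show ?thesis using isometric_if_gap_zero[OF cX cZ] ZS by blast
qed

lemma iso_class_in_bauer_classes:
  assumes "metric_bauer_simplex X"
  shows "iso_class X \<in> bauer_classes"
proof -
  obtain Z :: "(nat \<Rightarrow> real) metric" where Z: "metric_bauer_simplex Z" "affinely_isometric X Z"
    using exists_sequence_copy[OF assms] by blast
  then show ?thesis
    using iso_class_eq[OF compact_convex_space.conv[OF simplex_compact_convex[OF assms]] Z(2)]
    unfolding bauer_classes_def by blast
qed

text \<open>\<open>class_gap\<close> picks representatives by \<open>SOME\<close>; nonemptiness of
  the class makes them genuine copies.\<close>

lemma some_copy:
  assumes "metric_bauer_simplex X"
  defines "Z \<equiv> SOME Z. Z \<in> iso_class X"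
  shows "metric_bauer_simplex Z" "affinely_isometric X Z"
proof -
  have "\<exists>Z. Z \<in> iso_class X" using exists_sequence_copy[OF assms(1)] by (simp add: iso_class_def)
  then have "Z \<in> iso_class X" unfolding Z_def by (rule someI_ex)
  then show "metric_bauer_simplex Z" "affinely_isometric X Z" by (simp_all add: iso_class_def)
qed

lemma class_gap_eq:
  assumes X: "metric_bauer_simplex X" and Y: "metric_bauer_simplex Y"
  shows "class_gap (iso_class X) (iso_class Y) = intertwining_gap X Y"
proof -
  note conv = compact_convex_space.conv[OF simplex_compact_convex]
  show ?thesis
    unfolding class_gap_def
    by (rule gap_iso_invariant[symmetric])
      (rule conv[OF X] conv[OF Y] conv[OF some_copy(1)[OF X]] conv[OF some_copy(1)[OF Y]]
        some_copy(2)[OF X] some_copy(2)[OF Y])+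
qed

lemma bauer_classesE:
  assumes "A \<in> bauer_classes"
  obtains X :: "(nat \<Rightarrow> real) metric" where "metric_bauer_simplex X" "A = iso_class X"
  using assms unfolding bauer_classes_def by blast

section \<open>The quasimetric on classes and its completeness\<close>

lemma quasimetric_class_gap: "quasimetric_on bauer_classes class_gap"
  unfolding quasimetric_on_def
proof (intro conjI ballI exI[of _ 2])
  fix A B assume "A \<in> bauer_classes" "B \<in> bauer_classes"
  then obtain X Y :: "(nat \<Rightarrow> real) metric" where X: "metric_bauer_simplex X" "A = iso_class X"
    and Y: "metric_bauer_simplex Y" "B = iso_class Y" by (meson bauer_classesE)
  note cX = simplex_compact_convex[OF X(1)] and cY = simplex_compact_convex[OF Y(1)]
  have g: "class_gap A B = intertwining_gap X Y" "class_gap B A = intertwining_gap Y X"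
    unfolding X(2) Y(2) by (rule class_gap_eq; fact)+
  show "0 \<le> class_gap A B" unfolding g by (rule compact_convex_space.gap_nonneg[OF cX cY])
  show "class_gap A B = class_gap B A" unfolding g by (rule gap_commute)
  show "class_gap A B = 0 \<longleftrightarrow> A = B"
  proof
    assume "class_gap A B = 0"
    then have "affinely_isometric X Y" unfolding g by (rule isometric_if_gap_zero[OF cX cY])
    then show "A = B" unfolding X(2) Y(2) by (rule iso_class_eq[OF compact_convex_space.conv[OF cX]])
  next
    assume "A = B"
    moreover have "Y \<in> iso_class Y" unfolding iso_class_def using Y(1) affinely_isometric_refl by simp
    ultimately have "Y \<in> iso_class X" unfolding X(2) Y(2) by simp
    then have "affinely_isometric X Y" by (simp add: iso_class_def)
    then show "class_gap A B = 0" unfolding g by (rule gap_zero_if_isometric[OF cX cY])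
  qed
next
  fix A B C assume "A \<in> bauer_classes" "B \<in> bauer_classes" "C \<in> bauer_classes"
  then obtain X Y Z :: "(nat \<Rightarrow> real) metric" where X: "metric_bauer_simplex X" "A = iso_class X"
    and Y: "metric_bauer_simplex Y" "B = iso_class Y" and Z: "metric_bauer_simplex Z" "C = iso_class Z"
    by (meson bauer_classesE)
  show "class_gap A C \<le> 2 * (class_gap A B + class_gap B C)"
    unfolding X(2) Y(2) Z(2) class_gap_eq[OF X(1) Y(1)] class_gap_eq[OF Y(1) Z(1)] class_gap_eq[OF X(1) Z(1)]
    by (intro gap_quasi_triangle simplex_compact_convex X(1) Y(1) Z(1))
qed

text \<open>The chain limit controls a subsequence only; the Cauchy property and the quasi-triangle
  inequality carry the convergence over to all indices.\<close>

lemma gap_Cauchy_limit: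
  fixes X :: "nat \<Rightarrow> 'a::locally_convex_space metric"
  assumes X: "\<And>n. metric_bauer_simplex (X n)"
    and Cauchy: "\<And>e. e > 0 \<Longrightarrow> \<exists>N. \<forall>m\<ge>N. \<forall>n\<ge>N. intertwining_gap (X m) (X n) < e"
  shows "\<exists>Z :: (nat \<Rightarrow> real) metric. metric_bauer_simplex Z \<and> (\<lambda>n. intertwining_gap (X n) Z) \<longlonglongrightarrow> 0"
proof -
  \<comment> \<open>The divisor 9 compensates the loss in \<open>isom_eps_corr\<close>, so that the
    correspondences have distortion \<open>(1/2) ^ k\<close>.\<close>
  have "\<forall>k. \<exists>N. \<forall>m\<ge>N. \<forall>n\<ge>N. intertwining_gap (X m) (X n) < (1/2) ^ k / 9"
    by (intro allI Cauchy) simp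
  then obtain N where N: "\<forall>k. \<forall>m\<ge>N k. \<forall>n\<ge>N k. intertwining_gap (X m) (X n) < (1/2) ^ k / 9"
    unfolding choice_iff by (rule exE)
  \<comment> \<open>Partial sums put both \<open>r k\<close> and \<open>r (Suc k)\<close> beyond
    \<open>N k\<close>, which is what linking consecutive members requires.\<close>
  define r where "r = (\<lambda>k. \<Sum>i\<le>k. N i)"
  have r: "N k \<le> r k" "N k \<le> r (Suc k)" for k unfolding r_def by (rule member_le_sum; simp)+
  note cc = simplex_compact_convex[OF X]
  define K where "K = (\<lambda>n. extreme_boundary (mspace (X n)))"
  have model: "bauer_model (X n) (K n)" for n unfolding K_def by (rule bauer_model_of_simplex[OF X])
  have "\<forall>k. \<exists>R. corr ((1/2) ^ k) (X (r k)) (K (r k)) (X (r (Suc k))) (K (r (Suc k))) R"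
  proof
    fix k
    have "intertwining_gap (X (r k)) (X (r (Suc k))) < (1/2) ^ k / 9" using N r by simp
    then obtain f where "f \<in> isom_eps ((1/2) ^ k / 9) (X (r k)) (X (r (Suc k)))"
      using compact_convex_space.gap_less[OF cc cc] by metis
    from isom_eps_corr[OF model model this]
    show "\<exists>R. corr ((1/2) ^ k) (X (r k)) (K (r k)) (X (r (Suc k))) (K (r (Suc k))) R"
      by (intro exI) simp
  qed
  then obtain R where "\<forall>k. corr ((1/2) ^ k) (X (r k)) (K (r k)) (X (r (Suc k))) (K (r (Suc k))) (R k)"
    unfolding choice_iff by (rule exE)
  then have "corr_chain (\<lambda>k. X (r k)) (\<lambda>k. K (r k)) R" using model by (simp add: corr_chain_def)
  from corr_chain.chain_limit[OF this] obtain Z :: "(nat \<Rightarrow> real) metric" and M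
    where Z: "bauer_model Z M" "\<forall>n. intertwining_gap (X (r n)) Z \<le> 78 * (1/2) ^ n" by blast
  have ZS: "metric_bauer_simplex Z" by (rule bauer_model.metric_bauer_simplex[OF Z(1)])
  note cZ = simplex_compact_convex[OF ZS]
  have "(\<lambda>n. intertwining_gap (X n) Z) \<longlonglongrightarrow> 0"
  proof (rule LIMSEQ_I)
    fix e :: real assume "e > 0"
    \<comment> \<open>The quasi-triangle inequality gives 2 * (78 + 1/9), which is below
      158.\<close>
    then have "e / 158 > 0" by simp
    then obtain k where "(1/2) ^ k < e / 158" using real_arch_pow_inv[of "e / 158" "1/2"] by auto
    then obtain h :: real where h: "(1/2) ^ k = h" "0 < h" "h < e / 158" by auto
    have "norm (intertwining_gap (X n) Z - 0) < e" if n: "n \<ge> N k" for n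
    proof -
      have "intertwining_gap (X n) (X (r k)) < h / 9" using N r(1) n unfolding h(1)[symmetric] by simp
      moreover have "intertwining_gap (X (r k)) Z \<le> 78 * h" using Z(2) unfolding h(1)[symmetric] by (rule allE)
      moreover have "c < e" if "a < h / 9" "b \<le> 78 * h" "c \<le> 2 * (a + b)" for a b c :: real
        using that h(2,3) by simp
      ultimately have "intertwining_gap (X n) Z < e"
        using gap_quasi_triangle[OF cc[of n] cc[of "r k"] cZ] by blast
      then show ?thesis using compact_convex_space.gap_nonneg[OF cc cZ, of n] by simp
    qed
    then show "\<exists>no. \<forall>n\<ge>no. norm (intertwining_gap (X n) Z - 0) < e" by blast
  qed
  then show ?thesis using ZS by blast
qed

lemma complete_class_gap: "complete_quasimetric_on bauer_classes class_gap"
  unfolding complete_quasimetric_on_def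
proof (intro conjI allI impI quasimetric_class_gap)
  fix s :: "nat \<Rightarrow> (nat \<Rightarrow> real) metric set"
  assume s: "range s \<subseteq> bauer_classes" and Cauchy: "\<forall>e>0. \<exists>N. \<forall>m\<ge>N. \<forall>n\<ge>N. class_gap (s m) (s n) < e"
  have "\<forall>n. \<exists>X :: (nat \<Rightarrow> real) metric. metric_bauer_simplex X \<and> s n = iso_class X"
    using range_subsetD[OF s] unfolding bauer_classes_def image_iff Bex_def mem_Collect_eq by (rule allI)
  then obtain X :: "nat \<Rightarrow> (nat \<Rightarrow> real) metric" where "\<forall>n. metric_bauer_simplex (X n) \<and> s n = iso_class (X n)" unfolding choice_iff by (rule exE)
  then have X: "\<And>n. metric_bauer_simplex (X n)" "\<And>n. s n = iso_class (X n)" by simp_all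
  have "\<exists>N. \<forall>m\<ge>N. \<forall>n\<ge>N. intertwining_gap (X m) (X n) < e" if "e > 0" for e
    using Cauchy that unfolding X(2) class_gap_eq[OF X(1) X(1)] by blast
  from gap_Cauchy_limit[OF X(1) this] obtain Z :: "(nat \<Rightarrow> real) metric"
    where Z: "metric_bauer_simplex Z" "(\<lambda>n. intertwining_gap (X n) Z) \<longlonglongrightarrow> 0" by blast
  then have "(\<lambda>n. class_gap (s n) (iso_class Z)) \<longlonglongrightarrow> 0" by (simp add: X(2) class_gap_eq[OF X(1) Z(1)])
  then show "\<exists>x\<in>bauer_classes. (\<lambda>n. class_gap (s n) x) \<longlonglongrightarrow> 0"
    using iso_class_in_bauer_classes[OF Z(1)] by blast
qed

section \<open>Comparison with the quantum Gromov--Hausdorff distance\<close>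

lemma gap_tendsto_iff_dist_q_tendsto:
  assumes Xs: "\<And>n. metric_bauer_simplex (Xs n)" and X: "metric_bauer_simplex X"
  shows "(\<lambda>n. intertwining_gap (Xs n) X) \<longlonglongrightarrow> 0 \<longleftrightarrow>
    (\<lambda>n. dist_q (Aff (Xs n)) (lip_const (Xs n)) (Aff X) (lip_const X)) \<longlonglongrightarrow> 0"
    (is "?g \<longlonglongrightarrow> 0 \<longleftrightarrow> ?q \<longlonglongrightarrow> 0")
proof
  note M = bauer_model_of_simplex[OF Xs] and MX = bauer_model_of_simplex[OF X]
  note cX = simplex_compact_convex[OF X] and cc = simplex_compact_convex[OF Xs]
  show "?q \<longlonglongrightarrow> 0" if g: "?g \<longlonglongrightarrow> 0"
  proof (rule order_tendstoI)
    fix a :: ennreal assume "0 < a"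
    \<comment> \<open>Passing to a smaller \<open>b\<close> ensures a finite bound even if
      \<open>a\<close> is infinite.\<close>
    then obtain b where b: "0 < b" "b < a" by (meson dense)
    then obtain c where c: "b = ennreal c" "c \<ge> 0" by (cases b) auto
    then have "c > 0" using b by (simp add: ennreal_less_zero_iff)
    then have "\<forall>\<^sub>F n in sequentially. ?g n < c / 10" using g by (intro order_tendstoD(2)) auto
    then show "\<forall>\<^sub>F n in sequentially. ?q n < a"
    proof eventually_elim
      case (elim n)
      obtain f where "f \<in> isom_eps (c / 10) (Xs n) X"
        using compact_convex_space.gap_less[OF cc cX elim] by metis
      then have "?q n \<le> ennreal (10 * (c / 10))" by (rule isom_eps_dist_q[OF M MX])
      then show ?case using b c by simp
    qed
  qed simp
  show "?g \<longlonglongrightarrow> 0" if q: "?q \<longlonglongrightarrow> 0"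
  proof (rule order_tendstoI)
    fix a :: real assume "a < 0"
    then have "a < ?g n" for n using compact_convex_space.gap_nonneg[OF cc cX, of n] by linarith
    then show "\<forall>\<^sub>F n in sequentially. a < ?g n" by simp
  next
    fix a :: real assume a: "0 < a"
    \<comment> \<open>The losses are 8 in \<open>dist_q_corr\<close> and 13 in
      \<open>corr_gap_le\<close>, and 8 * 13 = 104 is below 105.\<close>
    then have "\<forall>\<^sub>F n in sequentially. ?q n < ennreal (a / 105)" using q by (intro order_tendstoD(2)) auto
    then show "\<forall>\<^sub>F n in sequentially. ?g n < a"
    proof eventually_elim
      case (elim n)
      obtain R where R: "corr (8 * (a / 105)) (Xs n) (extreme_boundary (mspace (Xs n))) X (extreme_boundary (mspace X)) R"
        using dist_q_corr[OF M MX _ elim] a by auto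
      have "?g n \<le> 13 * (8 * (a / 105))" by (rule corr_gap_le[OF M MX R]) (use a in simp)
      then show ?case using a by simp
    qed
  qed
qed

theorem theorem3p7:
  shows
    "complete_quasimetric_on bauer_classes class_gap \<and>
     (\<forall>(X :: 'a::locally_convex_space metric) (Y :: 'b::locally_convex_space metric).
        metric_bauer_simplex X \<longrightarrow> metric_bauer_simplex Y \<longrightarrow>
          iso_class X \<in> bauer_classes \<and>
          class_gap (iso_class X) (iso_class Y) = intertwining_gap X Y \<and>
          quantum_gap (Aff X) (lip_const X) (Aff Y) (lip_const Y) = intertwining_gap X Y) \<and>
     (\<forall>(Xs :: nat \<Rightarrow> 'a metric) (X :: 'b metric).
        (\<forall>n. metric_bauer_simplex (Xs n)) \<longrightarrow> metric_bauer_simplex X \<longrightarrow>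
          ((\<lambda>n. intertwining_gap (Xs n) X) \<longlonglongrightarrow> 0 \<longleftrightarrow>
           (\<lambda>n. dist_q (Aff (Xs n)) (lip_const (Xs n)) (Aff X) (lip_const X)) \<longlonglongrightarrow> 0))"
proof (intro conjI allI impI)
  show "complete_quasimetric_on bauer_classes class_gap" by (rule complete_class_gap)
next
  fix X :: "'a metric" and Y :: "'b metric"
  assume X: "metric_bauer_simplex X" and Y: "metric_bauer_simplex Y"
  show "iso_class X \<in> bauer_classes" by (rule iso_class_in_bauer_classes[OF X])
  show "class_gap (iso_class X) (iso_class Y) = intertwining_gap X Y" by (rule class_gap_eq[OF X Y])
  show "quantum_gap (Aff X) (lip_const X) (Aff Y) (lip_const Y) = intertwining_gap X Y"
    by (rule quantum_gap_eq[OF bauer_model_of_simplex[OF X] bauer_model_of_simplex[OF Y]])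
next
  fix Xs :: "nat \<Rightarrow> 'a metric" and X :: "'b metric"
  assume "\<forall>n. metric_bauer_simplex (Xs n)" "metric_bauer_simplex X"
  then show "(\<lambda>n. intertwining_gap (Xs n) X) \<longlonglongrightarrow> 0 \<longleftrightarrow>
      (\<lambda>n. dist_q (Aff (Xs n)) (lip_const (Xs n)) (Aff X) (lip_const X)) \<longlonglongrightarrow> 0"
    by (intro gap_tendsto_iff_dist_q_tendsto) auto
qed

end
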